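(* Let $\mathcal M_n$ be a finite and non-empty collection of candidate models, let $r_n=\inf_{m\in\mathcal M_n}|m_1|$, $s_n=\sup_{m\in\mathcal M_n}|m|$, and let $|\mathcal M_n|$ be the number of models in $\mathcal M_n$. Let $\hat m_n^*$ be a minimizer of $\hat\rho^2(m)$ over $m\in\mathcal M_n$, let $\alpha\in(0,1)$, and let $\mathcal I(m)$ be the prediction interval $\hat y^{(0)}(m)\pm Q_{1-\alpha/2}\,\hat\rho(m)$, where $Q_{1-\alpha/2}$ is the $1-\alpha/2$ quantile of the standard normal distribution. Then for every $\varepsilon>0$, $$\left|(1-\alpha)-\mathbb P\left(y^{(0)}\in\mathcal I(\hat m_n^* )\,\middle|\,X,Y\right)\right|\le\varepsilon$$ except on an event (in terms of the training sample) whose probability is not larger than $$31\,|\mathcal M_n|\,s_n\exp\left(-n\left(\frac{r_n}{n}\right)^2\left(1-\frac{s_n}{n}\right)^5\frac{\varepsilon^2}{900(1+4\varepsilon)^2}\right),$$ uniformly over all data-generating processes as described in the context (i.e. for every such process). Alternatively, the probability of the exception event is bounded from above by $$31\,|\mathcal M_n|\,s_n\exp\left(-n\left(1-\frac{s_n}{n}\right)^5\frac{\varepsilon^2}{1768(1+4\varepsilon)^2d^2}\right),$$ uniformly over all data-generating processes as described in the context such that $\operatorname{Var}(y)/\sigma^2\le d$, for some $d>0$.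
   Context: Data-generating process. $y=\sum_{i=1}^\infty x_i\beta_i+u$, where $x=(x_i)_{i\ge1}$ are stochastic explanatory variables, $\beta=(\beta_i)_{i\ge1}$ are unknown parameters, $u$ has mean $0$ and variance $\sigma^2>0$, $x$ is centered with variance-covariance $\Sigma=[\mathbb E x_ix_j]_{i,j\ge1}$ such that every finite subvector $(x_{i_1},\dots,x_{i_k})'$ has positive definite covariance matrix, $u$ and $x$ are independent, the series converges in squared mean, and $(y,x)$ is jointly Gaussian. The training sample $(Y,X)$ consists of $n$ i.i.d. copies $(y^{(j)},x^{(j)})$, $1\le j\le n$, of $(y,x)$; $Y=(y^{(1)},\dots,y^{(n)})'$ and $X$ has rows $x^{(j)}$. Candidate models. $\mathcal M_n$ is a collection of $0$-$1$ sequences $m=(m_i)_{i\ge1}$; $|m|=\sum_i m_i$ and $6\le|m|<n$. $x(m)$ consists of the entries $x_i$ with $m_i=1$ and $X(m)$ ($n\times|m|$) of the corresponding columns of $X$. By Gaussianity, $y\mid x(m)\sim N(x(m)'\theta,\sigma^2(m))$ for some $\theta\in\mathbb R^{|m|}$ and $\sigma^2(m)>0$ (both depending on $m$). The coordinates of $x(m)$ are divided into two blocks of sizes $|m_1|\ge3$ and $|m_2|\ge3$, $|m_1|+|m_2|=|m|$; correspondingly $X(m)=(X_1(m),X_2(m))$. (Here $|m_1|,|m_2|$ denote block sizes.) Estimator. Put $M_1(m)=I_n-X_1(m)(X_1(m)'X_1(m))^{-1}X_1(m)'$ and $X_2^*(m)=M_1(m)X_2(m)$ (Moore–Penrose inverses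 on the null event where inverses do not exist). Let $\hat\theta_1^*=(X_1(m)'X_1(m))^{-1}X_1(m)'Y$, $\hat\theta_2=(X_2(m)'M_1(m)X_2(m))^{-1}X_2(m)'M_1(m)Y$, and let $\hat\sigma^2(m)$ be the usual unbiased variance estimator (residual sum of squares of the least-squares regression of $Y$ on $X(m)$, divided by $n-|m|$). For fixed tuning parameters $c_1,c_2\ge0$ let $$a_1(m)=\min\left\{1,\frac{c_1\hat\sigma^2(m)|m_1|}{\hat\theta_1^{*\prime}X_1(m)'X_1(m)\hat\theta_1^*}\right\},\quad a_2(m)=\min\left\{1,\frac{c_2\hat\sigma^2(m)|m_2|}{\hat\theta_2'X_2^*(m)'X_2^*(m)\hat\theta_2}\right\}.$$ Set $\hat\theta_1^{*JS}=(1-a_1(m))\hat\theta_1^*$, $\hat\theta_2^{JS}=(1-a_2(m))\hat\theta_2$, $\hat\theta_1^{JS}=\hat\theta_1^{*JS}-(X_1(m)'X_1(m))^{-1}X_1(m)'X_2(m)\hat\theta_2^{JS}$. The estimator $\hat\beta^B(m)$ of $\beta$ has $i$-th component $0$ if $m_i=0$, and its remaining $|m|$ components are given by $(\hat\theta_1^{JS\prime},\hat\theta_2^{JS\prime})'$. Prediction errors. Let $(y^{(0)},x^{(0)})$ be a copy of $(y,x)$ independent of the training sample, $\hat y^{(0)}(m)=\sum_i x_i^{(0)}\hat\beta_i^B(m)$, and $$\rho^2(m)=\mathbb E\left[(\hat y^{(0)}(m)-y^{(0)})^2\,\middle|\,X,Y\right].$$ With $a_1=a_1(m),a_2=a_2(m)$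 the empirical counterpart is $$\hat\rho^2(m)=w_1\hat\sigma^2(m)+w_2\frac{Y'(I_n-M_1(m))Y}{n}+w_3\frac{Y'M_1(m)Y}{n-|m_1|},$$ $$w_1=(1-a_2)^2\tfrac{|m|}{n-|m|+1}+1-a_2^2-(a_1-a_2)^2\tfrac{|m_1|}{n-|m_1|+1}+(a_2-a_1)(2-a_1-a_2)\tfrac{|m_1|}{n-|m_1|+1},$$ $$w_2=a_1^2,\qquad w_3=a_2^2-a_1^2\tfrac{|m_1|}{n}+(a_2-a_1)^2\tfrac{|m_1|}{n-|m_1|+1}.$$ $\hat\rho(m)$ denotes the square root of $\hat\rho^2(m)$ (taken as $0$ if $\hat\rho^2(m)\le0$). *)

theory Defs
  imports "HOL-Probability.Probability" "Jordan_Normal_Form.Matrix"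
begin

section \<open>Data-generating process\<close>

text \<open>Normality includes the degenerate case of a point mass.\<close>

definition normal_rv :: "'a measure \<Rightarrow> ('a \<Rightarrow> real) \<Rightarrow> bool" where
  "normal_rv P f \<longleftrightarrow>
     (\<exists>\<mu> s. s > 0 \<and> distributed P lborel f (normal_density \<mu> s)) \<or>
     (f \<in> borel_measurable P \<and> (\<exists>\<mu>. AE \<omega> in P. f \<omega> = \<mu>))"

definition jointly_gaussian :: "'a measure \<Rightarrow> ('a \<Rightarrow> real) \<Rightarrow> (nat \<Rightarrow> 'a \<Rightarrow> real) \<Rightarrow> bool" where
  "jointly_gaussian P y x \<longleftrightarrow>
     (\<forall>b c N. normal_rv P (\<lambda>\<omega>. b * y \<omega> + (\<Sum>i<N. c i * x i \<omega>)))"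

text \<open>
  The regressors are indexed from 0. In the last clause, \<open>y - u\<close> is the limit in squared mean
  of the partial sums of \<open>\<Sum>i. x i * \<beta> i\<close>; the integrability clauses exclude the
  case in which the integrals are 0 by convention.
\<close>

definition data_generating_process ::
  "'a measure \<Rightarrow> ('a \<Rightarrow> real) \<Rightarrow> (nat \<Rightarrow> 'a \<Rightarrow> real) \<Rightarrow> ('a \<Rightarrow> real) \<Rightarrow> (nat \<Rightarrow> real) \<Rightarrow> real \<Rightarrow> bool" where
  "data_generating_process P y x u \<beta> \<sigma>2 \<longleftrightarrow>
     prob_space P \<and>
     y \<in> borel_measurable P \<and> u \<in> borel_measurable P \<and> (\<forall>i. x i \<in> borel_measurable P) \<and>
     integrable P (\<lambda>\<omega>. (u \<omega>)\<^sup>2) \<and>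
     prob_space.expectation P u = 0 \<and> prob_space.variance P u = \<sigma>2 \<and> \<sigma>2 > 0 \<and>
     (\<forall>i. integrable P (\<lambda>\<omega>. (x i \<omega>)\<^sup>2) \<and> prob_space.expectation P (x i) = 0) \<and>
     (\<forall>I c. finite I \<and> (\<exists>i\<in>I. c i \<noteq> 0) \<longrightarrow>
        (\<Sum>i\<in>I. \<Sum>j\<in>I. c i * c j * prob_space.expectation P (\<lambda>\<omega>. x i \<omega> * x j \<omega>)) > 0) \<and>
     prob_space.indep_set P
       (sets (vimage_algebra (space P) u borel))
       (sets (vimage_algebra (space P) (\<lambda>\<omega> i. x i \<omega>) (\<Pi>\<^sub>M i\<in>UNIV. borel))) \<and>
     jointly_gaussian P y x \<and>
     integrable P (\<lambda>\<omega>. (y \<omega>)\<^sup>2) \<and>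
     (\<lambda>N. prob_space.expectation P (\<lambda>\<omega>. (y \<omega> - u \<omega> - (\<Sum>i<N. x i \<omega> * \<beta> i))\<^sup>2))
       \<longlonglongrightarrow> 0"

section \<open>Sample\<close>

type_synonym obs = "real \<times> (nat \<Rightarrow> real)"

abbreviation obs_space :: "obs measure" where
  "obs_space \<equiv> borel \<Otimes>\<^sub>M (\<Pi>\<^sub>M i\<in>UNIV. borel)"

text \<open>
  Copy 0 is the new observation, copies 1 to \<open>n\<close> are the training sample. The copies live on a
  probability space \<open>M\<close> of their own.
\<close>

definition iid_copies ::
  "'b measure \<Rightarrow> (nat \<Rightarrow> 'b \<Rightarrow> obs) \<Rightarrow> nat \<Rightarrow> 'a measure \<Rightarrow> ('a \<Rightarrow> real) \<Rightarrow> (nat \<Rightarrow> 'a \<Rightarrow> real) \<Rightarrow> bool" where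
  "iid_copies M Z n P y x \<longleftrightarrow>
     prob_space M \<and>
     prob_space.indep_vars M (\<lambda>_. obs_space) Z {0..n} \<and>
     (\<forall>j\<in>{0..n}. distr M obs_space (Z j) = distr P obs_space (\<lambda>\<omega>. (y \<omega>, \<lambda>i. x i \<omega>)))"

definition training_algebra :: "'b measure \<Rightarrow> (nat \<Rightarrow> 'b \<Rightarrow> obs) \<Rightarrow> nat \<Rightarrow> 'b measure" where
  "training_algebra M Z n =
     vimage_algebra (space M) (\<lambda>\<omega>. \<lambda>j\<in>{1..n}. Z j \<omega>) (\<Pi>\<^sub>M j\<in>{1..n}. obs_space)"

text \<open>A data set \<open>D\<close> gives observation \<open>j\<close> as \<open>D j\<close>; matrix row \<open>j\<close> holds observation \<open>j + 1\<close>.\<close>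

definition response :: "nat \<Rightarrow> (nat \<Rightarrow> obs) \<Rightarrow> real Matrix.vec" where
  "response n D = Matrix.vec n (\<lambda>j. fst (D (Suc j)))"

definition design :: "nat \<Rightarrow> (nat \<Rightarrow> obs) \<Rightarrow> nat list \<Rightarrow> real Matrix.mat" where
  "design n D is = Matrix.mat n (length is) (\<lambda>(j, k). snd (D (Suc j)) (is ! k))"

section \<open>Block shrinkage estimator for a regression with two blocks\<close>

text \<open>Moore-Penrose inverse, through the four Penrose equations. Every real matrix has exactly one.\<close>

definition pinv :: "real Matrix.mat \<Rightarrow> real Matrix.mat" where
  "pinv A = (THE B. B \<in> carrier_mat (dim_col A) (dim_row A) \<and>
     A * B * A = A \<and> B * A * B = B \<and>
     transpose_mat (A * B) = A * B \<and> transpose_mat (B * A) = B * A)"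

text \<open>Throughout, \<open>n = dim_row X1\<close>, \<open>|m\<^sub>1| = dim_col X1\<close> and \<open>|m\<^sub>2| = dim_col X2\<close>.\<close>

definition annihilator :: "real Matrix.mat \<Rightarrow> real Matrix.mat" where
  "annihilator X = 1\<^sub>m (dim_row X) - X * pinv (transpose_mat X * X) * transpose_mat X"

definition least_squares :: "real Matrix.mat \<Rightarrow> real Matrix.vec \<Rightarrow> real Matrix.vec" where
  "least_squares X Y = (pinv (transpose_mat X * X) * transpose_mat X) *\<^sub>v Y"

definition quad :: "real Matrix.vec \<Rightarrow> real Matrix.mat \<Rightarrow> real" where
  "quad v A = scalar_prod v (A *\<^sub>v v)"

definition join_cols :: "real Matrix.mat \<Rightarrow> real Matrix.mat \<Rightarrow> real Matrix.mat" where
  "join_cols X1 X2 = four_block_mat X1 X2 (0\<^sub>m 0 (dim_col X1)) (0\<^sub>m 0 (dim_col X2))"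

definition sigma_hat2 :: "real Matrix.mat \<Rightarrow> real Matrix.mat \<Rightarrow> real Matrix.vec \<Rightarrow> real" where
  "sigma_hat2 X1 X2 Y =
     (let X = join_cols X1 X2; e = Y - X *\<^sub>v least_squares X Y
      in scalar_prod e e / (real (dim_row X) - real (dim_col X)))"

definition theta1_star :: "real Matrix.mat \<Rightarrow> real Matrix.vec \<Rightarrow> real Matrix.vec" where
  "theta1_star X1 Y = least_squares X1 Y"

definition theta2_hat :: "real Matrix.mat \<Rightarrow> real Matrix.mat \<Rightarrow> real Matrix.vec \<Rightarrow> real Matrix.vec" where
  "theta2_hat X1 X2 Y =
     (pinv (transpose_mat X2 * annihilator X1 * X2) * transpose_mat X2 * annihilator X1) *\<^sub>v Y"

text \<open>The denominators vanish only on a null event, where the quotient is 0 by convention.\<close>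

definition shrink1 ::
  "real \<Rightarrow> real Matrix.mat \<Rightarrow> real Matrix.mat \<Rightarrow> real Matrix.vec \<Rightarrow> real" where
  "shrink1 c1 X1 X2 Y =
     min 1 (c1 * sigma_hat2 X1 X2 Y * real (dim_col X1) /
            quad (theta1_star X1 Y) (transpose_mat X1 * X1))"

definition shrink2 ::
  "real \<Rightarrow> real Matrix.mat \<Rightarrow> real Matrix.mat \<Rightarrow> real Matrix.vec \<Rightarrow> real" where
  "shrink2 c2 X1 X2 Y =
     (let X2s = annihilator X1 * X2
      in min 1 (c2 * sigma_hat2 X1 X2 Y * real (dim_col X2) /
                quad (theta2_hat X1 X2 Y) (transpose_mat X2s * X2s)))"

definition theta2_JS ::
  "real \<Rightarrow> real Matrix.mat \<Rightarrow> real Matrix.mat \<Rightarrow> real Matrix.vec \<Rightarrow> real Matrix.vec" where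
  "theta2_JS c2 X1 X2 Y = (1 - shrink2 c2 X1 X2 Y) \<cdot>\<^sub>v theta2_hat X1 X2 Y"

definition theta1_JS ::
  "real \<Rightarrow> real \<Rightarrow> real Matrix.mat \<Rightarrow> real Matrix.mat \<Rightarrow> real Matrix.vec \<Rightarrow> real Matrix.vec" where
  "theta1_JS c1 c2 X1 X2 Y =
     (1 - shrink1 c1 X1 X2 Y) \<cdot>\<^sub>v theta1_star X1 Y -
     (pinv (transpose_mat X1 * X1) * transpose_mat X1 * X2) *\<^sub>v theta2_JS c2 X1 X2 Y"

definition block_rho_hat2 ::
  "real \<Rightarrow> real \<Rightarrow> real Matrix.mat \<Rightarrow> real Matrix.mat \<Rightarrow> real Matrix.vec \<Rightarrow> real" where
  "block_rho_hat2 c1 c2 X1 X2 Y =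
     (let n = real (dim_row X1);
          p1 = real (dim_col X1);
          p = real (dim_col X1) + real (dim_col X2);
          a1 = shrink1 c1 X1 X2 Y;
          a2 = shrink2 c2 X1 X2 Y;
          w1 = (1 - a2)\<^sup>2 * (p / (n - p + 1)) + 1 - a2\<^sup>2
               - (a1 - a2)\<^sup>2 * (p1 / (n - p1 + 1))
               + (a2 - a1) * (2 - a1 - a2) * (p1 / (n - p1 + 1));
          w2 = a1\<^sup>2;
          w3 = a2\<^sup>2 - a1\<^sup>2 * (p1 / n) + (a2 - a1)\<^sup>2 * (p1 / (n - p1 + 1))
      in w1 * sigma_hat2 X1 X2 Y
         + w2 * (quad Y (1\<^sub>m (dim_row X1) - annihilator X1) / n)
         + w3 * (quad Y (annihilator X1) / (n - p1)))"

section \<open>Candidate models\<close>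

text \<open>
  A model is a 0-1 sequence. A function \<open>B\<close> assigns to each model the coordinates that form its
  first block; the second block consists of the remaining ones. Within a block, the coordinates
  are in increasing order.
\<close>

type_synonym model = "nat \<Rightarrow> nat"

definition coords :: "model \<Rightarrow> nat set" where
  "coords m = {i. m i = 1}"

definition candidate_model :: "nat \<Rightarrow> (model \<Rightarrow> nat set) \<Rightarrow> model \<Rightarrow> bool" where
  "candidate_model n B m \<longleftrightarrow>
     (\<forall>i. m i \<in> {0, 1}) \<and> finite (coords m) \<and>
     6 \<le> card (coords m) \<and> card (coords m) < n \<and>
     B m \<subseteq> coords m \<and> 3 \<le> card (B m) \<and> 3 \<le> card (coords m - B m)"

definition block1 :: "(model \<Rightarrow> nat set) \<Rightarrow> model \<Rightarrow> nat list" where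
  "block1 B m = sorted_list_of_set (B m)"

definition block2 :: "(model \<Rightarrow> nat set) \<Rightarrow> model \<Rightarrow> nat list" where
  "block2 B m = sorted_list_of_set (coords m - B m)"

definition beta_hat ::
  "nat \<Rightarrow> real \<Rightarrow> real \<Rightarrow> (model \<Rightarrow> nat set) \<Rightarrow> (nat \<Rightarrow> obs) \<Rightarrow> model \<Rightarrow> nat \<Rightarrow> real" where
  "beta_hat n c1 c2 B D m i =
     (let X1 = design n D (block1 B m); X2 = design n D (block2 B m); Y = response n D;
          \<theta> = theta1_JS c1 c2 X1 X2 Y @\<^sub>v theta2_JS c2 X1 X2 Y
      in if m i = 0 then 0 else vec_index \<theta> (LEAST k. (block1 B m @ block2 B m) ! k = i))"

definition y_hat0 ::
  "nat \<Rightarrow> real \<Rightarrow> real \<Rightarrow> (model \<Rightarrow> nat set) \<Rightarrow> (nat \<Rightarrow> obs) \<Rightarrow> model \<Rightarrow> real" where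
  "y_hat0 n c1 c2 B D m = (\<Sum>i\<in>coords m. snd (D 0) i * beta_hat n c1 c2 B D m i)"

definition rho_hat2 ::
  "nat \<Rightarrow> real \<Rightarrow> real \<Rightarrow> (model \<Rightarrow> nat set) \<Rightarrow> (nat \<Rightarrow> obs) \<Rightarrow> model \<Rightarrow> real" where
  "rho_hat2 n c1 c2 B D m =
     block_rho_hat2 c1 c2 (design n D (block1 B m)) (design n D (block2 B m)) (response n D)"

definition rho_hat ::
  "nat \<Rightarrow> real \<Rightarrow> real \<Rightarrow> (model \<Rightarrow> nat set) \<Rightarrow> (nat \<Rightarrow> obs) \<Rightarrow> model \<Rightarrow> real" where
  "rho_hat n c1 c2 B D m =
     (if rho_hat2 n c1 c2 B D m \<le> 0 then 0 else sqrt (rho_hat2 n c1 c2 B D m))"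

section \<open>Prediction interval\<close>

definition quantile :: "real measure \<Rightarrow> real \<Rightarrow> real" where
  "quantile N p = Inf {z. p \<le> cdf N z}"

definition prediction_interval ::
  "nat \<Rightarrow> real \<Rightarrow> real \<Rightarrow> (model \<Rightarrow> nat set) \<Rightarrow> real \<Rightarrow> (nat \<Rightarrow> obs) \<Rightarrow> model \<Rightarrow> real set" where
  "prediction_interval n c1 c2 B \<alpha> D m =
     (let q = quantile std_normal_distribution (1 - \<alpha> / 2)
      in {y_hat0 n c1 c2 B D m - q * rho_hat n c1 c2 B D m ..
          y_hat0 n c1 c2 B D m + q * rho_hat n c1 c2 B D m})"

definition conditional_coverage ::
  "nat \<Rightarrow> real \<Rightarrow> real \<Rightarrow> (model \<Rightarrow> nat set) \<Rightarrow> real \<Rightarrow> 'b measure \<Rightarrow> (nat \<Rightarrow> 'b \<Rightarrow> obs) \<Rightarrow>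
   ('b \<Rightarrow> model) \<Rightarrow> 'b \<Rightarrow> real" where
  "conditional_coverage n c1 c2 B \<alpha> M Z mhat =
     real_cond_exp M (training_algebra M Z n)
       (indicat_real {\<omega> \<in> space M.
          fst (Z 0 \<omega>) \<in> prediction_interval n c1 c2 B \<alpha> (\<lambda>j. Z j \<omega>) (mhat \<omega>)})"

text \<open>
  A minimizer of \<open>rho_hat2\<close> over the candidate models that is a (measurable) function of the
  training sample.
\<close>

definition selects_minimizer ::
  "nat \<Rightarrow> real \<Rightarrow> real \<Rightarrow> (model \<Rightarrow> nat set) \<Rightarrow> model set \<Rightarrow> 'b measure \<Rightarrow> (nat \<Rightarrow> 'b \<Rightarrow> obs) \<Rightarrow>
   ('b \<Rightarrow> model) \<Rightarrow> bool" where
  "selects_minimizer n c1 c2 B Ms M Z mhat \<longleftrightarrow>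
     mhat \<in> measurable (training_algebra M Z n) (count_space Ms) \<and>
     (\<forall>\<omega>\<in>space M. \<forall>m\<in>Ms.
        rho_hat2 n c1 c2 B (\<lambda>j. Z j \<omega>) (mhat \<omega>) \<le> rho_hat2 n c1 c2 B (\<lambda>j. Z j \<omega>) m)"

end

theory Submission
  imports Defs "Jordan_Normal_Form.Determinant"
begin

text \<open>
  Orthonormalizing the regressors of a model by Gram-Schmidt, with the first block first, turns the
  sample into a matrix of independent standard normal entries. The squared prediction error \<open>\<rho>\<close> and its estimate
  \<open>\<rho>h\<close> become functions of the two shrinkage factors and of a few quadratic and linear statistics of that
  matrix. Off an event of exponentially small probability all of these are near their typical values,
  and then \<open>\<bar>\<rho>h - \<rho>\<bar> \<le> \<eta> * \<rho>\<close> with \<open>\<eta> = 4 \<epsilon> / (1 + 4 \<epsilon>)\<close>, simultaneously for all shrinkage factors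
  in \<open>[0, 1]\<close>; nothing else about the factors is used. The mixed statistic of the two least-squares
  fits is obtained by polarization from norms of fits whose coefficients depend on the projected data.
  Given the training sample, the prediction error is centered normal, so its coverage differs from
  the nominal one by at most \<open>\<bar>ln (\<rho>h / \<rho>)\<bar> / 4 \<le> \<epsilon>\<close>. A union bound over the models concludes.
\<close>

section \<open>Characteristic functions\<close>

text \<open>The obstacle is the mixed statistic. The first block of \<open>f2\<close> is the image,
  under the fit on the first block, of the noise minus its fit by the second block. That inner fit
  has random coefficients, so no chi-square argument covers its product with \<open>f1\<close>
  directly. They depend, however, only on residuals on the first block, which are independent of the
  projections onto it; given these residuals, \<open>f1\<close> plus or minus \<open>c\<close> times
  that block comes from a Gaussian vector with fixed coefficients. A second obstacle is scale: the
  fit on the first block fluctuates with the variance \<open>t2\<close> of the response without that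
  block, while the prediction error may be much smaller than \<open>t2\<close>. The factor
  \<open>q\<close> measures this loss. It is the size of the first block over \<open>n\<close>, or
  \<open>1 / d\<close>, and its square appears in the two bounds. The fifth power of
  \<open>1 - s / n\<close> arises because the tolerance \<open>\<delta>\<close> contains the second
  power of \<open>\<kappa> = 1 - p / n\<close>, is squared in the exponent, and is multiplied by
  \<open>n - p = n * \<kappa>\<close> degrees of freedom. The divisor 14400 is 900 times the 16 that
  stems from \<open>(4 * \<epsilon>)^2\<close>.\<close>

lemma integral_eq_of_weighted_char_eq:
 fixes \<mu> \<nu> :: "'a measure" and w X :: "'a => real"
 assumes "prob_space \<mu>" "prob_space \<nu>" and s: "sets \<mu> = sets \<nu>"
  and w[measurable]: "w \<in> borel_measurable \<mu>" and X[measurable]: "X \<in> borel_measurable \<mu>"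
  and w0: "\<And>x. 0 \<le> w x" and w2: "\<And>x. w x \<le> 2"
  and eq: "\<And>t. (\<integral>x. w x * iexp (t * X x) \<partial>\<mu>) = (\<integral>x. w x * iexp (t * X x) \<partial>\<nu>)"
  and B[measurable]: "B \<in> sets borel"
 shows "(\<integral>x. w x * indicator B (X x) \<partial>\<mu>) = (\<integral>x. w x * indicator B (X x) \<partial>\<nu>)"
proof -
 interpret mu: prob_space \<mu> by fact
 interpret nu: prob_space \<nu> by fact
 have [measurable]: "w \<in> borel_measurable \<nu>" "X \<in> borel_measurable \<nu>"
  using w X s by (simp_all cong: measurable_cong_sets)
 have im: "integrable \<mu> w" by (rule mu.integrable_const_bound[where B=2]) (use w0 w2 in auto)
 have inu: "integrable \<nu> w" by (rule nu.integrable_const_bound[where B=2]) (use w0 w2 in auto)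
 define m where "m = (\<integral>x. w x \<partial>\<mu>)"
 have m_nu: "m = (\<integral>x. w x \<partial>\<nu>)"
 proof -
  have "complex_of_real (\<integral>x. w x \<partial>\<mu>) = complex_of_real (\<integral>x. w x \<partial>\<nu>)"
   using eq[of 0] by simp
  then show ?thesis unfolding m_def by (simp only: of_real_eq_iff)
 qed
 have m0: "m \<ge> 0" unfolding m_def using w0 by simp
 show ?thesis
 proof (cases "m = 0")
  case True
  have "AE x in \<mu>. w x = 0" using True m_def im w0 integral_nonneg_eq_0_iff_AE[of \<mu> w] by auto
  then have "AE x in \<mu>. w x * indicator B (X x) = 0" by auto
  then have a: "(\<integral>x. w x * indicator B (X x) \<partial>\<mu>) = 0" by (simp add: integral_eq_zero_AE)
  have "AE x in \<nu>. w x = 0" using True m_nu inu w0 integral_nonneg_eq_0_iff_AE[of \<nu> w] by auto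
  then have "AE x in \<nu>. w x * indicator B (X x) = 0" by auto
  then have "(\<integral>x. w x * indicator B (X x) \<partial>\<nu>) = 0" by (simp add: integral_eq_zero_AE)
  with a show ?thesis by simp
 next
  case False
  then have mp: "m > 0" using m0 by simp
  have *: "prob_space (density P (\<lambda>x. ennreal (w x / m)))" if "prob_space P" "w \<in> borel_measurable P" "integrable P w" "(\<integral>x. w x \<partial>P) = m" for P
  proof (rule prob_spaceI)
   have [measurable]: "w \<in> borel_measurable P" using that by simp
   have "emeasure (density P (\<lambda>x. ennreal (w x / m))) (space P) = (\<integral>\<^sup>+x. ennreal (w x / m) \<partial>P)"
    by (subst emeasure_density) (auto intro!: nn_integral_cong)
   also have "... = ennreal (\<integral>x. w x / m \<partial>P)"
    by (rule nn_integral_eq_integral) (use that mp w0 in auto)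
   also have "... = 1" using that mp by simp
   finally show "emeasure (density P (\<lambda>x. ennreal (w x / m))) (space (density P (\<lambda>x. ennreal (w x / m)))) = 1" by simp
  qed
  \<comment> \<open>With the weights normalized to probability densities, the hypothesis says that
    \<open>X\<close> has the same characteristic function under both reweighted measures, and Levy
    uniqueness applies. Total mass zero is treated apart because it cannot be normalized.\<close>
  let ?M = "\<lambda>P. density P (\<lambda>x. ennreal (w x / m))"
  interpret M1: prob_space "?M \<mu>" by (rule *) (use im m_def mu.prob_space_axioms in auto)
  interpret M2: prob_space "?M \<nu>" by (rule *) (use inu m_nu nu.prob_space_axioms in auto)
  have ch: "char (distr (?M P) borel X) t = (\<integral>x. w x * iexp (t * X x) \<partial>P) / m" 
   if [measurable]: "w \<in> borel_measurable P" "X \<in> borel_measurable P" for P t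
  proof -
   have "char (distr (?M P) borel X) t = (\<integral>x. iexp (t * X x) \<partial>?M P)"
    unfolding char_def by (subst integral_distr) auto
   also have "... = (\<integral>x. (w x / m) *\<^sub>R iexp (t * X x) \<partial>P)"
    by (subst integral_density) (use w0 mp in auto)
   also have "... = (\<integral>x. (w x * iexp (t * X x)) / m \<partial>P)"
    by (simp add: scaleR_conv_of_real)
   also have "... = (\<integral>x. w x * iexp (t * X x) \<partial>P) / m" by simp
   finally show ?thesis .
  qed
  have "distr (?M \<mu>) borel X = distr (?M \<nu>) borel X"
  proof (rule Levy_uniqueness)
   show "real_distribution (distr (?M \<mu>) borel X)" by (rule M1.real_distribution_distr) simp
   show "real_distribution (distr (?M \<nu>) borel X)" by (rule M2.real_distribution_distr) simp
   show "char (distr (?M \<mu>) borel X) = char (distr (?M \<nu>) borel X)"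
    unfolding fun_eq_iff ch[OF w X] ch[OF \<open>w \<in> borel_measurable \<nu>\<close> \<open>X \<in> borel_measurable \<nu>\<close>] eq by simp
  qed
  then have e: "measure (distr (?M \<mu>) borel X) B = measure (distr (?M \<nu>) borel X) B" by simp
  have i: "measure (distr (?M P) borel X) B = (\<integral>x. w x * indicator B (X x) \<partial>P) / m"
   if [measurable]: "w \<in> borel_measurable P" "X \<in> borel_measurable P" and "prob_space (?M P)" for P
  proof -
   interpret prob_space "?M P" by fact
   have "measure (distr (?M P) borel X) B = measure (?M P) (X -` B \<inter> space P)"
    by (subst measure_distr) auto
   also have "... = (\<integral>x. indicator (X -` B \<inter> space P) x \<partial>?M P)"
    by simp
   also have "... = (\<integral>x. indicator B (X x) \<partial>?M P)"
    by (rule Bochner_Integration.integral_cong) (auto simp: indicator_def)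
   also have "... = (\<integral>x. (w x / m) *\<^sub>R indicator B (X x) \<partial>P)"
    by (subst integral_density) (use w0 mp in auto)
   also have "... = (\<integral>x. w x * indicator B (X x) \<partial>P) / m" by simp
   finally show ?thesis .
  qed
  from e i[of \<mu>] i[of \<nu>] M1.prob_space_axioms M2.prob_space_axioms mp show ?thesis by simp
 qed
qed

text \<open>The real part of a factor of modulus at most 1 becomes a weight in \<open>[0, 2]\<close>
  after adding 1; the imaginary part is the real part of \<open>- \<i> * F\<close>.\<close>

lemma complex_integral_eq_of_weighted_char_eq:
 fixes \<mu> \<nu> :: "'a measure" and F :: "'a => complex" and X :: "'a => real"
 assumes p: "prob_space \<mu>" "prob_space \<nu>" and s: "sets \<mu> = sets \<nu>"
  and F[measurable]: "F \<in> borel_measurable \<mu>" and X[measurable]: "X \<in> borel_measurable \<mu>"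
  and F1: "\<And>x. norm (F x) \<le> 1"
  and eq1: "\<And>t. (\<integral>x. iexp (t * X x) \<partial>\<mu>) = (\<integral>x. iexp (t * X x) \<partial>\<nu>)"
  and eq: "\<And>t. (\<integral>x. F x * iexp (t * X x) \<partial>\<mu>) = (\<integral>x. F x * iexp (t * X x) \<partial>\<nu>)"
  and B[measurable]: "B \<in> sets borel"
 shows "(\<integral>x. F x * indicator B (X x) \<partial>\<mu>) = (\<integral>x. F x * indicator B (X x) \<partial>\<nu>)"
proof -
 interpret mu: prob_space \<mu> by fact
 interpret nu: prob_space \<nu> by fact
 have [measurable]: "F \<in> borel_measurable \<nu>" "X \<in> borel_measurable \<nu>"
  using F X s by (simp_all cong: measurable_cong_sets)
 have re: "(\<integral>x. Re (G x) * indicator B (X x) \<partial>\<mu>) = (\<integral>x. Re (G x) * indicator B (X x) \<partial>\<nu>)"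
  if G[measurable]: "G \<in> borel_measurable \<mu>" "G \<in> borel_measurable \<nu>" and G1: "\<And>x. norm (G x) \<le> 1"
   and eqG: "\<And>t. (\<integral>x. G x * iexp (t * X x) \<partial>\<mu>) = (\<integral>x. G x * iexp (t * X x) \<partial>\<nu>)" for G :: "'a => complex"
 proof -
  have reb: "\<bar>Re (G x)\<bar> \<le> 1" for x using abs_Re_le_cmod[of "G x"] G1[of x] by linarith
  \<comment> \<open>Taking real parts is not complex linear, but conjugation turns the transform at
    \<open>- t\<close> into one at \<open>t\<close>. The hypothesis at both frequencies thus
    controls the transform of \<open>Re G\<close>.\<close>
  have key: "(\<integral>x. complex_of_real (1 + Re (G x)) * iexp (t * X x) \<partial>P) = (\<integral>x. iexp (t * X x) \<partial>P) +
    ((\<integral>x. G x * iexp (t * X x) \<partial>P) + cnj (\<integral>x. G x * iexp ((-t) * X x) \<partial>P)) / 2"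
   if "prob_space P" and [measurable]: "G \<in> borel_measurable P" "X \<in> borel_measurable P" for P t
  proof -
   interpret prob_space P by fact
   have 1: "integrable P (\<lambda>x. iexp (t * X x))" by (rule integrable_const_bound[where B=1]) auto
   have 2: "integrable P (\<lambda>x. G x * iexp (t * X x))" for t
    by (rule integrable_const_bound[where B=1]) (auto simp: norm_mult G1)
   have 3: "integrable P (\<lambda>x. cnj (G x * iexp ((-t) * X x)))" using 2[of "-t"] by (simp only: integrable_cnj)
   have c: "cnj (iexp ((-t) * X x)) = iexp (t * X x)" for x by (simp add: exp_cnj)
   have "complex_of_real (1 + Re (G x)) * iexp (t * X x) = iexp (t * X x) + (G x * iexp (t * X x) + cnj (G x * iexp ((-t) * X x))) / 2" for x
   proof -
    have "G x * iexp (t * X x) + cnj (G x * iexp ((-t) * X x)) = (G x + cnj (G x)) * iexp (t * X x)"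
     by (simp only: complex_cnj_mult c distrib_right)
    also have "... = 2 * complex_of_real (Re (G x)) * iexp (t * X x)" by (simp only: complex_add_cnj) simp
    finally show ?thesis by (simp add: algebra_simps)
   qed
   then have "(\<integral>x. complex_of_real (1 + Re (G x)) * iexp (t * X x) \<partial>P) = (\<integral>x. iexp (t * X x) + (G x * iexp (t * X x) + cnj (G x * iexp ((-t) * X x))) / 2 \<partial>P)"
    by (intro Bochner_Integration.integral_cong) simp_all
   also have "... = (\<integral>x. iexp (t * X x) \<partial>P) + (\<integral>x. (G x * iexp (t * X x) + cnj (G x * iexp ((-t) * X x))) / 2 \<partial>P)"
    by (rule Bochner_Integration.integral_add[OF 1]) (use 2[of t] 3 in \<open>simp only: integrable_divide Bochner_Integration.integrable_add simp_thms\<close>)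
   also have "(\<integral>x. (G x * iexp (t * X x) + cnj (G x * iexp ((-t) * X x))) / 2 \<partial>P) = ((\<integral>x. G x * iexp (t * X x) \<partial>P) + (\<integral>x. cnj (G x * iexp ((-t) * X x)) \<partial>P)) / 2"
    using Bochner_Integration.integral_add[OF 2[of t] 3] by (simp only: integral_divide_zero)
   also have "(\<integral>x. cnj (G x * iexp ((-t) * X x)) \<partial>P) = cnj (\<integral>x. G x * iexp ((-t) * X x) \<partial>P)"
    by (rule Bochner_Integration.integral_cnj)
   finally show ?thesis .
  qed
  have "(\<integral>x. (1 + Re (G x)) * indicator B (X x) \<partial>\<mu>) = (\<integral>x. (1 + Re (G x)) * indicator B (X x) \<partial>\<nu>)"
  proof (rule integral_eq_of_weighted_char_eq[OF p s])
   show "0 \<le> 1 + Re (G x)" "1 + Re (G x) \<le> 2" for x using reb[of x] by auto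
   show "(\<integral>x. complex_of_real (1 + Re (G x)) * iexp (t * X x) \<partial>\<mu>) = (\<integral>x. complex_of_real (1 + Re (G x)) * iexp (t * X x) \<partial>\<nu>)" for t
    unfolding key[OF p(1) G(1) X] key[OF p(2) G(2) \<open>X \<in> borel_measurable \<nu>\<close>] eq1 eqG ..
  qed auto
  moreover have "(\<integral>x. 1 * indicator B (X x) \<partial>\<mu>) = (\<integral>x. 1 * (indicator B (X x) :: real) \<partial>\<nu>)"
   by (rule integral_eq_of_weighted_char_eq[OF p s, of "\<lambda>_. 1"]) (use eq1 in auto)
  moreover have "(\<integral>x. (1 + Re (G x)) * indicator B (X x) \<partial>P) = (\<integral>x. 1 * indicator B (X x) \<partial>P) + (\<integral>x. Re (G x) * indicator B (X x) \<partial>P)"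
   if "prob_space P" and [measurable]: "G \<in> borel_measurable P" "X \<in> borel_measurable P" for P
  proof -
   interpret prob_space P by fact
   have "integrable P (\<lambda>x. 1 * indicator B (X x) :: real)" by (rule integrable_const_bound[where B=1]) auto
   moreover have "integrable P (\<lambda>x. Re (G x) * indicator B (X x))"
    by (rule integrable_const_bound[where B=1]) (use reb in \<open>auto simp: indicator_def\<close>)
   ultimately show ?thesis by (subst Bochner_Integration.integral_add[symmetric]) (auto simp: algebra_simps)
  qed
  ultimately show ?thesis using p that X \<open>X \<in> borel_measurable \<nu>\<close> by fastforce
 qed
 have a: "(\<integral>x. Re (F x) * indicator B (X x) \<partial>\<mu>) = (\<integral>x. Re (F x) * indicator B (X x) \<partial>\<nu>)"
  by (rule re[OF F \<open>F \<in> borel_measurable \<nu>\<close> F1 eq])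
 have "(\<integral>x. Re (- \<i> * F x) * indicator B (X x) \<partial>\<mu>) = (\<integral>x. Re (- \<i> * F x) * indicator B (X x) \<partial>\<nu>)"
 proof (rule re)
  show "(\<integral>x. (- \<i> * F x) * iexp (t * X x) \<partial>\<mu>) = (\<integral>x. (- \<i> * F x) * iexp (t * X x) \<partial>\<nu>)" for t
   by (simp only: mult.assoc integral_mult_right_zero eq)
 qed (auto simp: F1 norm_mult)
 then have b: "(\<integral>x. Im (F x) * indicator B (X x) \<partial>\<mu>) = (\<integral>x. Im (F x) * indicator B (X x) \<partial>\<nu>)" by simp
 have "(\<integral>x. F x * indicator B (X x) \<partial>P) = Complex (\<integral>x. Re (F x) * indicator B (X x) \<partial>P) (\<integral>x. Im (F x) * indicator B (X x) \<partial>P)"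
  if "prob_space P" and [measurable]: "F \<in> borel_measurable P" "X \<in> borel_measurable P" for P
 proof -
  interpret prob_space P by fact
  have i: "integrable P (\<lambda>x. F x * indicator B (X x))"
   by (rule integrable_const_bound[where B=1]) (auto simp: indicator_def F1)
  have "Re (F x * indicator B (X x)) = Re (F x) * indicator B (X x)" "Im (F x * indicator B (X x)) = Im (F x) * indicator B (X x)" for x
   by (auto simp: indicator_def)
  with i show ?thesis by (simp add: complex_eq_iff integral_Re[symmetric] integral_Im[symmetric])
 qed
 then show ?thesis using a b p by simp
qed

text \<open>The coordinates are exchanged for indicators one at a time.\<close>

lemma measure_eqI_PiM_char:
 fixes \<mu> \<nu> :: "('i => real) measure"
 assumes fin: "finite I" and p: "prob_space \<mu>" "prob_space \<nu>"
  and s: "sets \<mu> = sets (\<Pi>\<^sub>M i\<in>I. borel)" "sets \<nu> = sets (\<Pi>\<^sub>M i\<in>I. borel)"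
  and eq: "\<And>c. (\<integral>x. iexp (\<Sum>i\<in>I. c i * x i) \<partial>\<mu>) = (\<integral>x. iexp (\<Sum>i\<in>I. c i * x i) \<partial>\<nu>)"
 shows "\<mu> = \<nu>"
proof -
 interpret mu: prob_space \<mu> by fact
 interpret nu: prob_space \<nu> by fact
 have comp: "(\<lambda>x. x i) \<in> borel_measurable \<mu>" "(\<lambda>x. x i) \<in> borel_measurable \<nu>" if "i \<in> I" for i
  using measurable_component_singleton[OF that, of "\<lambda>_. borel"] s by (simp_all cong: measurable_cong_sets)
 have meas: "(\<lambda>x. (\<Prod>j\<in>J. indicator (B j) (x j)) * iexp (\<Sum>i\<in>I. c i * x i) :: complex) \<in> borel_measurable \<mu>"
  if "J \<subseteq> I" "\<And>j. j \<in> J ==> B j \<in> sets borel" for J B c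
 proof -
  have "(\<lambda>x. indicator (B j) (x j) :: complex) \<in> borel_measurable \<mu>" if "j \<in> J" for j
  proof -
   have [measurable]: "(\<lambda>x. x j) \<in> borel_measurable \<mu>" "B j \<in> sets borel" using that comp \<open>J \<subseteq> I\<close> \<open>\<And>j. j \<in> J ==> B j \<in> sets borel\<close> by auto
   show ?thesis by measurable
  qed
  moreover have "(\<lambda>x. \<Sum>i\<in>I. c i * x i) \<in> borel_measurable \<mu>"
   by (intro borel_measurable_sum borel_measurable_times comp) auto
  then have "(\<lambda>x. iexp (\<Sum>i\<in>I. c i * x i)) \<in> borel_measurable \<mu>" by measurable
  ultimately show ?thesis by (intro borel_measurable_times borel_measurable_prod) auto
 qed
 have main: "(\<integral>x. (\<Prod>j\<in>J. indicator (B j) (x j)) * iexp (\<Sum>i\<in>I. c i * x i) \<partial>\<mu>) =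
   (\<integral>x. (\<Prod>j\<in>J. indicator (B j) (x j)) * iexp (\<Sum>i\<in>I. c i * x i) \<partial>\<nu>)"
  if "J \<subseteq> I" "\<And>j. j \<in> J ==> B j \<in> sets borel" for J B c
  using finite_subset[OF that(1) fin] that
 proof (induction J arbitrary: c rule: finite_induct)
  case empty
  then show ?case using eq by simp
 next
  case (insert j J)
  let ?F = "\<lambda>x. (\<Prod>j\<in>J. indicator (B j) (x j)) * iexp (\<Sum>i\<in>I. c i * x i) :: complex"
  have jI: "j \<in> I" and Bj: "B j \<in> sets borel" using insert.prems by auto
  \<comment> \<open>Adding \<open>t\<close> to the coefficient of coordinate \<open>j\<close>
    multiplies the integrand by \<open>iexp (t * x j)\<close>. The induction hypothesis for all
    \<open>c\<close> is therefore the equality of transforms in \<open>x j\<close> that is needed to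
    insert the next indicator.\<close>
  have shift: "(\<Sum>i\<in>I. (c i + (if i = j then t else 0)) * x i) = (\<Sum>i\<in>I. c i * x i) + t * x j" for t and x :: "'i => real"
   using fin jI by (simp add: distrib_right sum.distrib if_distrib[of "\<lambda>a. a * _"] cong: if_cong)
  have "(\<integral>x. ?F x * indicator (B j) (x j) \<partial>\<mu>) = (\<integral>x. ?F x * indicator (B j) (x j) \<partial>\<nu>)"
  proof (rule complex_integral_eq_of_weighted_char_eq[OF p _ _ comp(1)[OF jI]])
   show "sets \<mu> = sets \<nu>" using s by simp
   show "?F \<in> borel_measurable \<mu>" using meas insert.prems by auto
   show "norm (?F x) \<le> 1" for x
    by (auto simp: norm_mult prod_norm[symmetric] indicator_def intro!: prod_le_1)
   show "(\<integral>x. iexp (t * x j) \<partial>\<mu>) = (\<integral>x. iexp (t * x j) \<partial>\<nu>)" for t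
    using eq[of "\<lambda>i. if i = j then t else 0"] fin jI by (simp add: if_distrib[of "\<lambda>a. a * _"] cong: if_cong)
   show "(\<integral>x. ?F x * iexp (t * x j) \<partial>\<mu>) = (\<integral>x. ?F x * iexp (t * x j) \<partial>\<nu>)" for t
    using insert.IH[of "\<lambda>i. c i + (if i = j then t else 0)"] insert.prems
    by (simp only: shift) (simp add: distrib_left exp_add mult.assoc)
  qed (rule Bj)
  then show ?case using insert.hyps by (simp add: mult_ac)
 qed
 have box: "emeasure \<mu> (Pi\<^sub>E I A) = emeasure \<nu> (Pi\<^sub>E I A)" if A: "\<And>i. i \<in> I ==> A i \<in> sets borel" for A
 proof -
  have "measure P (Pi\<^sub>E I A) = Re (\<integral>x. (\<Prod>j\<in>I. indicator (A j) (x j)) * iexp (\<Sum>i\<in>I. 0 * x i) \<partial>P)"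
   if "prob_space P" "sets P = sets (\<Pi>\<^sub>M i\<in>I. borel)" for P
  proof -
   interpret prob_space P by fact
   have sp: "space P = extensional I" using sets_eq_imp_space_eq[OF that(2)] by (simp add: space_PiM PiE_UNIV_domain PiE_def)
   have [measurable]: "Pi\<^sub>E I A \<in> sets P" using A fin that(2) by (simp add: sets_PiM_I_finite)
   have "(\<integral>x. (\<Prod>j\<in>I. indicator (A j) (x j)) * iexp (\<Sum>i\<in>I. 0 * x i) \<partial>P) = (\<integral>x. complex_of_real (indicator (Pi\<^sub>E I A) x) \<partial>P)"
   proof (rule Bochner_Integration.integral_cong[OF refl])
    fix x assume "x \<in> space P"
    then have "x \<in> extensional I" using sp by simp
    have "(\<Prod>j\<in>I. indicator (A j) (x j) :: complex) = of_real (indicator (Pi\<^sub>E I A) x)"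
    proof (cases "\<forall>j\<in>I. x j \<in> A j")
     case True
     then show ?thesis using \<open>x \<in> extensional I\<close> by (simp add: PiE_def)
    next
     case False
     then show ?thesis using fin by (auto simp: prod_zero_iff indicator_def PiE_def)
    qed
    then show "(\<Prod>j\<in>I. indicator (A j) (x j)) * iexp (\<Sum>i\<in>I. 0 * x i) = complex_of_real (indicator (Pi\<^sub>E I A) x)" by simp
   qed
   also have "... = complex_of_real (measure P (Pi\<^sub>E I A))" by simp
   finally show ?thesis by simp
  qed
  with p s main[of I A "\<lambda>_. 0"] A have "measure \<mu> (Pi\<^sub>E I A) = measure \<nu> (Pi\<^sub>E I A)" by simp
  then show ?thesis by (simp add: mu.emeasure_eq_measure nu.emeasure_eq_measure)
 qed
 show ?thesis
 proof (rule measure_eqI_PiM_finite[OF fin s])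
  show "emeasure \<mu> (Pi\<^sub>E I A) = emeasure \<nu> (Pi\<^sub>E I A)" if "\<And>i. i \<in> I ==> A i \<in> sets borel" for A by (rule box[OF that])
  show "range (\<lambda>_::nat. Pi\<^sub>E I (\<lambda>_. UNIV::real set)) \<subseteq> prod_algebra I (\<lambda>_. borel)"
   using fin by (auto intro!: prod_algebraI_finite)
  show "(\<Union>_::nat. Pi\<^sub>E I (\<lambda>_. UNIV::real set)) = space (PiM I (\<lambda>_. borel))" by (simp add: space_PiM)
  show "emeasure \<mu> (Pi\<^sub>E I (\<lambda>_. UNIV)) \<noteq> \<infinity>" for n::nat by (simp add: mu.emeasure_eq_measure)
 qed
qed

section \<open>Product measures of standard normal distributions\<close>

definition gauss :: "'i set => ('i => real) measure" where
 "gauss I = (\<Pi>\<^sub>M i\<in>I. std_normal_distribution)"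

lemma prob_space_std_normal: "prob_space std_normal_distribution"
 by (rule prob_space_normal_density) simp

lemma prob_space_gauss: "prob_space (gauss I)"
 unfolding gauss_def by (rule prob_space_PiM) (rule prob_space_std_normal)

lemma sets_gauss [measurable_cong]: "sets (gauss I) = sets (\<Pi>\<^sub>M i\<in>I. borel)"
 unfolding gauss_def by (intro sets_PiM_cong) auto

lemma space_gauss: "space (gauss I) = extensional I"
 using sets_eq_imp_space_eq[OF sets_gauss[of I]] by (simp add: space_PiM PiE_def)

interpretation std_normal_product: product_sigma_finite "\<lambda>_. std_normal_distribution"
 by unfold_locales (metis prob_space_imp_sigma_finite prob_space_std_normal sigma_finite_measure.sigma_finite_countable)

lemma integral_gauss_prod:
 fixes f :: "'i => real => 'b::{real_normed_field,banach,second_countable_topology}"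
 assumes "finite I" "\<And>i. i \<in> I ==> integrable std_normal_distribution (f i)"
 shows "(\<integral>x. (\<Prod>i\<in>I. f i (x i)) \<partial>gauss I) = (\<Prod>i\<in>I. \<integral>x. f i x \<partial>std_normal_distribution)"
 unfolding gauss_def by (rule std_normal_product.product_integral_prod) fact+

lemma nn_integral_gauss_prod:
 assumes "finite I" "\<And>i. i \<in> I ==> f i \<in> borel_measurable borel"
 shows "(\<integral>\<^sup>+x. (\<Prod>i\<in>I. f i (x i)) \<partial>gauss I) = (\<Prod>i\<in>I. \<integral>\<^sup>+x. f i x \<partial>std_normal_distribution)"
 unfolding gauss_def by (rule std_normal_product.product_nn_integral_prod) (use assms in auto)

lemma integral_gauss_iexp:
 assumes "finite I"
 shows "(\<integral>x. iexp (\<Sum>i\<in>I. c i * x i) \<partial>gauss I) = exp (- (\<Sum>i\<in>I. (c i)^2) / 2)"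
proof -
 interpret prob_space std_normal_distribution by (rule prob_space_std_normal)
 have "(\<integral>x. iexp (\<Sum>i\<in>I. c i * x i) \<partial>gauss I) = (\<integral>x. (\<Prod>i\<in>I. iexp (c i * x i)) \<partial>gauss I)"
  using assms by (simp add: exp_sum[symmetric] sum_distrib_left)
 also have "... = (\<Prod>i\<in>I. \<integral>x. iexp (c i * x) \<partial>std_normal_distribution)"
  by (rule integral_gauss_prod[OF assms], rule integrable_const_bound[where B=1]) auto
 also have "... = (\<Prod>i\<in>I. complex_of_real (exp (- (c i)\<^sup>2 / 2)))"
  using char_std_normal_distribution by (simp add: char_def fun_eq_iff)
 also have "... = complex_of_real (exp (\<Sum>i\<in>I. - (c i)\<^sup>2 / 2))"
  using assms by (simp add: exp_sum)
 finally show ?thesis by (simp add: sum_negf sum_divide_distrib)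
qed

lemma (in prob_space) distr_eq_gauss:
 fixes X :: "'i => 'a => real"
 assumes fin: "finite I" and X: "\<And>i. i \<in> I ==> X i \<in> borel_measurable M"
  and eq: "\<And>c. (\<integral>w. iexp (\<Sum>i\<in>I. c i * X i w) \<partial>M) = exp (- (\<Sum>i\<in>I. (c i)^2) / 2)"
 shows "distr M (\<Pi>\<^sub>M i\<in>I. borel) (\<lambda>w. \<lambda>i\<in>I. X i w) = gauss I"
proof (rule measure_eqI_PiM_char[OF fin])
 have m: "(\<lambda>w. \<lambda>i\<in>I. X i w) \<in> measurable M (\<Pi>\<^sub>M i\<in>I. borel)"
  by (rule measurable_restrict) (rule X)
 then show "prob_space (distr M (\<Pi>\<^sub>M i\<in>I. borel) (\<lambda>w. \<lambda>i\<in>I. X i w))" by (rule prob_space_distr)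
 show "prob_space (gauss I)" by (rule prob_space_gauss)
 show "sets (gauss I) = sets (\<Pi>\<^sub>M i\<in>I. borel)" by (rule sets_gauss)
 fix c :: "'i => real"
 have mm: "(\<lambda>x. iexp (\<Sum>i\<in>I. c i * x i)) \<in> borel_measurable (\<Pi>\<^sub>M i\<in>I. borel)" by measurable
 show "(\<integral>x. iexp (\<Sum>i\<in>I. c i * x i) \<partial>distr M (\<Pi>\<^sub>M i\<in>I. borel) (\<lambda>w. \<lambda>i\<in>I. X i w)) = (\<integral>x. iexp (\<Sum>i\<in>I. c i * x i) \<partial>gauss I)"
 proof -
  have "(\<Sum>i\<in>I. c i * (\<lambda>i\<in>I. X i w) i) = (\<Sum>i\<in>I. c i * X i w)" for w
   by (rule sum.cong) auto
  then show ?thesis by (simp only: integral_distr[OF m mm] eq integral_gauss_iexp[OF fin])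
 qed
qed simp

text \<open>Orthonormality of the rows \<open>f j\<close> makes \<open>c\<close> and the combined
  row \<open>\<Sum>j\<in>J. c j * f j i\<close> have equal norms, and the characteristic function of
  a standard normal vector depends on the norm only.\<close>

lemma gauss_linear_map:
 fixes f :: "'j => 'i => real"
 assumes fin: "finite I" "finite J"
  and orth: "\<And>j k. j \<in> J ==> k \<in> J ==> (\<Sum>i\<in>I. f j i * f k i) = (if j = k then 1 else 0)"
 shows "distr (gauss I) (\<Pi>\<^sub>M j\<in>J. borel) (\<lambda>x. \<lambda>j\<in>J. \<Sum>i\<in>I. f j i * x i) = gauss J"
proof -
 interpret prob_space "gauss I" by (rule prob_space_gauss)
 show ?thesis
 proof (rule distr_eq_gauss[OF fin(2)])
  show "(\<lambda>x. \<Sum>i\<in>I. f j i * x i) \<in> borel_measurable (gauss I)" if "j \<in> J" for j by measurable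
  fix c :: "'j => real"
  have 1: "(\<Sum>j\<in>J. c j * (\<Sum>i\<in>I. f j i * x i)) = (\<Sum>i\<in>I. (\<Sum>j\<in>J. c j * f j i) * x i)" for x :: "'i => real"
   by (simp add: sum_distrib_left sum_distrib_right mult.assoc) (rule sum.swap)
  have "(\<Sum>i\<in>I. (\<Sum>j\<in>J. c j * f j i)^2) = (\<Sum>i\<in>I. \<Sum>j\<in>J. \<Sum>k\<in>J. (c j * c k) * (f j i * f k i))"
   by (simp add: power2_eq_square sum_product mult_ac)
  also have "... = (\<Sum>j\<in>J. \<Sum>k\<in>J. (c j * c k) * (\<Sum>i\<in>I. f j i * f k i))"
   by (subst sum.swap, rule sum.cong[OF refl], subst sum.swap) (simp add: sum_distrib_left)
  also have "... = (\<Sum>j\<in>J. \<Sum>k\<in>J. if j = k then c j * c k else 0)"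
   by (intro sum.cong refl) (simp add: orth)
  also have "... = (\<Sum>j\<in>J. (c j)^2)" using fin by (simp add: power2_eq_square)
  finally have 2: "(\<Sum>i\<in>I. (\<Sum>j\<in>J. c j * f j i)^2) = (\<Sum>j\<in>J. (c j)^2)" .
  show "(\<integral>x. iexp (\<Sum>j\<in>J. c j * (\<Sum>i\<in>I. f j i * x i)) \<partial>gauss I) = exp (- (\<Sum>j\<in>J. (c j)^2) / 2)"
   unfolding 1 integral_gauss_iexp[OF fin(1)] 2 ..
 qed
qed

lemma measure_gauss_linear_map:
 fixes f :: "'j => 'i => real"
 assumes fin: "finite I" "finite J"
  and orth: "\<And>j k. j \<in> J ==> k \<in> J ==> (\<Sum>i\<in>I. f j i * f k i) = (if j = k then 1 else 0)"
  and A: "A \<in> sets (gauss J)"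
 shows "measure (gauss I) {x\<in>space (gauss I). (\<lambda>j\<in>J. \<Sum>i\<in>I. f j i * x i) \<in> A} = measure (gauss J) A"
proof -
 have m: "(\<lambda>x. \<lambda>j\<in>J. \<Sum>i\<in>I. f j i * x i) \<in> measurable (gauss I) (\<Pi>\<^sub>M j\<in>J. borel)" by measurable
 have "measure (gauss J) A = measure (distr (gauss I) (\<Pi>\<^sub>M j\<in>J. borel) (\<lambda>x. \<lambda>j\<in>J. \<Sum>i\<in>I. f j i * x i)) A"
  by (simp only: gauss_linear_map[OF fin orth])
 also have "... = measure (gauss I) ((\<lambda>x. \<lambda>j\<in>J. \<Sum>i\<in>I. f j i * x i) -` A \<inter> space (gauss I))"
  by (rule measure_distr[OF m]) (use A sets_gauss in auto)
 also have "(\<lambda>x. \<lambda>j\<in>J. \<Sum>i\<in>I. f j i * x i) -` A \<inter> space (gauss I) = {x\<in>space (gauss I). (\<lambda>j\<in>J. \<Sum>i\<in>I. f j i * x i) \<in> A}" by auto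
 finally show ?thesis by simp
qed

lemma gauss_split:
 assumes "I \<inter> J = {}" "finite I" "finite J"
 shows "gauss (I \<union> J) = distr (gauss I \<Otimes>\<^sub>M gauss J) (\<Pi>\<^sub>M i\<in>I \<union> J. borel) (merge I J)"
proof -
 have "gauss (I \<union> J) = distr (gauss I \<Otimes>\<^sub>M gauss J) (\<Pi>\<^sub>M i\<in>I \<union> J. std_normal_distribution) (merge I J)"
  unfolding gauss_def by (rule std_normal_product.distr_merge[OF assms, symmetric])
 also have "... = distr (gauss I \<Otimes>\<^sub>M gauss J) (\<Pi>\<^sub>M i\<in>I \<union> J. borel) (merge I J)"
  by (rule distr_cong) (auto intro!: sets_PiM_cong)
 finally show ?thesis .
qed

text \<open>Conditioning in its crudest form: exceptional first coordinates cost the measure of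
  \<open>N\<close>, and for the others a uniform bound on the sections suffices.\<close>

lemma pair_measure_bound:
 assumes "prob_space M1" "prob_space M2" and A: "A \<in> sets (M1 \<Otimes>\<^sub>M M2)" and N: "N \<in> sets M1"
  and b: "\<And>x. x \<in> space M1 - N ==> measure M2 (Pair x -` A) \<le> c" and c: "c \<ge> 0"
 shows "measure (M1 \<Otimes>\<^sub>M M2) A \<le> measure M1 N + c"
proof -
 interpret M1: prob_space M1 by fact
 interpret M2: prob_space M2 by fact
 interpret pair_prob_space M1 M2 ..
 have "emeasure (M1 \<Otimes>\<^sub>M M2) A = (\<integral>\<^sup>+x. emeasure M2 (Pair x -` A) \<partial>M1)"
  by (rule M2.emeasure_pair_measure_alt[OF A])
 also have "... \<le> (\<integral>\<^sup>+x. indicator N x + ennreal c \<partial>M1)"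
 proof (rule nn_integral_mono)
  fix x assume x: "x \<in> space M1"
  show "emeasure M2 (Pair x -` A) \<le> indicator N x + ennreal c"
  proof (cases "x \<in> N")
   case True
   then have "emeasure M2 (Pair x -` A) \<le> indicator N x" using M2.measure_le_1 by auto
   then show ?thesis by (rule order_trans) simp
  next
   case False
   then show ?thesis using b[of x] x by (simp add: M2.emeasure_eq_measure ennreal_leI)
  qed
 qed
 also have "... = emeasure M1 N + ennreal c"
  using N by (subst nn_integral_add) (auto simp: M1.emeasure_space_1)
 also have "... = ennreal (measure M1 N + c)" using c by (simp add: M1.emeasure_eq_measure ennreal_plus)
 finally show ?thesis using c by (simp add: emeasure_eq_measure ennreal_plus[symmetric] del: ennreal_plus)
qed

section \<open>Exponential moments and tails of Gaussian quadratic and linear forms\<close>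

lemma nn_integral_std_normal_exp_square:
 assumes "l < 1 / 2"
 shows "(\<integral>\<^sup>+x. ennreal (exp (l * x^2)) \<partial>std_normal_distribution) = ennreal ((1 - 2 * l) powr (- 1 / 2))"
proof -
 \<comment> \<open>Tilting by \<open>exp (l * x^2)\<close> changes the standard normal density into
   \<open>s\<close> times the centered normal density with standard deviation
   \<open>s\<close>.\<close>
 define s where "s = 1 / sqrt (1 - 2 * l)"
 have pos: "1 - 2 * l > 0" using assms by simp
 have s: "s > 0" and s2: "s^2 = 1 / (1 - 2 * l)" using pos by (auto simp: s_def power_divide)
 have "std_normal_density x * exp (l * x^2) = s * normal_density 0 s x" for x
 proof -
  have a: "s * (1 / sqrt (2 * pi * s^2)) = 1 / sqrt (2 * pi)"
   using s by (simp add: real_sqrt_mult)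
  have b: "- x\<^sup>2 / 2 + l * x^2 = - (x - 0)\<^sup>2 / (2 * s^2)"
   unfolding s2 by (simp add: algebra_simps)
  have "std_normal_density x * exp (l * x^2) = 1 / sqrt (2 * pi) * exp (- x\<^sup>2 / 2 + l * x^2)"
   unfolding std_normal_density_def exp_add by simp
  also have "... = s * (1 / sqrt (2 * pi * s^2)) * exp (- (x - 0)\<^sup>2 / (2 * s^2))" unfolding a b ..
  finally show ?thesis by (simp add: normal_density_def mult.assoc)
 qed
 then have "(\<integral>\<^sup>+x. ennreal (exp (l * x^2)) \<partial>std_normal_distribution) = (\<integral>\<^sup>+x. ennreal s * ennreal (normal_density 0 s x) \<partial>lborel)"
  using s by (subst nn_integral_density) (auto simp: ennreal_mult[symmetric] intro!: nn_integral_cong)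
 also have "... = ennreal s * emeasure (density lborel (\<lambda>x. ennreal (normal_density 0 s x))) UNIV"
  by (subst nn_integral_cmult) (auto simp: emeasure_density)
 also have "... = ennreal s"
  using prob_space.emeasure_space_1[OF prob_space_normal_density[OF s, of 0]] by simp
 also have "s = (1 - 2 * l) powr (- 1 / 2)"
  using pos by (simp add: s_def powr_half_sqrt[symmetric] powr_minus_divide)
 finally show ?thesis .
qed

lemma one_minus_powr_le:
 assumes "\<bar>l\<bar> \<le> 1 / (4::real)"
 shows "(1 - 2 * l) powr (- 1 / 2) \<le> exp (l + 2 * l^2)"
proof -
 have "ln (1 - 2 * l) \<ge> - (2 * l) - (2 * l)\<^sup>2"
 proof (cases "l \<ge> 0")
  case True
  define u where "u = 2 * l"
  have u: "0 \<le> u" "u \<le> 1 / 2" using True assms by (auto simp: u_def)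
  have "u * u \<le> u * (1/2)" "u * u * u \<le> u * (1/2) * (1/2)" using u by (intro mult_mono; simp)+
  \<comment> \<open>Half of this polynomial is the excess over 1 of the right-hand side in the next
    line, where \<open>exp (u + u^2)\<close> is replaced by its quadratic Taylor polynomial.\<close>
  then have "0 \<le> u^2 * (1 - u - u * u - u * u * u)" using u by (intro mult_nonneg_nonneg) auto
  then have "1 \<le> (1 - u) * (1 + (u + u^2) + (u + u^2)^2 / 2)"
   by (simp add: power2_eq_square algebra_simps)
  also have "... \<le> (1 - u) * exp (u + u^2)"
   by (intro mult_left_mono exp_lower_Taylor_quadratic) (use u in auto)
  finally have "exp (- u - u\<^sup>2) \<le> 1 - u"
   by (simp add: exp_minus exp_diff exp_add field_simps)
  then have "- u - u\<^sup>2 \<le> ln (1 - u)" using u by (subst ln_ge_iff) auto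
  then show ?thesis by (simp add: u_def)
 next
  case False
  then show ?thesis using ln_one_plus_pos_lower_bound[of "- 2 * l"] assms by simp
 qed
 then have "- 1 / 2 * ln (1 - 2 * l) \<le> l + 2 * l^2" by (simp add: power2_eq_square)
 moreover have "1 - 2 * l > 0" using assms by auto
 ultimately show ?thesis by (simp add: powr_def)
qed

lemma gauss_exp_sum_squares:
 assumes "finite I" and l: "\<bar>l\<bar> \<le> 1 / 4"
 shows "(\<integral>\<^sup>+x. ennreal (exp (l * (\<Sum>i\<in>I. (x i)^2))) \<partial>gauss I) \<le> ennreal (exp (real (card I) * (l + 2 * l^2)))"
proof -
 have "(\<integral>\<^sup>+x. ennreal (exp (l * (\<Sum>i\<in>I. (x i)^2))) \<partial>gauss I) = (\<integral>\<^sup>+x. (\<Prod>i\<in>I. ennreal (exp (l * (x i)^2))) \<partial>gauss I)"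
  using assms by (simp add: sum_distrib_left exp_sum prod_ennreal)
 also have "... = (\<Prod>i\<in>I. \<integral>\<^sup>+x. ennreal (exp (l * x^2)) \<partial>std_normal_distribution)"
  by (rule nn_integral_gauss_prod[OF assms(1)]) auto
 also have "... = ennreal ((1 - 2 * l) powr (- 1 / 2)) ^ card I"
  using l by (simp add: nn_integral_std_normal_exp_square)
 also have "... \<le> ennreal (exp (l + 2 * l^2)) ^ card I"
  by (intro power_mono ennreal_leI one_minus_powr_le l) auto
 also have "... = ennreal (exp (real (card I) * (l + 2 * l^2)))"
  by (simp add: ennreal_power exp_of_nat_mult)
 finally show ?thesis .
qed

lemma measure_le_of_nn_integral_exp:
 assumes "prob_space M" and f[measurable]: "f \<in> borel_measurable M"
  and I: "(\<integral>\<^sup>+x. ennreal (exp (f x)) \<partial>M) \<le> ennreal (exp a)"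
 shows "measure M {x\<in>space M. c \<le> f x} \<le> exp (a - c)"
proof -
 interpret prob_space M by fact
 have "emeasure M {x\<in>space M. 1 \<le> ennreal (exp (- c)) * ennreal (exp (f x))} \<le> ennreal (exp (- c)) * (\<integral>\<^sup>+x. ennreal (exp (f x)) * indicator (space M) x \<partial>M)"
  by (rule nn_integral_Markov_inequality) auto
 also have "(\<integral>\<^sup>+x. ennreal (exp (f x)) * indicator (space M) x \<partial>M) = (\<integral>\<^sup>+x. ennreal (exp (f x)) \<partial>M)"
  by (rule nn_integral_cong) auto
 also have "ennreal (exp (- c)) * (\<integral>\<^sup>+x. ennreal (exp (f x)) \<partial>M) \<le> ennreal (exp (- c)) * ennreal (exp a)" by (intro mult_left_mono I) simp
 also have "... = ennreal (exp (a - c))" by (simp add: ennreal_mult[symmetric] exp_add[symmetric])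
 also have "{x\<in>space M. 1 \<le> ennreal (exp (- c)) * ennreal (exp (f x))} = {x\<in>space M. c \<le> f x}"
  by (auto simp: ennreal_mult[symmetric] exp_add[symmetric])
 finally show ?thesis by (simp add: emeasure_eq_measure)
qed

text \<open>\<open>K\<close> may exceed the number \<open>k\<close> of terms, so that a short sum
  can be measured on the scale of the sample size. The Chernoff exponent at \<open>l = d / 4\<close>
  and at \<open>l = - d / 4\<close> is \<open>(k - 2 * K) * d^2 / 8\<close>, which is at most
  \<open>- K * d^2 / 8\<close>.\<close>

lemma gauss_chi_square_tail:
 assumes fin: "finite I" and k: "real (card I) \<le> K" and d: "0 \<le> d" "d \<le> 1"
 shows "measure (gauss I) {x\<in>space (gauss I). K * d \<le> \<bar>(\<Sum>i\<in>I. (x i)^2) - real (card I)\<bar>} \<le> 2 * exp (- K * d^2 / 8)"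
proof -
 interpret prob_space "gauss I" by (rule prob_space_gauss)
 let ?q = "\<lambda>x. \<Sum>i\<in>I. (x i :: real)^2" let ?k = "real (card I)"
 have one: "prob {x\<in>space (gauss I). ?k * l + K * d * (d / 4) \<le> l * ?q x} \<le> exp (- K * d^2 / 8)"
  if l: "\<bar>l\<bar> = d / 4" for l
 proof -
  have "l^2 = (d / 4)^2" using l by (metis power2_abs)
  then have l2: "l^2 = d^2 / 16" by (simp add: power_divide)
  have "prob {x\<in>space (gauss I). ?k * l + K * d * (d / 4) \<le> l * ?q x} \<le> exp (?k * (l + 2 * l^2) - (?k * l + K * d * (d / 4)))"
   by (rule measure_le_of_nn_integral_exp[OF prob_space_gauss])
    (use gauss_exp_sum_squares[OF fin, of l] l d in auto)
  also have "... \<le> exp (- K * d^2 / 8)"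
  proof -
   have "?k * (l + 2 * l^2) - (?k * l + K * d * (d / 4)) = (?k - 2 * K) * (d^2 / 8)"
    unfolding l2 by (simp add: algebra_simps power2_eq_square)
   also have "... \<le> (- K) * (d^2 / 8)" by (rule mult_right_mono) (use k in auto)
   finally show ?thesis by simp
  qed
  finally show ?thesis .
 qed
 show ?thesis
 proof (cases "d = 0")
  case True
  then show ?thesis using prob_le_1 by (simp add: order_trans[OF prob_le_1])
 next
  case False
  then have d0: "d > 0" using d by simp
  have sub: "{x\<in>space (gauss I). K * d \<le> \<bar>?q x - ?k\<bar>} \<subseteq>
   {x\<in>space (gauss I). ?k * (d/4) + K * d * (d / 4) \<le> (d/4) * ?q x} \<union> {x\<in>space (gauss I). ?k * (-d/4) + K * d * (d / 4) \<le> (-d/4) * ?q x}"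
  proof safe
   fix x :: "'a => real"
   assume 1: "K * d \<le> \<bar>?q x - ?k\<bar>" and 2: "\<not> ?k * (- d / 4) + K * d * (d / 4) \<le> (- d / 4) * ?q x"
   have "(?k - ?q x) * (d/4) < K * d * (d/4)" using 2 by (simp add: algebra_simps)
   then have "?k - ?q x < K * d" using d0 by (simp only: mult_less_cancel_right_pos[of "d/4"])
   with 1 have "K * d \<le> ?q x - ?k" by linarith
   then have "K * d * (d/4) \<le> (?q x - ?k) * (d/4)" using d0 by (intro mult_right_mono) auto
   then show "?k * (d / 4) + K * d * (d / 4) \<le> d / 4 * ?q x" by (simp add: algebra_simps)
  qed
  have "prob {x\<in>space (gauss I). K * d \<le> \<bar>?q x - ?k\<bar>} \<le> prob ({x\<in>space (gauss I). ?k * (d/4) + K * d * (d / 4) \<le> (d/4) * ?q x} \<union> {x\<in>space (gauss I). ?k * (-d/4) + K * d * (d / 4) \<le> (-d/4) * ?q x})"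
   by (rule finite_measure_mono[OF sub]) measurable
  also have "... \<le> prob {x\<in>space (gauss I). ?k * (d/4) + K * d * (d / 4) \<le> (d/4) * ?q x} + prob {x\<in>space (gauss I). ?k * (-d/4) + K * d * (d / 4) \<le> (-d/4) * ?q x}"
   by (rule measure_Un_le) measurable
  also have "... \<le> 2 * exp (- K * d^2 / 8)"
   using one[of "d/4"] one[of "-d/4"] d by simp
  finally show ?thesis .
 qed
qed

lemma gauss_exp_linear:
 assumes fin: "finite I"
 shows "(\<integral>\<^sup>+x. ennreal (exp (\<Sum>i\<in>I. c i * x i)) \<partial>gauss I) = ennreal (exp ((\<Sum>i\<in>I. (c i)^2) / 2))"
proof -
 have one: "(\<integral>\<^sup>+x. ennreal (exp (c * x)) \<partial>std_normal_distribution) = ennreal (exp (c^2 / 2))" for c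
 proof -
  have "std_normal_density x * exp (c * x) = exp (c^2 / 2) * normal_density c 1 x" for x
  proof -
   have "- x\<^sup>2 / 2 + c * x = c^2 / 2 + - (x - c)\<^sup>2 / 2" by (simp add: power2_eq_square field_simps)
   then have "exp (- x\<^sup>2 / 2) * exp (c * x) = exp (c^2 / 2) * exp (- (x - c)\<^sup>2 / 2)" by (simp only: exp_add[symmetric])
   then show ?thesis unfolding std_normal_density_def normal_density_def by (simp add: field_simps)
  qed
  then have "(\<integral>\<^sup>+x. ennreal (exp (c * x)) \<partial>std_normal_distribution) = (\<integral>\<^sup>+x. ennreal (exp (c^2 / 2)) * ennreal (normal_density c 1 x) \<partial>lborel)"
   by (subst nn_integral_density) (auto simp: ennreal_mult[symmetric] intro!: nn_integral_cong)
  also have "... = ennreal (exp (c^2 / 2)) * emeasure (density lborel (\<lambda>x. ennreal (normal_density c 1 x))) UNIV"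
   by (subst nn_integral_cmult) (auto simp: emeasure_density)
  also have "... = ennreal (exp (c^2 / 2))"
   using prob_space.emeasure_space_1[OF prob_space_normal_density[of 1 c]] by simp
  finally show ?thesis .
 qed
 have "(\<integral>\<^sup>+x. ennreal (exp (\<Sum>i\<in>I. c i * x i)) \<partial>gauss I) = (\<integral>\<^sup>+x. (\<Prod>i\<in>I. ennreal (exp (c i * x i))) \<partial>gauss I)"
  using fin by (simp add: exp_sum prod_ennreal)
 also have "... = (\<Prod>i\<in>I. \<integral>\<^sup>+x. ennreal (exp (c i * x)) \<partial>std_normal_distribution)"
  by (rule nn_integral_gauss_prod[OF fin]) auto
 also have "... = ennreal (exp ((\<Sum>i\<in>I. (c i)^2) / 2))"
  using fin by (simp add: one prod_ennreal exp_sum[symmetric] sum_divide_distrib)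
 finally show ?thesis .
qed

text \<open>\<open>v\<close> is an upper bound on the variance, since in the application the
  variance itself depends on the regressors. The exponential tilt divides by \<open>sqrt v\<close>,
  hence the separate case of a form that vanishes identically.\<close>

lemma gauss_linear_tail:
 assumes fin: "finite I" and v: "(\<Sum>i\<in>I. (c i)^2) \<le> v" and u: "u \<ge> 0"
 shows "measure (gauss I) {x\<in>space (gauss I). u * sqrt v < \<bar>\<Sum>i\<in>I. c i * x i\<bar>} \<le> 2 * exp (- u\<^sup>2 / 2)"
proof -
 interpret prob_space "gauss I" by (rule prob_space_gauss)
 have v0: "0 \<le> v" using v by (rule order_trans[rotated]) (rule sum_nonneg, simp)
 show ?thesis
 proof (cases "v = 0")
  case True
  then have "(\<Sum>i\<in>I. (c i)^2) = 0" using v by (metis antisym sum_nonneg zero_le_power2)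
  then have "\<forall>i\<in>I. c i = 0" using fin by (simp add: sum_nonneg_eq_0_iff)
  then show ?thesis using True by simp
 next
  case False
  then have vp: "v > 0" using v0 by simp
  have one: "prob {x\<in>space (gauss I). u^2 \<le> (\<Sum>i\<in>I. (e * u / sqrt v * c i) * x i)} \<le> exp (- u\<^sup>2 / 2)"
   if e: "\<bar>e\<bar> = 1" for e
  proof -
   have e2: "e^2 = 1" using e by (metis power2_abs one_power2)
   have "(\<Sum>i\<in>I. (e * u / sqrt v * c i)^2) = u^2 / v * (\<Sum>i\<in>I. (c i)^2)"
    using vp e2 by (simp add: power_mult_distrib power_divide sum_distrib_left)
   also have "... \<le> u^2 / v * v" by (intro mult_left_mono v) (use vp in auto)
   finally have s: "(\<Sum>i\<in>I. (e * u / sqrt v * c i)^2) / 2 \<le> u^2 / 2" using vp by simp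
   have "prob {x\<in>space (gauss I). u^2 \<le> (\<Sum>i\<in>I. (e * u / sqrt v * c i) * x i)} \<le> exp (u^2 / 2 - u\<^sup>2)"
    by (rule measure_le_of_nn_integral_exp[OF prob_space_gauss])
     (use s in \<open>auto simp only: gauss_exp_linear[OF fin] exp_le_cancel_iff intro!: ennreal_leI, measurable\<close>)
   then show ?thesis by simp
  qed
  have "{x\<in>space (gauss I). u * sqrt v < \<bar>\<Sum>i\<in>I. c i * x i\<bar>} \<subseteq>
    {x\<in>space (gauss I). u^2 \<le> (\<Sum>i\<in>I. (1 * u / sqrt v * c i) * x i)} \<union> {x\<in>space (gauss I). u^2 \<le> (\<Sum>i\<in>I. (-1 * u / sqrt v * c i) * x i)}" 
  proof -
   have eq: "(\<Sum>i\<in>I. (e * u / sqrt v * c i) * x i) = u / sqrt v * (e * (\<Sum>i\<in>I. c i * x i))" for e x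
    by (simp add: sum_distrib_left mult_ac)
   have h: "u^2 \<le> u / sqrt v * y" if "u * sqrt v < y" for y
   proof -
    have "u / sqrt v * (u * sqrt v) \<le> u / sqrt v * y" by (rule mult_left_mono) (use that u vp in auto)
    then show ?thesis using vp by (simp add: power2_eq_square)
   qed
   have "u^2 \<le> u / sqrt v * (1 * y) \<or> u\<^sup>2 \<le> u / sqrt v * (-1 * y)" if "u * sqrt v < \<bar>y\<bar>" for y
    using that h[of y] h[of "- y"] by (cases "y \<ge> 0") simp_all
   then show ?thesis unfolding eq by blast
  qed
  then have "prob {x\<in>space (gauss I). u * sqrt v < \<bar>\<Sum>i\<in>I. c i * x i\<bar>} \<le> prob ({x\<in>space (gauss I). u^2 \<le> (\<Sum>i\<in>I. (1 * u / sqrt v * c i) * x i)} \<union> {x\<in>space (gauss I). u^2 \<le> (\<Sum>i\<in>I. (-1 * u / sqrt v * c i) * x i)})"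
   by (rule finite_measure_mono) measurable
  also have "... \<le> prob {x\<in>space (gauss I). u^2 \<le> (\<Sum>i\<in>I. (1 * u / sqrt v * c i) * x i)} + prob {x\<in>space (gauss I). u^2 \<le> (\<Sum>i\<in>I. (-1 * u / sqrt v * c i) * x i)}"
   by (rule measure_Un_le) measurable
  also have "... \<le> 2 * exp (- u\<^sup>2 / 2)" using one[of 1] one[of "-1"] by simp
  finally show ?thesis .
 qed
qed

section \<open>Laws of squared norms through moments and Laplace transforms\<close>

text \<open>For a bounded variable the exponential series may be integrated term by term, so the
  moments determine the law.\<close>

lemma char_bounded_eq_suminf:
 assumes "prob_space M" and U[measurable]: "U \<in> borel_measurable M" and U1: "\<And>x. \<bar>U x\<bar> \<le> 1"
 shows "char (distr M borel U) t = (\<Sum>k. (\<i> * of_real t) ^ k /\<^sub>R fact k * of_real (\<integral>x. U x ^ k \<partial>M))"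
proof -
 interpret prob_space M by fact
 let ?f = "\<lambda>k x. (\<i> * of_real t) ^ k /\<^sub>R fact k * of_real (U x ^ k) :: complex"
 have nf: "norm (?f k x) \<le> \<bar>t\<bar> ^ k /\<^sub>R fact k" for k x
 proof -
  have "norm (?f k x) = \<bar>t\<bar> ^ k /\<^sub>R fact k * \<bar>U x\<bar> ^ k"
   by (simp add: norm_mult norm_power power_abs)
  also have "... \<le> \<bar>t\<bar> ^ k /\<^sub>R fact k * 1"
   by (intro mult_left_mono power_le_one) (use U1 in auto)
  finally show ?thesis by simp
 qed
 have summ: "summable (\<lambda>k. \<bar>t\<bar> ^ k /\<^sub>R fact k)" by (rule summable_exp_generic)
 have int: "integrable M (?f k)" for k
  by (rule integrable_const_bound[where B="\<bar>t\<bar> ^ k /\<^sub>R fact k"]) (use nf in auto)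
 have "char (distr M borel U) t = (\<integral>x. iexp (t * U x) \<partial>M)"
  unfolding char_def by (subst integral_distr) auto
 also have "... = (\<integral>x. (\<Sum>k. ?f k x) \<partial>M)"
 proof (rule Bochner_Integration.integral_cong[OF refl])
  fix x
  have "(\<lambda>k. (\<i> * of_real (t * U x)) ^ k /\<^sub>R fact k) sums iexp (t * U x)" by (rule exp_converges)
  then show "iexp (t * U x) = (\<Sum>k. ?f k x)"
   by (simp add: sums_iff power_mult_distrib mult_ac)
 qed
 also have "... = (\<Sum>k. \<integral>x. ?f k x \<partial>M)"
 proof (rule integral_suminf[OF int])
  show "AE x in M. summable (\<lambda>k. norm (?f k x))"
   by (rule AE_I2, rule summable_comparison_test'[OF summ, of 0]) (use nf in simp)
  show "summable (\<lambda>k. \<integral>x. norm (?f k x) \<partial>M)"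
  proof (rule summable_comparison_test'[OF summ, of 0])
   fix k
   have "(\<integral>x. norm (?f k x) \<partial>M) \<le> (\<integral>x. \<bar>t\<bar> ^ k /\<^sub>R fact k \<partial>M)"
    by (rule integral_mono[OF integrable_norm[OF int] integrable_const nf])
   then show "norm (\<integral>x. norm (?f k x) \<partial>M) \<le> \<bar>t\<bar> ^ k /\<^sub>R fact k"
    by (simp add: prob_space)
  qed
 qed
 also have "... = (\<Sum>k. (\<i> * of_real t) ^ k /\<^sub>R fact k * of_real (\<integral>x. U x ^ k \<partial>M))"
 proof (rule suminf_cong)
  fix k
  have "(\<integral>x. ?f k x \<partial>M) = (\<i> * of_real t) ^ k /\<^sub>R fact k * (\<integral>x. of_real (U x ^ k) \<partial>M)"
   by (rule integral_mult_right_zero)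
  then show "(\<integral>x. ?f k x \<partial>M) = (\<i> * of_real t) ^ k /\<^sub>R fact k * of_real (\<integral>x. U x ^ k \<partial>M)"
   by (simp only: integral_complex_of_real)
 qed
 finally show ?thesis .
qed

text \<open>The moments of \<open>exp (- X)\<close> are the values of the Laplace transform of
  \<open>X\<close> at the natural numbers. This variable lies in \<open>[0, 1]\<close>, so they
  determine its law, and \<open>X\<close> is recovered by \<open>- ln\<close>.\<close>

lemma distr_eq_of_laplace:
 assumes p: "prob_space M" "prob_space N" and X[measurable]: "X \<in> borel_measurable M" and Y[measurable]: "Y \<in> borel_measurable N"
  and X0: "\<And>x. 0 \<le> X x" and Y0: "\<And>x. 0 \<le> Y x"
  and eq: "\<And>k::nat. (\<integral>x. exp (- real k * X x) \<partial>M) = (\<integral>x. exp (- real k * Y x) \<partial>N)"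
 shows "distr M borel X = distr N borel (Y :: _ => real)"
proof -
 have "distr M borel (\<lambda>x. exp (- X x)) = distr N borel (\<lambda>x. exp (- Y x))"
 proof (rule Levy_uniqueness)
  show "real_distribution (distr M borel (\<lambda>x. exp (- X x)))" by (rule prob_space.real_distribution_distr[OF p(1)]) simp
  show "real_distribution (distr N borel (\<lambda>x. exp (- Y x)))" by (rule prob_space.real_distribution_distr[OF p(2)]) simp
  have e: "exp (- X x) ^ k = exp (- real k * X x)" "exp (- Y y) ^ k = exp (- real k * Y y)" for x y k
   by (simp_all add: exp_of_nat_mult[symmetric])
  show "char (distr M borel (\<lambda>x. exp (- X x))) = char (distr N borel (\<lambda>x. exp (- Y x)))"
  proof
   fix t
   have "char (distr M borel (\<lambda>x. exp (- X x))) t = (\<Sum>k. (\<i> * of_real t) ^ k /\<^sub>R fact k * of_real (\<integral>x. exp (- X x) ^ k \<partial>M))"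
    by (rule char_bounded_eq_suminf[OF p(1)]) (use X0 in auto)
   moreover have "char (distr N borel (\<lambda>x. exp (- Y x))) t = (\<Sum>k. (\<i> * of_real t) ^ k /\<^sub>R fact k * of_real (\<integral>x. exp (- Y x) ^ k \<partial>N))"
    by (rule char_bounded_eq_suminf[OF p(2)]) (use Y0 in auto)
   ultimately show "char (distr M borel (\<lambda>x. exp (- X x))) t = char (distr N borel (\<lambda>x. exp (- Y x))) t"
    unfolding e eq by simp
  qed
 qed
 then have "distr (distr M borel (\<lambda>x. exp (- X x))) borel (\<lambda>u. - ln u) = distr (distr N borel (\<lambda>x. exp (- Y x))) borel (\<lambda>u. - ln u)"
  by simp
 then show ?thesis by (simp add: distr_distr comp_def)
qed

text \<open>Both sides are iterated integrals of one function: \<open>iexp\<close> of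
  \<open>sqrt (2 * l)\<close> times the bilinear form of \<open>B\<close> in \<open>g\<close> and
  \<open>h\<close>. Whichever variable is integrated first, the normal characteristic function turns
  the inner integral into the exponential of a squared norm.\<close>

lemma gauss_quadratic_duality:
 fixes B :: "'i => 'j => real"
 assumes fin: "finite I" "finite J" and l: "l \<ge> 0"
 shows "(\<integral>g. exp (- l * (\<Sum>j\<in>J. (\<Sum>i\<in>I. B i j * g i)^2)) \<partial>gauss I) = (\<integral>h. exp (- l * (\<Sum>i\<in>I. (\<Sum>j\<in>J. B i j * h j)^2)) \<partial>gauss J)"
proof -
 interpret I: prob_space "gauss I" by (rule prob_space_gauss)
 interpret J: prob_space "gauss J" by (rule prob_space_gauss)
 interpret pair_prob_space "gauss I" "gauss J" ..
 let ?f = "\<lambda>g h. iexp (\<Sum>j\<in>J. (sqrt (2 * l) * (\<Sum>i\<in>I. B i j * g i)) * h j)"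
 have f_alt: "?f g h = iexp (\<Sum>i\<in>I. (sqrt (2 * l) * (\<Sum>j\<in>J. B i j * h j)) * g i)" for g h
 proof -
  have "(\<Sum>j\<in>J. (sqrt (2 * l) * (\<Sum>i\<in>I. B i j * g i)) * h j) = (\<Sum>i\<in>I. (sqrt (2 * l) * (\<Sum>j\<in>J. B i j * h j)) * g i)"
   by (simp add: sum_distrib_left sum_distrib_right mult_ac) (rule sum.swap)
  then show ?thesis by simp
 qed
 have meas: "(\<lambda>(g, h). ?f g h) \<in> borel_measurable (gauss I \<Otimes>\<^sub>M gauss J)" by measurable
 have "integrable (gauss I \<Otimes>\<^sub>M gauss J) (\<lambda>(g, h). ?f g h)"
  by (rule integrable_const_bound[where B=1]) (use meas in auto)
 then have "(\<integral>h. (\<integral>g. ?f g h \<partial>gauss I) \<partial>gauss J) = (\<integral>g. (\<integral>h. ?f g h \<partial>gauss J) \<partial>gauss I)"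
  by (rule Fubini_integral)
 moreover have "(\<integral>h. ?f g h \<partial>gauss J) = of_real (exp (- l * (\<Sum>j\<in>J. (\<Sum>i\<in>I. B i j * g i)^2)))" for g
  using l by (subst integral_gauss_iexp[OF fin(2)]) (simp add: power_mult_distrib sum_distrib_left[symmetric])
 moreover have "(\<integral>g. ?f g h \<partial>gauss I) = of_real (exp (- l * (\<Sum>i\<in>I. (\<Sum>j\<in>J. B i j * h j)^2)))" for h
  unfolding f_alt using l by (subst integral_gauss_iexp[OF fin(1)]) (simp add: power_mult_distrib sum_distrib_left[symmetric])
 ultimately have "(\<integral>h. complex_of_real (exp (- l * (\<Sum>i\<in>I. (\<Sum>j\<in>J. B i j * h j)^2))) \<partial>gauss J) = (\<integral>g. complex_of_real (exp (- l * (\<Sum>j\<in>J. (\<Sum>i\<in>I. B i j * g i)^2))) \<partial>gauss I)"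
  by (simp only:)
 then have "complex_of_real (\<integral>h. exp (- l * (\<Sum>i\<in>I. (\<Sum>j\<in>J. B i j * h j)^2)) \<partial>gauss J) = complex_of_real (\<integral>g. exp (- l * (\<Sum>j\<in>J. (\<Sum>i\<in>I. B i j * g i)^2)) \<partial>gauss I)"
  by (simp only: integral_complex_of_real)
 then show ?thesis by (simp only: of_real_eq_iff)
qed

text \<open>A linear map and its transpose have the same singular values, so they map standard normal
 vectors to vectors with equally distributed norms.\<close>

lemma gauss_quadratic_law:
 fixes B :: "'i => 'j => real"
 assumes fin: "finite I" "finite J" and A[measurable]: "A \<in> sets borel"
 shows "measure (gauss I) {g\<in>space (gauss I). (\<Sum>j\<in>J. (\<Sum>i\<in>I. B i j * g i)^2) \<in> A} = measure (gauss J) {h\<in>space (gauss J). (\<Sum>i\<in>I. (\<Sum>j\<in>J. B i j * h j)^2) \<in> A}"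
proof -
 let ?X = "\<lambda>g. \<Sum>j\<in>J. (\<Sum>i\<in>I. B i j * g i)^2" let ?Y = "\<lambda>h. \<Sum>i\<in>I. (\<Sum>j\<in>J. B i j * h j)^2"
 have mX: "?X \<in> borel_measurable (gauss I)" and mY: "?Y \<in> borel_measurable (gauss J)" by measurable
 have "distr (gauss I) borel ?X = distr (gauss J) borel ?Y"
  by (rule distr_eq_of_laplace[OF prob_space_gauss prob_space_gauss mX mY])
   (use gauss_quadratic_duality[OF fin] in \<open>auto intro!: sum_nonneg\<close>)
 then have "measure (distr (gauss I) borel ?X) A = measure (distr (gauss J) borel ?Y) A" by simp
 then have "measure (gauss I) (?X -` A \<inter> space (gauss I)) = measure (gauss J) (?Y -` A \<inter> space (gauss J))"
  using measure_distr[OF mX A] measure_distr[OF mY A] by simp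
 then show ?thesis by (simp only: vimage_def Collect_conj_eq[symmetric] Int_def mem_Collect_eq conj_commute)
qed

unbundle no vec_syntax
unbundle no inner_syntax

section \<open>Least squares\<close>

text \<open>The adjugate formula writes the inverse as a rational function of the entries, from
  which measurability follows. A singular matrix is sent to the zero matrix, since
  \<open>1 / 0 = 0\<close>.\<close>

definition minv :: "real mat => real mat" where
 "minv A = (1 / det A) \<cdot>\<^sub>m adj_mat A"

lemma minv_carrier [simp]: "A \<in> carrier_mat n n ==> minv A \<in> carrier_mat n n"
 by (simp add: minv_def adj_mat(1))

lemma minv_inverse:
 assumes A: "A \<in> carrier_mat n n" and d: "det A \<noteq> 0"
 shows "A * minv A = 1\<^sub>m n" "minv A * A = 1\<^sub>m n"
proof -
 note adj = adj_mat[OF A]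
 have "A * minv A = (1 / det A) \<cdot>\<^sub>m (A * adj_mat A)"
  unfolding minv_def by (rule mult_smult_distrib[OF A adj(1)])
 then show "A * minv A = 1\<^sub>m n" using d by (auto simp: adj(2))
 have "minv A * A = (1 / det A) \<cdot>\<^sub>m (adj_mat A * A)"
  unfolding minv_def by (rule mult_smult_assoc_mat[OF adj(1) A])
 then show "minv A * A = 1\<^sub>m n" using d by (auto simp: adj(3))
qed

lemma det_nonzero_of_inverse:
 fixes A :: "real mat"
 assumes "A \<in> carrier_mat n n" "B \<in> carrier_mat n n" "A * B = 1\<^sub>m n"
 shows "det A \<noteq> 0"
 using det_mult[OF assms(1,2)] assms(3) by auto

lemma minv_unique:
 assumes A: "A \<in> carrier_mat n n" and B: "B \<in> carrier_mat n n" and AB: "A * B = 1\<^sub>m n"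
 shows "minv A = B"
proof -
 have d: "det A \<noteq> 0" by (rule det_nonzero_of_inverse[OF assms])
 have "minv A = minv A * (A * B)" using minv_carrier[OF A] AB by simp
 also have "... = (minv A * A) * B" by (rule assoc_mult_mat[symmetric, of _ n n _ n _ n]) (use A B in auto)
 also have "... = B" using minv_inverse(2)[OF A d] B by simp
 finally show ?thesis .
qed

lemma transpose_minv:
 assumes A: "A \<in> carrier_mat n n" and d: "det A \<noteq> 0"
 shows "transpose_mat (minv A) = minv (transpose_mat A)"
proof (rule minv_unique[symmetric])
 have "transpose_mat A * transpose_mat (minv A) = transpose_mat (minv A * A)"
  using A by (subst transpose_mult[of _ n n _ n]) auto
 then show "transpose_mat A * transpose_mat (minv A) = 1\<^sub>m n" using minv_inverse(2)[OF A d] by simp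
qed (use A in auto)

abbreviation gram :: "real mat => real mat" where
 "gram W \<equiv> transpose_mat W * W"

definition fullrank :: "real mat => bool" where
 "fullrank W \<longleftrightarrow> det (gram W) \<noteq> 0"

text \<open>When \<open>W\<close> has full column rank, \<open>lsq W\<close> is its pseudo-inverse,
  which maps a response to the least-squares coefficients, and \<open>rsd W\<close> is the
  projection onto the orthogonal complement of the columns.\<close>

definition lsq :: "real mat => real mat" where
 "lsq W = minv (gram W) * transpose_mat W"

definition rsd :: "real mat => real mat" where
 "rsd W = 1\<^sub>m (dim_row W) - W * lsq W"

lemma gram_carrier [simp]: "W \<in> carrier_mat n p ==> gram W \<in> carrier_mat p p"
 by auto

lemma lsq_carrier [simp]: "W \<in> carrier_mat n p ==> lsq W \<in> carrier_mat p n"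
 unfolding lsq_def by (rule mult_carrier_mat[of _ p p]) auto

lemma rsd_carrier [simp]: "W \<in> carrier_mat n p ==> rsd W \<in> carrier_mat n n"
 unfolding rsd_def by (rule minus_carrier_mat, rule mult_carrier_mat[of _ n p]) auto

lemma scalar_prod_self_eq_0:
 fixes v :: "real Matrix.vec"
 assumes "v \<in> carrier_vec n" "scalar_prod v v = 0"
 shows "v = 0\<^sub>v n"
proof
 have "(\<Sum>i=0..<n. (v $ i)^2) = 0" using assms by (simp add: scalar_prod_def power2_eq_square)
 then have "\<forall>i\<in>{0..<n}. (v $ i)^2 = 0" by (subst (asm) sum_nonneg_eq_0_iff) auto
 then show "v $ i = 0\<^sub>v n $ i" if "i < dim_vec (0\<^sub>v n)" for i using that by simp
qed (use assms in auto)

lemma scalar_prod_transpose: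
 fixes A :: "real mat"
 assumes "A \<in> carrier_mat n p" "x \<in> carrier_vec p" "y \<in> carrier_vec n"
 shows "scalar_prod (A *\<^sub>v x) y = scalar_prod x (transpose_mat A *\<^sub>v y)"
proof -
 have "scalar_prod x (transpose_mat A *\<^sub>v y) = (\<Sum>k=0..<p. \<Sum>i=0..<n. x $ k * A $$ (i, k) * y $ i)"
  using assms by (auto simp: scalar_prod_def sum_distrib_left mult.assoc intro!: sum.cong)
 also have "... = (\<Sum>i=0..<n. \<Sum>k=0..<p. x $ k * A $$ (i, k) * y $ i)" by (rule sum.swap)
 also have "... = scalar_prod (A *\<^sub>v x) y"
  using assms by (auto simp: scalar_prod_def sum_distrib_right sum_distrib_left mult_ac intro!: sum.cong)
 finally show ?thesis by simp
qed

lemma gram_mult_eq_0: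
 fixes W :: "real mat"
 assumes W: "W \<in> carrier_mat n p" and v: "v \<in> carrier_vec p" and 0: "transpose_mat W *\<^sub>v (W *\<^sub>v v) = 0\<^sub>v p"
 shows "W *\<^sub>v v = 0\<^sub>v n"
proof (rule scalar_prod_self_eq_0)
 show "W *\<^sub>v v \<in> carrier_vec n" using W v by simp
 then have "scalar_prod (W *\<^sub>v v) (W *\<^sub>v v) = scalar_prod v (transpose_mat W *\<^sub>v (W *\<^sub>v v))"
  using scalar_prod_transpose[OF W v] by simp
 then show "scalar_prod (W *\<^sub>v v) (W *\<^sub>v v) = 0" using 0 v by simp
qed

lemma fullrank_iff:
 assumes W: "W \<in> carrier_mat n p"
 shows "fullrank W \<longleftrightarrow> (\<forall>v\<in>carrier_vec p. W *\<^sub>v v = 0\<^sub>v n \<longrightarrow> v = 0\<^sub>v p)"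
proof -
 have a: "gram W *\<^sub>v v = transpose_mat W *\<^sub>v (W *\<^sub>v v)" if "v \<in> carrier_vec p" for v
  by (rule assoc_mult_mat_vec[of _ p n _ p]) (use W that in auto)
 have b: "transpose_mat W *\<^sub>v 0\<^sub>v n = 0\<^sub>v p" using W by auto
 have G: "gram W \<in> carrier_mat p p" using W by simp
 have "gram W *\<^sub>v v = 0\<^sub>v p \<longleftrightarrow> W *\<^sub>v v = 0\<^sub>v n" if "v \<in> carrier_vec p" for v
  using gram_mult_eq_0[OF W that] a[OF that] b by auto
 then show ?thesis unfolding fullrank_def det_0_iff_vec_prod_zero_field[OF G] by auto
qed

context
 fixes W :: "real mat" and n p :: nat
 assumes W: "W \<in> carrier_mat n p" and fr: "fullrank W"
begin

lemma lsq_mult: "lsq W * W = 1\<^sub>m p"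
proof -
 have "lsq W * W = minv (gram W) * gram W"
  unfolding lsq_def by (rule assoc_mult_mat[of _ p p _ n _ p]) (use W in auto)
 then show ?thesis using minv_inverse(2)[of "gram W" p] W fr by (auto simp: fullrank_def)
qed

lemma transpose_minv_gram: "transpose_mat (minv (gram W)) = minv (gram W)"
 using transpose_minv[of "gram W" p] W fr transpose_mult[of "transpose_mat W" p n W p] by (auto simp: fullrank_def)

lemma transpose_lsq: "transpose_mat (lsq W) = W * minv (gram W)"
 unfolding lsq_def using W transpose_mult[of "minv (gram W)" p p "transpose_mat W" n] by (simp add: transpose_minv_gram)

lemma lsq_mult_transpose: "lsq W * transpose_mat (lsq W) = minv (gram W)"
proof -
 have "lsq W * transpose_mat (lsq W) = (lsq W * W) * minv (gram W)"
  unfolding transpose_lsq by (rule assoc_mult_mat[symmetric, of _ p n _ p _ p]) (use W in auto)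
 then show ?thesis using minv_carrier[OF gram_carrier[OF W]] by (simp add: lsq_mult)
qed

lemma proj_symmetric: "transpose_mat (W * lsq W) = W * lsq W"
proof -
 have "transpose_mat (W * lsq W) = (W * minv (gram W)) * transpose_mat W"
  using W transpose_mult[of W n p "lsq W" n] by (simp add: transpose_lsq)
 also have "... = W * lsq W"
  unfolding lsq_def by (rule assoc_mult_mat[of _ n p _ p _ n]) (use W in auto)
 finally show ?thesis .
qed

lemma rsd_symmetric: "transpose_mat (rsd W) = rsd W"
proof -
 have "transpose_mat (1\<^sub>m n - W * lsq W) = transpose_mat (1\<^sub>m n) - transpose_mat (W * lsq W)"
  by (rule transpose_minus[of _ n n]) (use W in auto)
 then show ?thesis unfolding rsd_def using W by (simp add: proj_symmetric)
qed

lemma rsd_mult: "rsd W * W = 0\<^sub>m n p"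
proof -
 have "rsd W * W = 1\<^sub>m n * W - (W * lsq W) * W"
  unfolding rsd_def using W by (subst minus_mult_distrib_mat[of _ n n]) auto
 also have "(W * lsq W) * W = W * (lsq W * W)" by (rule assoc_mult_mat[of _ n p _ n _ p]) (use W in auto)
 also have "... = W" using W by (simp add: lsq_mult)
 finally show ?thesis using W by simp
qed

lemma transpose_rsd: "transpose_mat W * rsd W = 0\<^sub>m p n"
proof -
 have "transpose_mat W * rsd W = transpose_mat (rsd W * W)"
  using W transpose_mult[of "rsd W" n n W p] by (simp add: rsd_symmetric)
 then show ?thesis by (simp add: rsd_mult)
qed

lemma rsd_idempotent: "rsd W * rsd W = rsd W"
proof -
 have "rsd W * rsd W = rsd W * 1\<^sub>m n - rsd W * (W * lsq W)"
  by (subst (2) rsd_def, subst mult_minus_distrib_mat[of _ n n]) (use W in auto)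
 also have "rsd W * (W * lsq W) = (rsd W * W) * lsq W"
  by (rule assoc_mult_mat[symmetric, of _ n n _ p _ n]) (use W in auto)
 also have "... = 0\<^sub>m n n" unfolding rsd_mult by (rule left_mult_zero_mat[of _ p n]) (use W in simp)
 finally show ?thesis using rsd_carrier[OF W] by (auto intro!: eq_matI)
qed

lemma lsq_rsd: "lsq W * rsd W = 0\<^sub>m p n"
proof -
 have "lsq W * rsd W = minv (gram W) * (transpose_mat W * rsd W)"
  unfolding lsq_def by (rule assoc_mult_mat[of _ p p _ n _ n]) (use W in auto)
 then show ?thesis unfolding transpose_rsd using right_mult_zero_mat[of "minv (gram W)" p p n] W by simp
qed

text \<open>By cyclicity the trace of \<open>W * lsq W\<close> is that of \<open>lsq W * W\<close>,
  the identity of size \<open>p\<close>. The result counts the degrees of freedom of the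
  residuals.\<close>

lemma rsd_trace: "(\<Sum>i=0..<n. rsd W $$ (i, i)) = real n - real p"
proof -
 have "(\<Sum>i=0..<n. rsd W $$ (i, i)) = (\<Sum>i=0..<n. 1 - (\<Sum>k=0..<p. W $$ (i, k) * lsq W $$ (k, i)))"
 proof (intro sum.cong refl)
  fix i assume "i \<in> {0..<n}"
  moreover have "dim_row (lsq W) = p" "dim_col (lsq W) = n" using lsq_carrier[OF W] by auto
  ultimately show "rsd W $$ (i, i) = 1 - (\<Sum>k=0..<p. W $$ (i, k) * lsq W $$ (k, i))"
   using W by (auto simp: rsd_def scalar_prod_def)
 qed
 also have "... = real n - (\<Sum>i=0..<n. \<Sum>k=0..<p. W $$ (i, k) * lsq W $$ (k, i))"
  by (simp add: sum_subtractf)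
 also have "(\<Sum>i=0..<n. \<Sum>k=0..<p. W $$ (i, k) * lsq W $$ (k, i)) = (\<Sum>k=0..<p. (lsq W * W) $$ (k, k))"
 proof (subst sum.swap, rule sum.cong[OF refl])
  fix k assume "k \<in> {0..<p}"
  moreover have "dim_row (lsq W) = p" "dim_col (lsq W) = n" using lsq_carrier[OF W] by auto
  ultimately show "(\<Sum>i=0..<n. W $$ (i, k) * lsq W $$ (k, i)) = (lsq W * W) $$ (k, k)"
   using W by (auto simp: scalar_prod_def mult.commute)
 qed
 also have "... = real p" by (simp add: lsq_mult)
 finally show ?thesis .
qed

lemma lsq_unique:
 assumes \<theta>: "\<theta> \<in> carrier_vec p" and Y: "Y \<in> carrier_vec n"
  and ortho: "transpose_mat W *\<^sub>v (Y - W *\<^sub>v \<theta>) = 0\<^sub>v p"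
 shows "\<theta> = lsq W *\<^sub>v Y"
proof -
 have "transpose_mat W *\<^sub>v (Y - W *\<^sub>v \<theta>) = transpose_mat W *\<^sub>v Y - transpose_mat W *\<^sub>v (W *\<^sub>v \<theta>)"
  by (rule mult_minus_distrib_mat_vec[of _ p n]) (use W \<theta> Y in auto)
 with ortho have z: "transpose_mat W *\<^sub>v Y - transpose_mat W *\<^sub>v (W *\<^sub>v \<theta>) = 0\<^sub>v p" by simp
 have e: "transpose_mat W *\<^sub>v Y = transpose_mat W *\<^sub>v (W *\<^sub>v \<theta>)"
 proof
  fix i assume "i < dim_vec (transpose_mat W *\<^sub>v (W *\<^sub>v \<theta>))"
  then have "i < p" using W by simp
  then have "(transpose_mat W *\<^sub>v Y - transpose_mat W *\<^sub>v (W *\<^sub>v \<theta>)) $ i = 0" unfolding z by simp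
  then show "(transpose_mat W *\<^sub>v Y) $ i = (transpose_mat W *\<^sub>v (W *\<^sub>v \<theta>)) $ i"
   using \<open>i < p\<close> W \<theta> Y by auto
 qed (use W in auto)
 have "lsq W *\<^sub>v Y = minv (gram W) *\<^sub>v (transpose_mat W *\<^sub>v Y)"
  unfolding lsq_def by (rule assoc_mult_mat_vec[of _ p p _ n]) (use W Y in auto)
 also have "... = (minv (gram W) * transpose_mat W) *\<^sub>v (W *\<^sub>v \<theta>)"
  unfolding e by (rule assoc_mult_mat_vec[symmetric, of _ p p _ n]) (use W \<theta> in auto)
 also have "... = (lsq W * W) *\<^sub>v \<theta>"
  unfolding lsq_def[symmetric] by (rule assoc_mult_mat_vec[symmetric, of _ p n _ p]) (use W \<theta> lsq_carrier[OF W] in auto)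
 also have "... = \<theta>" using \<theta> by (simp add: lsq_mult)
 finally show ?thesis by simp
qed

lemma rsd_vec:
 assumes Y: "Y \<in> carrier_vec n"
 shows "rsd W *\<^sub>v Y = Y - W *\<^sub>v (lsq W *\<^sub>v Y)"
proof -
 have "rsd W *\<^sub>v Y = 1\<^sub>m n *\<^sub>v Y - (W * lsq W) *\<^sub>v Y"
  unfolding rsd_def using W Y by (subst minus_mult_distrib_mat_vec[of _ n n]) auto
 also have "(W * lsq W) *\<^sub>v Y = W *\<^sub>v (lsq W *\<^sub>v Y)" by (rule assoc_mult_mat_vec[of _ n p _ n]) (use W Y in auto)
 finally show ?thesis using Y by simp
qed

lemma transpose_rsd_vec:
 assumes Y: "Y \<in> carrier_vec n"
 shows "transpose_mat W *\<^sub>v (Y - W *\<^sub>v (lsq W *\<^sub>v Y)) = 0\<^sub>v p"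
proof -
 have "transpose_mat W *\<^sub>v (rsd W *\<^sub>v Y) = (transpose_mat W * rsd W) *\<^sub>v Y"
  by (rule assoc_mult_mat_vec[symmetric, of _ p n _ n]) (use W Y in auto)
 also have "... = 0\<^sub>v p" unfolding transpose_rsd using Y by auto
 finally show ?thesis unfolding rsd_vec[OF Y] .
qed

lemma rsd_norm:
 assumes Y: "Y \<in> carrier_vec n"
 shows "scalar_prod (rsd W *\<^sub>v Y) (rsd W *\<^sub>v Y) = scalar_prod Y (rsd W *\<^sub>v Y)"
proof -
 have "scalar_prod (rsd W *\<^sub>v Y) (rsd W *\<^sub>v Y) = scalar_prod Y (transpose_mat (rsd W) *\<^sub>v (rsd W *\<^sub>v Y))"
  by (rule scalar_prod_transpose[of _ n n]) (use Y rsd_carrier[OF W] in auto)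
 also have "transpose_mat (rsd W) *\<^sub>v (rsd W *\<^sub>v Y) = (rsd W * rsd W) *\<^sub>v Y"
  unfolding rsd_symmetric by (rule assoc_mult_mat_vec[symmetric, of _ n n _ n]) (use W Y in auto)
 finally show ?thesis unfolding rsd_idempotent .
qed

lemma rsd_vec_W:
 assumes "\<theta> \<in> carrier_vec p"
 shows "rsd W *\<^sub>v (W *\<^sub>v \<theta>) = 0\<^sub>v n"
proof -
 have "rsd W *\<^sub>v (W *\<^sub>v \<theta>) = (rsd W * W) *\<^sub>v \<theta>"
  by (rule assoc_mult_mat_vec[symmetric, of _ n n _ p]) (use W assms in auto)
 then show ?thesis unfolding rsd_mult using assms by auto
qed

lemma lsq_vec_W:
 assumes "\<theta> \<in> carrier_vec p"
 shows "lsq W *\<^sub>v (W *\<^sub>v \<theta>) = \<theta>"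
proof -
 have "lsq W *\<^sub>v (W *\<^sub>v \<theta>) = (lsq W * W) *\<^sub>v \<theta>"
  by (rule assoc_mult_mat_vec[symmetric, of _ p n _ p]) (use W assms in auto)
 then show ?thesis unfolding lsq_mult using assms by auto
qed

text \<open>A nonsingular recombination of the columns keeps their span, hence the residuals, and
  transforms the coefficients by \<open>T\<close>. It serves both the passage from observed to
  orthonormalized regressors and the rotation of Gaussian regressors.\<close>

lemma
 assumes T: "T \<in> carrier_mat p p" and d: "det T \<noteq> 0"
 shows fullrank_mult: "fullrank (W * T)"
  and lsq_mult_right: "Y \<in> carrier_vec n ==> T *\<^sub>v (lsq (W * T) *\<^sub>v Y) = lsq W *\<^sub>v Y"
  and rsd_mult_right: "rsd (W * T) = rsd W"
  and minv_gram_mult: "minv (gram (W * T)) = minv T * minv (gram W) * transpose_mat (minv T)"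
proof -
 have WT: "W * T \<in> carrier_mat n p" using W T by auto
 have "gram (W * T) = (transpose_mat T * transpose_mat W) * (W * T)"
  using transpose_mult[of W n p T p] W T by simp
 also have "... = transpose_mat T * (transpose_mat W * (W * T))"
  by (rule assoc_mult_mat[of _ p p _ n _ p]) (use W T in auto)
 also have "transpose_mat W * (W * T) = gram W * T"
  by (rule assoc_mult_mat[symmetric, of _ p n _ p _ p]) (use W T in auto)
 finally have g: "gram (W * T) = transpose_mat T * (gram W * T)" .
 have G: "gram W \<in> carrier_mat p p" using W by simp
 have "det (gram (W * T)) = det T * (det (gram W) * det T)"
  unfolding g using det_mult[of "transpose_mat T" p "gram W * T"] det_mult[OF G T] det_transpose[OF T] T G by simp
 then show fr': "fullrank (W * T)" using fr d by (simp add: fullrank_def)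
 note m = minv_inverse[OF T d]
 let ?Ti = "minv T" and ?S = "minv (gram W)"
 have Ti: "?Ti \<in> carrier_mat p p" "transpose_mat ?Ti \<in> carrier_mat p p" "?S \<in> carrier_mat p p" using T G by auto
 have Tt: "transpose_mat T * transpose_mat ?Ti = 1\<^sub>m p"
  using transpose_mult[of ?Ti p p T p] T m(2) by simp
 show "minv (gram (W * T)) = ?Ti * ?S * transpose_mat ?Ti"
 proof (rule minv_unique)
  have "gram (W * T) * (?Ti * ?S * transpose_mat ?Ti) = transpose_mat T * ((gram W * ((T * ?Ti) * ?S)) * transpose_mat ?Ti)"
   unfolding g using T G Ti by (simp add: assoc_mult_mat[of _ p p _ p _ p] mult_carrier_mat[of _ p p _ p])
  also have "... = 1\<^sub>m p"
   using m(1) G Tt fr minv_inverse(1)[OF G] left_mult_one_mat[OF Ti(3)] left_mult_one_mat[OF Ti(2)] by (simp add: fullrank_def)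
  finally show "gram (W * T) * (?Ti * ?S * transpose_mat ?Ti) = 1\<^sub>m p" .
  show "gram (W * T) \<in> carrier_mat p p" using WT by simp
  show "?Ti * ?S * transpose_mat ?Ti \<in> carrier_mat p p" using Ti by auto
 qed
 then have "lsq (W * T) = (?Ti * ?S * transpose_mat ?Ti) * (transpose_mat T * transpose_mat W)"
  unfolding lsq_def using transpose_mult[of W n p T p] W T by simp
 also have "... = (?Ti * ?S) * ((transpose_mat ?Ti * transpose_mat T) * transpose_mat W)"
 proof -
  have "(?Ti * ?S * transpose_mat ?Ti) * (transpose_mat T * transpose_mat W) = (?Ti * ?S) * (transpose_mat ?Ti * (transpose_mat T * transpose_mat W))"
   by (rule assoc_mult_mat[of _ p p _ p _ n]) (use W T Ti mult_carrier_mat[OF Ti(1) Ti(3)] in auto)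
  also have "transpose_mat ?Ti * (transpose_mat T * transpose_mat W) = (transpose_mat ?Ti * transpose_mat T) * transpose_mat W"
   by (rule assoc_mult_mat[symmetric, of _ p p _ p _ n]) (use W T Ti in auto)
  finally show ?thesis .
 qed
 also have "transpose_mat ?Ti * transpose_mat T = 1\<^sub>m p" using transpose_mult[of T p p ?Ti p] T m(1) by simp
 also have "(?Ti * ?S) * (1\<^sub>m p * transpose_mat W) = ?Ti * lsq W"
  unfolding lsq_def using W assoc_mult_mat[OF Ti(1) Ti(3), of "transpose_mat W" n] by simp
 finally have L: "lsq (W * T) = ?Ti * lsq W" .
 have TL: "T * lsq (W * T) = lsq W"
  unfolding L using assoc_mult_mat[of T p p ?Ti p "lsq W" n] T m(1) lsq_carrier[OF W] by simp
 show "T *\<^sub>v (lsq (W * T) *\<^sub>v Y) = lsq W *\<^sub>v Y" if "Y \<in> carrier_vec n"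
  using assoc_mult_mat_vec[of T p p "lsq (W * T)" n Y] T that lsq_carrier[OF WT] by (simp add: TL)
 show "rsd (W * T) = rsd W"
  unfolding rsd_def using assoc_mult_mat[OF W T lsq_carrier[OF WT]] by (simp add: TL)
qed

end

lemma mult_mat_vec_carrier_dim [simp]: "A \<in> carrier_mat n p ==> A *\<^sub>v v \<in> carrier_vec n"
 by (metis carrier_matD(1) carrier_vecI dim_mult_mat_vec)

section \<open>Orthonormal bases of projections and the last column of a regression\<close>

text \<open>Deflation: a nonzero column of \<open>M\<close>, normalized, is a unit vector
  \<open>e\<close> of the range, and subtracting the projection onto \<open>e\<close> leaves a
  symmetric idempotent whose trace is smaller by 1. The trace is the sum of the squared entries, so
  it cannot become negative and the process stops.\<close>

lemma symmetric_idempotent_decomposition: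
 fixes M :: "nat => nat => real"
 assumes sym: "\<And>i j. i < n ==> j < n ==> M i j = M j i"
  and idem: "\<And>i j. i < n ==> j < n ==> (\<Sum>k=0..<n. M i k * M k j) = M i j"
 shows "\<exists>k f. real k = (\<Sum>i=0..<n. M i i) \<and>
  (\<forall>i<n. \<forall>j<n. M i j = (\<Sum>l=0..<k. f l i * f l j)) \<and>
  (\<forall>l<k. \<forall>m<k. (\<Sum>i=0..<n. f l i * f m i) = (if l = m then 1 else 0))"
proof -
 have *: "(\<Sum>i=0..<n. M i i) < real N ==> ?thesis" for N
  using sym idem
 proof (induction N arbitrary: M)
  case 0
  have "(\<Sum>i=0..<n. M i i) = (\<Sum>i=0..<n. \<Sum>k=0..<n. (M i k)^2)"
   using "0.prems"(2) by (intro sum.cong refl) (subst "0.prems"(3)[symmetric], auto simp: power2_eq_square intro!: sum.cong)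
  moreover have "... \<ge> 0" by (intro sum_nonneg) auto
  ultimately show ?case using "0.prems"(1) by simp
 next
  case (Suc N)
  note sym = Suc.prems(2) and idem = Suc.prems(3)
  show ?case
  proof (cases "\<forall>i<n. \<forall>j<n. M i j = 0")
   case True
   then show ?thesis by (intro exI[of _ 0] exI[of _ "\<lambda>_ _. 0"]) auto
  next
   case False
   then obtain r c where rc: "r < n" "c < n" "M r c \<noteq> 0" by auto
   have mcc: "M c c = (\<Sum>k=0..<n. (M k c)^2)"
    unfolding idem[OF rc(2,2), symmetric] by (rule sum.cong) (auto simp: power2_eq_square sym[OF rc(2)])
   have "(M r c)^2 \<le> (\<Sum>k=0..<n. (M k c)^2)" by (rule member_le_sum) (use rc in auto)
   moreover have "0 < (M r c)^2" using rc by simp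
   ultimately have pos: "M c c > 0" unfolding mcc by linarith
   define e where "e i = M i c / sqrt (M c c)" for i
   have ee: "e i * e j = M i c * M j c / M c c" for i j using pos by (simp add: e_def)
   have e1: "(\<Sum>i=0..<n. e i * e i) = 1"
    using pos mcc by (simp add: ee sum_divide_distrib[symmetric] power2_eq_square)
   have Me: "(\<Sum>k=0..<n. M i k * e k) = e i" if "i < n" for i
    using idem[OF that rc(2)] by (simp add: e_def sum_divide_distrib[symmetric])
   have eM: "(\<Sum>k=0..<n. e k * M k j) = e j" if "j < n" for j
    unfolding Me[OF that, symmetric] by (rule sum.cong) (auto simp: sym[OF that])
   define M' where "M' i j = M i j - e i * e j" for i j
   have sym': "M' i j = M' j i" if "i < n" "j < n" for i j using sym[OF that] by (simp add: M'_def)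
   have eM': "(\<Sum>k=0..<n. e k * M' k j) = 0" if "j < n" for j
   proof -
    have "(\<Sum>k=0..<n. e k * M' k j) = (\<Sum>k=0..<n. e k * M k j) - (\<Sum>k=0..<n. e k * e k) * e j"
     by (simp add: M'_def right_diff_distrib sum_subtractf sum_distrib_right mult.assoc)
    then show ?thesis using eM[OF that] e1 by simp
   qed
   have idem': "(\<Sum>k=0..<n. M' i k * M' k j) = M' i j" if "i < n" "j < n" for i j
   proof -
    have "(\<Sum>k=0..<n. M' i k * M' k j) = (\<Sum>k=0..<n. M i k * M' k j) - e i * (\<Sum>k=0..<n. e k * M' k j)"
     by (simp add: M'_def[of i] left_diff_distrib sum_subtractf sum_distrib_left mult.assoc)
    also have "... = (\<Sum>k=0..<n. M i k * M k j) - (\<Sum>k=0..<n. M i k * e k) * e j"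
     using that by (simp add: eM') (simp add: M'_def right_diff_distrib sum_subtractf sum_distrib_right mult.assoc)
    finally show ?thesis using that by (simp add: Me idem M'_def)
   qed
   have tr': "(\<Sum>i=0..<n. M' i i) = (\<Sum>i=0..<n. M i i) - 1"
    using e1 by (simp add: M'_def sum_subtractf)
   have "\<exists>k f. real k = (\<Sum>i=0..<n. M' i i) \<and>
     (\<forall>i<n. \<forall>j<n. M' i j = (\<Sum>l=0..<k. f l i * f l j)) \<and>
     (\<forall>l<k. \<forall>m<k. (\<Sum>i=0..<n. f l i * f m i) = (if l = m then 1 else 0))"
    by (rule Suc.IH[OF _ sym' idem']) (use Suc.prems(1) tr' in auto)
   then obtain k f where k: "real k = (\<Sum>i=0..<n. M' i i)"
    and f: "\<forall>i<n. \<forall>j<n. M' i j = (\<Sum>l=0..<k. f l i * f l j)"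
    and o: "\<forall>l<k. \<forall>m<k. (\<Sum>i=0..<n. f l i * f m i) = (if l = m then 1 else 0)"
    by (elim exE conjE)
   \<comment> \<open>The vectors \<open>f l\<close> lie in the range of \<open>M'\<close>, which
     \<open>e\<close> annihilates.\<close>
   have fe: "(\<Sum>i=0..<n. e i * f l i) = 0" if "l < k" for l
   proof -
    have ff: "f l i = (\<Sum>j=0..<n. M' i j * f l j)" if "i < n" for i
    proof -
     have "(\<Sum>j=0..<n. M' i j * f l j) = (\<Sum>j=0..<n. \<Sum>m=0..<k. f m i * (f m j * f l j))"
      using f that by (auto simp: sum_distrib_right mult.assoc intro!: sum.cong)
     also have "... = (\<Sum>m=0..<k. f m i * (\<Sum>j=0..<n. f m j * f l j))"
      by (subst sum.swap) (simp add: sum_distrib_left)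
     also have "... = (\<Sum>m=0..<k. if m = l then f m i else 0)"
      using o \<open>l < k\<close> by (intro sum.cong refl) auto
     finally show ?thesis using \<open>l < k\<close> by simp
    qed
    have "(\<Sum>i=0..<n. e i * f l i) = (\<Sum>i=0..<n. \<Sum>j=0..<n. e i * M' i j * f l j)"
     by (rule sum.cong[OF refl], subst ff) (auto simp: sum_distrib_left mult.assoc)
    also have "... = (\<Sum>j=0..<n. (\<Sum>i=0..<n. e i * M' i j) * f l j)"
     by (subst sum.swap) (simp add: sum_distrib_right)
    finally show ?thesis by (simp add: eM')
   qed
   then have fe': "(\<Sum>i=0..<n. f l i * e i) = 0" if "l < k" for l using that by (simp add: mult.commute)
   define g where "g l = (case l of 0 => e | Suc l => f l)" for l
   show ?thesis
   proof (intro exI[of _ "Suc k"] exI[of _ g] conjI allI impI)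
    show "real (Suc k) = (\<Sum>i=0..<n. M i i)" using k tr' by simp
    show "M i j = (\<Sum>l=0..<Suc k. g l i * g l j)" if "i < n" "j < n" for i j
    proof -
     have "(\<Sum>l=0..<Suc k. g l i * g l j) = e i * e j + M' i j"
      using f that by (simp add: sum.atLeast0_lessThan_Suc_shift g_def comp_def del: sum.op_ivl_Suc)
     then show ?thesis by (simp add: M'_def)
    qed
    show "(\<Sum>i=0..<n. g l i * g m i) = (if l = m then 1 else 0)" if "l < Suc k" "m < Suc k" for l m
     using that o e1 fe fe' by (cases l; cases m) (simp_all add: g_def)
   qed
  qed
 qed
 obtain N :: nat where "(\<Sum>i=0..<n. M i i) < real N" using reals_Archimedean2 by blast
 then show ?thesis by (rule *)
qed

text \<open>The projection onto the complement of the unit vector \<open>h\<close> has trace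
  \<open>p\<close>; an orthonormal basis of its range, followed by \<open>h\<close>, gives the
  columns of \<open>Q\<close>.\<close>

lemma orthogonal_matrix_with_last_column:
 fixes h :: "nat => real"
 assumes h1: "(\<Sum>i=0..<Suc p. (h i)^2) = 1"
 obtains Q where "Q \<in> carrier_mat (Suc p) (Suc p)" "transpose_mat Q * Q = 1\<^sub>m (Suc p)" "Q * transpose_mat Q = 1\<^sub>m (Suc p)"
  "\<And>i. i < Suc p ==> Q $$ (i, p) = h i"
proof -
 define M where "M i j = (if i = j then 1 else 0) - h i * h j" for i j :: nat
 have "(\<Sum>k=0..<Suc p. M i k * M k j) = M i j" if "i < Suc p" "j < Suc p" for i j
 proof -
  have "M i k * M k j = (if k = i then M i j else 0) - h i * (if k = j then h j else 0) + (h k)^2 * (h i * h j)" for k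
   by (auto simp: M_def power2_eq_square algebra_simps)
  then have "(\<Sum>k=0..<Suc p. M i k * M k j) = M i j - h i * h j + (\<Sum>k=0..<Suc p. (h k)^2) * (h i * h j)"
   using that by (simp only: sum.distrib sum_subtractf sum_distrib_left[symmetric] sum_distrib_right[symmetric]) simp
  then show ?thesis using h1 by simp
 qed
 moreover have "M i j = M j i" for i j by (simp add: M_def)
 ultimately obtain k f where k: "real k = (\<Sum>i=0..<Suc p. M i i)"
  and f: "\<forall>i<Suc p. \<forall>j<Suc p. M i j = (\<Sum>l=0..<k. f l i * f l j)"
  using symmetric_idempotent_decomposition[of "Suc p" M] by auto
 have "(\<Sum>i=0..<Suc p. M i i) = real (Suc p) - (\<Sum>i=0..<Suc p. (h i)^2)"
  by (simp only: M_def sum_subtractf power2_eq_square) simp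
 then have kp: "k = p" using k h1 by simp
 define Q where "Q = mat (Suc p) (Suc p) (\<lambda>(i, l). if l = p then h i else f l i)"
 have Q: "Q \<in> carrier_mat (Suc p) (Suc p)" by (simp add: Q_def)
 have QQ: "Q * transpose_mat Q = 1\<^sub>m (Suc p)"
 proof (rule eq_matI)
  fix i j assume "i < dim_row (1\<^sub>m (Suc p))" "j < dim_col (1\<^sub>m (Suc p))"
  then have ij: "i < Suc p" "j < Suc p" by auto
  then have "(Q * transpose_mat Q) $$ (i, j) = (\<Sum>l=0..<Suc p. Q $$ (i, l) * Q $$ (j, l))"
   using Q by (auto simp: scalar_prod_def intro!: sum.cong)
  also have "... = (\<Sum>l=0..<p. f l i * f l j) + h i * h j" using ij by (simp add: Q_def)
  also have "... = M i j + h i * h j" using f ij kp by simp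
  finally show "(Q * transpose_mat Q) $$ (i, j) = 1\<^sub>m (Suc p) $$ (i, j)" using ij by (simp add: M_def)
 qed (use Q in auto)
 have "transpose_mat Q * Q = 1\<^sub>m (Suc p)"
  by (rule mat_mult_left_right_inverse[OF Q _ QQ]) (use Q in auto)
 then show ?thesis by (rule that[OF Q _ QQ]) (simp add: Q_def)
qed

lemma mult_mat_vec_split_last:
 fixes W :: "real mat"
 assumes W: "W \<in> carrier_mat n (Suc p)" and z: "z \<in> carrier_vec (Suc p)"
 shows "W *\<^sub>v z = mat n p (\<lambda>(i, k). W $$ (i, k)) *\<^sub>v vec p (\<lambda>k. z $ k) + z $ p \<cdot>\<^sub>v col W p"
proof (rule eq_vecI)
 fix i assume "i < dim_vec (mat n p (\<lambda>(i, k). W $$ (i, k)) *\<^sub>v vec p (\<lambda>k. z $ k) + z $ p \<cdot>\<^sub>v col W p)"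
 then have i: "i < n" using W by simp
 have "(W *\<^sub>v z) $ i = (\<Sum>k=0..<p. W $$ (i, k) * z $ k) + W $$ (i, p) * z $ p"
 proof -
  have "(W *\<^sub>v z) $ i = (\<Sum>k=0..<Suc p. W $$ (i, k) * z $ k)"
   using i W z by (auto simp: scalar_prod_def simp del: sum.op_ivl_Suc intro!: sum.cong)
  then show ?thesis by (simp only: sum.atLeast0_lessThan_Suc)
 qed
 moreover have "(mat n p (\<lambda>(i, k). W $$ (i, k)) *\<^sub>v vec p (\<lambda>k. z $ k)) $ i = (\<Sum>k=0..<p. W $$ (i, k) * z $ k)"
  using i by (simp add: scalar_prod_def)
 ultimately show "(W *\<^sub>v z) $ i = (mat n p (\<lambda>(i, k). W $$ (i, k)) *\<^sub>v vec p (\<lambda>k. z $ k) + z $ p \<cdot>\<^sub>v col W p) $ i"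
  using i W by simp
qed (use W in auto)

text \<open>The last column \<open>z\<close> of the inverse Gram matrix makes
  \<open>W *\<^sub>v z\<close> orthogonal to every column but the last, so this vector is a multiple
  of the residual of the last column; its scalar product with that column is 1. Inverse Gram entries
  thereby become residual sums of squares, whose law is known.\<close>

lemma minv_gram_last:
 assumes W: "W \<in> carrier_mat n (Suc p)" and fr: "fullrank W"
  and Wr: "Wr = mat n p (\<lambda>(i, k). W $$ (i, k))" and frr: "fullrank Wr"
 shows "minv (gram W) $$ (p, p) * scalar_prod (col W p) (rsd Wr *\<^sub>v col W p) = 1"
proof -
 let ?w = "col W p" and ?S = "minv (gram W)"
 have Wrc: "Wr \<in> carrier_mat n p" by (simp add: Wr)
 have wc: "?w \<in> carrier_vec n" using W by (intro carrier_vecI) simp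
 have S: "?S \<in> carrier_mat (Suc p) (Suc p)" using W by simp
 define z where "z = col ?S p"
 have z: "z \<in> carrier_vec (Suc p)" using S by (intro carrier_vecI) (simp add: z_def)
 have zp: "z $ p = ?S $$ (p, p)" using S by (simp add: z_def)
 define x where "x = W *\<^sub>v z"
 have x: "x \<in> carrier_vec n" using W by (simp add: x_def)
 have Wx: "transpose_mat W *\<^sub>v x = unit_vec (Suc p) p"
 proof -
  have "transpose_mat W *\<^sub>v x = gram W *\<^sub>v z"
   unfolding x_def by (rule assoc_mult_mat_vec[symmetric, of _ "Suc p" n _ "Suc p"]) (use W z in auto)
  also have "... = col (gram W * ?S) p"
   unfolding z_def by (rule col_mult2[OF gram_carrier[OF W] S, symmetric]) simp
  also have "... = unit_vec (Suc p) p"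
   using minv_inverse(1)[of "gram W" "Suc p"] W fr by (simp add: fullrank_def)
  finally show ?thesis .
 qed
 have xk: "scalar_prod (col W k) x = (if k = p then 1 else 0)" if "k < Suc p" for k
 proof -
  have "(transpose_mat W *\<^sub>v x) $ k = scalar_prod (col W k) x" using W that by simp
  then show ?thesis unfolding Wx using that by auto
 qed
 have Wrx: "transpose_mat Wr *\<^sub>v x = 0\<^sub>v p"
 proof
  fix k assume "k < dim_vec (0\<^sub>v p)"
  then have k: "k < p" by simp
  then have "col Wr k = col W k" using W by (auto simp: Wr)
  then show "(transpose_mat Wr *\<^sub>v x) $ k = 0\<^sub>v p $ k" using k xk[of k] Wrc by simp
 qed (use Wrc in auto)
 have xs: "x = Wr *\<^sub>v vec p (\<lambda>k. z $ k) + z $ p \<cdot>\<^sub>v ?w"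
  unfolding x_def Wr by (rule mult_mat_vec_split_last[OF W z])
 have "lsq Wr *\<^sub>v x = minv (gram Wr) *\<^sub>v (transpose_mat Wr *\<^sub>v x)"
  unfolding lsq_def by (rule assoc_mult_mat_vec[of _ p p _ n]) (use Wrc x in auto)
 also have "... = 0\<^sub>v p" unfolding Wrx using minv_carrier[OF gram_carrier[OF Wrc]] by auto
 finally have "rsd Wr *\<^sub>v x = x" unfolding rsd_vec[OF Wrc frr x] using Wrc x by auto
 moreover have "rsd Wr *\<^sub>v x = z $ p \<cdot>\<^sub>v (rsd Wr *\<^sub>v ?w)"
 proof -
  have "rsd Wr *\<^sub>v x = rsd Wr *\<^sub>v (Wr *\<^sub>v vec p (\<lambda>k. z $ k)) + rsd Wr *\<^sub>v (z $ p \<cdot>\<^sub>v ?w)"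
   unfolding xs by (rule mult_add_distrib_mat_vec[of _ n n]) (use Wrc wc rsd_carrier[OF Wrc] in auto)
  also have "rsd Wr *\<^sub>v (Wr *\<^sub>v vec p (\<lambda>k. z $ k)) = 0\<^sub>v n" by (rule rsd_vec_W[OF Wrc frr]) simp
  also have "rsd Wr *\<^sub>v (z $ p \<cdot>\<^sub>v ?w) = z $ p \<cdot>\<^sub>v (rsd Wr *\<^sub>v ?w)"
   by (rule mult_mat_vec[of _ n n]) (use wc rsd_carrier[OF Wrc] in auto)
  finally show ?thesis using wc rsd_carrier[OF Wrc] by auto
 qed
 ultimately have xe: "x = z $ p \<cdot>\<^sub>v (rsd Wr *\<^sub>v ?w)" by simp
 have "scalar_prod ?w x = z $ p * scalar_prod ?w (rsd Wr *\<^sub>v ?w)"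
  by (subst xe, rule scalar_prod_smult_distrib[of _ n]) (use wc rsd_carrier[OF Wrc] in auto)
 then show ?thesis using xk[of p] zp by simp
qed

text \<open>In a linear relation between the columns, the residual projection removes all but the
  last column, whose coefficient must then vanish; the other coefficients vanish by full rank of
  \<open>Wr\<close>.\<close>

lemma fullrank_extend:
 assumes W: "W \<in> carrier_mat n (Suc p)" and Wr: "Wr = mat n p (\<lambda>(i, k). W $$ (i, k))" and frr: "fullrank Wr"
  and nz: "rsd Wr *\<^sub>v col W p \<noteq> 0\<^sub>v n"
 shows "fullrank W"
 unfolding fullrank_iff[OF W]
proof (intro ballI impI)
 fix z assume z: "z \<in> carrier_vec (Suc p)" and Wz: "W *\<^sub>v z = 0\<^sub>v n"
 let ?w = "col W p"
 have Wrc: "Wr \<in> carrier_mat n p" by (simp add: Wr)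
 have wc: "?w \<in> carrier_vec n" using W by (intro carrier_vecI) simp
 have xs: "0\<^sub>v n = Wr *\<^sub>v vec p (\<lambda>k. z $ k) + z $ p \<cdot>\<^sub>v ?w"
  unfolding Wz[symmetric] Wr by (rule mult_mat_vec_split_last[OF W z])
 have "rsd Wr *\<^sub>v 0\<^sub>v n = rsd Wr *\<^sub>v (Wr *\<^sub>v vec p (\<lambda>k. z $ k)) + rsd Wr *\<^sub>v (z $ p \<cdot>\<^sub>v ?w)"
  by (subst xs, rule mult_add_distrib_mat_vec[of _ n n]) (use Wrc wc rsd_carrier[OF Wrc] in auto)
 also have "rsd Wr *\<^sub>v (Wr *\<^sub>v vec p (\<lambda>k. z $ k)) = 0\<^sub>v n" by (rule rsd_vec_W[OF Wrc frr]) simp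
 also have "rsd Wr *\<^sub>v (z $ p \<cdot>\<^sub>v ?w) = z $ p \<cdot>\<^sub>v (rsd Wr *\<^sub>v ?w)"
  by (rule mult_mat_vec[of _ n n]) (use wc rsd_carrier[OF Wrc] in auto)
 moreover have "rsd Wr *\<^sub>v 0\<^sub>v n = 0\<^sub>v n"
 proof (rule eq_vecI)
  fix i assume "i < dim_vec (0\<^sub>v n :: real Matrix.vec)"
  then show "(rsd Wr *\<^sub>v 0\<^sub>v n) $ i = 0\<^sub>v n $ i"
   using scalar_prod_right_zero[of "row (rsd Wr) i" n] carrier_matD[OF rsd_carrier[OF Wrc]]
   by (simp add: carrier_vecI)
 qed (use carrier_matD[OF rsd_carrier[OF Wrc]] in simp)
 moreover have "z $ p \<cdot>\<^sub>v (rsd Wr *\<^sub>v ?w) \<in> carrier_vec n"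
  by (rule carrier_vecI) (simp add: carrier_matD[OF rsd_carrier[OF Wrc]])
 ultimately have e: "z $ p \<cdot>\<^sub>v (rsd Wr *\<^sub>v ?w) = 0\<^sub>v n" by simp
 have zp: "z $ p = 0"
 proof (rule ccontr)
  assume "z $ p \<noteq> 0"
  have "rsd Wr *\<^sub>v ?w = 0\<^sub>v n"
  proof
   fix i assume i: "i < dim_vec (0\<^sub>v n)"
   have "(z $ p \<cdot>\<^sub>v (rsd Wr *\<^sub>v ?w)) $ i = 0" using i by (subst e) simp
   then show "(rsd Wr *\<^sub>v ?w) $ i = 0\<^sub>v n $ i" using i \<open>z $ p \<noteq> 0\<close> rsd_carrier[OF Wrc] by simp
  qed (use rsd_carrier[OF Wrc] in auto)
  with nz show False ..
 qed
 have "Wr *\<^sub>v vec p (\<lambda>k. z $ k) = 0\<^sub>v n"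
 proof (rule eq_vecI)
  fix i assume "i < dim_vec (0\<^sub>v n :: real Matrix.vec)"
  then show "(Wr *\<^sub>v vec p (\<lambda>k. z $ k)) $ i = 0\<^sub>v n $ i"
   using arg_cong[OF xs, of "\<lambda>v. v $ i"] zp W Wrc by auto
 qed (use Wrc in auto)
 then have "vec p (\<lambda>k. z $ k) = 0\<^sub>v p" using frr unfolding fullrank_iff[OF Wrc] by auto
 then have "z $ k = 0" if "k < p" for k using that by (metis index_vec index_zero_vec(1))
 then show "z = 0\<^sub>v (Suc p)" using z zp by (intro eq_vecI) (auto simp: less_Suc_eq)
qed

section \<open>Regression on two blocks of columns\<close>

lemma join_cols_carrier [simp]:
 "W1 \<in> carrier_mat n p1 ==> W2 \<in> carrier_mat n p2 ==> join_cols W1 W2 \<in> carrier_mat n (p1 + p2)"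
 by (auto simp: join_cols_def)

lemma join_cols_mat:
 "join_cols (mat n p1 f) (mat n p2 (\<lambda>(i, k). f (i, p1 + k))) = mat n (p1 + p2) f"
 by (rule eq_matI) (auto simp: join_cols_def)

text \<open>The matrix behind \<open>theta2_hat\<close>, with \<open>minv\<close> and
  \<open>rsd\<close> in place of \<open>pinv\<close> and \<open>annihilator\<close>.\<close>

definition block2_coef :: "real mat => real mat => real mat" where
 "block2_coef W1 W2 = minv (transpose_mat W2 * rsd W1 * W2) * transpose_mat W2 * rsd W1"

context
 fixes W1 W2 :: "real mat" and n p1 p2 :: nat
 assumes W1: "W1 \<in> carrier_mat n p1" and W2: "W2 \<in> carrier_mat n p2"
begin

lemma join_cols_mult_vec:
 assumes a: "a \<in> carrier_vec p1" and b: "b \<in> carrier_vec p2"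
 shows "join_cols W1 W2 *\<^sub>v (a @\<^sub>v b) = W1 *\<^sub>v a + W2 *\<^sub>v b"
proof
 fix i assume "i < dim_vec (W1 *\<^sub>v a + W2 *\<^sub>v b)"
 then have i: "i < n" using W2 by simp
 have "row (join_cols W1 W2) i = row W1 i @\<^sub>v row W2 i"
  unfolding join_cols_def using W1 W2 i by (subst row_four_block_mat) auto
 then have "(join_cols W1 W2 *\<^sub>v (a @\<^sub>v b)) $ i = scalar_prod (row W1 i @\<^sub>v row W2 i) (a @\<^sub>v b)"
  using i W1 W2 by (simp add: join_cols_def)
 also have "... = scalar_prod (row W1 i) a + scalar_prod (row W2 i) b"
  by (rule scalar_prod_append[of _ p1 _ p2]) (use W1 W2 a b in auto)
 finally show "(join_cols W1 W2 *\<^sub>v (a @\<^sub>v b)) $ i = (W1 *\<^sub>v a + W2 *\<^sub>v b) $ i" using i W1 W2 by simp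
qed (use W1 W2 in \<open>auto simp: join_cols_def\<close>)

lemma transpose_join_cols_mult_vec:
 assumes y: "y \<in> carrier_vec n"
 shows "transpose_mat (join_cols W1 W2) *\<^sub>v y = (transpose_mat W1 *\<^sub>v y) @\<^sub>v (transpose_mat W2 *\<^sub>v y)"
proof -
 have "col (join_cols W1 W2) k = (if k < p1 then col W1 k else col W2 (k - p1))" if "k < p1 + p2" for k
  using W1 W2 that by (intro eq_vecI) (auto simp: join_cols_def)
 then show ?thesis using W1 W2 by (intro eq_vecI) (auto simp: join_cols_def)
qed

lemma join_cols_eq_0:
 assumes fr: "fullrank (join_cols W1 W2)" and a: "a \<in> carrier_vec p1" and b: "b \<in> carrier_vec p2"
  and 0: "W1 *\<^sub>v a + W2 *\<^sub>v b = 0\<^sub>v n"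
 shows "a = 0\<^sub>v p1" "b = 0\<^sub>v p2"
proof -
 have "a @\<^sub>v b = 0\<^sub>v (p1 + p2)"
  using fr join_cols_mult_vec[OF a b] 0 a b unfolding fullrank_iff[OF join_cols_carrier[OF W1 W2]] by auto
 moreover have "0\<^sub>v p1 @\<^sub>v 0\<^sub>v p2 = (0\<^sub>v (p1 + p2) :: real Matrix.vec)" by (rule eq_vecI) auto
 ultimately have "a @\<^sub>v b = 0\<^sub>v p1 @\<^sub>v 0\<^sub>v p2" by simp
 then show "a = 0\<^sub>v p1" "b = 0\<^sub>v p2" using append_vec_eq[OF a, of "0\<^sub>v p1" b "0\<^sub>v p2"] by auto
qed

lemma fullrank_join1: "fullrank (join_cols W1 W2) ==> fullrank W1"
 unfolding fullrank_iff[OF W1]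
proof (intro ballI impI)
 fix v assume fr: "fullrank (join_cols W1 W2)" and v: "v \<in> carrier_vec p1" "W1 *\<^sub>v v = 0\<^sub>v n"
 have "W2 *\<^sub>v 0\<^sub>v p2 = 0\<^sub>v n" using W2 by auto
 then show "v = 0\<^sub>v p1" using join_cols_eq_0(1)[OF fr v(1), of "0\<^sub>v p2"] v by auto
qed

context
 assumes fr: "fullrank (join_cols W1 W2)"
begin

text \<open>For a null vector \<open>v\<close>, the vector \<open>W2 *\<^sub>v v\<close> has
  residual zero on \<open>W1\<close>, which is a linear relation between the two blocks.\<close>

lemma det_block2: "det (transpose_mat W2 * rsd W1 * W2) \<noteq> 0"
proof
 note fr1 = fullrank_join1[OF fr]
 let ?A = "transpose_mat W2 * rsd W1 * W2"
 have A: "?A \<in> carrier_mat p2 p2"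
  by (rule mult_carrier_mat[OF mult_carrier_mat[OF _ rsd_carrier[OF W1]] W2]) (use W2 in simp)
 assume "det ?A = 0"
 then obtain v where v: "v \<in> carrier_vec p2" "v \<noteq> 0\<^sub>v p2" "?A *\<^sub>v v = 0\<^sub>v p2"
  using det_0_iff_vec_prod_zero_field[OF A] by auto
 let ?y = "W2 *\<^sub>v v"
 have y: "?y \<in> carrier_vec n" by (rule mult_mat_vec_carrier[OF W2 v(1)])
 have "?A *\<^sub>v v = (transpose_mat W2 * rsd W1) *\<^sub>v ?y"
  by (rule assoc_mult_mat_vec[OF mult_carrier_mat[OF _ rsd_carrier[OF W1]] W2 v(1)]) (use W2 in simp)
 also have "... = transpose_mat W2 *\<^sub>v (rsd W1 *\<^sub>v ?y)"
  by (rule assoc_mult_mat_vec[OF _ rsd_carrier[OF W1] y]) (use W2 in simp)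
 finally have e: "transpose_mat W2 *\<^sub>v (rsd W1 *\<^sub>v ?y) = 0\<^sub>v p2" using v by simp
 have "scalar_prod (rsd W1 *\<^sub>v ?y) (rsd W1 *\<^sub>v ?y) = scalar_prod ?y (rsd W1 *\<^sub>v ?y)"
  by (rule rsd_norm[OF W1 fr1 y])
 also have "... = scalar_prod v (transpose_mat W2 *\<^sub>v (rsd W1 *\<^sub>v ?y))"
  by (rule scalar_prod_transpose[OF W2 v(1) mult_mat_vec_carrier[OF rsd_carrier[OF W1] y]])
 also have "... = 0" unfolding e using v by simp
 finally have "rsd W1 *\<^sub>v ?y = 0\<^sub>v n" by (rule scalar_prod_self_eq_0[OF mult_mat_vec_carrier[OF rsd_carrier[OF W1] y]])
 then have z: "?y - W1 *\<^sub>v (lsq W1 *\<^sub>v ?y) = 0\<^sub>v n" unfolding rsd_vec[OF W1 fr1 y] .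
 have "W1 *\<^sub>v (- (lsq W1 *\<^sub>v ?y)) + ?y = 0\<^sub>v n"
 proof
  fix i assume i: "i < dim_vec (0\<^sub>v n)"
  have "(?y - W1 *\<^sub>v (lsq W1 *\<^sub>v ?y)) $ i = 0" using i by (subst z) simp
  moreover have "scalar_prod (row W1 i) (- (lsq W1 *\<^sub>v ?y)) = - scalar_prod (row W1 i) (lsq W1 *\<^sub>v ?y)"
   by (rule scalar_prod_uminus_right) (use W1 carrier_matD[OF lsq_carrier[OF W1]] in simp)
  ultimately show "(W1 *\<^sub>v (- (lsq W1 *\<^sub>v ?y)) + ?y) $ i = 0\<^sub>v n $ i" using i W1 W2 by simp
 qed (use W2 in auto)
 from join_cols_eq_0(2)[OF fr _ v(1) this] have "v = 0\<^sub>v p2" 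
  using mult_mat_vec_carrier[OF lsq_carrier[OF W1] y] by simp
 with v show False by simp
qed

lemma block2_coef_carrier: "block2_coef W1 W2 \<in> carrier_mat p2 n"
proof -
 have W2': "transpose_mat W2 \<in> carrier_mat p2 n" using W2 by simp
 note W2R = mult_carrier_mat[OF W2' rsd_carrier[OF W1]]
 show ?thesis unfolding block2_coef_def
  by (rule mult_carrier_mat[OF mult_carrier_mat[OF minv_carrier[OF mult_carrier_mat[OF W2R W2]] W2'] rsd_carrier[OF W1]])
qed

text \<open>Frisch--Waugh: the second block is obtained from the regression of the residuals.\<close>

lemma lsq_join_cols:
 assumes Y: "Y \<in> carrier_vec n"
 shows "lsq (join_cols W1 W2) *\<^sub>v Y =
  (lsq W1 *\<^sub>v (Y - W2 *\<^sub>v ((block2_coef W1 W2) *\<^sub>v Y))) @\<^sub>v ((block2_coef W1 W2) *\<^sub>v Y)"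
proof -
 note fr1 = fullrank_join1[OF fr]
 let ?A = "transpose_mat W2 * rsd W1 * W2"
 have A: "?A \<in> carrier_mat p2 p2"
  by (rule mult_carrier_mat[OF mult_carrier_mat[OF _ rsd_carrier[OF W1]] W2]) (use W2 in simp)
 have R: "rsd W1 \<in> carrier_mat n n" by (rule rsd_carrier[OF W1])
 have W2R: "transpose_mat W2 * rsd W1 \<in> carrier_mat p2 n" by (rule mult_carrier_mat[OF _ R]) (use W2 in simp)
 define b where "b = (block2_coef W1 W2) *\<^sub>v Y"
 define D where "D = Y - W2 *\<^sub>v b"
 define a where "a = lsq W1 *\<^sub>v D"
 have b: "b \<in> carrier_vec p2" unfolding b_def by (rule mult_mat_vec_carrier[OF block2_coef_carrier Y])
 have D: "D \<in> carrier_vec n" unfolding D_def using Y W2 by auto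
 have a: "a \<in> carrier_vec p1" unfolding a_def by (rule mult_mat_vec_carrier[OF lsq_carrier[OF W1] D])
 have "?A *\<^sub>v b = (transpose_mat W2 * rsd W1) *\<^sub>v Y"
 proof -
  have "b = (minv ?A * (transpose_mat W2 * rsd W1)) *\<^sub>v Y"
   unfolding b_def block2_coef_def
   by (subst assoc_mult_mat[OF minv_carrier[OF A] _ R]) (use W2 in auto)
  also have "... = minv ?A *\<^sub>v ((transpose_mat W2 * rsd W1) *\<^sub>v Y)"
   by (rule assoc_mult_mat_vec[OF minv_carrier[OF A] W2R Y])
  finally have "?A *\<^sub>v b = (?A * minv ?A) *\<^sub>v ((transpose_mat W2 * rsd W1) *\<^sub>v Y)"
   using assoc_mult_mat_vec[OF A minv_carrier[OF A] mult_mat_vec_carrier[OF W2R Y]] by (simp only:)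
  then show ?thesis unfolding minv_inverse(1)[OF A det_block2] one_mult_mat_vec[OF mult_mat_vec_carrier[OF W2R Y]] .
 qed
 moreover have "?A *\<^sub>v b = (transpose_mat W2 * rsd W1) *\<^sub>v (W2 *\<^sub>v b)"
  by (rule assoc_mult_mat_vec[OF W2R W2 b])
 ultimately have e: "(transpose_mat W2 * rsd W1) *\<^sub>v (W2 *\<^sub>v b) = (transpose_mat W2 * rsd W1) *\<^sub>v Y" by simp
 have "transpose_mat W2 *\<^sub>v (rsd W1 *\<^sub>v D) = (transpose_mat W2 * rsd W1) *\<^sub>v D"
  by (rule assoc_mult_mat_vec[symmetric, OF _ R D]) (use W2 in auto)
 also have "... = (transpose_mat W2 * rsd W1) *\<^sub>v Y - (transpose_mat W2 * rsd W1) *\<^sub>v (W2 *\<^sub>v b)"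
  unfolding D_def by (rule mult_minus_distrib_mat_vec[OF W2R Y]) (use W2 in auto)
 also have "... = 0\<^sub>v p2" unfolding e by (rule minus_cancel_vec[OF mult_mat_vec_carrier[OF W2R Y]])
 finally have z2: "transpose_mat W2 *\<^sub>v (D - W1 *\<^sub>v a) = 0\<^sub>v p2"
  unfolding rsd_vec[OF W1 fr1 D] a_def .
 have z1: "transpose_mat W1 *\<^sub>v (D - W1 *\<^sub>v a) = 0\<^sub>v p1"
  unfolding a_def by (rule transpose_rsd_vec[OF W1 fr1 D])
 have "Y - join_cols W1 W2 *\<^sub>v (a @\<^sub>v b) = D - W1 *\<^sub>v a"
  unfolding join_cols_mult_vec[OF a b] D_def using Y W1 W2 by (intro eq_vecI) auto
 moreover have "transpose_mat (join_cols W1 W2) *\<^sub>v (D - W1 *\<^sub>v a) = 0\<^sub>v p1 @\<^sub>v 0\<^sub>v p2"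
  using transpose_join_cols_mult_vec[of "D - W1 *\<^sub>v a"] z1 z2 W1 by (simp add: minus_carrier_vec D)
 moreover have "0\<^sub>v p1 @\<^sub>v 0\<^sub>v p2 = (0\<^sub>v (p1 + p2) :: real Matrix.vec)" by (rule eq_vecI) auto
 ultimately have "transpose_mat (join_cols W1 W2) *\<^sub>v (Y - join_cols W1 W2 *\<^sub>v (a @\<^sub>v b)) = 0\<^sub>v (p1 + p2)"
  by simp
 then have "a @\<^sub>v b = lsq (join_cols W1 W2) *\<^sub>v Y"
  by (rule lsq_unique[OF join_cols_carrier[OF W1 W2] fr append_carrier_vec[OF a b] Y])
 then show ?thesis unfolding a_def D_def b_def by (rule sym)
qed

end

end

section \<open>Measurability of matrix-valued and vector-valued maps\<close>

text \<open>Entrywise measurability, with dimensions that are fixed at every argument, also outside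
  the space of \<open>M\<close>, so that sizes can be rewritten under a binder.\<close>

definition meas_mat :: "'a measure => nat => nat => ('a => real mat) => bool" where
 "meas_mat M n p F \<longleftrightarrow> (\<forall>x. F x \<in> carrier_mat n p) \<and>
   (\<forall>i<n. \<forall>j<p. (\<lambda>x. F x $$ (i, j)) \<in> borel_measurable M)"

definition meas_vec :: "'a measure => nat => ('a => real Matrix.vec) => bool" where
 "meas_vec M n v \<longleftrightarrow> (\<forall>x. v x \<in> carrier_vec n) \<and> (\<forall>i<n. (\<lambda>x. v x $ i) \<in> borel_measurable M)"

lemma meas_mat_carrier: "meas_mat M n p F ==> F x \<in> carrier_mat n p"
 and meas_mat_entry: "meas_mat M n p F ==> i < n ==> j < p ==> (\<lambda>x. F x $$ (i, j)) \<in> borel_measurable M"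
 and meas_vec_carrier: "meas_vec M n v ==> v x \<in> carrier_vec n"
 and meas_vec_entry: "meas_vec M n v ==> i < n ==> (\<lambda>x. v x $ i) \<in> borel_measurable M"
 by (auto simp: meas_mat_def meas_vec_def)

lemma meas_mat_dim: "meas_mat M n p F ==> dim_row (F x) = n" "meas_mat M n p F ==> dim_col (F x) = p"
 and meas_vec_dim: "meas_vec M n v ==> dim_vec (v x) = n"
 using meas_mat_carrier[of M n p F x] meas_vec_carrier[of M n v x] by auto

lemma meas_mat_mat:
 "(\<And>i j. i < n ==> j < p ==> (\<lambda>x. f x (i, j)) \<in> borel_measurable M) ==> meas_mat M n p (\<lambda>x. mat n p (f x))"
 by (simp add: meas_mat_def)

lemma meas_vec_vec:
 "(\<And>i. i < n ==> (\<lambda>x. f x i) \<in> borel_measurable M) ==> meas_vec M n (\<lambda>x. vec n (f x))"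
 by (simp add: meas_vec_def)

lemma meas_mat_const: "A \<in> carrier_mat n p ==> meas_mat M n p (\<lambda>x. A)"
 by (simp add: meas_mat_def)

lemma meas_vec_const: "v \<in> carrier_vec n ==> meas_vec M n (\<lambda>x. v)"
 by (simp add: meas_vec_def)

lemma meas_mat_compose: "meas_mat N n p F ==> f \<in> measurable M N ==> meas_mat M n p (\<lambda>x. F (f x))"
 unfolding meas_mat_def by (auto intro: measurable_compose)

lemma meas_vec_compose: "meas_vec N n F ==> f \<in> measurable M N ==> meas_vec M n (\<lambda>x. F (f x))"
 unfolding meas_vec_def by (auto intro: measurable_compose)

lemma meas_mat_transpose: "meas_mat M n p F ==> meas_mat M p n (\<lambda>x. transpose_mat (F x))"
 by (auto simp: meas_mat_def meas_mat_dim cong: measurable_cong)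

lemma meas_scalar_prod:
 assumes "meas_vec M n v" "meas_vec M n w"
 shows "(\<lambda>x. scalar_prod (v x) (w x)) \<in> borel_measurable M"
 unfolding scalar_prod_def meas_vec_dim[OF assms(2)]
 by (intro borel_measurable_sum borel_measurable_times meas_vec_entry[OF assms(1)] meas_vec_entry[OF assms(2)]) auto

lemma meas_mat_mult:
 assumes F: "meas_mat M n k F" and G: "meas_mat M k p G"
 shows "meas_mat M n p (\<lambda>x. F x * G x)"
 unfolding meas_mat_def
proof (intro conjI allI impI)
 show "F x * G x \<in> carrier_mat n p" for x by (rule mult_carrier_mat[OF meas_mat_carrier[OF F] meas_mat_carrier[OF G]])
 fix i j assume ij: "i < n" "j < p"
 have "(F x * G x) $$ (i, j) = (\<Sum>l=0..<k. F x $$ (i, l) * G x $$ (l, j))" for x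
  using ij by (simp add: meas_mat_dim[OF F] meas_mat_dim[OF G] scalar_prod_def)
 then show "(\<lambda>x. (F x * G x) $$ (i, j)) \<in> borel_measurable M"
  using ij by (simp only:) (intro borel_measurable_sum borel_measurable_times meas_mat_entry[OF F] meas_mat_entry[OF G]; simp)
qed

lemma meas_mat_minus:
 assumes F: "meas_mat M n p F" and G: "meas_mat M n p G"
 shows "meas_mat M n p (\<lambda>x. F x - G x)"
 unfolding meas_mat_def
proof (intro conjI allI impI)
 show "F x - G x \<in> carrier_mat n p" for x by (rule minus_carrier_mat[OF meas_mat_carrier[OF G]])
 fix i j assume ij: "i < n" "j < p"
 have "(F x - G x) $$ (i, j) = F x $$ (i, j) - G x $$ (i, j)" for x
  using ij by (simp add: meas_mat_dim[OF F] meas_mat_dim[OF G])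
 then show "(\<lambda>x. (F x - G x) $$ (i, j)) \<in> borel_measurable M"
  using ij by (simp only:) (intro borel_measurable_diff meas_mat_entry[OF F] meas_mat_entry[OF G])
qed

lemma meas_mat_smult:
 assumes F: "meas_mat M n p F" and c: "c \<in> borel_measurable M"
 shows "meas_mat M n p (\<lambda>x. c x \<cdot>\<^sub>m F x)"
 unfolding meas_mat_def
proof (intro conjI allI impI)
 show "c x \<cdot>\<^sub>m F x \<in> carrier_mat n p" for x by (rule smult_carrier_mat[OF meas_mat_carrier[OF F]])
 fix i j assume ij: "i < n" "j < p"
 have "(c x \<cdot>\<^sub>m F x) $$ (i, j) = c x * F x $$ (i, j)" for x
  using ij by (simp add: meas_mat_dim[OF F])
 then show "(\<lambda>x. (c x \<cdot>\<^sub>m F x) $$ (i, j)) \<in> borel_measurable M"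
  using ij by (simp only:) (intro borel_measurable_times c meas_mat_entry[OF F])
qed

lemma meas_mult_mat_vec:
 assumes F: "meas_mat M n k F" and v: "meas_vec M k v"
 shows "meas_vec M n (\<lambda>x. F x *\<^sub>v v x)"
 unfolding meas_vec_def
proof (intro conjI allI impI)
 show "F x *\<^sub>v v x \<in> carrier_vec n" for x by (rule mult_mat_vec_carrier[OF meas_mat_carrier[OF F] meas_vec_carrier[OF v]])
 fix i assume i: "i < n"
 have "(F x *\<^sub>v v x) $ i = (\<Sum>l=0..<k. F x $$ (i, l) * v x $ l)" for x
  using i by (simp add: meas_mat_dim[OF F] meas_vec_dim[OF v] scalar_prod_def)
 then show "(\<lambda>x. (F x *\<^sub>v v x) $ i) \<in> borel_measurable M"
  using i by (simp only:) (intro borel_measurable_sum borel_measurable_times meas_mat_entry[OF F] meas_vec_entry[OF v]; simp)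
qed

lemma meas_vec_minus:
 assumes F: "meas_vec M n F" and G: "meas_vec M n G"
 shows "meas_vec M n (\<lambda>x. F x - G x)"
 unfolding meas_vec_def
proof (intro conjI allI impI)
 show "F x - G x \<in> carrier_vec n" for x by (rule minus_carrier_vec[OF meas_vec_carrier[OF F] meas_vec_carrier[OF G]])
 fix i assume i: "i < n"
 have "(F x - G x) $ i = F x $ i - G x $ i" for x using i by (simp add: meas_vec_dim[OF F] meas_vec_dim[OF G])
 then show "(\<lambda>x. (F x - G x) $ i) \<in> borel_measurable M"
  using i by (simp only:) (intro borel_measurable_diff meas_vec_entry[OF F] meas_vec_entry[OF G])
qed

lemma meas_vec_smult:
 assumes F: "meas_vec M n F" and c: "c \<in> borel_measurable M"
 shows "meas_vec M n (\<lambda>x. c x \<cdot>\<^sub>v F x)"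
 unfolding meas_vec_def
proof (intro conjI allI impI)
 show "c x \<cdot>\<^sub>v F x \<in> carrier_vec n" for x by (rule smult_carrier_vec[THEN iffD2, OF meas_vec_carrier[OF F]])
 fix i assume i: "i < n"
 have "(c x \<cdot>\<^sub>v F x) $ i = c x * F x $ i" for x using i by (simp add: meas_vec_dim[OF F])
 then show "(\<lambda>x. (c x \<cdot>\<^sub>v F x) $ i) \<in> borel_measurable M"
  using i by (simp only:) (intro borel_measurable_times c meas_vec_entry[OF F])
qed

lemma meas_vec_append:
 assumes F: "meas_vec M n F" and G: "meas_vec M k G"
 shows "meas_vec M (n + k) (\<lambda>x. F x @\<^sub>v G x)"
 unfolding meas_vec_def
proof (intro conjI allI impI)
 show "F x @\<^sub>v G x \<in> carrier_vec (n + k)" for x by (rule append_carrier_vec[OF meas_vec_carrier[OF F] meas_vec_carrier[OF G]])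
 fix i assume i: "i < n + k"
 have "(F x @\<^sub>v G x) $ i = (if i < n then F x $ i else G x $ (i - n))" for x using i by (simp add: meas_vec_dim[OF F] meas_vec_dim[OF G])
 then show "(\<lambda>x. (F x @\<^sub>v G x) $ i) \<in> borel_measurable M"
  using i meas_vec_entry[OF F, of i] meas_vec_entry[OF G, of "i - n"] by (cases "i < n") auto
qed

lemma meas_det:
 assumes F: "meas_mat M n n F"
 shows "(\<lambda>x. det (F x)) \<in> borel_measurable M"
 unfolding det_def'[OF meas_mat_carrier[OF F]]
proof (intro borel_measurable_sum borel_measurable_times borel_measurable_prod borel_measurable_const)
 fix \<pi> i assume "\<pi> \<in> {\<pi>. \<pi> permutes {0..<n}}" "i \<in> {0..<n}"
 then show "(\<lambda>x. F x $$ (i, \<pi> i)) \<in> borel_measurable M"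
  by (intro meas_mat_entry[OF F]) (auto simp: permutes_in_image dest: permutes_in_image[of \<pi> "{0..<n}" i])
qed

lemma meas_mat_minv:
 assumes F: "meas_mat M n n F"
 shows "meas_mat M n n (\<lambda>x. minv (F x))"
 unfolding minv_def
proof (intro meas_mat_smult borel_measurable_divide borel_measurable_const meas_det[OF F])
 show "meas_mat M n n (\<lambda>x. adj_mat (F x))"
  unfolding meas_mat_def
 proof (intro conjI allI impI)
  show "adj_mat (F x) \<in> carrier_mat n n" for x by (rule adj_mat(1)[OF meas_mat_carrier[OF F]])
  fix i j assume ij: "i < n" "j < n"
  have "adj_mat (F x) $$ (i, j) = (- 1) ^ (j + i) * det (mat_delete (F x) j i)" for x
   using ij by (simp add: adj_mat_def cofactor_def meas_mat_dim[OF F])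
  moreover have "meas_mat M (n - 1) (n - 1) (\<lambda>x. mat_delete (F x) j i)"
   unfolding mat_delete_def meas_mat_dim[OF F]
   by (rule meas_mat_mat) (use ij in \<open>auto intro!: meas_mat_entry[OF F]\<close>)
  ultimately show "(\<lambda>x. adj_mat (F x) $$ (i, j)) \<in> borel_measurable M"
   by (simp only:) (intro borel_measurable_times borel_measurable_const meas_det)
 qed
qed

lemma meas_mat_gram: "meas_mat M n p F ==> meas_mat M p p (\<lambda>x. gram (F x))"
 by (rule meas_mat_mult[OF meas_mat_transpose])

lemma meas_mat_lsq: "meas_mat M n p F ==> meas_mat M p n (\<lambda>x. lsq (F x))"
 unfolding lsq_def by (intro meas_mat_mult[of _ _ p] meas_mat_minv meas_mat_gram meas_mat_transpose)

lemma meas_mat_rsd: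
 assumes "meas_mat M n p F" shows "meas_mat M n n (\<lambda>x. rsd (F x))"
 unfolding rsd_def meas_mat_dim[OF assms]
 by (rule meas_mat_minus[OF meas_mat_const meas_mat_mult[OF assms meas_mat_lsq[OF assms]]]) simp

lemma sets_fullrank:
 assumes "meas_mat M n p F"
 shows "{x\<in>space M. fullrank (F x)} \<in> sets M"
proof -
 have [measurable]: "(\<lambda>x. det (gram (F x))) \<in> borel_measurable M" by (rule meas_det[OF meas_mat_gram[OF assms]])
 show ?thesis unfolding fullrank_def by measurable
qed

lemma meas_mat_join_cols:
 assumes F: "meas_mat M n p F" and G: "meas_mat M n k G"
 shows "meas_mat M n (p + k) (\<lambda>x. join_cols (F x) (G x))"
 unfolding meas_mat_def
proof (intro conjI allI impI)
 show "join_cols (F x) (G x) \<in> carrier_mat n (p + k)" for x by (rule join_cols_carrier[OF meas_mat_carrier[OF F] meas_mat_carrier[OF G]])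
 fix i j assume ij: "i < n" "j < p + k"
 have "join_cols (F x) (G x) $$ (i, j) = (if j < p then F x $$ (i, j) else G x $$ (i, j - p))" for x
  using ij by (simp add: join_cols_def meas_mat_dim[OF F] meas_mat_dim[OF G])
 then show "(\<lambda>x. join_cols (F x) (G x) $$ (i, j)) \<in> borel_measurable M"
  using ij meas_mat_entry[OF F, of i j] meas_mat_entry[OF G, of i "j - p"] by (cases "j < p") auto
qed

section \<open>Gaussian matrices\<close>

text \<open>Uncorrelated Gaussian families are independent: indexed by the disjoint sum of
  \<open>J\<close> and \<open>K\<close>, the two families form one orthonormal system, and the
  standard normal law on a disjoint sum is a product.\<close>

lemma distr_gauss_linear_pair:
 fixes f :: "'j => 'i => real" and h :: "'k => 'i => real"
 assumes fin: "finite I" "finite J" "finite K"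
  and ff: "\<And>j j'. j \<in> J ==> j' \<in> J ==> (\<Sum>i\<in>I. f j i * f j' i) = (if j = j' then 1 else 0)"
  and hh: "\<And>k k'. k \<in> K ==> k' \<in> K ==> (\<Sum>i\<in>I. h k i * h k' i) = (if k = k' then 1 else 0)"
  and fh: "\<And>j k. j \<in> J ==> k \<in> K ==> (\<Sum>i\<in>I. f j i * h k i) = 0"
 shows "distr (gauss I) ((\<Pi>\<^sub>M j\<in>J. borel) \<Otimes>\<^sub>M (\<Pi>\<^sub>M k\<in>K. borel))
  (\<lambda>x. (\<lambda>j\<in>J. \<Sum>i\<in>I. f j i * x i, \<lambda>k\<in>K. \<Sum>i\<in>I. h k i * x i)) = gauss J \<Otimes>\<^sub>M gauss K"
proof -
 define L1 :: "('j + 'k) set" where "L1 = Inl ` J"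
 define L2 :: "('j + 'k) set" where "L2 = Inr ` K"
 have finL: "finite L1" "finite L2" and disj: "L1 \<inter> L2 = {}" using fin by (auto simp: L1_def L2_def)
 define c where "c l i = (case l of Inl j => f j i | Inr k => h k i)" for l i
 let ?JK = "(\<Pi>\<^sub>M j\<in>J. (borel :: real measure)) \<Otimes>\<^sub>M (\<Pi>\<^sub>M k\<in>K. (borel :: real measure))"
 let ?L = "\<Pi>\<^sub>M l\<in>L1 \<union> L2. (borel :: real measure)"
 let ?\<psi> = "\<lambda>x. \<lambda>l\<in>L1 \<union> L2. \<Sum>i\<in>I. c l i * x i"
 let ?\<phi>1 = "\<lambda>z. \<lambda>j\<in>J. z (Inl j) :: real" let ?\<phi>2 = "\<lambda>z. \<lambda>k\<in>K. z (Inr k) :: real"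
 let ?\<Phi> = "\<lambda>z. (?\<phi>1 z, ?\<phi>2 z)"
 have in1: "Inl j \<in> L1" if "j \<in> J" for j using that by (simp add: L1_def)
 have in2: "Inr k \<in> L2" if "k \<in> K" for k using that by (simp add: L2_def)
 have hf: "(\<Sum>i\<in>I. h k i * f j i) = 0" if "j \<in> J" "k \<in> K" for j k
  using fh[OF that] by (simp add: mult.commute)
 have gL: "distr (gauss I) ?L ?\<psi> = gauss (L1 \<union> L2)"
 proof (rule gauss_linear_map)
  fix l m assume "l \<in> L1 \<union> L2" "m \<in> L1 \<union> L2"
  then show "(\<Sum>i\<in>I. c l i * c m i) = (if l = m then 1 else 0)"
   using ff hh fh hf by (auto simp: L1_def L2_def c_def split: if_splits)
 qed (use fin finL in auto)
 have m\<psi>: "?\<psi> \<in> measurable (gauss I) ?L" by measurable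
 have m\<Phi>: "?\<Phi> \<in> measurable ?L ?JK"
  by (intro measurable_Pair measurable_restrict measurable_component_singleton) (auto intro: in1 in2)
 have mm: "merge L1 L2 \<in> measurable (gauss L1 \<Otimes>\<^sub>M gauss L2) ?L" by measurable
 have m1: "?\<phi>1 \<in> measurable (gauss L1) (\<Pi>\<^sub>M j\<in>J. borel)"
  unfolding measurable_cong_sets[OF sets_gauss refl]
  by (intro measurable_restrict measurable_component_singleton in1)
 have m2: "?\<phi>2 \<in> measurable (gauss L2) (\<Pi>\<^sub>M k\<in>K. borel)"
  unfolding measurable_cong_sets[OF sets_gauss refl]
  by (intro measurable_restrict measurable_component_singleton in2)
 have d1: "distr (gauss L1) (\<Pi>\<^sub>M j\<in>J. borel) ?\<phi>1 = gauss J"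
 proof -
  have "distr (gauss L1) (\<Pi>\<^sub>M j\<in>J. borel) (\<lambda>x. \<lambda>j\<in>J. \<Sum>l\<in>L1. (if l = Inl j then 1 else 0) * x l) = gauss J"
   by (rule gauss_linear_map) (use fin finL in \<open>auto simp: L1_def if_distrib[of "\<lambda>a. a * _"] cong: if_cong\<close>)
  moreover have "(\<lambda>x. \<lambda>j\<in>J. \<Sum>l\<in>L1. (if l = Inl j then 1 else 0) * x l) = ?\<phi>1"
   using finL in1 by (auto simp: fun_eq_iff if_distrib[of "\<lambda>a. a * _"] cong: if_cong)
  ultimately show ?thesis by simp
 qed
 have d2: "distr (gauss L2) (\<Pi>\<^sub>M k\<in>K. borel) ?\<phi>2 = gauss K"
 proof -
  have "distr (gauss L2) (\<Pi>\<^sub>M k\<in>K. borel) (\<lambda>x. \<lambda>k\<in>K. \<Sum>l\<in>L2. (if l = Inr k then 1 else 0) * x l) = gauss K"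
   by (rule gauss_linear_map) (use fin finL in \<open>auto simp: L2_def if_distrib[of "\<lambda>a. a * _"] cong: if_cong\<close>)
  moreover have "(\<lambda>x. \<lambda>k\<in>K. \<Sum>l\<in>L2. (if l = Inr k then 1 else 0) * x l) = ?\<phi>2"
   using finL in2 by (auto simp: fun_eq_iff if_distrib[of "\<lambda>a. a * _"] cong: if_cong)
  ultimately show ?thesis by simp
 qed
 have "distr (gauss I) ?JK (\<lambda>x. (\<lambda>j\<in>J. \<Sum>i\<in>I. f j i * x i, \<lambda>k\<in>K. \<Sum>i\<in>I. h k i * x i)) = distr (gauss I) ?JK (?\<Phi> \<circ> ?\<psi>)"
  by (rule distr_cong) (auto simp: c_def in1 in2)
 also have "... = distr (distr (gauss I) ?L ?\<psi>) ?JK ?\<Phi>" by (rule distr_distr[symmetric, OF m\<Phi> m\<psi>])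
 also have "... = distr (distr (gauss L1 \<Otimes>\<^sub>M gauss L2) ?L (merge L1 L2)) ?JK ?\<Phi>"
  unfolding gL by (simp only: gauss_split[OF disj finL])
 also have "... = distr (gauss L1 \<Otimes>\<^sub>M gauss L2) ?JK (?\<Phi> \<circ> merge L1 L2)" by (rule distr_distr[OF m\<Phi> mm])
 also have "... = distr (gauss L1 \<Otimes>\<^sub>M gauss L2) ?JK (\<lambda>(x, y). (?\<phi>1 x, ?\<phi>2 y))"
 proof (rule distr_cong[OF refl refl])
  fix z assume "z \<in> space (gauss L1 \<Otimes>\<^sub>M gauss L2)"
  obtain x y where z: "z = (x, y)" by (cases z)
  have "Inr k \<notin> L1" for k by (auto simp: L1_def)
  then show "(?\<Phi> \<circ> merge L1 L2) z = (case z of (x, y) => (?\<phi>1 x, ?\<phi>2 y))"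
   by (auto simp: z merge_def in1 in2)
 qed
 also have "... = distr (gauss L1) (\<Pi>\<^sub>M j\<in>J. borel) ?\<phi>1 \<Otimes>\<^sub>M distr (gauss L2) (\<Pi>\<^sub>M k\<in>K. borel) ?\<phi>2"
 proof (rule pair_measure_distr[symmetric, OF m1 m2])
  show "sigma_finite_measure (distr (gauss L2) (\<Pi>\<^sub>M k\<in>K. borel) ?\<phi>2)"
   unfolding d2 by (rule prob_space_imp_sigma_finite[OF prob_space_gauss])
 qed
 also have "... = gauss J \<Otimes>\<^sub>M gauss K" unfolding d1 d2 ..
 finally show ?thesis .
qed

lemma distr_gauss_coordinate_pair:
 assumes fin: "finite I" "finite J" "finite K"
  and \<iota>: "inj_on \<iota> J" "\<iota> ` J \<subseteq> I" and \<kappa>: "inj_on \<kappa> K" "\<kappa> ` K \<subseteq> I" and disj: "\<iota> ` J \<inter> \<kappa> ` K = {}"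
 shows "distr (gauss I) ((\<Pi>\<^sub>M j\<in>J. borel) \<Otimes>\<^sub>M (\<Pi>\<^sub>M k\<in>K. borel))
  (\<lambda>x. (\<lambda>j\<in>J. x (\<iota> j), \<lambda>k\<in>K. x (\<kappa> k))) = gauss J \<Otimes>\<^sub>M gauss K"
proof -
 have s: "(\<Sum>i\<in>I. (if i = a then 1 else 0) * x i) = x a" if "a \<in> I" for a and x :: "'a => real"
  using that fin by (simp add: if_distrib[of "\<lambda>a. a * _"] cong: if_cong)
 have "distr (gauss I) ((\<Pi>\<^sub>M j\<in>J. borel) \<Otimes>\<^sub>M (\<Pi>\<^sub>M k\<in>K. borel))
  (\<lambda>x. (\<lambda>j\<in>J. \<Sum>i\<in>I. (if i = \<iota> j then 1 else 0) * x i, \<lambda>k\<in>K. \<Sum>i\<in>I. (if i = \<kappa> k then 1 else 0) * x i)) = gauss J \<Otimes>\<^sub>M gauss K"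
 proof (rule distr_gauss_linear_pair[OF fin])
  show "(\<Sum>i\<in>I. (if i = \<iota> j then 1 else 0) * (if i = \<iota> j' then 1 else 0)) = (if j = j' then 1 else (0::real))"
   if "j \<in> J" "j' \<in> J" for j j' using \<iota> that by (subst s) (auto dest: inj_onD)
  show "(\<Sum>i\<in>I. (if i = \<kappa> j then 1 else 0) * (if i = \<kappa> j' then 1 else 0)) = (if j = j' then 1 else (0::real))"
   if "j \<in> K" "j' \<in> K" for j j' using \<kappa> that by (subst s) (auto dest: inj_onD)
  show "(\<Sum>i\<in>I. (if i = \<iota> j then 1 else 0) * (if i = \<kappa> k then 1 else 0)) = (0::real)"
   if "j \<in> J" "k \<in> K" for j k using \<iota> \<kappa> disj that by (subst s) auto
 qed
 moreover have "(\<lambda>j\<in>J. \<Sum>i\<in>I. (if i = \<iota> j then 1 else 0) * x i) = (\<lambda>j\<in>J. x (\<iota> j))"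
  "(\<lambda>k\<in>K. \<Sum>i\<in>I. (if i = \<kappa> k then 1 else 0) * x i) = (\<lambda>k\<in>K. x (\<kappa> k))" for x :: "'a => real"
  using \<iota>(2) \<kappa>(2) by (auto simp: fun_eq_iff intro!: s)
 ultimately show ?thesis by simp
qed

text \<open>Comparison conditionally on a common first coordinate. It allows the second coordinate
  to be exchanged for one with another law or another dimension.\<close>

lemma pair_measure_le_pair:
 assumes p: "prob_space M1" "prob_space M2" "prob_space N2" and A: "A \<in> sets (M1 \<Otimes>\<^sub>M M2)" and B: "B \<in> sets (M1 \<Otimes>\<^sub>M N2)"
  and b: "\<And>x. x \<in> space M1 ==> measure M2 (Pair x -` A) \<le> measure N2 (Pair x -` B)"
 shows "measure (M1 \<Otimes>\<^sub>M M2) A \<le> measure (M1 \<Otimes>\<^sub>M N2) B"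
proof -
 interpret M1: prob_space M1 by fact
 interpret M2: prob_space M2 by fact
 interpret N2: prob_space N2 by fact
 interpret a: pair_prob_space M1 M2 ..
 interpret b: pair_prob_space M1 N2 ..
 have "emeasure (M1 \<Otimes>\<^sub>M M2) A = (\<integral>\<^sup>+x. emeasure M2 (Pair x -` A) \<partial>M1)"
  by (rule M2.emeasure_pair_measure_alt[OF A])
 also have "... \<le> (\<integral>\<^sup>+x. emeasure N2 (Pair x -` B) \<partial>M1)"
  by (rule nn_integral_mono) (auto simp: M2.emeasure_eq_measure N2.emeasure_eq_measure intro!: ennreal_leI b)
 also have "... = emeasure (M1 \<Otimes>\<^sub>M N2) B" by (rule N2.emeasure_pair_measure_alt[OF B, symmetric])
 finally show ?thesis by (simp add: a.emeasure_eq_measure b.emeasure_eq_measure)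
qed

section \<open>Residuals and inverse Gram matrices of Gaussian regressors\<close>

abbreviation gvec :: "nat => (nat => real) measure" where "gvec n \<equiv> gauss {0..<n}"
abbreviation gmat :: "nat => nat => (nat \<times> nat => real) measure" where "gmat n p \<equiv> gauss ({0..<n} \<times> {0..<p})"

lemma measurable_gauss_component: "i \<in> I ==> (\<lambda>x. x i) \<in> borel_measurable (gauss I)"
 unfolding measurable_cong_sets[OF sets_gauss refl] by (rule measurable_component_singleton)

lemma meas_gmat: "meas_mat (gmat n p) n p (mat n p)"
 by (rule meas_mat_mat) (auto intro!: measurable_gauss_component)

lemma meas_gvec: "meas_vec (gvec n) n (vec n)"
 by (rule meas_vec_vec) (auto intro!: measurable_gauss_component)

lemma scalar_prod_mult_vec_self:
 fixes A :: "real mat"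
 assumes "A \<in> carrier_mat p n"
 shows "scalar_prod (A *\<^sub>v vec n v) (A *\<^sub>v vec n v) = (\<Sum>j=0..<p. (\<Sum>i=0..<n. A $$ (j, i) * v i)^2)"
 using assms by (simp add: scalar_prod_def power2_eq_square)

text \<open>The residual projection is a sum of \<open>n - p\<close> orthonormal rank-one
  projections, so its quadratic form in a standard normal vector is chi-square with
  \<open>n - p\<close> degrees of freedom. With at least one degree of freedom there is no atom at
  0.\<close>

lemma
 assumes W: "W \<in> carrier_mat n p" and fr: "fullrank W"
 shows rsd_chi_square_tail: "real n - real p \<le> K ==> 0 \<le> d ==> d \<le> 1 ==>
   measure (gvec n) {v\<in>space (gvec n). K * d \<le> \<bar>scalar_prod (vec n v) (rsd W *\<^sub>v vec n v) - (real n - real p)\<bar>}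
    \<le> 2 * exp (- K * d^2 / 8)" (is "_ ==> _ ==> _ ==> ?tail")
  and rsd_quad_nonzero: "p < n ==>
   measure (gvec n) {v\<in>space (gvec n). scalar_prod (vec n v) (rsd W *\<^sub>v vec n v) = 0} = 0" (is "_ ==> ?nz")
proof -
 have R: "rsd W \<in> carrier_mat n n" by (rule rsd_carrier[OF W])
 obtain k f where k: "real k = (\<Sum>i=0..<n. rsd W $$ (i, i))"
  and f: "\<forall>i<n. \<forall>j<n. rsd W $$ (i, j) = (\<Sum>l=0..<k. f l i * f l j)"
  and o: "\<forall>l<k. \<forall>m<k. (\<Sum>i=0..<n. f l i * f m i) = (if l = m then 1 else 0)"
 proof -
  have "\<exists>k f. real k = (\<Sum>i=0..<n. rsd W $$ (i, i)) \<and>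
   (\<forall>i<n. \<forall>j<n. rsd W $$ (i, j) = (\<Sum>l=0..<k. f l i * f l j)) \<and>
   (\<forall>l<k. \<forall>m<k. (\<Sum>i=0..<n. f l i * f m i) = (if l = m then 1 else 0))"
  proof (rule symmetric_idempotent_decomposition)
   fix i j assume ij: "i < n" "j < n"
   show "rsd W $$ (i, j) = rsd W $$ (j, i)"
    using arg_cong[OF rsd_symmetric[OF W fr], of "\<lambda>A. A $$ (i, j)"] ij carrier_matD[OF R] by simp
   show "(\<Sum>k=0..<n. rsd W $$ (i, k) * rsd W $$ (k, j)) = rsd W $$ (i, j)"
    using arg_cong[OF rsd_idempotent[OF W fr], of "\<lambda>A. A $$ (i, j)"] ij carrier_matD[OF R] by (simp add: scalar_prod_def)
  qed
  then show ?thesis by (elim exE conjE) (rule that)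
 qed
 have kn: "real k = real n - real p" unfolding k by (rule rsd_trace[OF W fr])
 have q: "scalar_prod (vec n v) (rsd W *\<^sub>v vec n v) = (\<Sum>l=0..<k. ((\<lambda>l\<in>{0..<k}. \<Sum>i=0..<n. f l i * v i) l)^2)" for v
 proof -
  have "scalar_prod (vec n v) (rsd W *\<^sub>v vec n v) = (\<Sum>i=0..<n. \<Sum>j=0..<n. \<Sum>l=0..<k. (f l i * v i) * (f l j * v j))"
   using carrier_matD[OF R] f by (auto simp: scalar_prod_def sum_distrib_left sum_distrib_right mult_ac intro!: sum.cong)
  also have "... = (\<Sum>i=0..<n. \<Sum>l=0..<k. \<Sum>j=0..<n. (f l i * v i) * (f l j * v j))"
   by (intro sum.cong refl sum.swap)
  also have "... = (\<Sum>l=0..<k. \<Sum>i=0..<n. \<Sum>j=0..<n. (f l i * v i) * (f l j * v j))" by (rule sum.swap)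
  also have "... = (\<Sum>l=0..<k. (\<Sum>i=0..<n. f l i * v i)^2)" by (simp add: power2_eq_square sum_product)
  finally show ?thesis by simp
 qed
 have law: "measure (gvec n) {v\<in>space (gvec n). (\<lambda>l\<in>{0..<k}. \<Sum>i=0..<n. f l i * v i) \<in> A} = measure (gvec k) A"
  if "A \<in> sets (gvec k)" for A
  by (rule measure_gauss_linear_map) (use o that in auto)
 have in_sp: "(\<lambda>l\<in>{0..<k}. g l) \<in> space (gvec k)" for g by (simp add: space_gauss)
 show ?tail if "real n - real p \<le> K" "0 \<le> d" "d \<le> 1"
 proof -
  let ?A = "{x\<in>space (gvec k). K * d \<le> \<bar>(\<Sum>l=0..<k. (x l)^2) - real (card {0..<k})\<bar>}"
  have A: "?A \<in> sets (gvec k)" by measurable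
  have "measure (gvec k) ?A \<le> 2 * exp (- K * d^2 / 8)"
   by (rule gauss_chi_square_tail) (use that kn in auto)
  then have "measure (gvec n) {v\<in>space (gvec n). (\<lambda>l\<in>{0..<k}. \<Sum>i=0..<n. f l i * v i) \<in> ?A} \<le> 2 * exp (- K * d^2 / 8)"
   unfolding law[OF A] .
  then show ?thesis unfolding q using in_sp kn by (simp cong: conj_cong)
 qed
 show ?nz if "p < n"
 proof -
  let ?A = "{x\<in>space (gvec k). (\<Sum>l=0..<k. (x l)^2) = 0}"
  have A: "?A \<in> sets (gvec k)" by measurable
  have k0: "0 < k" using kn that by (cases k) auto
  have "measure (gvec k) ?A \<le> measure (gvec k) {x\<in>space (gvec k). x 0 = 0}"
  proof (rule finite_measure.finite_measure_mono)
   show "finite_measure (gvec k)" by (rule prob_space.finite_measure[OF prob_space_gauss])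
   show "{x\<in>space (gvec k). x 0 = 0} \<in> sets (gvec k)"
    using measurable_sets[OF measurable_gauss_component[of 0 "{0..<k}"], of "{0}"] k0
    by (simp add: vimage_def Int_def conj_commute)
   show "?A \<subseteq> {x\<in>space (gvec k). x 0 = 0}"
    using k0 by (auto simp: sum_nonneg_eq_0_iff)
  qed
  also have "... = 0"
  proof -
   have "measure (gvec k) {x\<in>space (gvec k). x 0 = 0} = measure (distr (gvec k) borel (\<lambda>x. x 0)) {0}"
    using measurable_gauss_component[of 0 "{0..<k}"] k0 by (subst measure_distr) (auto simp: vimage_def Int_def conj_commute)
   also have "distr (gvec k) borel (\<lambda>x. x 0) = std_normal_distribution"
   proof -
    have "distr (gvec k) borel (\<lambda>x. x 0) = distr (gvec k) std_normal_distribution (\<lambda>x. x 0)"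
     by (rule distr_cong) auto
    also have "... = std_normal_distribution"
     unfolding gauss_def by (rule distr_PiM_component) (use k0 prob_space_std_normal in auto)
    finally show ?thesis .
   qed
   also have "measure std_normal_distribution {0} = 0"
    by (simp add: measure_def emeasure_density nn_integral_0_iff_AE AE_lborel_singleton mult_eq_0_iff indicator_eq_0_iff)
   finally show ?thesis .
  qed
  finally have "measure (gvec k) ?A = 0" using measure_nonneg[of "gvec k" ?A] by simp
  then have "measure (gvec n) {v\<in>space (gvec n). (\<lambda>l\<in>{0..<k}. \<Sum>i=0..<n. f l i * v i) \<in> ?A} = 0"
   unfolding law[OF A] .
  then show ?thesis unfolding q using in_sp by (simp cong: conj_cong)
 qed
qed

text \<open>The last column is kept apart so that one can condition on the columns before
  it.\<close>

definition snoc_mat :: "nat => nat => (nat \<times> nat => real) \<times> (nat => real) => real mat" where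
 "snoc_mat n p gv = mat n (Suc p) (\<lambda>(i, k). if k < p then fst gv (i, k) else snd gv i)"

lemma meas_snoc_mat: "meas_mat (gmat n p \<Otimes>\<^sub>M gvec n) n (Suc p) (snoc_mat n p)"
 unfolding snoc_mat_def
proof (rule meas_mat_mat)
 fix i j assume "i < n" "j < Suc p"
 moreover have "(\<lambda>x. fst x (i, j)) \<in> borel_measurable (gmat n p \<Otimes>\<^sub>M gvec n)" if "i < n" "j < p"
  using measurable_compose[OF measurable_fst measurable_gauss_component[of "(i, j)" "{0..<n} \<times> {0..<p}"]] that by auto
 moreover have "(\<lambda>x. snd x i) \<in> borel_measurable (gmat n p \<Otimes>\<^sub>M gvec n)" if "i < n"
  using measurable_compose[OF measurable_snd measurable_gauss_component[of i "{0..<n}"]] that by auto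
 ultimately show "(\<lambda>x. (\<lambda>(i, k). if k < p then fst x (i, k) else snd x i) (i, j)) \<in> borel_measurable (gmat n p \<Otimes>\<^sub>M gvec n)"
  by (cases "j < p") auto
qed

lemma measure_gmat_Suc:
 assumes A: "{z\<in>space (gmat n p \<Otimes>\<^sub>M gvec n). Q (snoc_mat n p z)} \<in> sets (gmat n p \<Otimes>\<^sub>M gvec n)"
 shows "measure (gmat n (Suc p)) {g\<in>space (gmat n (Suc p)). Q (mat n (Suc p) g)} = measure (gmat n p \<Otimes>\<^sub>M gvec n) {z\<in>space (gmat n p \<Otimes>\<^sub>M gvec n). Q (snoc_mat n p z)}"
proof -
 let ?f = "\<lambda>x. (\<lambda>j\<in>{0..<n} \<times> {0..<p}. x j, \<lambda>i\<in>{0..<n}. x (i, p)) :: (nat \<times> nat => real) \<times> (nat => real)"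
 let ?N = "(\<Pi>\<^sub>M j\<in>{0..<n} \<times> {0..<p}. (borel :: real measure)) \<Otimes>\<^sub>M (\<Pi>\<^sub>M k\<in>{0..<n}. (borel :: real measure))"
 have d: "distr (gmat n (Suc p)) ?N ?f = gmat n p \<Otimes>\<^sub>M gvec n"
  by (rule distr_gauss_coordinate_pair[of _ _ _ "\<lambda>x. x"]) (auto simp: inj_on_def)
 have m: "?f \<in> measurable (gmat n (Suc p)) ?N"
  unfolding measurable_cong_sets[OF sets_gauss refl]
  by (intro measurable_Pair measurable_restrict measurable_component_singleton) auto
 have s: "sets ?N = sets (gmat n p \<Otimes>\<^sub>M gvec n)" by (intro sets_pair_measure_cong sets_gauss[symmetric])
 have "measure (gmat n p \<Otimes>\<^sub>M gvec n) {z\<in>space (gmat n p \<Otimes>\<^sub>M gvec n). Q (snoc_mat n p z)} =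
  measure (gmat n (Suc p)) (?f -` {z\<in>space (gmat n p \<Otimes>\<^sub>M gvec n). Q (snoc_mat n p z)} \<inter> space (gmat n (Suc p)))"
  by (subst (1) d[symmetric], rule measure_distr[OF m]) (use A s in simp)
 also have "?f -` {z\<in>space (gmat n p \<Otimes>\<^sub>M gvec n). Q (snoc_mat n p z)} \<inter> space (gmat n (Suc p)) = {g\<in>space (gmat n (Suc p)). Q (mat n (Suc p) g)}"
 proof -
  have "snoc_mat n p (?f g) = mat n (Suc p) g" for g
   by (rule eq_matI) (auto simp: snoc_mat_def less_Suc_eq)
  then show ?thesis by (auto simp: space_pair_measure space_gauss)
 qed
 finally show ?thesis by simp
qed

lemma snoc_mat_block: "mat n p (\<lambda>(i, k). snoc_mat n p (g, v) $$ (i, k)) = mat n p g"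
 and snoc_mat_col: "col (snoc_mat n p (g, v)) p = vec n v"
 by (rule eq_matI; simp add: snoc_mat_def)+ (rule eq_vecI; simp add: snoc_mat_def)

lemma snoc_mat_fullrank:
 assumes "fullrank (mat n p g)" and "scalar_prod (vec n v) (rsd (mat n p g) *\<^sub>v vec n v) \<noteq> 0"
 shows "fullrank (snoc_mat n p (g, v))"
  and "minv (gram (snoc_mat n p (g, v))) $$ (p, p) = 1 / scalar_prod (vec n v) (rsd (mat n p g) *\<^sub>v vec n v)"
proof -
 have S: "snoc_mat n p (g, v) \<in> carrier_mat n (Suc p)" by (simp add: snoc_mat_def)
 have "rsd (mat n p g) *\<^sub>v vec n v \<noteq> 0\<^sub>v n" using assms(2) by auto
 then show fr: "fullrank (snoc_mat n p (g, v))"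
  by (intro fullrank_extend[OF S snoc_mat_block[symmetric]]) (use assms in \<open>simp_all add: snoc_mat_col\<close>)
 have "minv (gram (snoc_mat n p (g, v))) $$ (p, p) * scalar_prod (vec n v) (rsd (mat n p g) *\<^sub>v vec n v) = 1"
  using minv_gram_last[OF S fr snoc_mat_block[symmetric] assms(1)] by (simp add: snoc_mat_col)
 then show "minv (gram (snoc_mat n p (g, v))) $$ (p, p) = 1 / scalar_prod (vec n v) (rsd (mat n p g) *\<^sub>v vec n v)"
  using assms(2) by (simp add: field_simps)
qed

lemma sets_rsd_quad_eq_0:
 assumes "W \<in> carrier_mat n p"
 shows "(\<lambda>v. scalar_prod (vec n v) (rsd W *\<^sub>v vec n v)) \<in> borel_measurable (gvec n)"
 by (rule meas_scalar_prod[OF meas_gvec meas_mult_mat_vec[OF meas_mat_const[OF rsd_carrier[OF assms]] meas_gvec]])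

text \<open>Columns are added one by one: given full rank so far, the next one has almost surely a
  nonzero residual.\<close>

lemma gmat_fullrank:
 "p \<le> n ==> measure (gmat n p) {g\<in>space (gmat n p). \<not> fullrank (mat n p g)} = 0"
proof (induction p)
 case 0
 have "fullrank (mat n 0 g)" for g :: "nat \<times> nat => real"
  unfolding fullrank_def by (subst det_dim_zero) auto
 then show ?case by simp
next
 case (Suc p)
 let ?M = "gmat n p \<Otimes>\<^sub>M gvec n"
 have B: "{z\<in>space ?M. \<not> fullrank (snoc_mat n p z)} \<in> sets ?M"
  using sets_fullrank[OF meas_snoc_mat] by (rule sets.sets_Collect_neg)
 have N: "{g\<in>space (gmat n p). \<not> fullrank (mat n p g)} \<in> sets (gmat n p)"
  using sets_fullrank[OF meas_gmat] by (rule sets.sets_Collect_neg)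
 have "measure ?M {z\<in>space ?M. \<not> fullrank (snoc_mat n p z)} \<le> measure (gmat n p) {g\<in>space (gmat n p). \<not> fullrank (mat n p g)} + 0"
 proof (rule pair_measure_bound[OF prob_space_gauss prob_space_gauss B N])
  fix g assume g: "g \<in> space (gmat n p) - {g\<in>space (gmat n p). \<not> fullrank (mat n p g)}"
  then have fr: "fullrank (mat n p g)" by simp
  interpret prob_space "gvec n" by (rule prob_space_gauss)
  have [measurable]: "(\<lambda>v. scalar_prod (vec n v) (rsd (mat n p g) *\<^sub>v vec n v)) \<in> borel_measurable (gvec n)"
   by (rule sets_rsd_quad_eq_0[of _ n p]) simp
  have "measure (gvec n) (Pair g -` {z\<in>space ?M. \<not> fullrank (snoc_mat n p z)}) \<le> measure (gvec n) {v\<in>space (gvec n). scalar_prod (vec n v) (rsd (mat n p g) *\<^sub>v vec n v) = 0}"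
   by (rule finite_measure_mono) (use snoc_mat_fullrank(1)[OF fr] in \<open>auto simp: space_pair_measure\<close>, measurable)
  also have "... = 0" by (rule rsd_quad_nonzero[OF _ fr]) (use Suc.prems in auto)
  finally show "measure (gvec n) (Pair g -` {z\<in>space ?M. \<not> fullrank (snoc_mat n p z)}) \<le> 0" .
 qed simp
 then have "measure ?M {z\<in>space ?M. \<not> fullrank (snoc_mat n p z)} = 0"
  using Suc by (simp add: measure_le_0_iff)
 then show ?case using measure_gmat_Suc[OF B] by simp
qed

lemma sets_not_fullrank_or:
 assumes "meas_mat M n p F" and "{x\<in>space M. Q x} \<in> sets M"
 shows "{x\<in>space M. \<not> fullrank (F x) \<or> Q x} \<in> sets M"
 using assms(2) sets.sets_Collect_neg[OF sets_fullrank[OF assms(1)]] by (rule sets.sets_Collect_disj)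

text \<open>Conditionally on the first \<open>p\<close> columns, \<open>minv_gram_last\<close>
  identifies the reciprocal of the entry with a residual sum of squares that has
  \<open>n - p\<close> degrees of freedom.\<close>

lemma gmat_last_tail:
 assumes np: "Suc p \<le> n" and K: "real n - real p \<le> K" and d: "0 \<le> d" "d \<le> 1"
 shows "measure (gmat n (Suc p)) {g\<in>space (gmat n (Suc p)). \<not> fullrank (mat n (Suc p) g) \<or>
   K * d \<le> \<bar>1 / minv (gram (mat n (Suc p) g)) $$ (p, p) - (real n - real p)\<bar>} \<le> 2 * exp (- K * d^2 / 8)"
proof -
 let ?M = "gmat n p \<Otimes>\<^sub>M gvec n"
 define Q where "Q W \<longleftrightarrow> \<not> fullrank W \<or> K * d \<le> \<bar>1 / minv (gram W) $$ (p, p) - (real n - real p)\<bar>" for W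
 have B: "{z\<in>space ?M. Q (snoc_mat n p z)} \<in> sets ?M"
 proof -
  have "(\<lambda>z. minv (gram (snoc_mat n p z)) $$ (p, p)) \<in> borel_measurable ?M"
   by (rule meas_mat_entry[OF meas_mat_minv[OF meas_mat_gram[OF meas_snoc_mat]]]) auto
  then have "{z\<in>space ?M. K * d \<le> \<bar>1 / minv (gram (snoc_mat n p z)) $$ (p, p) - (real n - real p)\<bar>} \<in> sets ?M"
   by measurable
  then show ?thesis unfolding Q_def by (rule sets_not_fullrank_or[OF meas_snoc_mat])
 qed
 have N: "{g\<in>space (gmat n p). \<not> fullrank (mat n p g)} \<in> sets (gmat n p)"
  using sets_fullrank[OF meas_gmat] by (rule sets.sets_Collect_neg)
 have "measure ?M {z\<in>space ?M. Q (snoc_mat n p z)} \<le> measure (gmat n p) {g\<in>space (gmat n p). \<not> fullrank (mat n p g)} + 2 * exp (- K * d^2 / 8)"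
 proof (rule pair_measure_bound[OF prob_space_gauss prob_space_gauss B N])
  fix g assume g: "g \<in> space (gmat n p) - {g\<in>space (gmat n p). \<not> fullrank (mat n p g)}"
  then have fr: "fullrank (mat n p g)" by simp
  interpret prob_space "gvec n" by (rule prob_space_gauss)
  let ?q = "\<lambda>v. scalar_prod (vec n v) (rsd (mat n p g) *\<^sub>v vec n v)"
  have q[measurable]: "?q \<in> borel_measurable (gvec n)"
   by (rule sets_rsd_quad_eq_0[of _ n p]) simp
  have "Pair g -` {z\<in>space ?M. Q (snoc_mat n p z)} \<subseteq> {v\<in>space (gvec n). ?q v = 0} \<union> {v\<in>space (gvec n). K * d \<le> \<bar>?q v - (real n - real p)\<bar>}"
  proof
   fix v assume "v \<in> Pair g -` {z\<in>space ?M. Q (snoc_mat n p z)}"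
   then show "v \<in> {v\<in>space (gvec n). ?q v = 0} \<union> {v\<in>space (gvec n). K * d \<le> \<bar>?q v - (real n - real p)\<bar>}"
    using snoc_mat_fullrank[OF fr, of v] by (cases "?q v = 0") (auto simp: space_pair_measure Q_def)
  qed
  then have "measure (gvec n) (Pair g -` {z\<in>space ?M. Q (snoc_mat n p z)}) \<le> measure (gvec n) ({v\<in>space (gvec n). ?q v = 0} \<union> {v\<in>space (gvec n). K * d \<le> \<bar>?q v - (real n - real p)\<bar>})"
   by (rule finite_measure_mono) measurable
  also have "... \<le> measure (gvec n) {v\<in>space (gvec n). ?q v = 0} + measure (gvec n) {v\<in>space (gvec n). K * d \<le> \<bar>?q v - (real n - real p)\<bar>}"
   by (rule measure_Un_le) measurable
  also have "measure (gvec n) {v\<in>space (gvec n). ?q v = 0} = 0" by (rule rsd_quad_nonzero[OF _ fr]) (use np in auto)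
  also have "measure (gvec n) {v\<in>space (gvec n). K * d \<le> \<bar>?q v - (real n - real p)\<bar>} \<le> 2 * exp (- K * d^2 / 8)"
   by (rule rsd_chi_square_tail[OF _ fr K d]) simp
  finally show "measure (gvec n) (Pair g -` {z\<in>space ?M. Q (snoc_mat n p z)}) \<le> 2 * exp (- K * d^2 / 8)" by simp
 qed simp
 also have "measure (gmat n p) {g\<in>space (gmat n p). \<not> fullrank (mat n p g)} = 0"
  by (rule gmat_fullrank) (use np in simp)
 finally show ?thesis using measure_gmat_Suc[OF B] unfolding Q_def by simp
qed

text \<open>Given the regressors, \<open>lsq W\<close> applied to a standard normal vector has
  covariance \<open>minv (gram W)\<close>; this is the identity behind it.\<close>

lemma lsq_transpose_quad:
 assumes W: "W \<in> carrier_mat n p" and fr: "fullrank W"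
 shows "(\<Sum>i=0..<n. (\<Sum>j=0..<p. lsq W $$ (j, i) * h j)^2) = scalar_prod (vec p h) (minv (gram W) *\<^sub>v vec p h)"
proof -
 have L: "lsq W \<in> carrier_mat p n" by (rule lsq_carrier[OF W])
 have Lt: "transpose_mat (lsq W) \<in> carrier_mat n p" using L by simp
 have "(\<Sum>i=0..<n. (\<Sum>j=0..<p. lsq W $$ (j, i) * h j)^2) = scalar_prod (transpose_mat (lsq W) *\<^sub>v vec p h) (transpose_mat (lsq W) *\<^sub>v vec p h)"
  unfolding scalar_prod_mult_vec_self[OF Lt] using carrier_matD[OF L] by simp
 also have "... = scalar_prod (vec p h) (transpose_mat (transpose_mat (lsq W)) *\<^sub>v (transpose_mat (lsq W) *\<^sub>v vec p h))"
  by (rule scalar_prod_transpose[OF Lt]) (rule vec_carrier, rule mult_mat_vec_carrier[OF Lt vec_carrier])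
 also have "transpose_mat (transpose_mat (lsq W)) *\<^sub>v (transpose_mat (lsq W) *\<^sub>v vec p h) = (lsq W * transpose_mat (lsq W)) *\<^sub>v vec p h"
  using assoc_mult_mat_vec[OF L Lt vec_carrier] by (simp only: transpose_transpose)
 finally show ?thesis unfolding lsq_mult_transpose[OF W fr] .
qed

lemma meas_gmat_quad: "(\<lambda>g. scalar_prod (vec p h) (minv (gram (mat n p g)) *\<^sub>v vec p h)) \<in> borel_measurable (gmat n p)"
 by (rule meas_scalar_prod[OF meas_vec_const meas_mult_mat_vec[OF meas_mat_minv[OF meas_mat_gram[OF meas_gmat]] meas_vec_const]]) auto

text \<open>For an orthogonal matrix \<open>Q\<close> with last column \<open>h\<close>, the
  regressors \<open>W * Q\<close> have the law of \<open>W\<close>, and the quadratic form of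
  \<open>h\<close> in the inverse Gram matrix of \<open>W\<close> is the last diagonal entry of the
  inverse Gram matrix of \<open>W * Q\<close>.\<close>

lemma gmat_quad_tail:
 assumes np: "Suc p \<le> n" and K: "real n - real p \<le> K" and d: "0 \<le> d" "d \<le> 1" and h: "(\<Sum>i=0..<Suc p. (h i)^2) = 1"
 shows "measure (gmat n (Suc p)) {g\<in>space (gmat n (Suc p)). \<not> fullrank (mat n (Suc p) g) \<or>
   K * d \<le> \<bar>1 / scalar_prod (vec (Suc p) h) (minv (gram (mat n (Suc p) g)) *\<^sub>v vec (Suc p) h) - (real n - real p)\<bar>} \<le> 2 * exp (- K * d^2 / 8)"
proof -
 let ?p = "Suc p" let ?J = "{0..<n} \<times> {0..<?p}"
 obtain Q where Q: "Q \<in> carrier_mat ?p ?p" and QQ: "transpose_mat Q * Q = 1\<^sub>m ?p" "Q * transpose_mat Q = 1\<^sub>m ?p"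
  and Qh: "\<And>i. i < ?p ==> Q $$ (i, p) = h i"
  using orthogonal_matrix_with_last_column[OF h] by blast
 have Qt: "transpose_mat Q \<in> carrier_mat ?p ?p" using Q by simp
 have dQ: "det Q \<noteq> 0" by (rule det_nonzero_of_inverse[OF Q Qt QQ(2)])
 have mQ: "minv Q = transpose_mat Q" by (rule minv_unique[OF Q Qt QQ(2)])
 define A where "A = {g\<in>space (gmat n ?p). \<not> fullrank (mat n ?p g) \<or>
   K * d \<le> \<bar>1 / minv (gram (mat n ?p g)) $$ (p, p) - (real n - real p)\<bar>}"
 have A: "A \<in> sets (gmat n ?p)"
 proof -
  have "(\<lambda>z. minv (gram (mat n ?p z)) $$ (p, p)) \<in> borel_measurable (gmat n ?p)"
   by (rule meas_mat_entry[OF meas_mat_minv[OF meas_mat_gram[OF meas_gmat]]]) auto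
  then have "{z\<in>space (gmat n ?p). K * d \<le> \<bar>1 / minv (gram (mat n ?p z)) $$ (p, p) - (real n - real p)\<bar>} \<in> sets (gmat n ?p)"
   by measurable
  then show ?thesis unfolding A_def by (rule sets_not_fullrank_or[OF meas_gmat])
 qed
 \<comment> \<open>Row \<open>(i, j)\<close> of the linear map that multiplies a matrix with
   \<open>Suc p\<close> columns by \<open>Q\<close> from the right.\<close>
 define f :: "nat \<times> nat => nat \<times> nat => real" where "f = (\<lambda>(i, j) (i', k). (if i' = i then Q $$ (k, j) else 0))"
 have fsum: "(\<Sum>x\<in>?J. f (i, j) x * y x) = (\<Sum>k=0..<?p. Q $$ (k, j) * y (i, k))" if "i < n" for i j and y :: "nat \<times> nat => real"
 proof -
  have "(\<Sum>x\<in>?J. f (i, j) x * y x) = (\<Sum>i'\<in>{0..<n}. \<Sum>k=0..<?p. if i' = i then Q $$ (k, j) * y (i', k) else 0)"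
   by (subst sum.cartesian_product) (auto simp: f_def simp del: sum.op_ivl_Suc intro!: sum.cong)
  also have "... = (\<Sum>i'\<in>{0..<n}. if i' = i then (\<Sum>k=0..<?p. Q $$ (k, j) * y (i', k)) else 0)"
   by (intro sum.cong) auto
  finally show ?thesis using that by simp
 qed
 have law: "measure (gmat n ?p) {x\<in>space (gmat n ?p). (\<lambda>j\<in>?J. \<Sum>i\<in>?J. f j i * x i) \<in> A} = measure (gmat n ?p) A"
 proof (rule measure_gauss_linear_map[OF _ _ _ A])
  fix a b assume "a \<in> ?J" "b \<in> ?J"
  then obtain i j i' j' where ab: "a = (i, j)" "b = (i', j')" "i < n" "i' < n" "j < ?p" "j' < ?p" by auto
  have "(\<Sum>x\<in>?J. f a x * f b x) = (\<Sum>k=0..<?p. Q $$ (k, j) * f (i', j') (i, k))"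
   unfolding ab using fsum ab by simp
  also have "... = (if i = i' then (\<Sum>k=0..<?p. Q $$ (k, j) * Q $$ (k, j')) else 0)"
   by (simp add: f_def)
  also have "(\<Sum>k=0..<?p. Q $$ (k, j) * Q $$ (k, j')) = (transpose_mat Q * Q) $$ (j, j')"
   using Q ab by (simp add: scalar_prod_def)
  finally show "(\<Sum>x\<in>?J. f a x * f b x) = (if a = b then 1 else 0)" unfolding QQ using ab by auto
 qed auto
 have mm: "mat n ?p (\<lambda>j\<in>?J. \<Sum>i\<in>?J. f j i * g i) = mat n ?p g * Q" for g
 proof (rule eq_matI)
  fix i j assume "i < dim_row (mat n ?p g * Q)" "j < dim_col (mat n ?p g * Q)"
  then have ij: "i < n" "j < ?p" using Q by auto
  have "mat n ?p (\<lambda>j\<in>?J. \<Sum>i\<in>?J. f j i * g i) $$ (i, j) = (\<Sum>k=0..<?p. Q $$ (k, j) * g (i, k))"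
   using ij fsum[OF ij(1), of j g] by simp
  also have "... = (mat n ?p g * Q) $$ (i, j)"
   using ij Q by (auto simp: scalar_prod_def mult.commute simp del: sum.op_ivl_Suc intro!: sum.cong)
  finally show "mat n ?p (\<lambda>j\<in>?J. \<Sum>i\<in>?J. f j i * g i) $$ (i, j) = (mat n ?p g * Q) $$ (i, j)" .
 qed (use Q in auto)
 have "{g\<in>space (gmat n ?p). \<not> fullrank (mat n ?p g) \<or>
   K * d \<le> \<bar>1 / scalar_prod (vec ?p h) (minv (gram (mat n ?p g)) *\<^sub>v vec ?p h) - (real n - real p)\<bar>} \<subseteq> {g\<in>space (gmat n ?p). \<not> fullrank (mat n ?p g)} \<union> {x\<in>space (gmat n ?p). (\<lambda>j\<in>?J. \<Sum>i\<in>?J. f j i * x i) \<in> A}"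
 proof (safe, goal_cases)
  case (1 g)
  have W: "mat n ?p g \<in> carrier_mat n ?p" by simp
  note fr = 1(4)[unfolded not_not]
  let ?S = "minv (gram (mat n ?p g))"
  have S: "?S \<in> carrier_mat ?p ?p" by (rule minv_carrier[OF gram_carrier[OF W]])
  have "minv (gram (mat n ?p g * Q)) $$ (p, p) = (transpose_mat Q * ?S * Q) $$ (p, p)"
   unfolding minv_gram_mult[OF W fr Q dQ] mQ by simp
  also have "transpose_mat Q * ?S * Q = transpose_mat Q * (?S * Q)" by (rule assoc_mult_mat[OF Qt S Q])
  also have "... $$ (p, p) = scalar_prod (col Q p) (col (?S * Q) p)"
   using Q S by simp
  also have "col (?S * Q) p = ?S *\<^sub>v col Q p" by (rule col_mult2[OF S Q]) simp
  also have "col Q p = vec ?p h" using Q Qh by (intro eq_vecI) auto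
  finally have e: "minv (gram (mat n ?p g * Q)) $$ (p, p) = scalar_prod (vec ?p h) (?S *\<^sub>v vec ?p h)" .
  show ?case using 1 e unfolding A_def mem_Collect_eq mm by (simp add: space_gauss)
 qed
 then have "measure (gmat n ?p) {g\<in>space (gmat n ?p). \<not> fullrank (mat n ?p g) \<or>
   K * d \<le> \<bar>1 / scalar_prod (vec ?p h) (minv (gram (mat n ?p g)) *\<^sub>v vec ?p h) - (real n - real p)\<bar>} \<le> measure (gmat n ?p) ({g\<in>space (gmat n ?p). \<not> fullrank (mat n ?p g)} \<union> {x\<in>space (gmat n ?p). (\<lambda>j\<in>?J. \<Sum>i\<in>?J. f j i * x i) \<in> A})"
 proof (rule finite_measure.finite_measure_mono[OF prob_space.finite_measure[OF prob_space_gauss]])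
  have "(\<lambda>x. \<lambda>j\<in>?J. \<Sum>i\<in>?J. f j i * x i) \<in> measurable (gmat n ?p) (gmat n ?p)"
   unfolding measurable_cong_sets[OF refl sets_gauss] by measurable
  from measurable_sets[OF this A] have "{x\<in>space (gmat n ?p). (\<lambda>j\<in>?J. \<Sum>i\<in>?J. f j i * x i) \<in> A} \<in> sets (gmat n ?p)"
   by (simp add: vimage_def Int_def conj_commute)
  then show "{g\<in>space (gmat n ?p). \<not> fullrank (mat n ?p g)} \<union> {x\<in>space (gmat n ?p). (\<lambda>j\<in>?J. \<Sum>i\<in>?J. f j i * x i) \<in> A} \<in> sets (gmat n ?p)"
   using sets.sets_Collect_neg[OF sets_fullrank[OF meas_gmat]] by (rule sets.Un[rotated])
 qed
 also have "... \<le> measure (gmat n ?p) {g\<in>space (gmat n ?p). \<not> fullrank (mat n ?p g)} + measure (gmat n ?p) {x\<in>space (gmat n ?p). (\<lambda>j\<in>?J. \<Sum>i\<in>?J. f j i * x i) \<in> A}"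
 proof (rule measure_Un_le)
  show "{g\<in>space (gmat n ?p). \<not> fullrank (mat n ?p g)} \<in> sets (gmat n ?p)" by (rule sets.sets_Collect_neg[OF sets_fullrank[OF meas_gmat]])
  have "(\<lambda>x. \<lambda>j\<in>?J. \<Sum>i\<in>?J. f j i * x i) \<in> measurable (gmat n ?p) (gmat n ?p)"
   unfolding measurable_cong_sets[OF refl sets_gauss] by measurable
  from measurable_sets[OF this A] show "{x\<in>space (gmat n ?p). (\<lambda>j\<in>?J. \<Sum>i\<in>?J. f j i * x i) \<in> A} \<in> sets (gmat n ?p)"
   by (simp add: vimage_def Int_def conj_commute)
 qed
 also have "... = measure (gmat n ?p) A" unfolding law using gmat_fullrank[OF np] by simp
 also have "... \<le> 2 * exp (- K * d^2 / 8)" unfolding A_def by (rule gmat_last_tail[OF np K d])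
 finally show ?thesis .
qed

lemma scalar_prod_quad_scale:
 assumes S: "S \<in> carrier_mat p p" and h: "\<And>i. i < p ==> h i = c * e i"
 shows "scalar_prod (vec p h) (S *\<^sub>v vec p h) = c^2 * scalar_prod (vec p e) (S *\<^sub>v vec p (e :: nat => real))"
proof -
 have "scalar_prod (vec p h) (S *\<^sub>v vec p h) = (\<Sum>i=0..<p. \<Sum>j=0..<p. h i * (S $$ (i, j) * h j))"
  using carrier_matD[OF S] by (simp add: scalar_prod_def sum_distrib_left)
 also have "... = (\<Sum>i=0..<p. \<Sum>j=0..<p. c^2 * (e i * (S $$ (i, j) * e j)))"
  by (intro sum.cong refl) (simp add: h power2_eq_square mult_ac)
 also have "... = c^2 * scalar_prod (vec p e) (S *\<^sub>v vec p e)"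
  using carrier_matD[OF S] by (simp add: scalar_prod_def sum_distrib_left)
 finally show ?thesis .
qed

text \<open>Given the regressors, the linear form is normal, and its variance is
  \<open>\<beta>2\<close> times the quadratic form of a unit vector in the inverse Gram matrix, to
  which \<open>gmat_quad_tail\<close> applies.\<close>

lemma lsq_linear_tail:
 fixes b :: "nat => real"
 assumes np: "Suc p \<le> n" and d: "0 \<le> d" "d < 1" and u: "0 \<le> u" and B: "\<beta>2 = (\<Sum>k=0..<Suc p. (b k)^2)"
 shows "measure (gmat n (Suc p) \<Otimes>\<^sub>M gvec n) {z\<in>space (gmat n (Suc p) \<Otimes>\<^sub>M gvec n). \<not> fullrank (mat n (Suc p) (fst z)) \<or>
   u * sqrt (\<beta>2 / ((real n - real p) * (1 - d))) < \<bar>scalar_prod (vec (Suc p) b) (lsq (mat n (Suc p) (fst z)) *\<^sub>v vec n (snd z))\<bar>}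
  \<le> 2 * exp (- (real n - real p) * d^2 / 8) + 2 * exp (- u\<^sup>2 / 2)"
proof -
 let ?M = "gmat n (Suc p) \<Otimes>\<^sub>M gvec n"
 let ?p = "Suc p" let ?G = "gmat n ?p" let ?k = "real n - real p"
 have k0: "0 < ?k" using np by simp
 have B0: "0 \<le> \<beta>2" unfolding B by (intro sum_nonneg) auto
 \<comment> \<open>The unit direction of \<open>b\<close>; if \<open>b\<close> vanishes, the last
   basis vector stands in for it.\<close>
 define e where "e i = (if \<beta>2 = 0 then (if i = p then 1 else 0) else b i / sqrt \<beta>2)" for i
 have e1: "(\<Sum>i=0..<?p. (e i)^2) = 1"
 proof (cases "\<beta>2 = 0")
  case True
  then show ?thesis by (simp add: e_def if_distrib[of "\<lambda>a. a^2"] cong: if_cong)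
 next
  case False
  then show ?thesis using B0 by (simp only: e_def if_False power_divide sum_divide_distrib[symmetric] B[symmetric]) simp
 qed
 have be: "b i = sqrt \<beta>2 * e i" if "i < ?p" for i
 proof (cases "\<beta>2 = 0")
  case True
  then have "\<forall>i\<in>{0..<?p}. (b i)^2 = 0" unfolding B by (subst (asm) sum_nonneg_eq_0_iff) auto
  then show ?thesis using True that by simp
 qed (use B0 in \<open>simp add: e_def\<close>)
 define N where "N = {g\<in>space ?G. \<not> fullrank (mat n ?p g) \<or>
   ?k * d \<le> \<bar>1 / scalar_prod (vec ?p e) (minv (gram (mat n ?p g)) *\<^sub>v vec ?p e) - ?k\<bar>}"
 have N: "N \<in> sets ?G"
 proof -
  note [measurable] = meas_gmat_quad[of "?p" e n]
  show ?thesis unfolding N_def by (rule sets_not_fullrank_or[OF meas_gmat]) measurable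
 qed
 have mW: "meas_mat ?M n ?p (\<lambda>z. mat n ?p (fst z))" by (rule meas_mat_compose[OF meas_gmat]) measurable
 have mv: "meas_vec ?M n (\<lambda>z. vec n (snd z))" by (rule meas_vec_compose[OF meas_gvec]) measurable
 let ?t = "u * sqrt (\<beta>2 / (?k * (1 - d)))"
 have A: "{z\<in>space ?M. \<not> fullrank (mat n ?p (fst z)) \<or> ?t < \<bar>scalar_prod (vec ?p b) (lsq (mat n ?p (fst z)) *\<^sub>v vec n (snd z))\<bar>} \<in> sets ?M" (is "?A \<in> _")
 proof -
  have [measurable]: "(\<lambda>z. scalar_prod (vec ?p b) (lsq (mat n ?p (fst z)) *\<^sub>v vec n (snd z))) \<in> borel_measurable ?M"
   by (rule meas_scalar_prod[OF meas_vec_const meas_mult_mat_vec[OF meas_mat_lsq[OF mW] mv]]) simp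
  show ?thesis by (rule sets_not_fullrank_or[OF mW]) measurable
 qed
 have "measure ?M ?A \<le> measure ?G N + 2 * exp (- u\<^sup>2 / 2)"
 proof (rule pair_measure_bound[OF prob_space_gauss prob_space_gauss A N])
  fix g assume g: "g \<in> space ?G - N"
  let ?W = "mat n ?p g" let ?S = "minv (gram ?W)"
  have W: "?W \<in> carrier_mat n ?p" by simp
  have S: "?S \<in> carrier_mat ?p ?p" by (rule minv_carrier[OF gram_carrier[OF W]])
  have fr: "fullrank ?W" and y: "\<bar>1 / scalar_prod (vec ?p e) (?S *\<^sub>v vec ?p e) - ?k\<bar> < ?k * d"
   using g unfolding N_def by auto
  let ?y = "1 / scalar_prod (vec ?p e) (?S *\<^sub>v vec ?p e)"
  have "?k - ?k * d < ?y" using y by linarith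
  then have yl: "?k * (1 - d) < ?y" by (simp add: algebra_simps)
  have kd: "0 < ?k * (1 - d)" using k0 d by simp
  have "scalar_prod (vec ?p e) (?S *\<^sub>v vec ?p e) = 1 / ?y" by simp
  also have "... \<le> 1 / (?k * (1 - d))" by (rule frac_le[OF _ _ kd less_imp_le[OF yl]]) simp_all
  finally have se: "scalar_prod (vec ?p e) (?S *\<^sub>v vec ?p e) \<le> 1 / (?k * (1 - d))" .
  have "(\<Sum>i=0..<n. (\<Sum>j=0..<?p. lsq ?W $$ (j, i) * b j)^2) = (sqrt \<beta>2)^2 * scalar_prod (vec ?p e) (?S *\<^sub>v vec ?p e)"
   unfolding lsq_transpose_quad[OF W fr] by (rule scalar_prod_quad_scale[OF S be])
  also have "... \<le> \<beta>2 / (?k * (1 - d))"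
   using mult_left_mono[OF se B0] B0 by simp
  finally have sq: "(\<Sum>i=0..<n. (\<Sum>j=0..<?p. lsq ?W $$ (j, i) * b j)^2) \<le> \<beta>2 / (?k * (1 - d))" .
  have lin: "scalar_prod (vec ?p b) (lsq ?W *\<^sub>v vec n v) = (\<Sum>i=0..<n. (\<Sum>j=0..<?p. lsq ?W $$ (j, i) * b j) * v i)" for v
  proof -
   have "scalar_prod (vec ?p b) (lsq ?W *\<^sub>v vec n v) = (\<Sum>j=0..<?p. \<Sum>i=0..<n. b j * (lsq ?W $$ (j, i) * v i))"
    using carrier_matD[OF lsq_carrier[OF W]] by (simp add: scalar_prod_def sum_distrib_left del: sum.op_ivl_Suc)
   also have "... = (\<Sum>i=0..<n. (\<Sum>j=0..<?p. lsq ?W $$ (j, i) * b j) * v i)"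
    by (subst sum.swap) (simp add: sum_distrib_right sum_distrib_left mult_ac del: sum.op_ivl_Suc)
   finally show ?thesis .
  qed
  have "Pair g -` ?A = {v\<in>space (gvec n). ?t < \<bar>\<Sum>i=0..<n. (\<Sum>j=0..<?p. lsq ?W $$ (j, i) * b j) * v i\<bar>}"
   using fr g by (auto simp: space_pair_measure lin simp del: sum.op_ivl_Suc)
  then show "measure (gvec n) (Pair g -` ?A) \<le> 2 * exp (- u\<^sup>2 / 2)"
   using gauss_linear_tail[OF _ sq u] by simp
 qed simp
 also have "measure ?G N \<le> 2 * exp (- ?k * d^2 / 8)"
  unfolding N_def by (rule gmat_quad_tail[OF np _ _ _ e1]) (use d in auto)
 finally show ?thesis by simp
qed

text \<open>Given the regressors, \<open>gauss_quadratic_law\<close> replaces the squared norm of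
  the coefficients by the quadratic form of a standard normal \<open>h\<close> in the inverse Gram
  matrix. Given \<open>h\<close> instead, that form is the ratio of \<open>x\<close>, the squared
  norm of \<open>h\<close>, and \<open>y\<close>, the reciprocal of the form at the direction of
  \<open>h\<close>; both concentrate.\<close>

lemma lsq_norm_tail:
 assumes np: "Suc p \<le> n" and d: "0 \<le> d" "d < 1"
  and H: "\<And>x y. 0 \<le> x ==> \<bar>x - real (Suc p)\<bar> < real n * d ==> \<bar>y - (real n - real p)\<bar> < (real n - real p) * d ==> lo \<le> x / y \<and> x / y \<le> hi"
  and d0: "0 < d"
 shows "measure (gmat n (Suc p) \<Otimes>\<^sub>M gvec n) {z\<in>space (gmat n (Suc p) \<Otimes>\<^sub>M gvec n). \<not> fullrank (mat n (Suc p) (fst z)) \<or>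
   scalar_prod (lsq (mat n (Suc p) (fst z)) *\<^sub>v vec n (snd z)) (lsq (mat n (Suc p) (fst z)) *\<^sub>v vec n (snd z)) \<notin> {lo..hi}}
  \<le> 2 * exp (- real n * d^2 / 8) + 2 * exp (- (real n - real p) * d^2 / 8)"
proof -
 let ?M = "gmat n (Suc p) \<Otimes>\<^sub>M gvec n"
 let ?p = "Suc p" let ?G = "gmat n ?p" let ?k = "real n - real p" let ?N = "?G \<Otimes>\<^sub>M gvec ?p"
 have k0: "0 < ?k" using np by simp
 interpret G: prob_space ?G by (rule prob_space_gauss)
 interpret V: prob_space "gvec n" by (rule prob_space_gauss)
 interpret Hh: prob_space "gvec ?p" by (rule prob_space_gauss)
 interpret N: pair_prob_space ?G "gvec ?p" ..
 interpret N': pair_prob_space "gvec ?p" ?G ..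
 have mW: "meas_mat ?M n ?p (\<lambda>z. mat n ?p (fst z))" by (rule meas_mat_compose[OF meas_gmat]) measurable
 have mv: "meas_vec ?M n (\<lambda>z. vec n (snd z))" by (rule meas_vec_compose[OF meas_gvec]) measurable
 let ?A = "{z\<in>space ?M. \<not> fullrank (mat n ?p (fst z)) \<or> scalar_prod (lsq (mat n ?p (fst z)) *\<^sub>v vec n (snd z)) (lsq (mat n ?p (fst z)) *\<^sub>v vec n (snd z)) \<notin> {lo..hi}}"
 have A: "?A \<in> sets ?M"
 proof -
  have [measurable]: "(\<lambda>z. scalar_prod (lsq (mat n ?p (fst z)) *\<^sub>v vec n (snd z)) (lsq (mat n ?p (fst z)) *\<^sub>v vec n (snd z))) \<in> borel_measurable ?M"
   by (intro meas_scalar_prod[OF meas_mult_mat_vec[OF meas_mat_lsq[OF mW] mv] meas_mult_mat_vec[OF meas_mat_lsq[OF mW] mv]])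
  show ?thesis by (rule sets_not_fullrank_or[OF mW]) measurable
 qed
 let ?q = "\<lambda>g h. scalar_prod (vec ?p h) (minv (gram (mat n ?p g)) *\<^sub>v vec ?p h)"
 let ?B = "{z\<in>space ?N. \<not> fullrank (mat n ?p (fst z)) \<or> ?q (fst z) (snd z) \<notin> {lo..hi}}"
 have nW: "meas_mat ?N n ?p (\<lambda>z. mat n ?p (fst z))" by (rule meas_mat_compose[OF meas_gmat]) measurable
 have nv: "meas_vec ?N ?p (\<lambda>z. vec ?p (snd z))" by (rule meas_vec_compose[OF meas_gvec]) measurable
 have B: "?B \<in> sets ?N"
 proof -
  have [measurable]: "(\<lambda>z. ?q (fst z) (snd z)) \<in> borel_measurable ?N"
   by (rule meas_scalar_prod[OF nv meas_mult_mat_vec[OF meas_mat_minv[OF meas_mat_gram[OF nW]] nv]])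
  show ?thesis by (rule sets_not_fullrank_or[OF nW]) measurable
 qed
 have "measure ?M ?A \<le> measure ?N ?B"
 proof (rule pair_measure_le_pair[OF prob_space_gauss prob_space_gauss prob_space_gauss A B])
  fix g assume g: "g \<in> space ?G"
  let ?W = "mat n ?p g"
  have W: "?W \<in> carrier_mat n ?p" by simp
  show "measure (gvec n) (Pair g -` ?A) \<le> measure (gvec ?p) (Pair g -` ?B)"
  proof (cases "fullrank ?W")
   case False
   then have "Pair g -` ?B = space (gvec ?p)" using g by (auto simp: space_pair_measure)
   then show ?thesis using Hh.prob_space by simp
  next
   case True
   have "Pair g -` ?A
    = {v\<in>space (gvec n). (\<Sum>j=0..<?p. (\<Sum>i=0..<n. lsq ?W $$ (j, i) * v i)^2) \<in> - {lo..hi}}"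
    using True g by (auto simp: space_pair_measure scalar_prod_mult_vec_self[OF lsq_carrier[OF W]] simp del: sum.op_ivl_Suc)
   moreover have "Pair g -` ?B = {h\<in>space (gvec ?p). (\<Sum>i=0..<n. (\<Sum>j=0..<?p. lsq ?W $$ (j, i) * h j)^2) \<in> - {lo..hi}}"
    using True g by (auto simp: space_pair_measure lsq_transpose_quad[OF W True] simp del: sum.op_ivl_Suc)
   ultimately show ?thesis
    using gauss_quadratic_law[of "{0..<n}" "{0..<?p}" "- {lo..hi}" "\<lambda>i j. lsq ?W $$ (j, i)"] by simp
  qed
 qed
 \<comment> \<open>The factors are exchanged in order to condition on \<open>h\<close> rather than
   on the regressors.\<close>
 also have "measure ?N ?B = measure (gvec ?p \<Otimes>\<^sub>M ?G) ((\<lambda>(h, g). (g, h)) -` ?B \<inter> space (gvec ?p \<Otimes>\<^sub>M ?G))"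
  by (subst (1) N.distr_pair_swap, rule measure_distr) (use B in auto)
 also have "... \<le> measure (gvec ?p) {h\<in>space (gvec ?p). real n * d \<le> \<bar>(\<Sum>i=0..<?p. (h i)^2) - real (card {0..<?p})\<bar>} + 2 * exp (- ?k * d^2 / 8)"
 proof (rule pair_measure_bound[OF prob_space_gauss prob_space_gauss])
  show "(\<lambda>(h, g). (g, h)) -` ?B \<inter> space (gvec ?p \<Otimes>\<^sub>M ?G) \<in> sets (gvec ?p \<Otimes>\<^sub>M ?G)"
   by (rule measurable_sets[OF measurable_pair_swap' B])
  show "{h\<in>space (gvec ?p). real n * d \<le> \<bar>(\<Sum>i=0..<?p. (h i)^2) - real (card {0..<?p})\<bar>} \<in> sets (gvec ?p)"
   by measurable
  fix h assume h: "h \<in> space (gvec ?p) - {h\<in>space (gvec ?p). real n * d \<le> \<bar>(\<Sum>i=0..<?p. (h i)^2) - real (card {0..<?p})\<bar>}"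
  define x where "x = (\<Sum>i=0..<?p. (h i)^2)"
  have x0: "0 \<le> x" unfolding x_def by (intro sum_nonneg) auto
  have "\<not> real n * d \<le> \<bar>x - real (card {0..<?p})\<bar>" using h unfolding x_def by blast
  then have xd: "\<bar>x - real ?p\<bar> < real n * d" by simp
  define e where "e i = (if x = 0 then (if i = p then 1 else 0) else h i / sqrt x)" for i
  have e1: "(\<Sum>i=0..<?p. (e i)^2) = 1"
  proof (cases "x = 0")
   case True
   then show ?thesis by (simp add: e_def if_distrib[of "\<lambda>a. a^2"] cong: if_cong)
  next
   case False
   then show ?thesis using x0 by (simp only: e_def if_False power_divide sum_divide_distrib[symmetric] x_def[symmetric]) simp
  qed
  have he: "h i = sqrt x * e i" if "i < ?p" for i
  proof (cases "x = 0")
   case True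
   then have "\<forall>i\<in>{0..<?p}. (h i)^2 = 0" unfolding x_def by (subst (asm) sum_nonneg_eq_0_iff) auto
   then show ?thesis using True that by simp
  qed (use x0 in \<open>simp add: e_def\<close>)
  have sub: "Pair h -` ((\<lambda>(h, g). (g, h)) -` ?B \<inter> space (gvec ?p \<Otimes>\<^sub>M ?G)) \<subseteq> {g\<in>space ?G. \<not> fullrank (mat n ?p g) \<or>
   ?k * d \<le> \<bar>1 / ?q g e - ?k\<bar>}"
  proof
   fix g assume "g \<in> Pair h -` ((\<lambda>(h, g). (g, h)) -` ?B \<inter> space (gvec ?p \<Otimes>\<^sub>M ?G))"
   then have g: "g \<in> space ?G" "\<not> fullrank (mat n ?p g) \<or> ?q g h \<notin> {lo..hi}" by (auto simp: space_pair_measure)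
   have "?q g h = x / (1 / ?q g e)"
    using scalar_prod_quad_scale[OF minv_carrier[OF gram_carrier] he, of "mat n ?p g" n] x0 by simp
   then have "?k * d \<le> \<bar>1 / ?q g e - ?k\<bar>" if "?q g h \<notin> {lo..hi}"
    using H[OF x0 xd, of "1 / ?q g e"] that unfolding atLeastAtMost_iff by (metis not_le)
   with g show "g \<in> {g\<in>space ?G. \<not> fullrank (mat n ?p g) \<or> ?k * d \<le> \<bar>1 / ?q g e - ?k\<bar>}" by blast
  qed
  have "measure ?G (Pair h -` ((\<lambda>(h, g). (g, h)) -` ?B \<inter> space (gvec ?p \<Otimes>\<^sub>M ?G))) \<le> measure ?G {g\<in>space ?G. \<not> fullrank (mat n ?p g) \<or>
   ?k * d \<le> \<bar>1 / ?q g e - ?k\<bar>}"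
  proof (rule G.finite_measure_mono[OF sub])
   note [measurable] = meas_gmat_quad[of "?p" e n]
   show "{g\<in>space ?G. \<not> fullrank (mat n ?p g) \<or> ?k * d \<le> \<bar>1 / ?q g e - ?k\<bar>} \<in> sets ?G"
    by (rule sets_not_fullrank_or[OF meas_gmat]) measurable
  qed
  also have "... \<le> 2 * exp (- ?k * d^2 / 8)" by (rule gmat_quad_tail[OF np _ _ _ e1]) (use d in auto)
  finally show "measure ?G (Pair h -` ((\<lambda>(h, g). (g, h)) -` ?B \<inter> space (gvec ?p \<Otimes>\<^sub>M ?G))) \<le> 2 * exp (- ?k * d^2 / 8)" .
 qed simp
 also have "measure (gvec ?p) {h\<in>space (gvec ?p). real n * d \<le> \<bar>(\<Sum>i=0..<?p. (h i)^2) - real (card {0..<?p})\<bar>} \<le> 2 * exp (- real n * d^2 / 8)"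
  by (rule gauss_chi_square_tail) (use np d in auto)
 finally show ?thesis by simp
qed

section \<open>Projections with coefficients that depend on the residuals\<close>

text \<open>The two independent vectors are read as one standard normal vector on the disjoint sum,
  which is why orthonormality is asked of the sum of the two scalar products.\<close>

lemma distr_gauss_pair_linear_map:
 fixes f :: "'j => 'i => real" and h :: "'j => 'k => real"
 assumes fin: "finite I" "finite K" "finite J"
  and orth: "\<And>j l. j \<in> J ==> l \<in> J ==> (\<Sum>i\<in>I. f j i * f l i) + (\<Sum>k\<in>K. h j k * h l k) = (if j = l then 1 else 0)"
 shows "distr (gauss I \<Otimes>\<^sub>M gauss K) (\<Pi>\<^sub>M j\<in>J. borel)
  (\<lambda>z. \<lambda>j\<in>J. (\<Sum>i\<in>I. f j i * fst z i) + (\<Sum>k\<in>K. h j k * snd z k)) = gauss J"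
proof -
 let ?L = "I <+> K" let ?N = "(\<Pi>\<^sub>M j\<in>I. (borel :: real measure)) \<Otimes>\<^sub>M (\<Pi>\<^sub>M k\<in>K. (borel :: real measure))"
 let ?c = "\<lambda>x. (\<lambda>i\<in>I. x (Inl i), \<lambda>k\<in>K. x (Inr k)) :: ('i => real) \<times> ('k => real)"
 let ?\<phi> = "\<lambda>z. \<lambda>j\<in>J. (\<Sum>i\<in>I. f j i * fst z i) + (\<Sum>k\<in>K. h j k * snd z k)"
 have d: "distr (gauss ?L) ?N ?c = gauss I \<Otimes>\<^sub>M gauss K"
  by (rule distr_gauss_coordinate_pair) (use fin in auto)
 have mc: "?c \<in> measurable (gauss ?L) ?N"
  unfolding measurable_cong_sets[OF sets_gauss refl]
  by (intro measurable_Pair measurable_restrict measurable_component_singleton) auto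
 have m\<phi>: "?\<phi> \<in> measurable ?N (\<Pi>\<^sub>M j\<in>J. borel)"
  by measurable
 define F where "F j l = (case l of Inl i => f j i | Inr k => h j k)" for j l
 have split: "(\<Sum>l\<in>?L. G l) = (\<Sum>i\<in>I. G (Inl i)) + (\<Sum>k\<in>K. G (Inr k))" for G :: "_ => real"
  using fin by (simp add: sum.Plus)
 have "distr (gauss I \<Otimes>\<^sub>M gauss K) (\<Pi>\<^sub>M j\<in>J. borel) ?\<phi> = distr (gauss ?L) (\<Pi>\<^sub>M j\<in>J. borel) (?\<phi> \<circ> ?c)"
  unfolding d[symmetric] by (rule distr_distr[OF m\<phi> mc])
 also have "?\<phi> \<circ> ?c = (\<lambda>x. \<lambda>j\<in>J. \<Sum>l\<in>?L. F j l * x l)"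
  by (simp add: fun_eq_iff split F_def)
 also have "distr (gauss ?L) (\<Pi>\<^sub>M j\<in>J. borel) ... = gauss J"
 proof (rule gauss_linear_map)
  show "(\<Sum>l\<in>?L. F j l * F m l) = (if j = m then 1 else 0)" if "j \<in> J" "m \<in> J" for j m
   unfolding split using orth[OF that] by (simp add: F_def)
 qed (use fin in auto)
 finally show ?thesis .
qed

text \<open>The projection of \<open>A\<close> onto the columns of \<open>W\<close> is independent of \<open>rsd W * A\<close>, so the latter may
 be frozen in the coefficients \<open>r\<close>.\<close>

lemma lsq_independent_norm_tail:
 fixes r :: "real mat => nat => real" and n p k :: nat
 assumes np: "Suc p \<le> n" and d: "0 < d" "d < 1"
  and H: "\<And>x y. 0 \<le> x ==> \<bar>x - real (Suc p)\<bar> < real n * d ==> \<bar>y - (real n - real p)\<bar> < (real n - real p) * d ==> lo \<le> x / y \<and> x / y \<le> hi"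
 defines "D \<equiv> \<lambda>z. lsq (mat n (Suc p) (fst z)) *\<^sub>v (mat n k (snd z) *\<^sub>v vec k (r (rsd (mat n (Suc p) (fst z)) * mat n k (snd z))))"
  and "\<nu>2 \<equiv> \<lambda>z. \<Sum>j=0..<k. (r (rsd (mat n (Suc p) (fst z)) * mat n k (snd z)) j)^2"
 assumes B: "{z\<in>space (gmat n (Suc p) \<Otimes>\<^sub>M gmat n k). \<not> fullrank (mat n (Suc p) (fst z)) \<or>
   scalar_prod (D z) (D z) \<notin> {lo * \<nu>2 z..hi * \<nu>2 z}} \<in> sets (gmat n (Suc p) \<Otimes>\<^sub>M gmat n k)"
 shows "measure (gmat n (Suc p) \<Otimes>\<^sub>M gmat n k) {z\<in>space (gmat n (Suc p) \<Otimes>\<^sub>M gmat n k). \<not> fullrank (mat n (Suc p) (fst z)) \<or>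
   scalar_prod (D z) (D z) \<notin> {lo * \<nu>2 z..hi * \<nu>2 z}} \<le> 2 * exp (- real n * d^2 / 8) + 2 * exp (- (real n - real p) * d^2 / 8)"
proof -
 let ?p = "Suc p" let ?G = "gmat n ?p" let ?K = "{0..<n} \<times> {0..<k}"
 let ?B = "{z\<in>space (?G \<Otimes>\<^sub>M gmat n k). \<not> fullrank (mat n ?p (fst z)) \<or> scalar_prod (D z) (D z) \<notin> {lo * \<nu>2 z..hi * \<nu>2 z}}"
 let ?F = "{z\<in>space (?G \<Otimes>\<^sub>M gvec n). \<not> fullrank (mat n ?p (fst z)) \<or>
   scalar_prod (lsq (mat n ?p (fst z)) *\<^sub>v vec n (snd z)) (lsq (mat n ?p (fst z)) *\<^sub>v vec n (snd z)) \<notin> {lo..hi}}"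
 have F: "?F \<in> sets (?G \<Otimes>\<^sub>M gvec n)"
 proof -
  have mW: "meas_mat (?G \<Otimes>\<^sub>M gvec n) n ?p (\<lambda>z. mat n ?p (fst z))" by (rule meas_mat_compose[OF meas_gmat]) measurable
  have mv: "meas_vec (?G \<Otimes>\<^sub>M gvec n) n (\<lambda>z. vec n (snd z))" by (rule meas_vec_compose[OF meas_gvec]) measurable
  have [measurable]: "(\<lambda>z. scalar_prod (lsq (mat n ?p (fst z)) *\<^sub>v vec n (snd z)) (lsq (mat n ?p (fst z)) *\<^sub>v vec n (snd z))) \<in> borel_measurable (?G \<Otimes>\<^sub>M gvec n)"
   by (intro meas_scalar_prod[OF meas_mult_mat_vec[OF meas_mat_lsq[OF mW] mv] meas_mult_mat_vec[OF meas_mat_lsq[OF mW] mv]])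
  show ?thesis by (rule sets_not_fullrank_or[OF mW]) measurable
 qed
 have "measure (?G \<Otimes>\<^sub>M gmat n k) ?B \<le> measure (?G \<Otimes>\<^sub>M gvec n) ?F"
 proof (rule pair_measure_le_pair[OF prob_space_gauss prob_space_gauss prob_space_gauss B F])
  fix g assume g: "g \<in> space ?G"
  let ?W = "mat n ?p g" let ?M = "rsd ?W" let ?P = "?W * lsq ?W"
  have W: "?W \<in> carrier_mat n ?p" by simp
  have M: "?M \<in> carrier_mat n n" and L: "lsq ?W \<in> carrier_mat ?p n" by (rule rsd_carrier[OF W] lsq_carrier[OF W])+
  have P: "?P \<in> carrier_mat n n" by (rule mult_carrier_mat[OF W L])
  interpret Fp: prob_space "gvec n" by (rule prob_space_gauss)
  interpret Kp: prob_space "gmat n k" by (rule prob_space_gauss)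
  show "measure (gmat n k) (Pair g -` ?B) \<le> measure (gvec n) (Pair g -` ?F)"
  proof (cases "fullrank ?W")
   case False
   then have "Pair g -` ?F = space (gvec n)" using g by (auto simp: space_pair_measure)
   then show ?thesis using Fp.prob_space by simp
  next
   case fr: True
   have MP1: "?M + ?P = 1\<^sub>m n"
    unfolding rsd_def using W P by (intro eq_matI) auto
   have Pt: "transpose_mat ?P = ?P" and Mt: "transpose_mat ?M = ?M" by (rule proj_symmetric[OF W fr] rsd_symmetric[OF W fr])+
   have MM: "?M * ?M = ?M" by (rule rsd_idempotent[OF W fr])
   have MP: "?M * ?P = 0\<^sub>m n n"
   proof -
    have "?M * ?P = (?M * ?W) * lsq ?W" by (rule assoc_mult_mat[symmetric, OF M W L])
    then show ?thesis unfolding rsd_mult[OF W fr] using left_mult_zero_mat[OF L, of n] by simp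
   qed
   have PP: "?P * ?P = ?P"
   proof -
    have "?P = (?M + ?P) * ?P" unfolding MP1 using P by simp
    also have "... = ?M * ?P + ?P * ?P" by (rule add_mult_distrib_mat[OF M P P])
    finally show ?thesis unfolding MP using P by simp
   qed
   have LP: "lsq ?W * ?P = lsq ?W"
    using assoc_mult_mat[OF L W L] L by (simp add: lsq_mult[OF W fr])
   have LM: "lsq ?W * ?M = 0\<^sub>m ?p n" by (rule lsq_rsd[OF W fr])
   \<comment> \<open>The matrix is replaced by the residual part of one copy \<open>a'\<close> plus
     the projected part of an independent copy \<open>a\<close>. The law is unchanged because
     \<open>?M\<close> and \<open>?P\<close> are complementary orthogonal projections.\<close>
   define f where "f = (\<lambda>(i::nat, j::nat) (i'::nat, j'::nat). if j' = j then ?M $$ (i, i') else 0)"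
   define h where "h = (\<lambda>(i::nat, j::nat) (i'::nat, j'::nat). if j' = j then ?P $$ (i, i') else 0)"
   define \<phi> where "\<phi> = (\<lambda>z. \<lambda>x\<in>?K. (\<Sum>y\<in>?K. f x y * fst z y) + (\<Sum>y\<in>?K. h x y * snd z y))"
   have fsum: "(\<Sum>y\<in>?K. f (i, j) y * a y) = (\<Sum>i'\<in>{0..<n}. ?M $$ (i, i') * a (i', j))"
    and hsum: "(\<Sum>y\<in>?K. h (i, j) y * a y) = (\<Sum>i'\<in>{0..<n}. ?P $$ (i, i') * a (i', j))" if "j < k" for i j and a :: "nat \<times> nat => real"
   proof -
    have "(\<Sum>y\<in>?K. f (i, j) y * a y) = (\<Sum>i'\<in>{0..<n}. \<Sum>j'\<in>{0..<k}. if j' = j then ?M $$ (i, i') * a (i', j') else 0)"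
     by (subst sum.cartesian_product) (auto simp: f_def intro!: sum.cong)
    then show "(\<Sum>y\<in>?K. f (i, j) y * a y) = (\<Sum>i'\<in>{0..<n}. ?M $$ (i, i') * a (i', j))" using that by simp
    have "(\<Sum>y\<in>?K. h (i, j) y * a y) = (\<Sum>i'\<in>{0..<n}. \<Sum>j'\<in>{0..<k}. if j' = j then ?P $$ (i, i') * a (i', j') else 0)"
     by (subst sum.cartesian_product) (auto simp: h_def intro!: sum.cong)
    then show "(\<Sum>y\<in>?K. h (i, j) y * a y) = (\<Sum>i'\<in>{0..<n}. ?P $$ (i, i') * a (i', j))" using that by simp
   qed
   have law: "distr (gmat n k \<Otimes>\<^sub>M gmat n k) (\<Pi>\<^sub>M x\<in>?K. borel) \<phi> = gmat n k"
    unfolding \<phi>_def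
   proof (rule distr_gauss_pair_linear_map)
    fix x y assume "x \<in> ?K" "y \<in> ?K"
    then obtain i j i' j' where xy: "x = (i, j)" "y = (i', j')" "i < n" "i' < n" "j < k" "j' < k" by auto
    have "(\<Sum>u\<in>?K. f x u * f y u) = (if j = j' then (?M * transpose_mat ?M) $$ (i, i') else 0)"
     unfolding xy using xy M by (simp add: fsum) (auto simp: f_def scalar_prod_def)
    moreover have "(\<Sum>u\<in>?K. h x u * h y u) = (if j = j' then (?P * transpose_mat ?P) $$ (i, i') else 0)"
     unfolding xy using xy carrier_matD[OF P] by (simp add: hsum del: index_mult_mat) (auto simp: h_def scalar_prod_def simp del: index_mult_mat simp add: index_mult_mat(1)[of i ?P i' "transpose_mat ?P"])
    moreover have "?M $$ (i, i') + ?P $$ (i, i') = (1\<^sub>m n :: real mat) $$ (i, i')"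
     unfolding MP1[symmetric] using xy M P by (simp del: index_mult_mat)
    ultimately show "(\<Sum>u\<in>?K. f x u * f y u) + (\<Sum>u\<in>?K. h x u * h y u) = (if x = y then 1 else 0)"
     unfolding Mt Pt MM PP using xy by auto
   qed auto
   have m\<phi>: "\<phi> \<in> measurable (gmat n k \<Otimes>\<^sub>M gmat n k) (\<Pi>\<^sub>M x\<in>?K. borel)" unfolding \<phi>_def by measurable
   have Bg: "Pair g -` ?B \<in> sets (gmat n k)" by (rule sets_Pair1[OF B])
   let ?C = "\<phi> -` (Pair g -` ?B) \<inter> space (gmat n k \<Otimes>\<^sub>M gmat n k)"
   have "measure (gmat n k) (Pair g -` ?B) = measure (distr (gmat n k \<Otimes>\<^sub>M gmat n k) (\<Pi>\<^sub>M x\<in>?K. borel) \<phi>) (Pair g -` ?B)"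
    unfolding law ..
   also have "... = measure (gmat n k \<Otimes>\<^sub>M gmat n k) ?C"
    by (rule measure_distr[OF m\<phi>]) (use Bg sets_gauss in blast)
   also have "... \<le> measure (gmat n k) {} + measure (gvec n) (Pair g -` ?F)"
   proof (rule pair_measure_bound[OF prob_space_gauss prob_space_gauss])
    show "?C \<in> sets (gmat n k \<Otimes>\<^sub>M gmat n k)" by (rule measurable_sets[OF m\<phi>]) (use Bg sets_gauss in blast)
    fix a' assume a': "a' \<in> space (gmat n k) - {}"
    let ?A' = "mat n k a'"
    let ?\<rho> = "r (?M * ?A')"
    define \<nu> where "\<nu> = sqrt (\<Sum>j=0..<k. (?\<rho> j)^2)"
    have \<nu>0: "0 \<le> \<nu>" and \<nu>sq: "\<nu>^2 = (\<Sum>j=0..<k. (?\<rho> j)^2)" by (auto simp: \<nu>_def sum_nonneg)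
    have matphi: "mat n k (\<phi> (a', a)) = ?M * ?A' + ?P * mat n k a" for a
    proof (rule eq_matI)
     fix i j assume "i < dim_row (?M * ?A' + ?P * mat n k a)" "j < dim_col (?M * ?A' + ?P * mat n k a)"
     then have ij: "i < n" "j < k" by auto
     have "(?M * ?A') $$ (i, j) = (\<Sum>i'\<in>{0..<n}. ?M $$ (i, i') * a' (i', j))" using ij carrier_matD[OF M] by (simp add: scalar_prod_def)
     moreover have "(?P * mat n k a) $$ (i, j) = (\<Sum>i'\<in>{0..<n}. ?P $$ (i, i') * a (i', j))"
      using ij carrier_matD[OF P] by (simp add: scalar_prod_def del: index_mult_mat add: index_mult_mat(1)[of i ?P j "mat n k a"])
     ultimately show "mat n k (\<phi> (a', a)) $$ (i, j) = (?M * ?A' + ?P * mat n k a) $$ (i, j)"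
      using ij fsum[OF ij(2), of i a'] hsum[OF ij(2), of i a] carrier_matD[OF M] carrier_matD[OF P] by (simp add: \<phi>_def del: index_mult_mat(1))
    qed (use M P in auto)
    \<comment> \<open>The residuals see the copy \<open>a'\<close> only. By \<open>LA\<close> the
      fit sees the copy \<open>a\<close> only, apart from the coefficients, which are a function of
      the residuals; so \<open>a'\<close> can be held fixed.\<close>
    have MA: "?M * mat n k (\<phi> (a', a)) = ?M * ?A'" for a
    proof -
     have A: "mat n k a \<in> carrier_mat n k" "?A' \<in> carrier_mat n k" by simp_all
     have "?M * (?M * ?A' + ?P * mat n k a) = ?M * (?M * ?A') + ?M * (?P * mat n k a)"
      by (rule mult_add_distrib_mat[OF M mult_carrier_mat[OF M A(2)] mult_carrier_mat[OF P A(1)]])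
     also have "?M * (?M * ?A') = ?M * ?A'" using assoc_mult_mat[OF M M A(2)] MM by simp
     also have "?M * (?P * mat n k a) = 0\<^sub>m n k" using assoc_mult_mat[OF M P A(1)] MP left_mult_zero_mat[OF A(1), of n] by simp
     finally show ?thesis unfolding matphi using mult_carrier_mat[OF M A(2)] by simp
    qed
    have LA: "lsq ?W *\<^sub>v (mat n k (\<phi> (a', a)) *\<^sub>v vec k ?\<rho>) = lsq ?W *\<^sub>v (mat n k a *\<^sub>v vec k ?\<rho>)" for a
    proof -
     have A: "mat n k a \<in> carrier_mat n k" "?A' \<in> carrier_mat n k" by simp_all
     have "lsq ?W * (?M * ?A' + ?P * mat n k a) = lsq ?W * (?M * ?A') + lsq ?W * (?P * mat n k a)"
      by (rule mult_add_distrib_mat[OF L mult_carrier_mat[OF M A(2)] mult_carrier_mat[OF P A(1)]])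
     also have "lsq ?W * (?M * ?A') = 0\<^sub>m ?p k" using assoc_mult_mat[OF L M A(2)] LM left_mult_zero_mat[OF A(2), of ?p] by simp
     also have "lsq ?W * (?P * mat n k a) = lsq ?W * mat n k a" using assoc_mult_mat[OF L P A(1)] LP by simp
     finally have "lsq ?W * mat n k (\<phi> (a', a)) = lsq ?W * mat n k a" unfolding matphi using mult_carrier_mat[OF L A(1)] by simp
     then show ?thesis
      using assoc_mult_mat_vec[OF L, of "mat n k (\<phi> (a', a))" k "vec k ?\<rho>"] assoc_mult_mat_vec[OF L A(1), of "vec k ?\<rho>"] by simp
    qed
    have sec: "Pair a' -` ?C = {a\<in>space (gmat n k). scalar_prod (lsq ?W *\<^sub>v (mat n k a *\<^sub>v vec k ?\<rho>)) (lsq ?W *\<^sub>v (mat n k a *\<^sub>v vec k ?\<rho>)) \<notin> {lo * \<nu>^2..hi * \<nu>^2}}"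
    proof -
     have "\<phi> (a', a) \<in> Pair g -` ?B \<longleftrightarrow> scalar_prod (lsq ?W *\<^sub>v (mat n k a *\<^sub>v vec k ?\<rho>)) (lsq ?W *\<^sub>v (mat n k a *\<^sub>v vec k ?\<rho>)) \<notin> {lo * \<nu>^2..hi * \<nu>^2}" for a
     proof -
      have "\<phi> (a', a) \<in> space (gmat n k)" by (simp add: space_gauss \<phi>_def)
      then show ?thesis using fr g unfolding vimage_def mem_Collect_eq D_def \<nu>2_def fst_conv snd_conv MA LA \<nu>sq
       by (simp add: space_pair_measure)
     qed
     then show ?thesis using a' by (auto simp: space_pair_measure)
    qed
    show "measure (gmat n k) (Pair a' -` ?C) \<le> measure (gvec n) (Pair g -` ?F)"
    \<comment> \<open>For vanishing coefficients the statistic and both ends of its interval are 0,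
      so the bad event is empty; otherwise one may divide by \<open>\<nu>\<close>.\<close>
    proof (cases "\<nu> = 0")
     case True
     then have "(\<Sum>j=0..<k. (?\<rho> j)^2) = 0" using \<nu>sq by simp
     then have "\<forall>j\<in>{0..<k}. (?\<rho> j)^2 = 0" by (subst (asm) sum_nonneg_eq_0_iff) auto
     then have "vec k ?\<rho> = 0\<^sub>v k" by (intro eq_vecI) auto
     moreover have "lsq ?W *\<^sub>v (mat n k a *\<^sub>v 0\<^sub>v k) = 0\<^sub>v ?p" for a
      using carrier_matD[OF L] by (intro eq_vecI) (auto simp: scalar_prod_def)
     ultimately have "Pair a' -` ?C = {}" unfolding sec using True by simp
     then show ?thesis by simp
    next
     case False
     then have \<nu>p: "0 < \<nu>" using \<nu>0 by simp
     \<comment> \<open>With the coefficients frozen, the combination of the columns of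
       \<open>a\<close> is \<open>\<nu>\<close> times a standard normal vector; \<open>e i\<close>
       extracts its entry \<open>i\<close>.\<close>
     define e where "e = (\<lambda>i::nat. \<lambda>(i'::nat, j). if i' = i then ?\<rho> j / \<nu> else 0)"
     have esum: "(\<Sum>y\<in>?K. e i y * a y) = (\<Sum>j=0..<k. ?\<rho> j / \<nu> * a (i, j))" if "i < n" for i and a :: "nat \<times> nat => real"
     proof -
      have "(\<Sum>y\<in>?K. e i y * a y) = (\<Sum>i'\<in>{0..<n}. \<Sum>j=0..<k. if i' = i then ?\<rho> j / \<nu> * a (i', j) else 0)"
       by (subst sum.cartesian_product) (auto simp: e_def intro!: sum.cong)
      also have "... = (\<Sum>i'\<in>{0..<n}. if i' = i then (\<Sum>j=0..<k. ?\<rho> j / \<nu> * a (i', j)) else 0)"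
       by (intro sum.cong) auto
      finally show ?thesis using that by simp
     qed
     have nn: "(\<Sum>j=0..<k. ?\<rho> j / \<nu> * (?\<rho> j / \<nu>)) = 1"
     proof -
      have "(\<Sum>j=0..<k. ?\<rho> j / \<nu> * (?\<rho> j / \<nu>)) = (\<Sum>j=0..<k. (?\<rho> j)^2) / \<nu>^2"
       by (simp add: sum_divide_distrib power2_eq_square)
      then show ?thesis using \<nu>p by (simp add: \<nu>sq[symmetric])
     qed
     let ?A = "{v\<in>space (gvec n). scalar_prod (lsq ?W *\<^sub>v vec n v) (lsq ?W *\<^sub>v vec n v) \<notin> {lo..hi}}"
     have A: "?A \<in> sets (gvec n)"
     proof -
      have [measurable]: "(\<lambda>v. scalar_prod (lsq ?W *\<^sub>v vec n v) (lsq ?W *\<^sub>v vec n v)) \<in> borel_measurable (gvec n)"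
       by (rule meas_scalar_prod[OF meas_mult_mat_vec[OF meas_mat_const[OF L] meas_gvec] meas_mult_mat_vec[OF meas_mat_const[OF L] meas_gvec]])
      show ?thesis by measurable
     qed
     have "measure (gmat n k) {a\<in>space (gmat n k). (\<lambda>i\<in>{0..<n}. \<Sum>y\<in>?K. e i y * a y) \<in> ?A} = measure (gvec n) ?A"
     proof (rule measure_gauss_linear_map[OF _ _ _ A])
      fix i i' assume i: "i \<in> {0..<n}" "i' \<in> {0..<n}"
      then have "(\<Sum>y\<in>?K. e i y * e i' y) = (\<Sum>j=0..<k. ?\<rho> j / \<nu> * e i' (i, j))" by (intro esum) simp
      also have "... = (if i = i' then (\<Sum>j=0..<k. ?\<rho> j / \<nu> * (?\<rho> j / \<nu>)) else 0)" by (simp add: e_def)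
      finally show "(\<Sum>y\<in>?K. e i y * e i' y) = (if i = i' then 1 else 0)" unfolding nn .
     qed auto
     moreover have "Pair a' -` ?C = {a\<in>space (gmat n k). (\<lambda>i\<in>{0..<n}. \<Sum>y\<in>?K. e i y * a y) \<in> ?A}"
     proof -
      have Lx: "scalar_prod (lsq ?W *\<^sub>v (mat n k a *\<^sub>v vec k ?\<rho>)) (lsq ?W *\<^sub>v (mat n k a *\<^sub>v vec k ?\<rho>)) = \<nu>^2 * scalar_prod (lsq ?W *\<^sub>v vec n (\<lambda>i\<in>{0..<n}. \<Sum>y\<in>?K. e i y * a y)) (lsq ?W *\<^sub>v vec n (\<lambda>i\<in>{0..<n}. \<Sum>y\<in>?K. e i y * a y))" for a
      proof -
       let ?u = "vec n (\<lambda>i\<in>{0..<n}. \<Sum>y\<in>?K. e i y * a y)"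
       have "mat n k a *\<^sub>v vec k ?\<rho> = \<nu> \<cdot>\<^sub>v ?u"
       proof (rule eq_vecI)
        fix i assume "i < dim_vec (\<nu> \<cdot>\<^sub>v ?u)"
        then have i: "i < n" by simp
        have "(\<nu> \<cdot>\<^sub>v ?u) $ i = \<nu> * (\<Sum>j=0..<k. ?\<rho> j / \<nu> * a (i, j))" using i esum[OF i, of a] by simp
        also have "... = (\<Sum>j=0..<k. a (i, j) * ?\<rho> j)"
         unfolding sum_distrib_left using \<nu>p by (intro sum.cong) auto
        also have "... = (mat n k a *\<^sub>v vec k ?\<rho>) $ i" using i by (simp add: scalar_prod_def)
        finally show "(mat n k a *\<^sub>v vec k ?\<rho>) $ i = (\<nu> \<cdot>\<^sub>v ?u) $ i" by simp
       qed simp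
       moreover have "lsq ?W *\<^sub>v (\<nu> \<cdot>\<^sub>v ?u) = \<nu> \<cdot>\<^sub>v (lsq ?W *\<^sub>v ?u)" by (rule mult_mat_vec[OF L]) simp
       ultimately show ?thesis using carrier_matD[OF L] by (simp add: power2_eq_square)
      qed
      have "scalar_prod (lsq ?W *\<^sub>v (mat n k a *\<^sub>v vec k ?\<rho>)) (lsq ?W *\<^sub>v (mat n k a *\<^sub>v vec k ?\<rho>)) \<notin> {lo * \<nu>^2..hi * \<nu>^2} \<longleftrightarrow> (\<lambda>i\<in>{0..<n}. \<Sum>y\<in>?K. e i y * a y) \<in> ?A" for a
       unfolding Lx using \<nu>p by (simp add: space_gauss mult.commute[of _ "\<nu>^2"])
      then show ?thesis unfolding sec by simp
     qed
     moreover have "Pair g -` ?F = ?A" using fr g by (auto simp: space_pair_measure)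
     ultimately show ?thesis by simp
    qed
   qed auto
   finally show ?thesis by simp
  qed
 qed
 also have "... \<le> 2 * exp (- real n * d^2 / 8) + 2 * exp (- (real n - real p) * d^2 / 8)"
  by (rule lsq_norm_tail[OF np _ _ H]) (use d in auto)
 finally show ?thesis .
qed

section \<open>Deterministic comparison of the two errors\<close>

lemma abs_le_of_power2_le:
 fixes x y :: real
 assumes "x^2 \<le> y^2" "0 \<le> y"
 shows "\<bar>x\<bar> \<le> y"
 using assms by (simp add: abs_le_square_iff[symmetric])

lemma abs_sum_of_six:
 fixes x1 :: real
 assumes "\<bar>x1\<bar> \<le> y1" "\<bar>x2\<bar> \<le> y2" "\<bar>x3\<bar> \<le> y3" "\<bar>x4\<bar> \<le> y4" "\<bar>x5\<bar> \<le> y5" "\<bar>x6\<bar> \<le> y6"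
 shows "\<bar>x1 + x2 + 2 * x3 - 2 * x4 - 2 * x5 - 2 * x6\<bar> \<le> y1 + y2 + 2 * y3 + 2 * y4 + 2 * y5 + 2 * y6"
 using assms unfolding abs_le_iff by (intro conjI) linarith+

text \<open>The bound \<open>1 / 42\<close> keeps the denominator above \<open>41 / 42\<close> of
  \<open>m\<close>, whence the factor \<open>42 / 41\<close>. The deviations of numerator and
  denominator contribute at most \<open>n * d * m\<close> each to the cross-multiplied
  difference.\<close>

lemma ratio_deviation:
 fixes x y :: real
 assumes m: "0 < m" "m \<le> n" and k: "0 \<le> k" "k \<le> n" and d: "0 \<le> d" "d \<le> 1 / 42"
  and x: "\<bar>x - k\<bar> < n * d" and y: "\<bar>y - m\<bar> < m * d"
 shows "\<bar>x / y - k / m\<bar> \<le> 2 * n / m * (d * 42 / 41)"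
proof -
 have md: "m * (41/42) \<le> m * (1 - d)" using m d by (intro mult_left_mono) auto
 have "m - m * d < y" using y by linarith
 then have yl: "m * (41/42) < y" using md by (simp add: algebra_simps)
 then have y0: "0 < y" using m by (auto intro: less_trans[of _ "m * (41/42)"])
 have n0: "0 < n" using m by linarith
 have "x / y - k / m = ((x - k) * m - k * (y - m)) / (y * m)"
  using y0 m by (simp add: field_simps)
 also have "\<bar>...\<bar> = \<bar>(x - k) * m - k * (y - m)\<bar> / (y * m)" using y0 m by simp
 also have "... \<le> (2 * n * d * m) / (y * m)"
 proof (rule divide_right_mono)
  have "\<bar>(x - k) * m\<bar> \<le> (n * d) * m" using x m by (simp add: abs_mult mult_right_mono)
  moreover have "\<bar>k * (y - m)\<bar> \<le> n * (m * d)" using y k m d by (simp add: abs_mult mult_mono)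
  then have "\<bar>k * (y - m)\<bar> \<le> n * d * m" by (simp add: mult_ac)
  ultimately show "\<bar>(x - k) * m - k * (y - m)\<bar> \<le> 2 * n * d * m"
   using abs_triangle_ineq4[of "(x - k) * m" "k * (y - m)"] by linarith
 qed (use y0 m in simp)
 also have "... = 2 * n * d / y" using m by simp
 also have "... \<le> 2 * n * d / (m * (41/42))"
  by (rule divide_left_mono) (use yl y0 m n0 d in auto)
 finally show ?thesis by (simp add: field_simps)
qed

text \<open>\<open>R\<close> is the common value of both errors when each statistic is replaced by
  its typical value, written as a sum of nonnegative terms. All fluctuations are compared with
  \<open>Q = R / (q * \<kappa>)\<close>. The divisors 42, 20 and 80 leave deviations of at most
  \<open>0.2\<close> and \<open>0.32\<close> times \<open>\<eta> * R\<close>; as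
  \<open>\<eta> < 1\<close>, this makes \<open>\<rho>\<close> at least \<open>0.68 * R\<close>, and
  \<open>0.68\<close> exceeds the total of \<open>0.52\<close>.\<close>

lemma estimated_error_close:
 fixes a1 a2 :: real
 assumes a: "0 \<le> a1" "a1 \<le> 1" "0 \<le> a2" "a2 \<le> 1"
  and B: "0 \<le> B1" "0 \<le> B2" and s2: "0 < s2" and t2: "t2 = B2 + s2"
  and \<kappa>: "0 < \<kappa>" "\<kappa> \<le> 1" and q: "0 < q" "q \<le> 1" and \<eta>: "0 < \<eta>" "\<eta> < 1"
  and \<phi>: "0 < \<phi>1" "\<phi>1 \<le> \<phi>" "1 + \<phi> \<le> 1 / \<kappa>"
  and qc: "q \<le> (101/100) * (\<phi>1 / (1 + \<phi>1)) \<or> q * t2 \<le> s2"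
  and \<delta>: "\<delta> = q * \<kappa>^2 * \<eta> / 42" and e: "e = q * \<kappa> * \<eta> / 20" and l: "l = q * \<kappa>^2 * \<eta> / 80"
  and A: "\<bar>Tn - (B1 + t2)\<bar> \<le> (B1 + t2) * \<delta>" and T3: "\<bar>T3 - t2\<bar> \<le> t2 * \<delta>" and S: "\<bar>S - s2\<bar> \<le> s2 * \<delta>"
  and F1: "\<bar>f11 - t2 * \<phi>1\<bar> \<le> t2 * e" and F2: "\<bar>f22 - s2 * \<phi>\<bar> \<le> s2 * e"
  and NN: "0 \<le> NN" "NN \<le> f22" and c: "0 < c" "c^2 = t2 * \<kappa> / s2"
  and F12: "\<bar>f12 - \<phi>1 * (s2 - l3)\<bar> \<le> e * ((t2 / c + c * (s2 + NN)) / 2)"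
  and L1: "l1^2 \<le> l^2 * (B1 * t2)" and L2: "l2^2 \<le> l^2 * (B1 * s2)" and L3: "l3^2 \<le> l^2 * (B2 * s2)"
  and \<rho>: "\<rho> = s2 + a1^2 * B1 + a2^2 * B2 + (a2 - a1)^2 * f11 + (1 - a2)^2 * f22 + 2 * (a2 - a1) * (1 - a2) * f12
   - 2 * a1 * (a2 - a1) * l1 - 2 * (1 - a2) * a1 * l2 - 2 * (1 - a2) * a2 * l3"
  and \<rho>h: "\<rho>h = ((1 - a2)^2 * \<phi> + 1 - a2\<^sup>2 - (a1 - a2)\<^sup>2 * \<phi>1 + (a2 - a1) * (2 - a1 - a2) * \<phi>1) * S
   + a1^2 * (Tn - (1 - \<pi>) * T3) + (a2^2 - a1\<^sup>2 * \<pi> + (a2 - a1)^2 * \<phi>1) * T3"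
 shows "\<bar>\<rho>h - \<rho>\<bar> \<le> \<eta> * \<rho>"
proof -
 define D where "D = a2 - a1"
 define R where "R = s2 + a1^2 * B1 + a2^2 * B2 + \<phi>1 * D^2 * B2 + s2 * (\<phi>1 * (1 - a1)^2 + (\<phi> - \<phi>1) * (1 - a2)^2)"
 have t0: "0 < t2" using t2 B s2 by simp
 have nn: "0 \<le> a1^2 * B1" "0 \<le> a2^2 * B2" "0 \<le> \<phi>1 * D^2 * B2" "0 \<le> s2 * (\<phi>1 * (1 - a1)^2 + (\<phi> - \<phi>1) * (1 - a2)^2)"
  using B \<phi> s2 by (auto intro!: mult_nonneg_nonneg add_nonneg_nonneg)
 have Rs: "s2 \<le> R" and R1: "a1^2 * B1 \<le> R" and R2: "a2^2 * B2 \<le> R" and R3: "\<phi>1 * D^2 * B2 \<le> R"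
  and R4: "s2 + a2^2 * B2 \<le> R"
  using nn s2 unfolding R_def by linarith+
 have R0: "0 < R" using Rs s2 by linarith
 have a1s: "a1^2 \<le> 1" and a2s: "a2^2 \<le> 1" using a by (auto intro: power_le_one)
 have D1: "\<bar>D\<bar> \<le> 1" using a by (auto simp: D_def)
 have D2: "D^2 \<le> 1" using D1 by (simp add: abs_square_le_1)
 have qk: "0 < q * \<kappa>" "q * \<kappa> \<le> q" "q * \<kappa> \<le> \<kappa>" "q * \<kappa> \<le> 1" using q \<kappa> by (auto intro: mult_le_one)
 have ik: "1 \<le> 1 / \<kappa>" "1 / \<kappa> \<le> 1 / (q * \<kappa>)" "1 / q \<le> 1 / (q * \<kappa>)" "1 \<le> 1 / q"
  using q \<kappa> qk by (auto intro!: divide_left_mono mult_pos_pos)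
 have \<phi>k: "\<phi> \<le> 1 / \<kappa>" "\<phi>1 \<le> 1 / \<kappa>" using \<phi> by linarith+
 have q1: "q * (a1^2 * t2) \<le> (101/100) * R"
  using qc
 proof
  assume "q * t2 \<le> s2"
  then have "a1^2 * (q * t2) \<le> 1 * s2" using a1s s2 t0 q by (intro mult_mono) auto
  then show ?thesis using Rs R0 by (simp add: mult_ac)
 next
  assume qq: "q \<le> (101/100) * (\<phi>1 / (1 + \<phi>1))"
  \<comment> \<open>\<open>R\<close> contains \<open>B2\<close> only with the factor
    \<open>a2^2 + \<phi>1 * D^2\<close>. Over all \<open>a2\<close> this is smallest at
    \<open>a2 = a1 * \<phi>1 / (1 + \<phi>1)\<close>, with value
    \<open>\<phi>1 / (1 + \<phi>1) * a1^2\<close>. The square expresses this minimum, and it is the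
    reason for the ratio in \<open>qc\<close>.\<close>
  have "0 \<le> (a2 * (1 + \<phi>1) - a1 * \<phi>1)^2" by simp
  then have "a1^2 * \<phi>1 \<le> (a2^2 + \<phi>1 * D^2) * (1 + \<phi>1)"
   unfolding D_def by (simp add: power2_eq_square algebra_simps)
  then have k: "\<phi>1 / (1 + \<phi>1) * a1^2 \<le> a2^2 + \<phi>1 * D^2" using \<phi> by (simp add: field_simps)
  have "\<phi>1 / (1 + \<phi>1) * (a1^2 * t2) = (\<phi>1 / (1 + \<phi>1) * a1^2) * B2 + \<phi>1 / (1 + \<phi>1) * a1^2 * s2"
   unfolding t2 by (simp add: algebra_simps)
  also have "... \<le> (a2^2 + \<phi>1 * D^2) * B2 + 1 * s2"
  proof (rule add_mono)
   show "\<phi>1 / (1 + \<phi>1) * a1^2 * B2 \<le> (a2^2 + \<phi>1 * D^2) * B2" by (rule mult_right_mono[OF k B(2)])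
   have "\<phi>1 / (1 + \<phi>1) \<le> 1" using \<phi> by simp
   then have "\<phi>1 / (1 + \<phi>1) * a1^2 \<le> 1" using a1s \<phi> by (intro mult_le_one) auto
   then show "\<phi>1 / (1 + \<phi>1) * a1^2 * s2 \<le> 1 * s2" using s2 by (intro mult_right_mono) auto
  qed
  also have "... \<le> R" using nn unfolding R_def by (simp add: algebra_simps)
  finally have "(101/100) * (\<phi>1 / (1 + \<phi>1) * (a1^2 * t2)) \<le> (101/100) * R" by (rule mult_left_mono) simp
  moreover have "q * (a1^2 * t2) \<le> (101/100) * (\<phi>1 / (1 + \<phi>1)) * (a1^2 * t2)"
   by (rule mult_right_mono[OF qq]) (use t0 in simp)
  then have "q * (a1^2 * t2) \<le> (101/100) * (\<phi>1 / (1 + \<phi>1) * (a1^2 * t2))" by (simp only: mult.assoc)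
  ultimately show ?thesis by (rule order_trans[rotated])
 qed
 have q2: "q * (a2^2 * t2) \<le> (101/100) * R"
 proof -
  have "a2^2 * t2 \<le> R" using R4 mult_right_mono[OF a2s, of s2] s2 unfolding t2 distrib_left by linarith
  then have "q * (a2^2 * t2) \<le> 1 * R" using q t0 by (intro mult_mono) auto
  then show ?thesis using R0 by simp
 qed
 \<comment> \<open>Two factors in \<open>[0, 1]\<close> differ by at most the larger one, which
   reduces the bound for \<open>D\<close> to those for \<open>a1\<close> and
   \<open>a2\<close>.\<close>
 have Dmax: "D^2 \<le> a1^2 \<or> D\<^sup>2 \<le> a2^2"
 proof (cases "a1 \<le> a2")
  case True
  then show ?thesis using a by (intro disjI2) (auto simp: D_def intro!: power_mono)
 next
  case False
  then have "(a1 - a2)^2 \<le> a1^2" using a by (intro power_mono) auto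
  then show ?thesis by (simp add: D_def power2_commute)
 qed
 have q3: "q * (D^2 * t2) \<le> (101/100) * R"
  using Dmax
 proof
  assume "D^2 \<le> a1^2"
  then have "q * (D^2 * t2) \<le> q * (a1^2 * t2)" using q t0 by (intro mult_left_mono mult_right_mono) auto
  then show ?thesis using q1 by linarith
 next
  assume "D^2 \<le> a2^2"
  then have "q * (D^2 * t2) \<le> q * (a2^2 * t2)" using q t0 by (intro mult_left_mono mult_right_mono) auto
  then show ?thesis using q2 by linarith
 qed
 define Q where "Q = R / (q * \<kappa>)"
 have Q: "R / q \<le> Q" "R / \<kappa> \<le> Q" "R \<le> Q" "0 < Q"
  using ik R0 qk q \<kappa> mult_left_mono[OF ik(2), of R] mult_left_mono[OF ik(3), of R] mult_left_mono[OF ik(1), of R] by (auto simp: Q_def)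
 have d1: "a1^2 * t2 \<le> (101/100) * Q" "a2^2 * t2 \<le> (101/100) * Q" "D^2 * t2 \<le> (101/100) * Q"
 proof -
  have "x \<le> (101/100) * Q" if "q * x \<le> (101/100) * R" for x
  proof -
   have "x \<le> (101/100) * (R / q)" using that q by (simp add: field_simps)
   then show ?thesis using Q(1) by linarith
  qed
  then show "a1^2 * t2 \<le> (101/100) * Q" "a2^2 * t2 \<le> (101/100) * Q" "D^2 * t2 \<le> (101/100) * Q" using q1 q2 q3 by blast+
 qed
 have d0: "0 \<le> \<delta>" "0 < e" "0 \<le> l" unfolding \<delta> e l using q \<kappa> \<eta> by auto
 have fs: "\<phi> * s2 \<le> Q" "\<phi>1 * s2 \<le> Q"
 proof -
  have "\<phi> * s2 \<le> 1 / \<kappa> * R" using \<phi>k Rs s2 \<kappa> \<phi> by (intro mult_mono) auto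
  then show *: "\<phi> * s2 \<le> Q" using Q(2) by simp
  have "\<phi>1 * s2 \<le> \<phi> * s2" using \<phi> s2 by simp
  then show "\<phi>1 * s2 \<le> Q" using * by linarith
 qed
 text \<open>The estimated error deviates from its target \<open>R\<close> by the three chi-square fluctuations.\<close>
 have id1: "\<rho>h - R = a1^2 * (Tn - (B1 + t2)) + (a2^2 - a1\<^sup>2 + D^2 * \<phi>1) * (T3 - t2)
   + ((1 - a2)^2 * \<phi> + 1 - a2\<^sup>2 + 2 * D * (1 - a2) * \<phi>1) * (S - s2)"
  unfolding \<rho>h R_def t2 D_def by (simp add: power2_eq_square algebra_simps)
 have "\<bar>a1^2 * (Tn - (B1 + t2))\<bar> = a1^2 * \<bar>Tn - (B1 + t2)\<bar>" by (simp add: abs_mult)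
 also have "... \<le> a1^2 * ((B1 + t2) * \<delta>)" by (rule mult_left_mono[OF A]) simp
 also have "... = \<delta> * (a1^2 * B1 + a1^2 * t2)" by (simp add: algebra_simps)
 also have "... \<le> \<delta> * ((201/100) * Q)" using R1 Q(3) d1(1) d0 by (intro mult_left_mono) auto
 finally have b1: "\<bar>a1^2 * (Tn - (B1 + t2))\<bar> \<le> \<delta> * ((201/100) * Q)" .
 have "\<bar>(a2^2 - a1\<^sup>2 + D^2 * \<phi>1) * (T3 - t2)\<bar> \<le> (\<bar>a2^2 - a1\<^sup>2\<bar> + D^2 * \<phi>1) * (t2 * \<delta>)"
  unfolding abs_mult using T3 \<phi> by (intro mult_mono order_trans[OF abs_triangle_ineq]) auto
 also have "... = \<delta> * (\<bar>a2^2 - a1\<^sup>2\<bar> * t2 + \<phi>1 * D^2 * B2 + D^2 * (\<phi>1 * s2))" unfolding t2 by (simp add: algebra_simps)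
 also have "... \<le> \<delta> * ((301/100) * Q)"
 proof (rule mult_left_mono)
  have "\<bar>a2^2 - a1\<^sup>2\<bar> * t2 \<le> (101/100) * Q"
  proof (cases "a1^2 \<le> a2^2")
   case True
   then have "\<bar>a2^2 - a1\<^sup>2\<bar> * t2 \<le> a2^2 * t2" using t0 by (intro mult_right_mono) auto
   then show ?thesis using d1(2) by linarith
  next
   case False
   then have "\<bar>a2^2 - a1\<^sup>2\<bar> * t2 \<le> a1^2 * t2" using t0 by (intro mult_right_mono) auto
   then show ?thesis using d1(1) by linarith
  qed
  moreover have "D^2 * (\<phi>1 * s2) \<le> 1 * Q" using D2 fs \<phi> s2 by (intro mult_mono) auto
  ultimately show "\<bar>a2^2 - a1\<^sup>2\<bar> * t2 + \<phi>1 * D^2 * B2 + D^2 * (\<phi>1 * s2) \<le> (301/100) * Q" using R3 Q(3) by linarith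
 qed (use d0 in simp)
 finally have b2: "\<bar>(a2^2 - a1\<^sup>2 + D^2 * \<phi>1) * (T3 - t2)\<bar> \<le> \<delta> * ((301/100) * Q)" .
 have a2': "0 \<le> (1 - a2)^2" "(1 - a2)^2 \<le> 1" using a by (auto intro: power_le_one)
 have "\<bar>((1 - a2)^2 * \<phi> + 1 - a2\<^sup>2 + 2 * D * (1 - a2) * \<phi>1) * (S - s2)\<bar> \<le> (1 / \<kappa> + 2 * (1 / \<kappa>)) * (s2 * \<delta>)"
  unfolding abs_mult
 proof (rule mult_mono)
  have "\<bar>2 * D * (1 - a2) * \<phi>1\<bar> = 2 * (\<bar>D\<bar> * (1 - a2) * \<phi>1)" using a \<phi> by (simp add: abs_mult)
  also have "\<bar>D\<bar> * (1 - a2) * \<phi>1 \<le> 1 * 1 * (1 / \<kappa>)" using D1 a \<phi> \<phi>k by (intro mult_mono) auto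
  finally have "\<bar>2 * D * (1 - a2) * \<phi>1\<bar> \<le> 2 * (1 / \<kappa>)" by simp
  moreover have "(1 - a2)^2 * \<phi> \<le> 1 * \<phi>" using a2' \<phi> by (intro mult_right_mono) auto
  moreover have "0 \<le> (1 - a2)^2 * \<phi>" using \<phi> by simp
  moreover have "0 \<le> a2^2" by simp
  ultimately show "\<bar>(1 - a2)\<^sup>2 * \<phi> + 1 - a2\<^sup>2 + 2 * D * (1 - a2) * \<phi>1\<bar> \<le> 1 / \<kappa> + 2 * (1 / \<kappa>)"
   using \<phi>(3) a2s by linarith
 qed (use S \<kappa> in auto)
 also have "... = \<delta> * (3 * (s2 / \<kappa>))" by (simp add: field_simps)
 also have "... \<le> \<delta> * (3 * Q)"
  using d0 Q(2) divide_right_mono[OF Rs, of \<kappa>] \<kappa> by (intro mult_left_mono) auto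
 finally have b3: "\<bar>((1 - a2)^2 * \<phi> + 1 - a2\<^sup>2 + 2 * D * (1 - a2) * \<phi>1) * (S - s2)\<bar> \<le> \<delta> * (3 * Q)" .
 have \<delta>Q: "\<delta> * Q = \<kappa> * \<eta> * R / 42" using q \<kappa> by (simp add: \<delta> Q_def power2_eq_square)
 have "\<kappa> * \<eta> * R \<le> 1 * \<eta> * R" using \<kappa> \<eta> R0 by (intro mult_right_mono) auto
 then have kR: "\<kappa> * \<eta> * R \<le> \<eta> * R" by simp
 have E1: "\<bar>\<rho>h - R\<bar> \<le> (802/4200) * (\<eta> * R)"
  unfolding id1 using b1 b2 b3 \<delta>Q kR by (simp add: abs_if split: if_splits)
 text \<open>The true error deviates from \<open>R\<close> by the fluctuations of the quadratic and linear forms.\<close>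
 have id2: "\<rho> - R = D^2 * (f11 - t2 * \<phi>1) + (1 - a2)^2 * (f22 - s2 * \<phi>) + 2 * (D * (1 - a2) * (f12 - s2 * \<phi>1))
   - 2 * (a1 * D * l1) - 2 * ((1 - a2) * (a1 * l2)) - 2 * ((1 - a2) * (a2 * l3))"
  unfolding \<rho> R_def t2 D_def by (simp add: power2_eq_square algebra_simps)
 have eQ: "e * Q = \<eta> * R / 20" using q \<kappa> by (simp add: e Q_def)
 have lQ: "l * Q = \<kappa> * \<eta> * R / 80" using q \<kappa> by (simp add: l Q_def power2_eq_square)
 have c1: "\<bar>D^2 * (f11 - t2 * \<phi>1)\<bar> \<le> (101/100) * (e * Q)"
 proof -
  have "\<bar>D^2 * (f11 - t2 * \<phi>1)\<bar> \<le> e * (D^2 * t2)" using mult_left_mono[OF F1, of "D^2"] by (simp add: abs_mult mult_ac)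
  also have "... \<le> e * ((101/100) * Q)" using d1 d0 by (intro mult_left_mono) auto
  finally show ?thesis by simp
 qed
 have c2: "\<bar>(1 - a2)\<^sup>2 * (f22 - s2 * \<phi>)\<bar> \<le> e * Q"
 proof -
  have "\<bar>(1 - a2)\<^sup>2 * (f22 - s2 * \<phi>)\<bar> \<le> 1 * (s2 * e)" unfolding abs_mult using F2 a2' by (intro mult_mono) auto
  also have "... \<le> Q * e" using Rs Q(3) d0 by (simp add: mult_right_mono)
  finally show ?thesis by (simp add: mult.commute)
 qed
 \<comment> \<open>The hypotheses bound squared linear forms by \<open>l^2\<close> times a product.
   Once the shrinkage weights are distributed over its two factors, each of them is at most
   \<open>(101/100) * Q\<close>.\<close>
 have prodb: "\<bar>x\<bar> \<le> (101/100) * (l * Q)" if "x^2 \<le> l^2 * (u * v)" "0 \<le> u" "u \<le> (101/100) * Q" "0 \<le> v" "v \<le> (101/100) * Q" for x u v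
 proof (rule abs_le_of_power2_le)
  have "u * v \<le> ((101/100) * Q) * ((101/100) * Q)" using that by (intro mult_mono) auto
  then have "l^2 * (u * v) \<le> l^2 * (((101/100) * Q) * ((101/100) * Q))" by (intro mult_left_mono) auto
  also have "... = ((101/100) * (l * Q))^2" by (simp add: power2_eq_square)
  finally show "x^2 \<le> ((101/100) * (l * Q))^2" using that(1) by linarith
 qed (use d0 Q in simp)
 have c3: "\<bar>a1 * D * l1\<bar> \<le> (101/100) * (l * Q)"
 proof (rule prodb[where u = "a1^2 * B1" and v = "D^2 * t2"])
  have "(a1^2 * D^2) * l1^2 \<le> (a1^2 * D^2) * (l^2 * (B1 * t2))" by (rule mult_left_mono[OF L1]) simp
  then show "(a1 * D * l1)^2 \<le> l^2 * (a1^2 * B1 * (D^2 * t2))" by (simp add: power_mult_distrib mult_ac)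
 qed (use nn R1 Q d1 t0 in auto)
 have c4: "\<bar>a1 * l2\<bar> \<le> (101/100) * (l * Q)"
 proof (rule prodb[where u = "a1^2 * B1" and v = s2])
  have "a1^2 * l2^2 \<le> a1^2 * (l^2 * (B1 * s2))" by (rule mult_left_mono[OF L2]) simp
  then show "(a1 * l2)^2 \<le> l^2 * (a1^2 * B1 * s2)" by (simp add: power_mult_distrib mult_ac)
 qed (use nn R1 Q Rs s2 in auto)
 have c5: "\<bar>a2 * l3\<bar> \<le> (101/100) * (l * Q)"
 proof (rule prodb[where u = "a2^2 * B2" and v = s2])
  have "a2^2 * l3^2 \<le> a2^2 * (l^2 * (B2 * s2))" by (rule mult_left_mono[OF L3]) simp
  then show "(a2 * l3)^2 \<le> l^2 * (a2^2 * B2 * s2)" by (simp add: power_mult_distrib mult_ac)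
 qed (use nn R2 Q Rs s2 in auto)
 have c6: "\<bar>D * \<phi>1 * l3\<bar> \<le> (101/100) * (l * Q)"
 proof (rule prodb[where u = "\<phi>1 * D^2 * B2" and v = "\<phi>1 * s2"])
  have "(D^2 * \<phi>1^2) * l3^2 \<le> (D^2 * \<phi>1^2) * (l^2 * (B2 * s2))" by (rule mult_left_mono[OF L3]) simp
  then show "(D * \<phi>1 * l3)^2 \<le> l^2 * (\<phi>1 * D^2 * B2 * (\<phi>1 * s2))" by (simp add: power_mult_distrib power2_eq_square mult_ac)
 qed (use nn R3 Q fs \<phi> s2 in auto)
 define X where "X = (t2 / c + c * (s2 + NN)) / 2"
 have e20: "e \<le> 1 / 20"
 proof -
  have "q * \<kappa> * \<eta> \<le> 1" by (rule mult_le_one[OF qk(4)]) (use \<eta> in auto)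
  then show ?thesis by (simp add: e)
 qed
 \<comment> \<open>The choice \<open>c^2 = t2 * \<kappa> / s2\<close> makes
   \<open>c * s2 / \<kappa>\<close> equal to \<open>t2 / c\<close>, so the two summands of
   \<open>X\<close> have bounds of the same size.\<close>
 have X: "X \<le> (103/100) * (t2 / c)" and X0: "0 \<le> X"
 proof -
  have "f22 \<le> s2 * \<phi> + s2 * e" using F2 by linarith
  then have "s2 + NN \<le> s2 * (1 + \<phi> + e)" using NN by (simp add: algebra_simps)
  also have "... \<le> s2 * ((105/100) * (1 / \<kappa>))"
   using s2 \<phi>(3) e20 ik(1) by (intro mult_left_mono) auto
  finally have "c * (s2 + NN) \<le> c * (s2 * ((105/100) * (1 / \<kappa>)))" using c by (intro mult_left_mono) auto
  also have "... = (105/100) * (c * s2 / \<kappa>)" by simp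
  also have "c * s2 / \<kappa> = t2 / c"
  proof -
   have "c * c * s2 = t2 * \<kappa>" using c s2 by (simp add: power2_eq_square)
   then show ?thesis using c \<kappa> by (simp add: field_simps)
  qed
  finally have h: "c * (s2 + NN) \<le> (105/100) * (t2 / c)" .
  define y where "y = t2 / c"
  have "0 \<le> y" unfolding y_def using t0 c by simp
  then show "X \<le> (103/100) * (t2 / c)" using h unfolding X_def y_def[symmetric] by (simp add: field_simps)
  show "0 \<le> X" unfolding X_def using t0 c NN s2 by simp
 qed
 have DX: "\<bar>D\<bar> * X \<le> (1041/1000) * Q"
 proof -
  \<comment> \<open>Squared, this is the product of \<open>q * (D^2 * t2)\<close>, which is at most
    \<open>(101/100) * R\<close>, and of \<open>s2 / (q * \<kappa>)\<close>, which is at most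
    \<open>Q\<close>.\<close>
  have "\<bar>D * (t2 / c)\<bar> \<le> (101/100) * Q"
  proof (rule abs_le_of_power2_le)
   have "(D * (t2 / c))^2 = D^2 * (t2 * t2 / c^2)" by (simp add: power2_eq_square)
   also have "t2 * t2 / c^2 = t2 * s2 / \<kappa>" unfolding c(2) using t0 s2 \<kappa> by (simp add: field_simps)
   also have "D^2 * (t2 * s2 / \<kappa>) = (q * (D^2 * t2)) * (s2 / (q * \<kappa>))" using q by (simp add: field_simps)
   also have "... \<le> ((101/100) * R) * (R / (q * \<kappa>))"
    by (rule mult_mono[OF q3 divide_right_mono[OF Rs]]) (use s2 qk R0 in auto)
   also have "... = (101/100) * (R * Q)" by (simp add: Q_def)
   also have "... \<le> (101/100) * (Q * Q)" using Q by (simp add: mult_right_mono)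
   also have "... \<le> ((101/100) * Q)^2" using Q by (simp add: power2_eq_square)
   finally show "(D * (t2 / c))^2 \<le> ((101/100) * Q)^2" .
  qed (use Q in simp)
  then have h: "\<bar>D\<bar> * (t2 / c) \<le> (101/100) * Q" using t0 c by (simp add: abs_mult)
  have "\<bar>D\<bar> * X \<le> \<bar>D\<bar> * ((103/100) * (t2 / c))" by (rule mult_left_mono[OF X]) simp
  also have "... = (103/100) * (\<bar>D\<bar> * (t2 / c))" by simp
  also have "... \<le> (103/100) * ((101/100) * Q)" by (rule mult_left_mono[OF h]) simp
  also have "... \<le> (1041/1000) * Q" using Q by simp
  finally show ?thesis using Q(4) by simp
 qed
 have c7: "\<bar>D * (1 - a2) * (f12 - s2 * \<phi>1)\<bar> \<le> (105/100) * (e * Q) + (101/100) * (l * Q)"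
 proof -
  have "\<bar>D * (1 - a2) * (f12 - s2 * \<phi>1)\<bar> = (1 - a2) * \<bar>D * (f12 - s2 * \<phi>1)\<bar>" using a by (simp add: abs_mult)
  also have "... \<le> 1 * \<bar>D * (f12 - s2 * \<phi>1)\<bar>" using a by (intro mult_right_mono) auto
  also have "D * (f12 - s2 * \<phi>1) = D * (f12 - \<phi>1 * (s2 - l3)) - D * \<phi>1 * l3" by (simp add: algebra_simps)
  also have "1 * \<bar>D * (f12 - \<phi>1 * (s2 - l3)) - D * \<phi>1 * l3\<bar> \<le> \<bar>D * (f12 - \<phi>1 * (s2 - l3))\<bar> + \<bar>D * \<phi>1 * l3\<bar>" by simp
  also have "\<bar>D * (f12 - \<phi>1 * (s2 - l3))\<bar> \<le> e * (\<bar>D\<bar> * X)"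
   using mult_left_mono[OF F12, of "\<bar>D\<bar>"] unfolding X_def by (simp add: abs_mult mult_ac)
  also have "... \<le> e * ((1041/1000) * Q)" using DX d0 by (intro mult_left_mono) auto
  also have "... = (1041/1000) * (e * Q)" by simp
  finally show ?thesis using c6 mult_pos_pos[OF d0(2) Q(4)] by linarith
 qed
 have sh: "\<bar>(1 - a2) * y\<bar> \<le> \<bar>y\<bar>" for y using a mult_right_mono[of "1 - a2" 1 "\<bar>y\<bar>"] by (simp add: abs_mult)
 have E2: "\<bar>\<rho> - R\<bar> \<le> (32/100) * (\<eta> * R)"
 proof -
  have "\<bar>\<rho> - R\<bar> \<le> (101/100) * (e * Q) + e * Q + 2 * ((105/100) * (e * Q) + (101/100) * (l * Q)) + 6 * ((101/100) * (l * Q))"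
   unfolding id2
   using abs_sum_of_six[OF c1 c2 c7 c3 order_trans[OF sh c4] order_trans[OF sh c5]] by (simp add: algebra_simps)
  also have "... = (411/100) * (e * Q) + (808/100) * (l * Q)" by (simp add: algebra_simps)
  also have "... \<le> (32/100) * (\<eta> * R)" unfolding eQ lQ using kR mult_pos_pos[OF \<eta>(1) R0] by linarith
  finally show ?thesis .
 qed
 have \<eta>R: "0 \<le> \<eta> * R" "\<eta> * R \<le> R" using \<eta> R0 by auto
 have "\<bar>\<rho>h - \<rho>\<bar> \<le> (52/100) * (\<eta> * R)" using E1 E2 \<eta>R by linarith
 moreover have "(68/100) * R \<le> \<rho>" using E2 \<eta>R by linarith
 then have "\<eta> * ((68/100) * R) \<le> \<eta> * \<rho>" using \<eta> by (intro mult_left_mono) auto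
 ultimately show ?thesis using \<eta>R by linarith
qed

section \<open>Collecting the fluctuations of one regression\<close>

text \<open>Of the 14 exponentials, 2 stem from the residual sum of squares, 4 from the norm of the
  coefficients and 4 from each of the two linear forms. \<open>L\<close> is a common lower bound for
  all exponents, of which the one with \<open>n - p\<close> degrees of freedom is the
  smallest.\<close>

lemma regression_tail:
 fixes b b' :: "nat => real"
 assumes p: "0 < p" "p < n" and \<delta>: "0 < \<delta>" "\<delta> \<le> 1 / 42" and L: "0 \<le> L" "8 * L \<le> (real n - real p) * \<delta>^2"
  and e: "2 * real n / (real n - real p + 1) * (\<delta> * 42 / 41) \<le> e"
  and l: "0 \<le> l" "2 * L / ((real n - real p) * (1 - \<delta>)) \<le> l^2"
 defines "good \<equiv> \<lambda>z. fullrank (mat n p (fst z)) \<and>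
   \<bar>scalar_prod (vec n (snd z)) (rsd (mat n p (fst z)) *\<^sub>v vec n (snd z)) - (real n - real p)\<bar> \<le> (real n - real p) * \<delta> \<and>
   \<bar>scalar_prod (lsq (mat n p (fst z)) *\<^sub>v vec n (snd z)) (lsq (mat n p (fst z)) *\<^sub>v vec n (snd z)) - real p / (real n - real p + 1)\<bar> \<le> e \<and>
   (scalar_prod (vec p b) (lsq (mat n p (fst z)) *\<^sub>v vec n (snd z)))\<^sup>2 \<le> l^2 * (\<Sum>k=0..<p. (b k)^2) \<and>
   (scalar_prod (vec p b') (lsq (mat n p (fst z)) *\<^sub>v vec n (snd z)))\<^sup>2 \<le> l^2 * (\<Sum>k=0..<p. (b' k)^2)"
 shows "{z\<in>space (gmat n p \<Otimes>\<^sub>M gvec n). \<not> good z} \<in> sets (gmat n p \<Otimes>\<^sub>M gvec n)"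
  and "measure (gmat n p \<Otimes>\<^sub>M gvec n) {z\<in>space (gmat n p \<Otimes>\<^sub>M gvec n). \<not> good z} \<le> 14 * exp (- L)"
proof -
 let ?M = "gmat n p \<Otimes>\<^sub>M gvec n" let ?k = "real n - real p"
 obtain p' where p': "p = Suc p'" using p by (cases p) auto
 have k1: "?k + 1 = real n - real p'" by (simp add: p')
 have k0: "0 < ?k" using p by simp
 interpret G: prob_space "gmat n p" by (rule prob_space_gauss)
 interpret V: prob_space "gvec n" by (rule prob_space_gauss)
 interpret pair_prob_space "gmat n p" "gvec n" ..
 have mW: "meas_mat ?M n p (\<lambda>z. mat n p (fst z))" by (rule meas_mat_compose[OF meas_gmat]) measurable
 have mv: "meas_vec ?M n (\<lambda>z. vec n (snd z))" by (rule meas_vec_compose[OF meas_gvec]) measurable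
 define q where "q z = scalar_prod (vec n (snd z)) (rsd (mat n p (fst z)) *\<^sub>v vec n (snd z))" for z :: "(nat \<times> nat => real) \<times> (nat => real)"
 define f where "f z = scalar_prod (lsq (mat n p (fst z)) *\<^sub>v vec n (snd z)) (lsq (mat n p (fst z)) *\<^sub>v vec n (snd z))" for z :: "(nat \<times> nat => real) \<times> (nat => real)"
 define g where "g c z = scalar_prod (vec p c) (lsq (mat n p (fst z)) *\<^sub>v vec n (snd z))" for c and z :: "(nat \<times> nat => real) \<times> (nat => real)"
 have q[measurable]: "q \<in> borel_measurable ?M"
  unfolding q_def by (rule meas_scalar_prod[OF mv meas_mult_mat_vec[OF meas_mat_rsd[OF mW] mv]])
 have f[measurable]: "f \<in> borel_measurable ?M"
  unfolding f_def by (rule meas_scalar_prod[OF meas_mult_mat_vec[OF meas_mat_lsq[OF mW] mv] meas_mult_mat_vec[OF meas_mat_lsq[OF mW] mv]])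
 have g[measurable]: "g c \<in> borel_measurable ?M" for c
  unfolding g_def by (rule meas_scalar_prod[OF meas_vec_const meas_mult_mat_vec[OF meas_mat_lsq[OF mW] mv]]) simp
 define E1 where "E1 = {z\<in>space ?M. \<not> fullrank (mat n p (fst z)) \<or> ?k * \<delta> \<le> \<bar>q z - ?k\<bar>}"
 define E2 where "E2 = {z\<in>space ?M. \<not> fullrank (mat n p (fst z)) \<or> f z \<notin> {real p / (?k + 1) - e..real p / (?k + 1) + e}}"
 \<comment> \<open>At the threshold \<open>sqrt (2 * L)\<close> the normal tail is a multiple of
   \<open>exp (- L)\<close>.\<close>
 define E3 where "E3 c = {z\<in>space ?M. \<not> fullrank (mat n p (fst z)) \<or> sqrt (2 * L) * sqrt ((\<Sum>k=0..<p. (c k)^2) / ((?k + 1) * (1 - \<delta>))) < \<bar>g c z\<bar>}" for c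
 have E1: "E1 \<in> sets ?M" unfolding E1_def by (rule sets_not_fullrank_or[OF mW]) measurable
 have E2: "E2 \<in> sets ?M" unfolding E2_def by (rule sets_not_fullrank_or[OF mW]) measurable
 have E3: "E3 c \<in> sets ?M" for c unfolding E3_def by (rule sets_not_fullrank_or[OF mW]) measurable
 have good_alt: "good z \<longleftrightarrow> fullrank (mat n p (fst z)) \<and> \<bar>q z - ?k\<bar> \<le> ?k * \<delta> \<and> \<bar>f z - real p / (?k + 1)\<bar> \<le> e \<and>
   (g b z)\<^sup>2 \<le> l^2 * (\<Sum>k=0..<p. (b k)^2) \<and> (g b' z)\<^sup>2 \<le> l^2 * (\<Sum>k=0..<p. (b' k)^2)" for z
  unfolding good_def q_def f_def g_def ..
 show bad: "{z\<in>space ?M. \<not> good z} \<in> sets ?M"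
  unfolding good_alt de_Morgan_conj by (rule sets_not_fullrank_or[OF mW]) measurable
 have neg: "exp (- a * c / 8) \<le> exp (- L)" if "8 * L \<le> a * c" for a c :: real
 proof -
  have "- a * c / 8 = - (a * c / 8)" by simp
  then show ?thesis using that by (simp only: exp_le_cancel_iff)
 qed
 have mE1: "measure ?M E1 \<le> 2 * exp (- L)"
 proof -
  have "measure ?M E1 \<le> measure (gmat n p) {g\<in>space (gmat n p). \<not> fullrank (mat n p g)} + 2 * exp (- ?k * \<delta>^2 / 8)"
  proof (rule pair_measure_bound[OF prob_space_gauss prob_space_gauss E1 sets.sets_Collect_neg[OF sets_fullrank[OF meas_gmat]]])
   fix x assume x: "x \<in> space (gmat n p) - {g\<in>space (gmat n p). \<not> fullrank (mat n p g)}"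
   then have "Pair x -` E1 = {v\<in>space (gvec n). ?k * \<delta> \<le> \<bar>scalar_prod (vec n v) (rsd (mat n p x) *\<^sub>v vec n v) - ?k\<bar>}"
    by (auto simp: E1_def space_pair_measure q_def)
   moreover have "measure (gvec n) {v\<in>space (gvec n). ?k * \<delta> \<le> \<bar>scalar_prod (vec n v) (rsd (mat n p x) *\<^sub>v vec n v) - ?k\<bar>} \<le> 2 * exp (- ?k * \<delta>^2 / 8)"
    by (rule rsd_chi_square_tail) (use x \<delta> in auto)
   ultimately show "measure (gvec n) (Pair x -` E1) \<le> 2 * exp (- ?k * \<delta>^2 / 8)" by simp
  qed simp
  also have "measure (gmat n p) {g\<in>space (gmat n p). \<not> fullrank (mat n p g)} = 0" by (rule gmat_fullrank) (use p in simp)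
  also have "exp (- ?k * \<delta>^2 / 8) \<le> exp (- L)" by (rule neg[OF L(2)])
  finally show ?thesis by simp
 qed
 have tails: "exp (- real n * \<delta>^2 / 8) \<le> exp (- L)" "exp (- (real n - real p') * \<delta>^2 / 8) \<le> exp (- L)"
 proof -
  have "?k * \<delta>^2 \<le> real n * \<delta>^2" "?k * \<delta>^2 \<le> (real n - real p') * \<delta>^2" by (intro mult_right_mono; simp add: p')+
  then show "exp (- real n * \<delta>^2 / 8) \<le> exp (- L)" "exp (- (real n - real p') * \<delta>^2 / 8) \<le> exp (- L)"
   using L(2) by (intro neg; linarith)+
 qed
 have mE2: "measure ?M E2 \<le> 4 * exp (- L)"
 proof -
  have "measure ?M E2 \<le> 2 * exp (- real n * \<delta>^2 / 8) + 2 * exp (- (real n - real p') * \<delta>^2 / 8)"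
   unfolding E2_def f_def unfolding p'
  proof (rule lsq_norm_tail)
   fix x y assume "0 \<le> x" "\<bar>x - real (Suc p')\<bar> < real n * \<delta>" "\<bar>y - (real n - real p')\<bar> < (real n - real p') * \<delta>"
   then have "\<bar>x / y - real (Suc p') / (real n - real p')\<bar> \<le> 2 * real n / (real n - real p') * (\<delta> * 42 / 41)"
    by (intro ratio_deviation) (use p \<delta> p' in auto)
   also have "... \<le> e" using e unfolding k1 .
   finally show "real (Suc p') / (real n - real (Suc p') + 1) - e \<le> x / y \<and> x / y \<le> real (Suc p') / (real n - real (Suc p') + 1) + e"
    using k1 unfolding p' by (auto simp: abs_le_iff algebra_simps)
  qed (use p \<delta> p' in auto)
  then show ?thesis using tails by linarith
 qed
 have mE3: "measure ?M (E3 c) \<le> 4 * exp (- L)" for c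
 proof -
  have "measure ?M (E3 c) \<le> 2 * exp (- (real n - real p') * \<delta>^2 / 8) + 2 * exp (- (sqrt (2 * L))\<^sup>2 / 2)"
   unfolding E3_def g_def k1 unfolding p' by (rule lsq_linear_tail) (use p \<delta> p' L in auto)
  moreover have "(sqrt (2 * L))^2 / 2 = L" using L by simp
  then have "exp (- (sqrt (2 * L))\<^sup>2 / 2) = exp (- L)" by simp
  ultimately show ?thesis using tails by linarith
 qed
 have "{z\<in>space ?M. \<not> good z} \<subseteq> E1 \<union> E2 \<union> E3 b \<union> E3 b'"
 proof
  fix z assume "z \<in> {z\<in>space ?M. \<not> good z}"
  then have z: "z \<in> space ?M" "\<not> good z" by auto
  show "z \<in> E1 \<union> E2 \<union> E3 b \<union> E3 b'"
  proof (rule ccontr)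
   assume n: "z \<notin> E1 \<union> E2 \<union> E3 b \<union> E3 b'"
   have sq: "(g c z)^2 \<le> l^2 * (\<Sum>k=0..<p. (c k)^2)" if "z \<notin> E3 c" for c
   proof -
    let ?s = "\<Sum>k=0..<p. (c k)^2"
    have s0: "0 \<le> ?s" by (intro sum_nonneg) auto
    have kd: "0 < ?k * (1 - \<delta>)" using k0 \<delta> by simp
    have "\<bar>g c z\<bar> \<le> sqrt (2 * L) * sqrt (?s / ((?k + 1) * (1 - \<delta>)))" using that z(1) unfolding E3_def by auto
    then have "\<bar>g c z\<bar>\<^sup>2 \<le> (sqrt (2 * L) * sqrt (?s / ((?k + 1) * (1 - \<delta>))))^2" by (rule power_mono) simp
    also have "... = 2 * L * (?s / ((?k + 1) * (1 - \<delta>)))"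
     using L s0 k0 \<delta> by (simp add: power_mult_distrib)
    also have "... \<le> 2 * L * (?s / (?k * (1 - \<delta>)))"
     using L s0 kd \<delta> k0 by (intro mult_left_mono divide_left_mono mult_right_mono mult_pos_pos) auto
    also have "... = 2 * L / (?k * (1 - \<delta>)) * ?s" by simp
    also have "... \<le> l^2 * ?s" by (rule mult_right_mono[OF l(2) s0])
    finally show ?thesis by simp
   qed
   have "z \<notin> E1" "z \<notin> E2" "z \<notin> E3 b" "z \<notin> E3 b'" using n by auto
   then have "good z" unfolding good_alt using sq[of b] sq[of b'] z(1) unfolding E1_def E2_def by (auto simp: abs_le_iff)
   with z show False by simp
  qed
 qed
 then have "measure ?M {z\<in>space ?M. \<not> good z} \<le> measure ?M (E1 \<union> E2 \<union> E3 b \<union> E3 b')"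
  by (rule finite_measure_mono) (use E1 E2 E3 in auto)
 also have "... \<le> measure ?M E1 + measure ?M E2 + measure ?M (E3 b) + measure ?M (E3 b')"
  using measure_Un_le[of "E1 \<union> E2 \<union> E3 b" ?M "E3 b'"] measure_Un_le[of "E1 \<union> E2" ?M "E3 b"] measure_Un_le[of E1 ?M E2] E1 E2 E3 by fastforce
 also have "... \<le> 14 * exp (- L)" using mE1 mE2 mE3[of b] mE3[of b'] by linarith
 finally show "measure ?M {z\<in>space ?M. \<not> good z} \<le> 14 * exp (- L)" .
qed

text \<open>Recombining the columns with orthonormal coefficient vectors, in every row alike, is an
  orthonormal map on the matrix as a whole.\<close>

lemma distr_gmat_rows:
 fixes c :: "nat => nat => real"
 assumes cc: "\<And>a a'. a < m ==> a' < m ==> (\<Sum>k=0..<q. c a k * c a' k) = (if a = a' then 1 else 0)"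
  and hh: "(\<Sum>k=0..<q. (h k)^2) = 1" and ch: "\<And>a. a < m ==> (\<Sum>k=0..<q. c a k * h k) = 0"
 shows "distr (gmat n q) ((\<Pi>\<^sub>M x\<in>{0..<n} \<times> {0..<m}. borel) \<Otimes>\<^sub>M (\<Pi>\<^sub>M i\<in>{0..<n}. borel))
  (\<lambda>g. (\<lambda>x\<in>{0..<n} \<times> {0..<m}. \<Sum>k=0..<q. c (snd x) k * g (fst x, k), \<lambda>i\<in>{0..<n}. \<Sum>k=0..<q. h k * g (i, k))) = gmat n m \<Otimes>\<^sub>M gvec n"
proof -
 let ?I = "{0..<n} \<times> {0..<q}"
 have S: "(\<Sum>x\<in>?I. (if fst x = i then d (snd x) else 0) * y x) = (\<Sum>k=0..<q. d k * y (i, k))" if "i < n" for i and d :: "nat => real" and y :: "nat \<times> nat => real"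
 proof -
  have "(\<Sum>x\<in>?I. (if fst x = i then d (snd x) else 0) * y x) = (\<Sum>i'\<in>{0..<n}. \<Sum>k=0..<q. if i' = i then d k * y (i', k) else 0)"
   by (subst sum.cartesian_product) (auto intro!: sum.cong)
  also have "... = (\<Sum>i'\<in>{0..<n}. if i' = i then (\<Sum>k=0..<q. d k * y (i', k)) else 0)" by (intro sum.cong) auto
  finally show ?thesis using that by simp
 qed
 have "distr (gmat n q) ((\<Pi>\<^sub>M x\<in>{0..<n} \<times> {0..<m}. borel) \<Otimes>\<^sub>M (\<Pi>\<^sub>M i\<in>{0..<n}. borel))
  (\<lambda>g. (\<lambda>x\<in>{0..<n} \<times> {0..<m}. \<Sum>y\<in>?I. (if fst y = fst x then c (snd x) (snd y) else 0) * g y, \<lambda>i\<in>{0..<n}. \<Sum>y\<in>?I. (if fst y = i then h (snd y) else 0) * g y)) = gmat n m \<Otimes>\<^sub>M gvec n"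
 proof (rule distr_gauss_linear_pair)
  fix x x' assume "x \<in> {0..<n} \<times> {0..<m}" "x' \<in> {0..<n} \<times> {0..<m}"
  then obtain i a i' a' where x: "x = (i, a)" "x' = (i', a')" "i < n" "i' < n" "a < m" "a' < m" by auto
  show "(\<Sum>y\<in>?I. (if fst y = fst x then c (snd x) (snd y) else 0) * (if fst y = fst x' then c (snd x') (snd y) else 0)) = (if x = x' then 1 else 0)"
   unfolding x fst_conv snd_conv S[OF x(3), of "c a" "\<lambda>y. if fst y = i' then c a' (snd y) else 0"]
   using cc[OF x(5,6)] by (cases "i = i'") auto
 next
  fix i i' assume i: "i \<in> {0..<n}" "i' \<in> {0..<n}"
  then show "(\<Sum>y\<in>?I. (if fst y = i then h (snd y) else 0) * (if fst y = i' then h (snd y) else 0)) = (if i = i' then 1 else 0)"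
   using hh S[of i h "\<lambda>y. if fst y = i' then h (snd y) else 0"] by (auto simp: power2_eq_square)
 next
  fix x i assume "x \<in> {0..<n} \<times> {0..<m}" "i \<in> {0..<n}"
  then obtain i' a where x: "x = (i', a)" "i' < n" "a < m" by auto
  show "(\<Sum>y\<in>?I. (if fst y = fst x then c (snd x) (snd y) else 0) * (if fst y = i then h (snd y) else 0)) = 0"
   unfolding x fst_conv snd_conv S[OF x(2), of "c a" "\<lambda>y. if fst y = i then h (snd y) else 0"]
   using ch[OF x(3)] by (cases "i' = i") simp_all
 qed auto
 moreover have "(\<lambda>x\<in>{0..<n} \<times> {0..<m}. \<Sum>y\<in>?I. (if fst y = fst x then c (snd x) (snd y) else 0) * g y) = (\<lambda>x\<in>{0..<n} \<times> {0..<m}. \<Sum>k=0..<q. c (snd x) k * g (fst x, k))"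
  "(\<lambda>i\<in>{0..<n}. \<Sum>y\<in>?I. (if fst y = i then h (snd y) else 0) * g y) = (\<lambda>i\<in>{0..<n}. \<Sum>k=0..<q. h k * g (i, k))" for g :: "nat \<times> nat => real"
  by (auto simp: fun_eq_iff S)
 ultimately show ?thesis by simp
qed

lemma measure_gmat_columns:
 fixes h :: "nat => real"
 assumes mq: "m \<le> q" and hh: "(\<Sum>k=0..<q. (h k)^2) = 1" and h0: "\<And>k. k < m ==> h k = 0"
  and E: "E \<in> sets (gmat n m \<Otimes>\<^sub>M gvec n)"
 defines "\<Phi> \<equiv> \<lambda>g. (\<lambda>x\<in>{0..<n} \<times> {0..<m}. g x, \<lambda>i\<in>{0..<n}. \<Sum>k=0..<q. h k * g (i, k))"
 shows "{g\<in>space (gmat n q). \<Phi> g \<in> E} \<in> sets (gmat n q)"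
  and "measure (gmat n q) {g\<in>space (gmat n q). \<Phi> g \<in> E} = measure (gmat n m \<Otimes>\<^sub>M gvec n) E"
proof -
 let ?N = "(\<Pi>\<^sub>M x\<in>{0..<n} \<times> {0..<m}. (borel :: real measure)) \<Otimes>\<^sub>M (\<Pi>\<^sub>M i\<in>{0..<n}. (borel :: real measure))"
 have "distr (gmat n q) ?N
  (\<lambda>g. (\<lambda>x\<in>{0..<n} \<times> {0..<m}. \<Sum>k=0..<q. (if k = snd x then 1 else 0) * g (fst x, k), \<lambda>i\<in>{0..<n}. \<Sum>k=0..<q. h k * g (i, k))) = gmat n m \<Otimes>\<^sub>M gvec n"
  by (rule distr_gmat_rows[where c = "\<lambda>a k. if k = a then 1 else 0"]) (use mq hh h0 in \<open>auto simp: if_distrib[of "\<lambda>a. a * _"] cong: if_cong\<close>)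
 moreover have "(\<lambda>x\<in>{0..<n} \<times> {0..<m}. \<Sum>k=0..<q. (if k = snd x then 1 else 0) * g (fst x, k)) = (\<lambda>x\<in>{0..<n} \<times> {0..<m}. g x)" for g :: "nat \<times> nat => real"
  using mq by (auto simp: fun_eq_iff if_distrib[of "\<lambda>a. a * _"] cong: if_cong)
 ultimately have d: "distr (gmat n q) ?N \<Phi> = gmat n m \<Otimes>\<^sub>M gvec n" unfolding \<Phi>_def by simp
 have m: "\<Phi> \<in> measurable (gmat n q) ?N"
  unfolding \<Phi>_def measurable_cong_sets[OF sets_gauss refl]
  by (intro measurable_Pair measurable_restrict borel_measurable_sum borel_measurable_times borel_measurable_const measurable_component_singleton) (use mq in auto)
 have s: "sets ?N = sets (gmat n m \<Otimes>\<^sub>M gvec n)" by (intro sets_pair_measure_cong sets_gauss[symmetric])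
 have eq: "\<Phi> -` E \<inter> space (gmat n q) = {g\<in>space (gmat n q). \<Phi> g \<in> E}" by auto
 show "{g\<in>space (gmat n q). \<Phi> g \<in> E} \<in> sets (gmat n q)"
  using measurable_sets[OF m, of E] E s eq by simp
 show "measure (gmat n q) {g\<in>space (gmat n q). \<Phi> g \<in> E} = measure (gmat n m \<Otimes>\<^sub>M gvec n) E"
  unfolding eq[symmetric] by (subst d[symmetric], rule measure_distr[OF m, symmetric]) (use E s in simp)
qed

lemma measure_gmat_blocks:
 assumes E: "E \<in> sets (gmat n m \<Otimes>\<^sub>M gmat n k)"
 defines "\<Phi> \<equiv> \<lambda>g. (\<lambda>x\<in>{0..<n} \<times> {0..<m}. g x, \<lambda>x\<in>{0..<n} \<times> {0..<k}. g (fst x, m + snd x)) :: (nat \<times> nat => real) \<times> (nat \<times> nat => real)"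
 shows "{g\<in>space (gmat n (m + k)). \<Phi> g \<in> E} \<in> sets (gmat n (m + k))"
  and "measure (gmat n (m + k)) {g\<in>space (gmat n (m + k)). \<Phi> g \<in> E} = measure (gmat n m \<Otimes>\<^sub>M gmat n k) E"
proof -
 let ?N = "(\<Pi>\<^sub>M x\<in>{0..<n} \<times> {0..<m}. (borel :: real measure)) \<Otimes>\<^sub>M (\<Pi>\<^sub>M i\<in>{0..<n} \<times> {0..<k}. (borel :: real measure))"
 have d: "distr (gmat n (m + k)) ?N \<Phi> = gmat n m \<Otimes>\<^sub>M gmat n k"
  unfolding \<Phi>_def by (rule distr_gauss_coordinate_pair[where \<iota> = "\<lambda>x. x"]) (auto simp: inj_on_def)
 have m: "\<Phi> \<in> measurable (gmat n (m + k)) ?N"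
  unfolding \<Phi>_def measurable_cong_sets[OF sets_gauss refl]
  by (intro measurable_Pair measurable_restrict measurable_component_singleton) auto
 have s: "sets ?N = sets (gmat n m \<Otimes>\<^sub>M gmat n k)" by (intro sets_pair_measure_cong sets_gauss[symmetric])
 have eq: "\<Phi> -` E \<inter> space (gmat n (m + k)) = {g\<in>space (gmat n (m + k)). \<Phi> g \<in> E}" by auto
 show "{g\<in>space (gmat n (m + k)). \<Phi> g \<in> E} \<in> sets (gmat n (m + k))"
  using measurable_sets[OF m, of E] E s eq by simp
 show "measure (gmat n (m + k)) {g\<in>space (gmat n (m + k)). \<Phi> g \<in> E} = measure (gmat n m \<Otimes>\<^sub>M gmat n k) E"
  unfolding eq[symmetric] by (subst d[symmetric], rule measure_distr[OF m, symmetric]) (use E s in simp)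
qed

text \<open>The left-hand side exhibits the coefficients of the second block as a function of the
  residuals on the first block alone, which is what lets them be frozen in
  \<open>lsq_independent_norm_tail\<close>.\<close>

lemma block2_coef_alt:
 assumes W1: "W1 \<in> carrier_mat n p1" and fr: "fullrank W1" and W2: "W2 \<in> carrier_mat n p2" and v: "v \<in> carrier_vec n"
 shows "lsq (rsd W1 * W2) *\<^sub>v (rsd W1 *\<^sub>v v) = block2_coef W1 W2 *\<^sub>v v"
proof -
 have R: "rsd W1 \<in> carrier_mat n n" by (rule rsd_carrier[OF W1])
 have W2t: "transpose_mat W2 \<in> carrier_mat p2 n" using W2 by simp
 have t: "transpose_mat (rsd W1 * W2) = transpose_mat W2 * rsd W1"
  using transpose_mult[OF R W2] rsd_symmetric[OF W1 fr] by simp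
 have RR: "rsd W1 * (rsd W1 * W2) = rsd W1 * W2"
  using assoc_mult_mat[OF R R W2] rsd_idempotent[OF W1 fr] by simp
 have g: "transpose_mat W2 * rsd W1 * (rsd W1 * W2) = transpose_mat W2 * rsd W1 * W2"
  using assoc_mult_mat[OF W2t R mult_carrier_mat[OF R W2]] assoc_mult_mat[OF W2t R W2] RR by simp
 have A: "minv (transpose_mat W2 * rsd W1 * W2) \<in> carrier_mat p2 p2"
  by (rule minv_carrier[OF mult_carrier_mat[OF mult_carrier_mat[OF W2t R] W2]])
 have "lsq (rsd W1 * W2) = block2_coef W1 W2"
  unfolding lsq_def t g block2_coef_def using assoc_mult_mat[OF A W2t R] by simp
 moreover have "block2_coef W1 W2 *\<^sub>v (rsd W1 *\<^sub>v v) = block2_coef W1 W2 *\<^sub>v v"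
 proof -
  have B: "minv (transpose_mat W2 * rsd W1 * W2) * transpose_mat W2 \<in> carrier_mat p2 n" by (rule mult_carrier_mat[OF A W2t])
  have "block2_coef W1 W2 * rsd W1 = block2_coef W1 W2"
   unfolding block2_coef_def using assoc_mult_mat[OF B R R] rsd_idempotent[OF W1 fr] by simp
  then show ?thesis using assoc_mult_mat_vec[OF mult_carrier_mat[OF B R] R v] unfolding block2_coef_def by simp
 qed
 ultimately show ?thesis by simp
qed

text \<open>\<open>g\<close> stands for the squared norm of the second vector. It cancels, together
  with \<open>f11\<close>, in the difference of the two norms, so that it needs no estimate of its
  own; \<open>c\<close> is free and is chosen later to balance the two terms on the right.\<close>

lemma polarization_bound:
 fixes c :: real
 assumes c: "0 < c"
  and plus: "\<bar>f11 + 2 * c * f12 + c^2 * g - \<phi> * \<nu>p\<bar> \<le> e * \<nu>p" and minus: "\<bar>f11 - 2 * c * f12 + c^2 * g - \<phi> * \<nu>m\<bar> \<le> e * \<nu>m"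
  and \<nu>p: "\<nu>p = t2 + 2 * c * (s2 - l3) + c^2 * (s2 + NN)" and \<nu>m: "\<nu>m = t2 - 2 * c * (s2 - l3) + c^2 * (s2 + NN)"
 shows "\<bar>f12 - \<phi> * (s2 - l3)\<bar> \<le> e * ((t2 / c + c * (s2 + NN)) / 2)"
proof -
 have "4 * c * (f12 - \<phi> * (s2 - l3)) = (f11 + 2 * c * f12 + c^2 * g - \<phi> * \<nu>p) - (f11 - 2 * c * f12 + c^2 * g - \<phi> * \<nu>m)"
  unfolding \<nu>p \<nu>m by (simp add: algebra_simps)
 then have "\<bar>4 * c * (f12 - \<phi> * (s2 - l3))\<bar> \<le> e * \<nu>p + e * \<nu>m" using plus minus by linarith
 also have "... = 4 * c * (e * ((t2 / c + c * (s2 + NN)) / 2))"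
  unfolding \<nu>p \<nu>m using c by (simp add: field_simps power2_eq_square)
 finally have "4 * c * \<bar>f12 - \<phi> * (s2 - l3)\<bar> \<le> 4 * c * (e * ((t2 / c + c * (s2 + NN)) / 2))"
  using c by (simp add: abs_mult)
 then show ?thesis using c by simp
qed

section \<open>Prediction error in the orthonormalized model\<close>

lemma scalar_prod_as_sum: "w \<in> carrier_vec m ==> scalar_prod u w = (\<Sum>i=0..<m. u $ i * w $ i)"
 by (simp add: scalar_prod_def)

text \<open>The event of \<open>regression_tail\<close>, as a predicate on regressors and
  response.\<close>

definition regular_fit :: "nat => nat => (nat => real) => (nat => real) => real => real => real => real mat => real Matrix.vec => bool" where
 "regular_fit n p b b' \<delta> e l W v \<longleftrightarrow> fullrank W \<and>
   \<bar>scalar_prod v (rsd W *\<^sub>v v) - (real n - real p)\<bar> \<le> (real n - real p) * \<delta> \<and>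
   \<bar>scalar_prod (lsq W *\<^sub>v v) (lsq W *\<^sub>v v) - real p / (real n - real p + 1)\<bar> \<le> e \<and>
   (scalar_prod (vec p b) (lsq W *\<^sub>v v))\<^sup>2 \<le> l^2 * (\<Sum>k=0..<p. (b k)^2) \<and>
   (scalar_prod (vec p b') (lsq W *\<^sub>v v))\<^sup>2 \<le> l^2 * (\<Sum>k=0..<p. (b' k)^2)"

definition mix_cols :: "nat => nat => (nat => real) => (nat \<times> nat => real) => real Matrix.vec" where
 "mix_cols n q h g = vec n (\<lambda>i. \<Sum>k=0..<q. h k * g (i, k))"

lemma mix_cols_carrier [simp]: "mix_cols n q h g \<in> carrier_vec n"
 by (simp add: mix_cols_def)

lemma regular_fit_tail:
 fixes b b' h :: "nat => real"
 assumes p: "0 < p" "p < n" and \<delta>: "0 < \<delta>" "\<delta> \<le> 1 / 42" and L: "0 \<le> L" "8 * L \<le> (real n - real p) * \<delta>^2"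
  and e: "2 * real n / (real n - real p + 1) * (\<delta> * 42 / 41) \<le> e"
  and l: "0 \<le> l" "2 * L / ((real n - real p) * (1 - \<delta>)) \<le> l^2"
  and h: "p \<le> q" "(\<Sum>k=0..<q. (h k)^2) = 1" "\<And>k. k < p ==> h k = 0"
 shows "{g\<in>space (gmat n q). \<not> regular_fit n p b b' \<delta> e l (mat n p g) (mix_cols n q h g)} \<in> sets (gmat n q)"
  and "measure (gmat n q) {g\<in>space (gmat n q). \<not> regular_fit n p b b' \<delta> e l (mat n p g) (mix_cols n q h g)} \<le> 14 * exp (- L)"
proof -
 let ?N = "gmat n p \<Otimes>\<^sub>M gvec n"
 let ?\<Phi> = "\<lambda>g. (\<lambda>x\<in>{0..<n} \<times> {0..<p}. g x, \<lambda>i\<in>{0..<n}. \<Sum>k=0..<q. h k * g (i, k)) :: (nat \<times> nat => real) \<times> (nat => real)"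
 define E where "E = {z\<in>space ?N. \<not> regular_fit n p b b' \<delta> e l (mat n p (fst z)) (vec n (snd z))}"
 have E: "E \<in> sets ?N" "measure ?N E \<le> 14 * exp (- L)"
  unfolding E_def regular_fit_def by (rule regression_tail[OF p \<delta> L e l])+
 have [simp]: "mat n p (\<lambda>x\<in>{0..<n} \<times> {0..<p}. g x) = mat n p g" for g :: "nat \<times> nat => real"
  by (intro eq_matI) auto
 have [simp]: "vec n (\<lambda>i\<in>{0..<n}. \<Sum>k=0..<q. h k * g (i, k)) = mix_cols n q h g" for g :: "nat \<times> nat => real"
  unfolding mix_cols_def by (intro eq_vecI) auto
 have "{g\<in>space (gmat n q). ?\<Phi> g \<in> E} = {g\<in>space (gmat n q). \<not> regular_fit n p b b' \<delta> e l (mat n p g) (mix_cols n q h g)}"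
  by (auto simp: E_def space_pair_measure space_gauss)
 then show "{g\<in>space (gmat n q). \<not> regular_fit n p b b' \<delta> e l (mat n p g) (mix_cols n q h g)} \<in> sets (gmat n q)"
  "measure (gmat n q) {g\<in>space (gmat n q). \<not> regular_fit n p b b' \<delta> e l (mat n p g) (mix_cols n q h g)} \<le> 14 * exp (- L)"
  using measure_gmat_columns[OF h(1,2) h(3) E(1)] E(2) by simp_all
qed

text \<open>A mixture of independent standard normal columns with a unit coefficient vector is again
  a standard normal vector.\<close>

lemma mix_cols_chi_square_tail:
 fixes h :: "nat => real" and n q :: nat and d :: real
 assumes h: "(\<Sum>k=0..<q. (h k)^2) = 1" and d: "0 \<le> d" "d \<le> 1"
 defines "A \<equiv> {g\<in>space (gmat n q). real n * d \<le> \<bar>scalar_prod (mix_cols n q h g) (mix_cols n q h g) - real n\<bar>}"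
 shows "A \<in> sets (gmat n q)" "measure (gmat n q) A \<le> 2 * exp (- real n * d^2 / 8)"
proof -
 let ?I = "{0..<n} \<times> {0..<q}" let ?f = "\<lambda>j x. if fst x = j then h (snd x) else 0"
 have S: "(\<Sum>x\<in>?I. ?f j x * y x) = (\<Sum>k=0..<q. h k * y (j, k))" if "j < n" for j and y :: "nat \<times> nat => real"
 proof -
  have "(\<Sum>x\<in>?I. ?f j x * y x) = (\<Sum>i=0..<n. \<Sum>k=0..<q. if i = j then h k * y (i, k) else 0)"
   by (subst sum.cartesian_product) (auto intro!: sum.cong)
  also have "... = (\<Sum>i=0..<n. if i = j then (\<Sum>k=0..<q. h k * y (i, k)) else 0)" by (intro sum.cong) auto
  finally show ?thesis using that by simp
 qed
 define B where "B = {x\<in>space (gvec n). real n * d \<le> \<bar>(\<Sum>i=0..<n. (x i)^2) - real (card {0..<n})\<bar>}"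
 have [measurable]: "(\<lambda>x. x i) \<in> borel_measurable (gvec n)" if "i \<in> {0..<n}" for i
  by (rule measurable_gauss_component[OF that])
 have B: "B \<in> sets (gvec n)" unfolding B_def by measurable
 have 1: "(\<Sum>x\<in>?I. ?f j x * ?f k x) = (if j = k then 1 else 0)" if "j \<in> {0..<n}" "k \<in> {0..<n}" for j k
  using that S[of j "?f k"] h by (cases "j = k") (simp_all add: power2_eq_square)
 have eq: "{x\<in>space (gmat n q). (\<lambda>j\<in>{0..<n}. \<Sum>i\<in>?I. ?f j i * x i) \<in> B} = A"
  unfolding A_def B_def scalar_prod_as_sum[OF mix_cols_carrier] by (auto simp: S space_gauss mix_cols_def power2_eq_square)
 have m: "(\<lambda>x. \<lambda>j\<in>{0..<n}. \<Sum>i\<in>?I. ?f j i * x i) \<in> measurable (gmat n q) (gvec n)"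
  unfolding measurable_cong_sets[OF sets_gauss sets_gauss]
  by (intro measurable_restrict borel_measurable_sum borel_measurable_times borel_measurable_const measurable_component_singleton)
 show "A \<in> sets (gmat n q)" using measurable_sets[OF m B] eq by (simp add: vimage_def Int_def conj_commute)
 have "measure (gmat n q) A = measure (gvec n) B"
  unfolding eq[symmetric] by (rule measure_gauss_linear_map[OF _ _ 1 B]) auto
 also have "... \<le> 2 * exp (- real n * d^2 / 8)"
  unfolding B_def by (rule gauss_chi_square_tail) (use d in auto)
 finally show "measure (gmat n q) A \<le> 2 * exp (- real n * d^2 / 8)" .
qed

text \<open>Under \<open>gmat n (Suc p)\<close> the first \<open>p\<close> columns of
  \<open>g\<close> play the orthonormalized regressors and column \<open>p\<close> the standardized
  error. \<open>w\<close> is the response without the contribution of the first block, with variance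
  \<open>t2\<close> per observation. \<open>f1\<close> and \<open>f2\<close> are the estimation
  errors of the regression on the first block and of the full regression, and \<open>N\<close> is
  the second block of \<open>f2\<close>.\<close>

locale gaussian_regression =
 fixes n p1 p2 :: nat and b :: "nat => real" and \<sigma> :: real
 assumes p1: "0 < p1" and p2: "0 < p2" and pn: "p1 + p2 < n" and \<sigma>: "0 < \<sigma>"
begin

abbreviation "p \<equiv> p1 + p2"
definition "W1 g = mat n p1 (g :: nat \<times> nat => real)"
definition "W2 g = mat n p2 (\<lambda>(i, k). g (i, p1 + k) :: real)"
definition "W g = mat n p (g :: nat \<times> nat => real)"
definition "noise g = \<sigma> \<cdot>\<^sub>v vec n (\<lambda>i. g (i, p))"
definition "Y g = W g *\<^sub>v vec p b + noise g"
definition "w g = W2 g *\<^sub>v vec p2 (\<lambda>k. b (p1 + k)) + noise g"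
definition "f1 g = lsq (W1 g) *\<^sub>v w g"
definition "f2 g = lsq (W g) *\<^sub>v noise g"
definition "B1 = (\<Sum>k=0..<p1. (b k)^2)"
definition "B2 = (\<Sum>k=0..<p2. (b (p1 + k))^2)"
definition "t2 = B2 + \<sigma>^2"
definition "N g = block2_coef (W1 g) (W2 g) *\<^sub>v noise g"
definition "\<phi>1 = real p1 / (real n - real p1 + 1)"
definition "\<phi> = real p / (real n - real p + 1)"

text \<open>In orthonormal coordinates the block estimator is \<open>a2 - a1\<close> times the fit
  on the first block, padded by zeros, plus \<open>1 - a2\<close> times the full fit. The mean
  squared error of prediction is then the noise variance plus a squared Euclidean distance of
  coefficients.\<close>

definition prediction_error :: "real => real => (nat \<times> nat => real) => real" where
 "prediction_error a1 a2 g = \<sigma>^2 + (\<Sum>k=0..<p. (b k - ((if k < p1 then (a2 - a1) * (lsq (W1 g) *\<^sub>v Y g) $ k else 0)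
   + (1 - a2) * (lsq (W g) *\<^sub>v Y g) $ k))^2)"

definition estimated_error :: "real => real => (nat \<times> nat => real) => real" where
 "estimated_error a1 a2 g = ((1 - a2)^2 * \<phi> + 1 - a2\<^sup>2 - (a1 - a2)\<^sup>2 * \<phi>1 + (a2 - a1) * (2 - a1 - a2) * \<phi>1)
   * (scalar_prod (Y g) (rsd (W g) *\<^sub>v Y g) / (real n - real p))
  + a1^2 * ((scalar_prod (Y g) (Y g) - scalar_prod (Y g) (rsd (W1 g) *\<^sub>v Y g)) / real n)
  + (a2^2 - a1\<^sup>2 * (real p1 / real n) + (a2 - a1)^2 * \<phi>1)
   * (scalar_prod (Y g) (rsd (W1 g) *\<^sub>v Y g) / (real n - real p1))"

lemma carriers: "W1 g \<in> carrier_mat n p1" "W2 g \<in> carrier_mat n p2" "W g \<in> carrier_mat n p"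
 "noise g \<in> carrier_vec n" "Y g \<in> carrier_vec n" "w g \<in> carrier_vec n"
 "f1 g \<in> carrier_vec p1" "f2 g \<in> carrier_vec p"
proof -
 show W: "W1 g \<in> carrier_mat n p1" "W2 g \<in> carrier_mat n p2" "W g \<in> carrier_mat n p"
  and \<nu>: "noise g \<in> carrier_vec n" unfolding W1_def W2_def W_def noise_def by simp_all
 show "Y g \<in> carrier_vec n" unfolding Y_def by (rule add_carrier_vec[OF mult_mat_vec_carrier_dim[OF W(3)] \<nu>])
 show "w g \<in> carrier_vec n" unfolding w_def by (rule add_carrier_vec[OF mult_mat_vec_carrier_dim[OF W(2)] \<nu>])
 show "f1 g \<in> carrier_vec p1" unfolding f1_def by (rule mult_mat_vec_carrier_dim[OF lsq_carrier[OF W(1)]])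
 show "f2 g \<in> carrier_vec p" unfolding f2_def by (rule mult_mat_vec_carrier_dim[OF lsq_carrier[OF W(3)]])
qed

lemma W_join: "W g = join_cols (W1 g) (W2 g)"
 unfolding W_def W1_def W2_def by (rule join_cols_mat[symmetric])

lemma Y_alt: "Y g = W1 g *\<^sub>v vec p1 b + w g"
proof -
 have "vec p b = vec p1 b @\<^sub>v vec p2 (\<lambda>k. b (p1 + k))" by (intro eq_vecI) auto
 then have "W g *\<^sub>v vec p b = W1 g *\<^sub>v vec p1 b + W2 g *\<^sub>v vec p2 (\<lambda>k. b (p1 + k))"
  unfolding W_join using join_cols_mult_vec[OF carriers(1,2)] by simp
 then show ?thesis unfolding Y_def w_def
  using assoc_add_vec[OF mult_mat_vec_carrier_dim[OF carriers(1)] mult_mat_vec_carrier_dim[OF carriers(2)] carriers(4)] by simp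
qed

text \<open>The standard deviation is split off so that a unit coefficient vector remains, as the
  tail bounds for \<open>mix_cols\<close> require.\<close>

lemma Y_mix: "Y g = sqrt (B1 + t2) \<cdot>\<^sub>v mix_cols n (Suc p) (\<lambda>k. (if k < p then b k else \<sigma>) / sqrt (B1 + t2)) g"
 and w_mix: "w g = sqrt t2 \<cdot>\<^sub>v mix_cols n (Suc p) (\<lambda>k. (if k < p1 then 0 else if k < p then b k else \<sigma>) / sqrt t2) g"
 and noise_mix: "noise g = \<sigma> \<cdot>\<^sub>v mix_cols n (Suc p) (\<lambda>k. if k < p then 0 else 1) g"
proof -
 have "0 \<le> B1" "0 \<le> B2" unfolding B1_def B2_def by (auto intro!: sum_nonneg)
 moreover have "0 < \<sigma>^2" using \<sigma> by simp
 ultimately have t: "0 < t2" "0 < B1 + t2" unfolding t2_def by linarith+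
 show "Y g = sqrt (B1 + t2) \<cdot>\<^sub>v mix_cols n (Suc p) (\<lambda>k. (if k < p then b k else \<sigma>) / sqrt (B1 + t2)) g"
  unfolding Y_def W_def noise_def mix_cols_def using t
  by (intro eq_vecI) (simp_all add: scalar_prod_def sum_distrib_left sum_divide_distrib[symmetric] mult.commute)
 have s: "(\<Sum>k=0..<Suc p. (if k < p1 then 0 else if k < p then b k else \<sigma>) * x k) = (\<Sum>k=0..<p2. x (p1 + k) * b (p1 + k)) + \<sigma> * x p" for x :: "nat => real"
 proof -
  have "(\<Sum>k=0..<p1 + p2. (if k < p1 then 0 else if k < p then b k else \<sigma>) * x k) = (\<Sum>k\<in>{p1..<p1 + p2}. b k * x k)"
   by (rule sum.mono_neutral_cong_right) auto
  also have "... = (\<Sum>k=0..<p2. x (p1 + k) * b (p1 + k))"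
   using sum.shift_bounds_nat_ivl[of "\<lambda>k. b k * x k" 0 p1 p2] by (simp add: add.commute mult.commute)
  finally show ?thesis by simp
 qed
 have "sqrt t2 * (\<Sum>k=0..<Suc p. (if k < p1 then 0 else if k < p then b k else \<sigma>) / sqrt t2 * x k) = (\<Sum>k=0..<Suc p. (if k < p1 then 0 else if k < p then b k else \<sigma>) * x k)" for x :: "nat => real"
  unfolding sum_distrib_left by (intro sum.cong) (use t in auto)
 then show "w g = sqrt t2 \<cdot>\<^sub>v mix_cols n (Suc p) (\<lambda>k. (if k < p1 then 0 else if k < p then b k else \<sigma>) / sqrt t2) g"
  unfolding w_def W2_def noise_def mix_cols_def s
  by (intro eq_vecI) (simp_all add: scalar_prod_def s del: sum.op_ivl_Suc)
 show "noise g = \<sigma> \<cdot>\<^sub>v mix_cols n (Suc p) (\<lambda>k. if k < p then 0 else 1) g"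
  unfolding noise_def mix_cols_def by (intro eq_vecI) auto
qed

context
 fixes g :: "nat \<times> nat => real"
 assumes fr: "fullrank (W g)"
begin

lemma fr1: "fullrank (W1 g)"
 using fr fullrank_join1[OF carriers(1,2)] unfolding W_join by simp

lemma lsq1_Y: "lsq (W1 g) *\<^sub>v Y g = vec p1 b + f1 g"
 unfolding Y_alt f1_def using lsq_vec_W[OF carriers(1) fr1, of "vec p1 b"]
  mult_add_distrib_mat_vec[OF lsq_carrier[OF carriers(1)] mult_mat_vec_carrier_dim[OF carriers(1)] carriers(6)] by simp

lemma lsq_Y: "lsq (W g) *\<^sub>v Y g = vec p b + f2 g"
 unfolding Y_def f2_def using lsq_vec_W[OF carriers(3) fr, of "vec p b"]
  mult_add_distrib_mat_vec[OF lsq_carrier[OF carriers(3)] mult_mat_vec_carrier_dim[OF carriers(3)] carriers(4)] by simp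

lemma rss1: "scalar_prod (Y g) (rsd (W1 g) *\<^sub>v Y g) = scalar_prod (w g) (rsd (W1 g) *\<^sub>v w g)"
proof -
 have "rsd (W1 g) *\<^sub>v Y g = rsd (W1 g) *\<^sub>v w g"
  unfolding Y_alt using rsd_vec_W[OF carriers(1) fr1, of "vec p1 b"] mult_mat_vec_carrier_dim[OF rsd_carrier[OF carriers(1)]]
   mult_add_distrib_mat_vec[OF rsd_carrier[OF carriers(1)] mult_mat_vec_carrier_dim[OF carriers(1)] carriers(6)] by simp
 then show ?thesis using rsd_norm[OF carriers(1) fr1 carriers(5)[of g]] rsd_norm[OF carriers(1) fr1 carriers(6)[of g]] by metis
qed

lemma rss: "scalar_prod (Y g) (rsd (W g) *\<^sub>v Y g) = scalar_prod (noise g) (rsd (W g) *\<^sub>v noise g)"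
proof -
 have "rsd (W g) *\<^sub>v Y g = rsd (W g) *\<^sub>v noise g"
  unfolding Y_def using rsd_vec_W[OF carriers(3) fr, of "vec p b"] mult_mat_vec_carrier_dim[OF rsd_carrier[OF carriers(3)]]
   mult_add_distrib_mat_vec[OF rsd_carrier[OF carriers(3)] mult_mat_vec_carrier_dim[OF carriers(3)] carriers(4)] by simp
 then show ?thesis using rsd_norm[OF carriers(3) fr carriers(5)[of g]] rsd_norm[OF carriers(3) fr carriers(4)[of g]] by metis
qed

lemma N_carrier: "N g \<in> carrier_vec p2"
 unfolding N_def by (rule mult_mat_vec_carrier_dim[OF block2_coef_carrier[OF carriers(1,2) fr[unfolded W_join]]])

lemma f2_split: "f2 g = (lsq (W1 g) *\<^sub>v (noise g - W2 g *\<^sub>v N g)) @\<^sub>v N g"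
 unfolding f2_def N_def W_join by (rule lsq_join_cols[OF carriers(1,2) fr[unfolded W_join] carriers(4)])

lemma f2_block2: "k < p2 ==> f2 g $ (p1 + k) = N g $ k"
 unfolding f2_split using N_carrier carrier_matD[OF lsq_carrier[OF carriers(1)]] by simp

text \<open>With the fits written as \<open>b\<close> plus estimation error, the difference to be
  squared is \<open>a1 * b - (a2 - a1) * f1 - (1 - a2) * f2\<close> on the first block and
  \<open>a2 * b - (1 - a2) * N\<close> on the second.\<close>

lemma prediction_error_expand:
 "prediction_error a1 a2 g = \<sigma>^2 + a1^2 * B1 + a2^2 * B2 + (a2 - a1)^2 * (\<Sum>k=0..<p1. (f1 g $ k)^2) + (1 - a2)^2 * (\<Sum>k=0..<p. (f2 g $ k)^2)
  + 2 * (a2 - a1) * (1 - a2) * (\<Sum>k=0..<p1. f1 g $ k * f2 g $ k)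
  - 2 * a1 * (a2 - a1) * (\<Sum>k=0..<p1. b k * f1 g $ k) - 2 * (1 - a2) * a1 * (\<Sum>k=0..<p1. b k * f2 g $ k)
  - 2 * (1 - a2) * a2 * (\<Sum>k=0..<p2. b (p1 + k) * N g $ k)"
proof -
 have split: "(\<Sum>k=0..<p. F k) = (\<Sum>k=0..<p1. F k) + (\<Sum>k=0..<p2. F (p1 + k))" for F :: "nat => real"
  using sum.atLeastLessThan_concat[of 0 p1 p F] sum.shift_bounds_nat_ivl[of F 0 p1 p2] by (simp add: add.commute)
 have d: "dim_vec (f1 g) = p1" "dim_vec (f2 g) = p" using carriers(7,8)[of g] by auto
 have 1: "(\<Sum>k=0..<p1. (b k - ((if k < p1 then (a2 - a1) * (lsq (W1 g) *\<^sub>v Y g) $ k else 0) + (1 - a2) * (lsq (W g) *\<^sub>v Y g) $ k))^2)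
   = (\<Sum>k=0..<p1. a1^2 * (b k)^2 + (a2 - a1)^2 * (f1 g $ k)^2 + (1 - a2)^2 * (f2 g $ k)^2 + 2 * (a2 - a1) * (1 - a2) * (f1 g $ k * f2 g $ k)
    - 2 * a1 * (a2 - a1) * (b k * f1 g $ k) - 2 * (1 - a2) * a1 * (b k * f2 g $ k))"
  unfolding lsq1_Y lsq_Y by (intro sum.cong refl) (simp add: d, simp add: power2_eq_square algebra_simps)
 have 2: "(\<Sum>k=0..<p2. (b (p1 + k) - ((if p1 + k < p1 then (a2 - a1) * (lsq (W1 g) *\<^sub>v Y g) $ (p1 + k) else 0) + (1 - a2) * (lsq (W g) *\<^sub>v Y g) $ (p1 + k)))^2)
   = (\<Sum>k=0..<p2. a2^2 * (b (p1 + k))^2 + (1 - a2)^2 * (f2 g $ (p1 + k))^2 - 2 * (1 - a2) * a2 * (b (p1 + k) * N g $ k))"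
  unfolding lsq_Y by (intro sum.cong refl) (simp add: d f2_block2, simp add: power2_eq_square algebra_simps)
 show ?thesis
  unfolding prediction_error_def split 1 2 B1_def B2_def sum.distrib sum_subtractf sum_distrib_left[symmetric]
  by (simp add: algebra_simps)
qed

end

text \<open>The argument \<open>A\<close> is to be \<open>rsd (W1 g) * U g\<close>. Then these are
  the coefficients of \<open>w g + c \<cdot>\<^sub>v (noise g - W2 g *\<^sub>v N g)\<close> with
  respect to the second block and the standardized error, written as a function of the residuals
  alone.\<close>

definition perturbed :: "real => real mat => nat => real" where
 "perturbed c A j = (if j < p2 then b (p1 + j) - c * (\<sigma> * (lsq (mat n p2 (\<lambda>(i, k). A $$ (i, k))) *\<^sub>v vec n (\<lambda>i. A $$ (i, p2))) $ j) else \<sigma> * (1 + c))"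

definition "U g = mat n (Suc p2) (\<lambda>(i, k). g (i, p1 + k) :: real)"

lemma perturbed_eq:
 assumes fr: "fullrank (W g)"
 shows "j < p2 ==> perturbed c (rsd (W1 g) * U g) j = b (p1 + j) - c * N g $ j"
  and "lsq (W1 g) *\<^sub>v (U g *\<^sub>v vec (Suc p2) (perturbed c (rsd (W1 g) * U g))) = f1 g + c \<cdot>\<^sub>v (lsq (W1 g) *\<^sub>v (noise g - W2 g *\<^sub>v N g))"
proof -
 let ?A = "rsd (W1 g) * U g" let ?v = "vec n (\<lambda>i. g (i, p)) :: real Matrix.vec"
 let ?b2 = "vec p2 (\<lambda>k. b (p1 + k))"
 have U: "U g \<in> carrier_mat n (Suc p2)" by (simp add: U_def)
 have R: "rsd (W1 g) \<in> carrier_mat n n" by (rule rsd_carrier[OF carriers(1)])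
 have colU: "k < p2 ==> col (U g) k = col (W2 g) k" "col (U g) p2 = ?v" for k
  by (auto simp: U_def W2_def intro!: eq_vecI)
 note dims = carrier_matD[OF R] carrier_matD[OF U] carrier_matD[OF carriers(2)]
 have A2: "mat n p2 (\<lambda>(i, k). ?A $$ (i, k)) = rsd (W1 g) * W2 g"
  by (intro eq_matI) (simp_all add: dims colU)
 have Av: "vec n (\<lambda>i. ?A $$ (i, p2)) = rsd (W1 g) *\<^sub>v ?v"
  by (intro eq_vecI) (simp_all add: dims colU)
 have B: "block2_coef (W1 g) (W2 g) \<in> carrier_mat p2 n" by (rule block2_coef_carrier[OF carriers(1,2) fr[unfolded W_join]])
 have NN: "N g = \<sigma> \<cdot>\<^sub>v (block2_coef (W1 g) (W2 g) *\<^sub>v ?v)"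
  unfolding N_def noise_def using mult_mat_vec[OF B, of ?v \<sigma>] by simp
 have Nc: "N g \<in> carrier_vec p2" by (rule N_carrier[OF fr])
 show pe: "perturbed c ?A j = b (p1 + j) - c * N g $ j" if "j < p2" for j
  unfolding perturbed_def A2 Av block2_coef_alt[OF carriers(1) fr1[OF fr] carriers(2) vec_carrier] NN using that carrier_matD[OF B] by simp
 have e: "mat n p2 (\<lambda>(i, k). U g $$ (i, k)) = W2 g" by (intro eq_matI) (auto simp: U_def W2_def)
 have vp: "vec p2 (\<lambda>k. vec (Suc p2) (perturbed c ?A) $ k) = ?b2 - c \<cdot>\<^sub>v N g"
  using Nc by (intro eq_vecI) (auto simp: pe)
 have "U g *\<^sub>v vec (Suc p2) (perturbed c ?A) = W2 g *\<^sub>v (?b2 - c \<cdot>\<^sub>v N g) + (\<sigma> * (1 + c)) \<cdot>\<^sub>v ?v"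
  unfolding mult_mat_vec_split_last[OF U vec_carrier] e vp colU by (simp add: perturbed_def)
 also have "W2 g *\<^sub>v (?b2 - c \<cdot>\<^sub>v N g) = W2 g *\<^sub>v ?b2 - c \<cdot>\<^sub>v (W2 g *\<^sub>v N g)"
  using mult_minus_distrib_mat_vec[OF carriers(2)[of g], of ?b2 "c \<cdot>\<^sub>v N g"] mult_mat_vec[OF carriers(2)[of g] Nc, of c] Nc by simp
 also have "(W2 g *\<^sub>v ?b2 - c \<cdot>\<^sub>v (W2 g *\<^sub>v N g)) + (\<sigma> * (1 + c)) \<cdot>\<^sub>v ?v = w g + c \<cdot>\<^sub>v (noise g - W2 g *\<^sub>v N g)"
  unfolding w_def noise_def by (intro eq_vecI) (use dims in \<open>auto simp: algebra_simps\<close>)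
 finally have eq: "U g *\<^sub>v vec (Suc p2) (perturbed c ?A) = w g + c \<cdot>\<^sub>v (noise g - W2 g *\<^sub>v N g)" .
 have c2: "noise g - W2 g *\<^sub>v N g \<in> carrier_vec n" by (rule minus_carrier_vec[OF carriers(4) mult_mat_vec_carrier_dim[OF carriers(2)]])
 show "lsq (W1 g) *\<^sub>v (U g *\<^sub>v vec (Suc p2) (perturbed c ?A)) = f1 g + c \<cdot>\<^sub>v (lsq (W1 g) *\<^sub>v (noise g - W2 g *\<^sub>v N g))"
  unfolding eq f1_def using mult_add_distrib_mat_vec[OF lsq_carrier[OF carriers(1)] carriers(6) iffD2[OF smult_carrier_vec c2]]
   mult_mat_vec[OF lsq_carrier[OF carriers(1)] c2] by simp
qed

lemma sets_notin_interval:
 fixes f h :: "'a => real"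
 assumes [measurable]: "f \<in> borel_measurable M" "h \<in> borel_measurable M"
 shows "{z\<in>space M. f z \<notin> {a * h z..d * h z}} \<in> sets M"
 unfolding atLeastAtMost_iff by measurable

text \<open>The squared norm of \<open>f1\<close> plus \<open>c\<close> times the first block of
  \<open>f2\<close>; \<open>mixed_variance\<close> is the sum of squares of the coefficients in
  \<open>perturbed\<close>. The ratio of the two concentrates at \<open>\<phi>1\<close>.\<close>

definition "mixed_norm c g = (\<Sum>k=0..<p1. (f1 g $ k)^2) + 2 * c * (\<Sum>k=0..<p1. f1 g $ k * f2 g $ k) + c^2 * (\<Sum>k=0..<p1. (f2 g $ k)^2)"
definition "mixed_variance c g = t2 + 2 * c * (\<sigma>^2 - (\<Sum>k=0..<p2. b (p1 + k) * N g $ k)) + c^2 * (\<sigma>^2 + (\<Sum>k=0..<p2. (N g $ k)^2))"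

text \<open>\<open>lsq_independent_norm_tail\<close> applies to the first block and the remaining
  \<open>Suc p2\<close> columns, because the coefficients \<open>perturbed c\<close> depend on the
  residuals only. The sign of \<open>c\<close> is left open: the polarization takes both.\<close>

lemma perturbed_tail:
 assumes \<delta>: "0 < \<delta>" "\<delta> \<le> 1 / 42" and L: "8 * L \<le> (real n - real p) * \<delta>^2"
  and e: "2 * real n / (real n - real p1 + 1) * (\<delta> * 42 / 41) \<le> e"
 obtains E where "E \<in> sets (gmat n (Suc p))" "measure (gmat n (Suc p)) E \<le> 4 * exp (- L)"
  "\<And>g. g \<in> space (gmat n (Suc p)) - E ==> fullrank (W g) ==>
   \<bar>mixed_norm c g - \<phi>1 * mixed_variance c g\<bar> \<le> e * mixed_variance c g"
proof -
 \<comment> \<open>The tail bounds are stated for \<open>Suc p\<close> columns, hence the shift by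
   one; \<open>real n - real p'\<close> is the denominator of \<open>\<phi>1\<close>.\<close>
 define p' where "p' = p1 - 1"
 have p': "Suc p' = p1" and rp: "real n - real p' = real n - real p1 + 1" using p1 by (auto simp: p'_def of_nat_diff)
 let ?G = "gmat n p1 \<Otimes>\<^sub>M gmat n (Suc p2)"
 let ?X = "\<lambda>z. mat n p1 (fst z) :: real mat" let ?V = "\<lambda>z. mat n (Suc p2) (snd z) :: real mat"
 let ?r = "\<lambda>z. perturbed c (rsd (?X z) * ?V z)"
 let ?D = "\<lambda>z. lsq (?X z) *\<^sub>v (?V z *\<^sub>v vec (Suc p2) (?r z))"
 let ?\<nu> = "\<lambda>z. \<Sum>j=0..<Suc p2. (?r z j)^2"
 have mX: "meas_mat ?G n p1 ?X" by (rule meas_mat_compose[OF meas_gmat measurable_fst])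
 have mV: "meas_mat ?G n (Suc p2) ?V" by (rule meas_mat_compose[OF meas_gmat measurable_snd])
 have mA: "meas_mat ?G n (Suc p2) (\<lambda>z. rsd (?X z) * ?V z)" by (rule meas_mat_mult[OF meas_mat_rsd[OF mX] mV])
 have mA2: "meas_mat ?G n p2 (\<lambda>z. mat n p2 (\<lambda>(i, k). (rsd (?X z) * ?V z) $$ (i, k)))"
  by (rule meas_mat_mat) (use meas_mat_entry[OF mA] in simp)
 have mAv: "meas_vec ?G n (\<lambda>z. vec n (\<lambda>i. (rsd (?X z) * ?V z) $$ (i, p2)))"
  by (rule meas_vec_vec) (use meas_mat_entry[OF mA] in simp)
 have mr: "(\<lambda>z. ?r z j) \<in> borel_measurable ?G" for j
 proof (cases "j < p2")
  case True
  from borel_measurable_diff[OF borel_measurable_const borel_measurable_times[OF borel_measurable_const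
   borel_measurable_times[OF borel_measurable_const meas_vec_entry[OF meas_mult_mat_vec[OF meas_mat_lsq[OF mA2] mAv] True]]]]
  show ?thesis unfolding perturbed_def if_P[OF True] .
 qed (simp add: perturbed_def)
 have mD: "meas_vec ?G p1 ?D"
  by (rule meas_mult_mat_vec[OF meas_mat_lsq[OF mX] meas_mult_mat_vec[OF mV meas_vec_vec[OF mr]]])
 have mD2: "(\<lambda>z. scalar_prod (?D z) (?D z)) \<in> borel_measurable ?G" by (rule meas_scalar_prod[OF mD mD])
 have m\<nu>: "?\<nu> \<in> borel_measurable ?G" by (intro borel_measurable_sum borel_measurable_power mr)
 define E where "E = {z\<in>space ?G. \<not> fullrank (?X z) \<or> scalar_prod (?D z) (?D z) \<notin> {(\<phi>1 - e) * ?\<nu> z..(\<phi>1 + e) * ?\<nu> z}}"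
 have E: "E \<in> sets ?G" unfolding E_def by (rule sets_not_fullrank_or[OF mX sets_notin_interval[OF mD2 m\<nu>]])
 have mE: "measure ?G E \<le> 2 * exp (- real n * \<delta>^2 / 8) + 2 * exp (- (real n - real p') * \<delta>^2 / 8)"
  unfolding E_def
 proof (rule lsq_independent_norm_tail[where p = p' and r = "perturbed c" and k = "Suc p2" and lo = "\<phi>1 - e" and hi = "\<phi>1 + e", unfolded p'])
  show "{z\<in>space ?G. \<not> fullrank (?X z) \<or> scalar_prod (?D z) (?D z) \<notin> {(\<phi>1 - e) * ?\<nu> z..(\<phi>1 + e) * ?\<nu> z}} \<in> sets ?G"
   using E unfolding E_def .
  fix x y assume "0 \<le> x" "\<bar>x - real p1\<bar> < real n * \<delta>" "\<bar>y - (real n - real p')\<bar> < (real n - real p') * \<delta>"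
  then have "\<bar>x / y - real p1 / (real n - real p')\<bar> \<le> 2 * real n / (real n - real p') * (\<delta> * 42 / 41)"
   by (intro ratio_deviation) (use pn \<delta> p' in auto)
  also have "... \<le> e" unfolding rp by (rule e)
  finally have "\<bar>x / y - \<phi>1\<bar> \<le> e" unfolding \<phi>1_def rp .
  then show "\<phi>1 - e \<le> x / y \<and> x / y \<le> \<phi>1 + e" by (auto simp: abs_le_iff)
 qed (use pn \<delta> p' in auto)
 have "exp (- a * \<delta>^2 / 8) \<le> exp (- L)" if "real n - real p \<le> a" for a
 proof -
  have "(real n - real p) * \<delta>^2 \<le> a * \<delta>^2" using that by (intro mult_right_mono) auto
  then have "- a * \<delta>^2 / 8 \<le> - L" using L by simp
  then show ?thesis by (simp only: exp_le_cancel_iff)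
 qed
 from this[of "real n"] this[of "real n - real p'"] have mE': "measure ?G E \<le> 4 * exp (- L)"
  using mE p' by linarith
 let ?\<Phi> = "\<lambda>g. (\<lambda>x\<in>{0..<n} \<times> {0..<p1}. g x, \<lambda>x\<in>{0..<n} \<times> {0..<Suc p2}. g (fst x, p1 + snd x)) :: (nat \<times> nat => real) \<times> (nat \<times> nat => real)"
 have X: "?X (?\<Phi> g) = W1 g" and V: "?V (?\<Phi> g) = U g" for g
  by (auto simp: W1_def U_def intro!: eq_matI)
 show thesis
 proof (rule that)
  show "{g\<in>space (gmat n (Suc p)). ?\<Phi> g \<in> E} \<in> sets (gmat n (Suc p))"
   "measure (gmat n (Suc p)) {g\<in>space (gmat n (Suc p)). ?\<Phi> g \<in> E} \<le> 4 * exp (- L)"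
   using measure_gmat_blocks[OF E] mE' by simp_all
  fix g assume g: "g \<in> space (gmat n (Suc p)) - {g\<in>space (gmat n (Suc p)). ?\<Phi> g \<in> E}" and fr: "fullrank (W g)"
  have "?\<Phi> g \<in> space ?G" by (simp add: space_pair_measure space_gauss)
  with g have "scalar_prod (?D (?\<Phi> g)) (?D (?\<Phi> g)) \<in> {(\<phi>1 - e) * ?\<nu> (?\<Phi> g)..(\<phi>1 + e) * ?\<nu> (?\<Phi> g)}"
   unfolding E_def by blast
  then have *: "\<bar>scalar_prod (?D (?\<Phi> g)) (?D (?\<Phi> g)) - \<phi>1 * ?\<nu> (?\<Phi> g)\<bar> \<le> e * ?\<nu> (?\<Phi> g)"
   by (simp add: abs_le_iff algebra_simps)
  define h where "h = lsq (W1 g) *\<^sub>v (noise g - W2 g *\<^sub>v N g)"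
  have hc: "h \<in> carrier_vec p1" unfolding h_def by (rule mult_mat_vec_carrier_dim[OF lsq_carrier[OF carriers(1)]])
  have h: "h $ k = f2 g $ k" if "k < p1" for k
   unfolding f2_split[OF fr] h_def[symmetric] using that carrier_vecD[OF hc] by simp
  have D: "?D (?\<Phi> g) = f1 g + c \<cdot>\<^sub>v h" unfolding X V h_def by (rule perturbed_eq(2)[OF fr])
  have "scalar_prod (?D (?\<Phi> g)) (?D (?\<Phi> g)) = (\<Sum>k=0..<p1. (f1 g $ k + c * f2 g $ k) * (f1 g $ k + c * f2 g $ k))"
   unfolding D by (subst scalar_prod_as_sum[where m = p1]) (use carriers(7)[of g] hc h carrier_vecD[OF carriers(7)[of g]] carrier_vecD[OF hc] in \<open>auto intro!: sum.cong\<close>)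
  also have "... = (\<Sum>k=0..<p1. (f1 g $ k)^2 + 2 * c * (f1 g $ k * f2 g $ k) + c^2 * (f2 g $ k)^2)"
   by (intro sum.cong) (auto simp: power2_eq_square algebra_simps)
  finally have D2: "scalar_prod (?D (?\<Phi> g)) (?D (?\<Phi> g)) = mixed_norm c g"
   by (simp add: mixed_norm_def sum.distrib sum_distrib_left)
  have "?\<nu> (?\<Phi> g) = (\<Sum>j=0..<p2. (b (p1 + j) - c * N g $ j)^2) + (\<sigma> * (1 + c))^2"
   unfolding X V using perturbed_eq(1)[OF fr, of _ c] by (simp add: perturbed_def[of c _ p2])
  also have "... = (\<Sum>j=0..<p2. (b (p1 + j))^2 - 2 * c * (b (p1 + j) * N g $ j) + c^2 * (N g $ j)^2) + (\<sigma> * (1 + c))^2"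
   by (intro arg_cong2[where f = "(+)"] sum.cong) (auto simp: power2_eq_square algebra_simps)
  also have "... = mixed_variance c g"
   unfolding mixed_variance_def t2_def B2_def sum.distrib sum_subtractf sum_distrib_left[symmetric] by (simp add: power2_eq_square algebra_simps)
  finally show "\<bar>mixed_norm c g - \<phi>1 * mixed_variance c g\<bar> \<le> e * mixed_variance c g"
   using * unfolding D2 by simp
 qed
qed

end

context gaussian_regression
begin

text \<open>The 38 exponentials are 2 for the norm of the response, 14 for the regression of
  \<open>w\<close> on the first block, 14 for that of the noise on all regressors, and 4 for each of
  the two perturbed fits that feed the polarization.\<close>

lemma prediction_error_tail:
 fixes q \<eta> :: real
 assumes q: "0 < q" "q \<le> 1" and \<eta>: "0 < \<eta>" "\<eta> < 1"
  and qc: "q \<le> (101/100) * (\<phi>1 / (1 + \<phi>1)) \<or> q * t2 \<le> \<sigma>^2"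
 obtains E where "E \<in> sets (gmat n (Suc p))"
  "measure (gmat n (Suc p)) E \<le> 38 * exp (- (real n * q^2 * (1 - real p / real n) ^ 5 * \<eta>^2 / 14400))"
  "\<And>g a1 a2. g \<in> space (gmat n (Suc p)) - E ==> 0 \<le> a1 ==> a1 \<le> 1 ==> 0 \<le> a2 ==> a2 \<le> 1 ==>
    fullrank (W g) \<and> \<bar>estimated_error a1 a2 g - prediction_error a1 a2 g\<bar> \<le> \<eta> * prediction_error a1 a2 g"
proof -
 let ?G = "gmat n (Suc p)"
 interpret G: prob_space ?G by (rule prob_space_gauss)
 have [simp]: "(real p1 + real p2 = 0) = False" using p1 by simp
 define \<kappa> where "\<kappa> = 1 - real p / real n"
 \<comment> \<open>The divisor meets two requirements. \<open>8 * L\<close> must not exceed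
   \<open>(n - p) * \<delta>^2\<close>, which asks for at least \<open>8 * 42^2 = 14112\<close>. The
   bound on the linear forms, with \<open>1 - \<delta>\<close> replaced by \<open>8 / 9\<close>,
   holds with equality at 14400, both sides being
   \<open>q^2 * \<kappa> ^ 4 * \<eta>^2 / 6400\<close>.\<close>
 define L where "L = real n * q^2 * \<kappa> ^ 5 * \<eta>^2 / 14400"
 define \<delta> where "\<delta> = q * \<kappa>^2 * \<eta> / 42"
 define e where "e = q * \<kappa> * \<eta> / 20"
 define l where "l = q * \<kappa>^2 * \<eta> / 80"
 define c where "c = sqrt (t2 * \<kappa>) / \<sigma>"
 have n0: "0 < real n" and pr: "real p < real n" and p1r: "0 < real p1" "real p1 \<le> real p" using pn p1 by auto
 have k: "real n - real p = real n * \<kappa>" using n0 by (simp add: \<kappa>_def field_simps)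
 have \<kappa>: "0 < \<kappa>" "\<kappa> \<le> 1" using n0 pr by (auto simp: \<kappa>_def)
 have B: "0 \<le> B1" "0 \<le> B2" by (auto simp: B1_def B2_def intro!: sum_nonneg)
 have s2: "0 < \<sigma>^2" using \<sigma> by simp
 have t2: "0 < t2" "t2 = B2 + \<sigma>^2" using B s2 unfolding t2_def by linarith+
 have c: "0 < c" "c^2 = t2 * \<kappa> / \<sigma>^2" using t2 \<kappa> \<sigma> by (auto simp: c_def power_divide)
 have x: "q * \<kappa>^2 * \<eta> \<le> 1" "0 < q * \<kappa>^2 * \<eta>" using q \<kappa> \<eta> by (auto intro!: mult_le_one power_le_one)
 have \<delta>: "0 < \<delta>" "\<delta> \<le> 1 / 42" using x by (auto simp: \<delta>_def)
 have L0: "0 \<le> L" using \<kappa> by (auto simp: L_def)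
 have L8: "8 * L \<le> (real n - real p) * \<delta>^2"
 proof -
  have z: "0 \<le> real n * q^2 * \<kappa> ^ 5 * \<eta>^2" using \<kappa> by simp
  have "(real n - real p) * \<delta>^2 = real n * q^2 * \<kappa> ^ 5 * \<eta>^2 / 1764"
   unfolding k \<delta>_def by (simp add: power2_eq_square eval_nat_numeral)
  moreover have "8 * L \<le> real n * q^2 * \<kappa> ^ 5 * \<eta>^2 / 1764" unfolding L_def
  proof -
   have "8 * (X / 14400) \<le> X / 1764" if "0 \<le> X" for X :: real using that by simp
   from this[OF z] show "8 * (real n * q^2 * \<kappa> ^ 5 * \<eta>^2 / 14400) \<le> real n * q^2 * \<kappa> ^ 5 * \<eta>^2 / 1764" .
  qed
  ultimately show ?thesis by (simp only:)
 qed
 have L81: "8 * L \<le> (real n - real p1) * \<delta>^2"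
  by (rule order_trans[OF L8]) (use p1r in \<open>auto intro!: mult_right_mono\<close>)
 \<comment> \<open>The ratio of two chi-square variables magnifies the relative deviation by about
   \<open>2 / \<kappa>\<close>, so \<open>\<delta>\<close> carries one more factor
   \<open>\<kappa>\<close> than \<open>e\<close>.\<close>
 have e2: "2 * real n / (real n * \<kappa>) * (\<delta> * 42 / 41) \<le> e"
 proof -
  have "2 * real n / (real n * \<kappa>) * (\<delta> * 42 / 41) = q * \<kappa> * \<eta> * (2 / 41)"
   unfolding \<delta>_def using n0 \<kappa> by (simp add: power2_eq_square field_simps)
  also have "... \<le> q * \<kappa> * \<eta> * (1 / 20)" using q \<kappa> \<eta> by (intro mult_left_mono) auto
  finally show ?thesis by (simp add: e_def)
 qed
 have e1: "2 * real n / (real n - real r + 1) * (\<delta> * 42 / 41) \<le> e" if "real r \<le> real p" for r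
 proof -
  have "2 * real n / (real n - real r + 1) \<le> 2 * real n / (real n * \<kappa>)"
   using that pr k n0 \<kappa> by (intro divide_left_mono mult_pos_pos) auto
  then have "2 * real n / (real n - real r + 1) * (\<delta> * 42 / 41) \<le> 2 * real n / (real n * \<kappa>) * (\<delta> * 42 / 41)"
   using \<delta> by (intro mult_right_mono) auto
  with e2 show ?thesis by linarith
 qed
 have l0: "0 \<le> l" using x by (simp add: l_def)
 have l1: "2 * L / ((real n - real r) * (1 - \<delta>)) \<le> l^2" if "real r \<le> real p" for r
 proof -
  have z: "0 \<le> q^2 * \<kappa> ^ 4 * \<eta>^2" using \<kappa> by simp
  have "real n * \<kappa> \<le> real n - real r" "0 \<le> real n - real r" using that k pr by linarith+
  then have kd: "real n * \<kappa> * (8/9) \<le> (real n - real r) * (1 - \<delta>)" using \<delta> by (intro mult_mono) auto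
  have "2 * L / ((real n - real r) * (1 - \<delta>)) \<le> 2 * L / (real n * \<kappa> * (8/9))"
  proof (intro divide_left_mono[OF kd] mult_pos_pos)
   show "0 < real n - real r" using that pr by linarith
  qed (use L0 n0 \<kappa> \<delta> in auto)
  also have "... = q^2 * \<kappa> ^ 4 * \<eta>^2 / 6400"
   unfolding L_def using n0 \<kappa> by (simp add: field_simps eval_nat_numeral)
  also have "... = l^2" unfolding l_def by (simp add: power2_eq_square eval_nat_numeral)
  finally show ?thesis .
 qed
 have st: "0 < B1 + t2" using B t2 by linarith
 have split: "(\<Sum>k=0..<p. F k) = (\<Sum>k=0..<p1. F k) + (\<Sum>k=0..<p2. F (p1 + k))" for F :: "nat => real"
  using sum.atLeastLessThan_concat[of 0 p1 p F] sum.shift_bounds_nat_ivl[of F 0 p1 p2] by (simp add: add.commute)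
 define hY where "hY k = (if k < p then b k else \<sigma>) / sqrt (B1 + t2)" for k
 define hw where "hw k = (if k < p1 then 0 else if k < p then b k else \<sigma>) / sqrt t2" for k
 define hv where "hv k = (if k < p then 0 else 1 :: real)" for k
 have hY: "(\<Sum>k=0..<Suc p. (hY k)^2) = 1"
 proof -
  have "(\<Sum>k=0..<Suc p. (hY k)^2) = (B1 + B2 + \<sigma>^2) / (B1 + t2)"
   unfolding sum.op_ivl_Suc hY_def using st by (simp add: split B1_def B2_def power_divide add_divide_distrib sum_divide_distrib)
  then show ?thesis using st t2(2) by simp
 qed
 have hw: "(\<Sum>k=0..<Suc p. (hw k)^2) = 1"
 proof -
  have "(\<Sum>k=0..<Suc p. (hw k)^2) = (B2 + \<sigma>^2) / t2"
   unfolding sum.op_ivl_Suc hw_def using t2(1) by (simp add: split B2_def power_divide add_divide_distrib sum_divide_distrib)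
  then show ?thesis using t2 by simp
 qed
 have hv: "(\<Sum>k=0..<Suc p. (hv k)^2) = 1" by (simp add: hv_def)
 \<comment> \<open>The zero padding lets the two linear forms of the full regression pick out the
   error on the first block, \<open>?l2\<close> below, and on the second block,
   \<open>?l3\<close>.\<close>
 let ?b1 = "\<lambda>k. if k < p1 then b k else 0" let ?b2 = "\<lambda>k. if k < p1 then 0 else b k"
 define EA where "EA = {g\<in>space ?G. real n * \<delta> \<le> \<bar>scalar_prod (mix_cols n (Suc p) hY g) (mix_cols n (Suc p) hY g) - real n\<bar>}"
 define E1 where "E1 = {g\<in>space ?G. \<not> regular_fit n p1 b b \<delta> e l (mat n p1 g) (mix_cols n (Suc p) hw g)}"
 define E2 where "E2 = {g\<in>space ?G. \<not> regular_fit n p ?b1 ?b2 \<delta> e l (mat n p g) (mix_cols n (Suc p) hv g)}"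
 have nL: "exp (- real n * \<delta>^2 / 8) \<le> exp (- L)"
 proof -
  have "(real n - real p) * \<delta>^2 \<le> real n * \<delta>^2" by (intro mult_right_mono) auto
  then have "- real n * \<delta>^2 / 8 \<le> - L" using L8 by simp
  then show ?thesis by (simp only: exp_le_cancel_iff)
 qed
 have EA1: "EA \<in> sets ?G" unfolding EA_def by (rule mix_cols_chi_square_tail(1)[OF hY]) (use \<delta> in auto)
 have "measure ?G EA \<le> 2 * exp (- real n * \<delta>^2 / 8)"
  unfolding EA_def by (rule mix_cols_chi_square_tail(2)[OF hY]) (use \<delta> in auto)
 with nL EA1 have EA: "EA \<in> sets ?G" "measure ?G EA \<le> 2 * exp (- L)" by linarith+
 have E1: "E1 \<in> sets ?G" "measure ?G E1 \<le> 14 * exp (- L)"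
  unfolding E1_def using p1 pn p1r
  by (intro regular_fit_tail[where L = L] \<delta> L0 L81 e1 l0 l1 hw; simp add: hw_def)+
 have E2: "E2 \<in> sets ?G" "measure ?G E2 \<le> 14 * exp (- L)"
  unfolding E2_def using p1 pn p1r
  by (intro regular_fit_tail[where L = L] \<delta> L0 L8 e1 l0 l1 hv; simp add: hv_def)+
 obtain E3 where E3: "E3 \<in> sets ?G" "measure ?G E3 \<le> 4 * exp (- L)" and H3: "\<And>g. g \<in> space ?G - E3 ==> fullrank (W g) ==>
   \<bar>mixed_norm c g - \<phi>1 * mixed_variance c g\<bar> \<le> e * mixed_variance c g"
  by (rule perturbed_tail[OF \<delta> L8 e1[OF p1r(2)], of c]) (rule that, assumption, assumption, blast)
 obtain E4 where E4: "E4 \<in> sets ?G" "measure ?G E4 \<le> 4 * exp (- L)" and H4: "\<And>g. g \<in> space ?G - E4 ==> fullrank (W g) ==>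
   \<bar>mixed_norm (- c) g - \<phi>1 * mixed_variance (- c) g\<bar> \<le> e * mixed_variance (- c) g"
  by (rule perturbed_tail[OF \<delta> L8 e1[OF p1r(2)], of "- c"]) (rule that, assumption, assumption, blast)
 let ?E = "EA \<union> E1 \<union> E2 \<union> E3 \<union> E4"
 show thesis
 proof (rule that)
  show "?E \<in> sets ?G" using EA E1 E2 E3 E4 by auto
  have "measure ?G ?E \<le> measure ?G (EA \<union> E1 \<union> E2 \<union> E3) + measure ?G E4" by (rule measure_Un_le) (use EA E1 E2 E3 E4 in auto)
  also have "measure ?G (EA \<union> E1 \<union> E2 \<union> E3) \<le> measure ?G (EA \<union> E1 \<union> E2) + measure ?G E3" by (rule measure_Un_le) (use EA E1 E2 E3 E4 in auto)
  also have "measure ?G (EA \<union> E1 \<union> E2) \<le> measure ?G (EA \<union> E1) + measure ?G E2" by (rule measure_Un_le) (use EA E1 E2 E3 E4 in auto)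
  also have "measure ?G (EA \<union> E1) \<le> measure ?G EA + measure ?G E1" by (rule measure_Un_le) (use EA E1 E2 E3 E4 in auto)
  finally have "measure ?G ?E \<le> 38 * exp (- L)" using EA(2) E1(2) E2(2) E3(2) E4(2) by linarith
  then show "measure ?G ?E \<le> 38 * exp (- (real n * q^2 * (1 - real p / real n) ^ 5 * \<eta>^2 / 14400))"
   unfolding L_def \<kappa>_def .
 next
  fix g and a1 a2 :: real assume g: "g \<in> space ?G - ?E" and a: "0 \<le> a1" "a1 \<le> 1" "0 \<le> a2" "a2 \<le> 1"
  let ?v = "mix_cols n (Suc p) hv g" let ?w = "mix_cols n (Suc p) hw g" let ?y = "mix_cols n (Suc p) hY g"
  have v: "noise g = \<sigma> \<cdot>\<^sub>v ?v" using noise_mix[of g] unfolding hv_def .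
  have w: "w g = sqrt t2 \<cdot>\<^sub>v ?w" using w_mix[of g] unfolding hw_def .
  have y: "Y g = sqrt (B1 + t2) \<cdot>\<^sub>v ?y" using Y_mix[of g] unfolding hY_def .
  have rf1: "regular_fit n p1 b b \<delta> e l (W1 g) ?w" using g unfolding E1_def W1_def by blast
  have rf2: "regular_fit n p ?b1 ?b2 \<delta> e l (W g) ?v" using g unfolding E2_def W_def by blast
  have fr: "fullrank (W g)" using rf2 by (simp add: regular_fit_def)
  have cY: "\<bar>scalar_prod ?y ?y - real n\<bar> \<le> real n * \<delta>" using g unfolding EA_def by auto
  have lW: "lsq (W g) \<in> carrier_mat p n" "lsq (W1 g) \<in> carrier_mat p1 n" by (rule lsq_carrier[OF carriers(3)], rule lsq_carrier[OF carriers(1)])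
  have f1: "f1 g = sqrt t2 \<cdot>\<^sub>v (lsq (W1 g) *\<^sub>v ?w)" unfolding f1_def w by (rule mult_mat_vec[OF lW(2) mix_cols_carrier])
  have f2: "f2 g = \<sigma> \<cdot>\<^sub>v (lsq (W g) *\<^sub>v ?v)" unfolding f2_def v by (rule mult_mat_vec[OF lW(1) mix_cols_carrier])
  have sc: "scalar_prod (t \<cdot>\<^sub>v x) (A *\<^sub>v (t \<cdot>\<^sub>v x)) = t^2 * scalar_prod x (A *\<^sub>v x)"
   if "A \<in> carrier_mat n n" "x \<in> carrier_vec n" for A t and x :: "real Matrix.vec"
   using that by (simp add: mult_mat_vec[OF that] power2_eq_square carrier_matD[OF that(1)] mult_mat_vec_carrier_dim[OF that(1)])
  have R: "rsd (W g) \<in> carrier_mat n n" "rsd (W1 g) \<in> carrier_mat n n" by (rule rsd_carrier[OF carriers(3)], rule rsd_carrier[OF carriers(1)])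
  have r0: "0 < real n - real p" "0 < real n - real p1" using pr p1r by linarith+
  let ?f11 = "\<Sum>k=0..<p1. (f1 g $ k)^2" let ?f22 = "\<Sum>k=0..<p. (f2 g $ k)^2" let ?f12 = "\<Sum>k=0..<p1. f1 g $ k * f2 g $ k"
  let ?NN = "\<Sum>k=0..<p2. (N g $ k)^2"
  let ?l1 = "\<Sum>k=0..<p1. b k * f1 g $ k" let ?l2 = "\<Sum>k=0..<p1. b k * f2 g $ k" let ?l3 = "\<Sum>k=0..<p2. b (p1 + k) * N g $ k"
  let ?Tn = "scalar_prod (Y g) (Y g) / real n" let ?T3 = "scalar_prod (Y g) (rsd (W1 g) *\<^sub>v Y g) / (real n - real p1)"
  let ?S = "scalar_prod (Y g) (rsd (W g) *\<^sub>v Y g) / (real n - real p)"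
  have close: "\<bar>t * z / m - t\<bar> \<le> t * d" if "\<bar>z - m\<bar> \<le> m * d" "0 < m" "0 \<le> t" for t z m d :: real
  proof -
   have "t * z / m - t = t / m * (z - m)" using that by (simp add: field_simps)
   then have "\<bar>t * z / m - t\<bar> = t / m * \<bar>z - m\<bar>" using that by (simp add: abs_mult)
   also have "... \<le> t / m * (m * d)" by (rule mult_left_mono) (use that in auto)
   finally show ?thesis using that by simp
  qed
  have A: "\<bar>?Tn - (B1 + t2)\<bar> \<le> (B1 + t2) * \<delta>"
  proof -
   have "scalar_prod (Y g) (Y g) = (B1 + t2) * scalar_prod ?y ?y"
    using sc[OF one_carrier_mat mix_cols_carrier, of "sqrt (B1 + t2)"] st by (simp add: y)
   then show ?thesis using close[OF cY n0, of "B1 + t2"] st by simp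
  qed
  have T3: "\<bar>?T3 - t2\<bar> \<le> t2 * \<delta>"
   using close[OF _ r0(2), of "scalar_prod ?w (rsd (W1 g) *\<^sub>v ?w)" \<delta> t2] rf1 t2(1)
   unfolding rss1[OF fr] w sc[OF R(2) mix_cols_carrier] regular_fit_def by simp
  have S: "\<bar>?S - \<sigma>\<^sup>2\<bar> \<le> \<sigma>^2 * \<delta>"
   using close[OF _ r0(1), of "scalar_prod ?v (rsd (W g) *\<^sub>v ?v)" \<delta> "\<sigma>^2"] rf2
   unfolding rss[OF fr] v sc[OF R(1) mix_cols_carrier] regular_fit_def by simp
  have norm: "(\<Sum>k=0..<m. ((t \<cdot>\<^sub>v u) $ k)^2) = t^2 * scalar_prod u u"
   and lin: "(\<Sum>k=0..<m. d k * (t \<cdot>\<^sub>v u) $ k) = t * scalar_prod (vec m d) u" if "u \<in> carrier_vec m" for u :: "real Matrix.vec" and m t d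
   unfolding scalar_prod_as_sum[OF that] sum_distrib_left using that by (auto intro!: sum.cong simp: power2_eq_square)
  have lc: "lsq (W1 g) *\<^sub>v ?w \<in> carrier_vec p1" "lsq (W g) *\<^sub>v ?v \<in> carrier_vec p" by (rule mult_mat_vec_carrier_dim[OF lW(2)], rule mult_mat_vec_carrier_dim[OF lW(1)])
  have scaled: "\<bar>t * z - t * m\<bar> \<le> t * d" if "\<bar>z - m\<bar> \<le> d" "0 \<le> t" for t z m d :: real
   using mult_left_mono[OF that] that(2) by (simp add: abs_mult right_diff_distrib[symmetric])
  have F1: "\<bar>?f11 - t2 * \<phi>1\<bar> \<le> t2 * e"
   unfolding f1 norm[OF lc(1)] \<phi>1_def real_sqrt_pow2[OF less_imp_le[OF t2(1)]]
   by (rule scaled[OF _ less_imp_le[OF t2(1)]]) (use rf1 in \<open>unfold regular_fit_def, blast\<close>)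
  have F2: "\<bar>?f22 - \<sigma>\<^sup>2 * \<phi>\<bar> \<le> \<sigma>^2 * e"
   unfolding f2 norm[OF lc(2)] \<phi>_def
   by (rule scaled) (use rf2 in \<open>unfold regular_fit_def, blast\<close>, simp)
  have NN: "0 \<le> ?NN" "?NN \<le> ?f22" unfolding split using f2_block2[OF fr] by (auto intro!: sum_nonneg)
  have L1: "?l1^2 \<le> l^2 * (B1 * t2)"
   unfolding f1 lin[OF lc(1)] B1_def using rf1 t2(1) mult_left_mono[of _ "l^2 * (\<Sum>k=0..<p1. (b k)^2)" t2]
   by (simp add: regular_fit_def power_mult_distrib mult_ac)
  have l2: "?l2 = \<sigma> * scalar_prod (vec p ?b1) (lsq (W g) *\<^sub>v ?v)"
   unfolding lin[OF lc(2), symmetric] f2[symmetric] split by simp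
  have l3: "?l3 = \<sigma> * scalar_prod (vec p ?b2) (lsq (W g) *\<^sub>v ?v)"
   unfolding lin[OF lc(2), symmetric] f2[symmetric] split using f2_block2[OF fr] by simp
  have bb: "(\<Sum>k=0..<p. (?b1 k)^2) = B1" "(\<Sum>k=0..<p. (?b2 k)^2) = B2" unfolding split B1_def B2_def by simp_all
  have L2: "?l2^2 \<le> l^2 * (B1 * \<sigma>^2)" and L3: "?l3^2 \<le> l^2 * (B2 * \<sigma>^2)"
   unfolding l2 l3 power_mult_distrib using rf2[unfolded regular_fit_def bb] s2
    mult_left_mono[of "(scalar_prod (vec p ?b1) (lsq (W g) *\<^sub>v ?v))^2" "l^2 * B1" "\<sigma>^2"]
    mult_left_mono[of "(scalar_prod (vec p ?b2) (lsq (W g) *\<^sub>v ?v))^2" "l^2 * B2" "\<sigma>^2"] by (simp_all add: mult_ac)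
  have F12: "\<bar>?f12 - \<phi>1 * (\<sigma>^2 - ?l3)\<bar> \<le> e * ((t2 / c + c * (\<sigma>^2 + ?NN)) / 2)"
   by (rule polarization_bound[OF c(1) _ _ refl refl]) (use H3[OF _ fr] H4[OF _ fr] g in \<open>auto simp: mixed_norm_def mixed_variance_def\<close>)
  have \<phi>p: "0 < \<phi>1" "\<phi>1 \<le> \<phi>" "1 + \<phi> \<le> 1 / \<kappa>"
  proof -
   show "0 < \<phi>1" using p1r r0 by (simp add: \<phi>1_def)
   show "\<phi>1 \<le> \<phi>" unfolding \<phi>1_def \<phi>_def using p1r r0 by (intro frac_le) auto
   have "1 + \<phi> = (real n + 1) / (real n - real p + 1)" using r0 unfolding \<phi>_def by (simp add: field_simps)
   also have "... \<le> real n / (real n - real p)" using r0 n0 by (simp add: divide_le_eq le_divide_eq) (simp add: field_simps)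
   also have "... = 1 / \<kappa>" using k n0 by simp
   finally show "1 + \<phi> \<le> 1 / \<kappa>" .
  qed
  have Th: "(scalar_prod (Y g) (Y g) - scalar_prod (Y g) (rsd (W1 g) *\<^sub>v Y g)) / real n = ?Tn - (1 - real p1 / real n) * ?T3"
   using n0 r0 by (simp add: field_simps)
  have "\<bar>estimated_error a1 a2 g - prediction_error a1 a2 g\<bar> \<le> \<eta> * prediction_error a1 a2 g"
   by (rule estimated_error_close[OF a B s2 t2(2) \<kappa> q \<eta> \<phi>p qc \<delta>_def e_def l_def A T3 S F1 F2 NN c F12 L1 L2 L3
    prediction_error_expand[OF fr] estimated_error_def[of a1 a2 g, unfolded Th]])
  then show "fullrank (W g) \<and> \<bar>estimated_error a1 a2 g - prediction_error a1 a2 g\<bar> \<le> \<eta> * prediction_error a1 a2 g"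
   using fr by simp
 qed
qed

end

section \<open>Gaussian data-generating processes\<close>

definition square_integrable :: "'a measure => ('a => real) => bool" where
 "square_integrable M f \<longleftrightarrow> f \<in> borel_measurable M \<and> integrable M (\<lambda>q. (f q)^2)"

lemma square_integrable_mult:
 assumes "square_integrable M f" "square_integrable M g"
 shows "integrable M (\<lambda>q. f q * g q)"
proof (rule Bochner_Integration.integrable_bound)
 show "integrable M (\<lambda>q. (f q)^2 + (g q)^2)" using assms by (auto simp: square_integrable_def)
 show "(\<lambda>q. f q * g q) \<in> borel_measurable M" using assms by (auto simp: square_integrable_def)
 have "\<bar>a * b\<bar> \<le> a^2 + b^2" for a b :: real
 proof -
  have "0 \<le> (\<bar>a\<bar> - \<bar>b\<bar>)^2" by simp
  then have "2 * \<bar>a * b\<bar> \<le> a^2 + b^2" by (simp add: power2_diff abs_mult)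
  moreover have "0 \<le> \<bar>a * b\<bar>" by simp
  ultimately show ?thesis by linarith
 qed
 then show "AE q in M. norm (f q * g q) \<le> norm ((f q)^2 + (g q)^2)" by simp
qed

lemma square_integrable_cmult: "square_integrable M f ==> square_integrable M (\<lambda>q. c * f q)"
 by (auto simp: square_integrable_def power_mult_distrib)

lemma square_integrable_add:
 assumes "square_integrable M f" "square_integrable M g"
 shows "square_integrable M (\<lambda>q. f q + g q)"
proof -
 have "integrable M (\<lambda>q. (f q)^2 + (g q)^2 + 2 * (f q * g q))"
  using assms square_integrable_mult[OF assms] by (auto simp: square_integrable_def)
 then show ?thesis using assms by (auto simp: square_integrable_def power2_sum mult.assoc)
qed

lemma square_integrable_diff:
 assumes "square_integrable M f" "square_integrable M g"
 shows "square_integrable M (\<lambda>q. f q - g q)"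
 using square_integrable_add[OF assms(1) square_integrable_cmult[OF assms(2), of "- 1"]] by simp

lemma square_integrable_sum:
 assumes "\<And>i. i \<in> I ==> square_integrable M (F i)"
 shows "square_integrable M (\<lambda>q. \<Sum>i\<in>I. c i * F i q)"
 using assms
proof (induction I rule: infinite_finite_induct)
 case (insert i I)
 have "square_integrable M (\<lambda>q. c i * F i q + (\<Sum>j\<in>I. c j * F j q))"
  by (rule square_integrable_add[OF square_integrable_cmult]) (use insert in auto)
 then show ?case using insert by simp
qed (auto simp: square_integrable_def)

lemma integral_sum_mult:
 assumes "\<And>i. i \<in> I ==> square_integrable M (F i)" "square_integrable M g"
 shows "(\<integral>q. (\<Sum>i\<in>I. c i * F i q) * g q \<partial>M) = (\<Sum>i\<in>I. c i * (\<integral>q. F i q * g q \<partial>M))"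
proof -
 have "(\<integral>q. (\<Sum>i\<in>I. c i * F i q) * g q \<partial>M) = (\<integral>q. (\<Sum>i\<in>I. c i * (F i q * g q)) \<partial>M)"
  by (simp add: sum_distrib_right mult.assoc)
 also have "... = (\<Sum>i\<in>I. \<integral>q. c i * (F i q * g q) \<partial>M)"
  by (rule Bochner_Integration.integral_sum) (use square_integrable_mult[OF assms(1) assms(2)] in auto)
 finally show ?thesis by simp
qed

lemma integral_mult_sum:
 assumes "\<And>i. i \<in> I ==> square_integrable M (F i)" "square_integrable M g"
 shows "(\<integral>q. g q * (\<Sum>i\<in>I. c i * F i q) \<partial>M) = (\<Sum>i\<in>I. c i * (\<integral>q. g q * F i q \<partial>M))"
 using integral_sum_mult[of I M F g c, OF assms] by (simp add: mult.commute)

lemma integral_diff_mult: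
 assumes "square_integrable M f" "square_integrable M h" "square_integrable M g"
 shows "(\<integral>q. (f q - h q) * g q \<partial>M) = (\<integral>q. f q * g q \<partial>M) - (\<integral>q. h q * g q \<partial>M)"
 unfolding left_diff_distrib
 by (rule Bochner_Integration.integral_diff[OF square_integrable_mult[OF assms(1,3)] square_integrable_mult[OF assms(2,3)]])

lemma integral_add_cmult:
 fixes f g :: "'a => real"
 assumes "integrable M f" "integrable M g"
 shows "(\<integral>q. f q + c * g q \<partial>M) = (\<integral>q. f q \<partial>M) + c * (\<integral>q. g q \<partial>M)"
 using Bochner_Integration.integral_add[OF assms(1) integrable_mult_right[OF assms(2), of c]] by simp

lemma square_integrable_imp_integrable:
 assumes "prob_space M" "square_integrable M f"
 shows "integrable M f"
proof -
 interpret prob_space M by fact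
 show ?thesis using square_integrable_mult[OF assms(2), of "\<lambda>_. 1"] by (simp add: square_integrable_def)
qed

text \<open>The coefficients form an upper triangular matrix: the first variables are built from the
  first regressors only, so that orthonormalization respects the first block. Positive definiteness
  excludes a vanishing residual.\<close>

lemma gram_schmidt_coefficients:
 fixes X :: "nat => 'a => real"
 assumes X: "\<And>k. k < p ==> square_integrable M (X k)"
  and pd: "\<And>c k. k < p ==> c k \<noteq> 0 ==> 0 < (\<integral>q. (\<Sum>i=0..<p. c i * X i q) * (\<Sum>i=0..<p. c i * X i q) \<partial>M)"
  and m: "m \<le> p"
 shows "\<exists>R. (\<forall>k<m. 0 < R k k \<and> (\<forall>i>k. R i k = 0)) \<and>
  (\<forall>k<m. \<forall>l<m. (\<integral>q. (\<Sum>i=0..<p. R i k * X i q) * (\<Sum>i=0..<p. R i l * X i q) \<partial>M) = (if k = l then 1 else 0 :: real))"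
 using m
proof (induction m)
 case (Suc m)
 from Suc.IH[OF Suc_leD[OF Suc.prems]] obtain R where tri: "\<And>k. k < m ==> 0 < R k k" "\<And>i k. k < m ==> k < i ==> R i k = 0"
  and orth: "\<And>k l. k < m ==> l < m ==> (\<integral>q. (\<Sum>i=0..<p. R i k * X i q) * (\<Sum>i=0..<p. R i l * X i q) \<partial>M) = (if k = l then 1 else 0 :: real)"
  by blast
 have mp: "m < p" using Suc by simp
 define W where "W k q = (\<Sum>i=0..<p. R i k * X i q)" for k q
 have W: "square_integrable M (W k)" for k unfolding W_def by (rule square_integrable_sum) (use X in auto)
 have WW: "(\<integral>q. W k q * W l q \<partial>M) = (if k = l then 1 else 0)" if "k < m" "l < m" for k l
  using orth[OF that] unfolding W_def .
 define a where "a l = (\<integral>q. X m q * W l q \<partial>M)" for l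
 \<comment> \<open>Coefficients of the residual of \<open>X m\<close> on the variables found so far.
   Triangularity gives \<open>d m = 1\<close>, to which \<open>pd\<close> applies.\<close>
 define d where "d i = (if i = m then 1 else 0) - (\<Sum>l=0..<m. a l * R i l)" for i
 define r where "r q = (\<Sum>i=0..<p. d i * X i q)" for q
 have r: "square_integrable M r" unfolding r_def by (rule square_integrable_sum) (use X in auto)
 have r_alt: "r q = X m q - (\<Sum>l=0..<m. a l * W l q)" for q
 proof -
  have "(\<Sum>i=0..<p. (\<Sum>l=0..<m. a l * R i l) * X i q) = (\<Sum>l=0..<m. a l * W l q)"
   unfolding W_def sum_distrib_left sum_distrib_right by (subst sum.swap) (simp add: mult.assoc)
  moreover have "(\<Sum>i=0..<p. (if i = m then 1 else 0) * X i q) = X m q"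
   using mp by (simp add: if_distrib[of "\<lambda>t. t * _"] cong: if_cong)
  ultimately show ?thesis unfolding r_def d_def left_diff_distrib sum_subtractf by simp
 qed
 have dm: "d m = 1" using tri(2) by (simp add: d_def)
 define t where "t = (\<integral>q. r q * r q \<partial>M)"
 have t: "0 < t" unfolding t_def r_def by (rule pd[of m]) (use mp dm in auto)
 have rW: "(\<integral>q. r q * W l q \<partial>M) = 0" if "l < m" for l
 proof -
  have "(\<integral>q. r q * W l q \<partial>M) = a l - (\<integral>q. (\<Sum>l=0..<m. a l * W l q) * W l q \<partial>M)"
   unfolding r_alt a_def[of l] by (rule integral_diff_mult[OF X[OF mp] square_integrable_sum W]) (rule W)
  also have "(\<integral>q. (\<Sum>l=0..<m. a l * W l q) * W l q \<partial>M) = (\<Sum>k=0..<m. a k * (\<integral>q. W k q * W l q \<partial>M))"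
   by (rule integral_sum_mult) (rule W)+
  also have "... = (\<Sum>k=0..<m. if k = l then a k else 0)" by (rule sum.cong) (use that WW in auto)
  also have "... = a l" using that by simp
  finally show ?thesis by simp
 qed
 define R' where "R' i k = (if k = m then d i / sqrt t else R i k)" for i k
 have W': "(\<Sum>i=0..<p. R' i k * X i q) = (if k = m then r q / sqrt t else W k q)" for k q
  by (simp add: R'_def r_def W_def sum_divide_distrib)
 show ?case
 proof (intro exI[of _ R'] conjI allI impI)
  fix k assume k: "k < Suc m"
  show "0 < R' k k" using k t dm tri(1)[of k] by (auto simp: R'_def)
  fix i assume i: "k < i"
  show "R' i k = 0"
  proof (cases "k = m")
   case True
   then have "d i = 0" using i tri(2) by (simp add: d_def)
   then show ?thesis using True by (simp add: R'_def)
  qed (use i k tri(2)[of k i] in \<open>auto simp: R'_def\<close>)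
 next
  fix k l assume kl: "k < Suc m" "l < Suc m"
  have rr: "(\<integral>q. r q / sqrt t * (r q / sqrt t) \<partial>M) = 1"
  proof -
   have "(\<integral>q. r q / sqrt t * (r q / sqrt t) \<partial>M) = (\<integral>q. r q * r q / t \<partial>M)" using t by simp
   then show ?thesis using t by (simp add: t_def)
  qed
  have rl: "(\<integral>q. r q / sqrt t * W l q \<partial>M) = 0" "(\<integral>q. W l q * (r q / sqrt t) \<partial>M) = 0" if "l < m" for l
   using rW[OF that] by (simp_all add: mult.commute[of "W l _"])
  show "(\<integral>q. (\<Sum>i=0..<p. R' i k * X i q) * (\<Sum>i=0..<p. R' i l * X i q) \<partial>M) = (if k = l then 1 else 0)"
   unfolding W' using kl rr rl WW[of k l] by (cases "k = m"; cases "l = m") auto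
 qed
qed simp

text \<open>A centered point mass sits at 0, so the formula covers the degenerate case with variance
  0.\<close>

lemma (in prob_space) char_normal_rv:
 assumes n: "normal_rv M f" and f: "square_integrable M f" and E: "expectation f = 0"
 shows "(\<integral>q. iexp (f q) \<partial>M) = exp (- (\<integral>q. (f q)^2 \<partial>M) / 2)"
 using n unfolding normal_rv_def
proof (elim disjE exE conjE)
 fix \<mu> s assume s: "0 < s" and d: "distributed M lborel f (normal_density \<mu> s)"
 have \<mu>: "\<mu> = 0" using normal_distributed_expectation[OF s d] E by simp
 have v: "(\<integral>q. (f q)^2 \<partial>M) = s^2" using normal_distributed_variance[OF s d] E by simp
 have "distributed M lborel (\<lambda>q. f q / s) std_normal_density"
  using normal_standard_normal_convert[OF s, of f \<mu>] d \<mu> by simp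
 then have D: "distr M lborel (\<lambda>q. f q / s) = std_normal_distribution" and m: "(\<lambda>q. f q / s) \<in> measurable M lborel"
  by (auto simp: distributed_def)
 have "(\<integral>q. iexp (f q) \<partial>M) = (\<integral>q. iexp (s * (f q / s)) \<partial>M)" using s by simp
 also have "... = (\<integral>z. iexp (s * z) \<partial>std_normal_distribution)"
  unfolding D[symmetric] by (rule integral_distr[OF m, symmetric]) measurable
 also have "... = exp (- s\<^sup>2 / 2)" using fun_cong[OF char_std_normal_distribution, of s] by (simp add: char_def)
 finally show ?thesis using v by simp
next
 fix \<mu> assume m: "f \<in> borel_measurable M" and ae: "AE q in M. f q = \<mu>"
 have "expectation f = (\<integral>q. \<mu> \<partial>M)" by (rule integral_cong_AE) (use m ae in auto)
 then have \<mu>: "\<mu> = 0" using E by (simp add: prob_space)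
 have "(\<integral>q. (f q)^2 \<partial>M) = (\<integral>q. 0 \<partial>M)" by (rule integral_cong_AE) (use m ae \<mu> in auto)
 moreover have "(\<integral>q. iexp (f q) \<partial>M) = (\<integral>q. 1 \<partial>M)" by (rule integral_cong_AE) (use m ae \<mu> in auto)
 ultimately show ?thesis by (simp add: prob_space)
qed

text \<open>For \<open>k\<close> below the number of regressors this is the \<open>k\<close>-th
  orthonormalized regressor of the observation; from that number on it is the regression error
  divided by its standard deviation.\<close>

definition standardized :: "(nat => nat => real) => (nat => real) => real => nat list => nat => obs => real" where
 "standardized R b s xs k z = (if k < length xs then \<Sum>i=0..<length xs. R i k * snd z (xs ! i)
   else (fst z - (\<Sum>k=0..<length xs. b k * (\<Sum>i=0..<length xs. R i k * snd z (xs ! i)))) / s)"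

context
 fixes P :: "'a measure" and y u :: "'a => real" and x :: "nat => 'a => real" and \<beta> :: "nat => real" and \<sigma>2 :: real
 assumes dgp: "data_generating_process P y x u \<beta> \<sigma>2"
begin

interpretation P: prob_space P using dgp by (simp add: data_generating_process_def)

lemma process_square_integrable: "square_integrable P y" "square_integrable P u" "square_integrable P (x i)"
 using dgp by (auto simp: data_generating_process_def square_integrable_def)

lemma process_moments: "P.expectation u = 0" "P.expectation (x i) = 0" "(\<integral>q. u q * u q \<partial>P) = \<sigma>2" "0 < \<sigma>2"
 using dgp by (auto simp: data_generating_process_def power2_eq_square)

text \<open>Independence of \<open>u\<close> from the whole sequence of regressors passes to the
  smaller sigma-algebra of a single regressor.\<close>

lemma noise_uncorrelated: "(\<integral>q. u q * x i q \<partial>P) = 0"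
proof -
 have m: "u \<in> borel_measurable P" "\<And>i. x i \<in> borel_measurable P"
  using process_square_integrable by (auto simp: square_integrable_def)
 have ind: "P.indep_set (sets (vimage_algebra (space P) u borel)) (sets (vimage_algebra (space P) (\<lambda>q i. x i q) (\<Pi>\<^sub>M i\<in>UNIV. borel)))"
  using dgp by (simp add: data_generating_process_def)
 have "P.indep_set (sigma_sets (space P) {u -` A \<inter> space P |A. A \<in> sets borel}) (sigma_sets (space P) {x i -` A \<inter> space P |A. A \<in> sets borel})"
  unfolding P.indep_set_def
 proof (rule P.indep_sets_mono_sets[OF ind[unfolded P.indep_set_def]])
  fix b :: bool
  have "{x i -` A \<inter> space P |A. A \<in> sets borel} \<subseteq> sets (vimage_algebra (space P) (\<lambda>q i. x i q) (\<Pi>\<^sub>M i\<in>UNIV. (borel :: real measure)))"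
  proof safe
   fix A :: "real set" assume A: "A \<in> sets borel"
   have "(\<lambda>f. f i) -` A \<inter> space (\<Pi>\<^sub>M i\<in>UNIV. borel) \<in> sets (\<Pi>\<^sub>M i\<in>UNIV. (borel :: real measure))"
    by (rule measurable_sets[OF _ A], rule measurable_component_singleton) simp
   then show "x i -` A \<inter> space P \<in> sets (vimage_algebra (space P) (\<lambda>q i. x i q) (\<Pi>\<^sub>M i\<in>UNIV. (borel :: real measure)))"
    by (intro sets_vimage_algebra2[THEN equalityD2, THEN subsetD] CollectI exI[of _ "(\<lambda>f. f i) -` A \<inter> space (\<Pi>\<^sub>M i\<in>UNIV. (borel :: real measure))"])
     (auto simp: space_PiM)
  qed
  then have "sigma_sets (space P) {x i -` A \<inter> space P |A. A \<in> sets borel} \<subseteq> sets (vimage_algebra (space P) (\<lambda>q i. x i q) (\<Pi>\<^sub>M i\<in>UNIV. (borel :: real measure)))"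
   using sets.sigma_sets_subset[of _ "vimage_algebra (space P) (\<lambda>q i. x i q) (\<Pi>\<^sub>M i\<in>UNIV. (borel :: real measure))"] by simp
  moreover have "sigma_sets (space P) {u -` A \<inter> space P |A. A \<in> sets borel} \<subseteq> sets (vimage_algebra (space P) u borel)"
   unfolding sets_vimage_algebra by (rule sigma_sets_mono') auto
  ultimately show "case_bool (sigma_sets (space P) {u -` A \<inter> space P |A. A \<in> sets borel}) (sigma_sets (space P) {x i -` A \<inter> space P |A. A \<in> sets borel}) b
   \<subseteq> case_bool (sets (vimage_algebra (space P) u borel)) (sets (vimage_algebra (space P) (\<lambda>q i. x i q) (\<Pi>\<^sub>M i\<in>UNIV. borel))) b"
   by (cases b) auto
 qed
 then have "P.indep_var borel u borel (x i)" unfolding P.indep_var_eq using m by auto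
 then have "(\<integral>q. u q * x i q \<partial>P) = P.expectation u * P.expectation (x i)"
  by (rule P.indep_var_lebesgue_integral)
   (use process_square_integrable square_integrable_imp_integrable[OF P.prob_space_axioms] in auto)
 then show ?thesis by (simp add: process_moments)
qed

lemma signal_limit: "(\<lambda>N. \<integral>q. (y q - u q - (\<Sum>i<N. x i q * \<beta> i))^2 \<partial>P) \<longlonglongrightarrow> 0"
 using dgp by (simp add: data_generating_process_def)

lemma residual_square_integrable: "square_integrable P (\<lambda>q. y q - u q - (\<Sum>i<N. x i q * \<beta> i))"
 using square_integrable_sum[of "{..<N}" P x \<beta>] process_square_integrable
 by (auto simp: mult.commute intro!: square_integrable_diff)

text \<open>The mean of \<open>y\<close> equals that of \<open>y - u\<close> minus any partial sum,
  and squared means are bounded by second moments, which here tend to 0.\<close>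

lemma response_mean: "P.expectation y = 0"
proof -
 have int: "integrable P y" "integrable P u" "integrable P (x i)" for i
  using process_square_integrable square_integrable_imp_integrable[OF P.prob_space_axioms] by auto
 have "(P.expectation y)^2 \<le> (\<integral>q. (y q - u q - (\<Sum>i<N. x i q * \<beta> i))^2 \<partial>P)" (is "_ \<le> (\<integral>q. (?D q)^2 \<partial>P)") for N
 proof -
  have D: "square_integrable P ?D" by (rule residual_square_integrable)
  have "P.expectation ?D = P.expectation y" using int process_moments by simp
  moreover have "P.variance ?D = (\<integral>q. (?D q)^2 \<partial>P) - (P.expectation ?D)\<^sup>2"
   by (rule P.variance_eq) (use D square_integrable_imp_integrable[OF P.prob_space_axioms D] in \<open>auto simp: square_integrable_def\<close>)
  moreover have "0 \<le> P.variance ?D" by (rule P.variance_positive)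
  ultimately show ?thesis by simp
 qed
 then have "(P.expectation y)^2 \<le> 0" by (intro LIMSEQ_le_const[OF signal_limit]) auto
 then show ?thesis by simp
qed

text \<open>The differences between \<open>y - u\<close> and the partial sums all have the same
  covariance \<open>?c\<close> with \<open>u\<close>, because \<open>u\<close> is uncorrelated with
  the regressors. For each \<open>t > 0\<close> the inequality
  \<open>2 * \<bar>a * b\<bar> \<le> t * a^2 + b^2 / t\<close> and the limit give
  \<open>2 * \<bar>?c\<bar> \<le> t * \<sigma>2\<close>, which forces \<open>?c = 0\<close>.\<close>

lemma noise_response: "(\<integral>q. y q * u q \<partial>P) = \<sigma>2"
proof -
 note sq = process_square_integrable
 let ?c = "(\<integral>q. y q * u q \<partial>P) - \<sigma>2"
 have bound: "2 * \<bar>?c\<bar> \<le> t * \<sigma>2" if t: "0 < t" for t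
 proof -
  have "2 * \<bar>?c\<bar> - t * \<sigma>2 \<le> 1 / t * (\<integral>q. (y q - u q - (\<Sum>i<N. x i q * \<beta> i))^2 \<partial>P)" (is "_ \<le> 1 / t * (\<integral>q. (?D q)^2 \<partial>P)") for N
  proof -
   have D: "square_integrable P ?D" by (rule residual_square_integrable)
   have S: "square_integrable P (\<lambda>q. \<Sum>i<N. x i q * \<beta> i)"
    using square_integrable_sum[of "{..<N}" P x \<beta>] sq(3) by (simp add: mult.commute)
   have "(\<integral>q. (\<Sum>i<N. \<beta> i * x i q) * u q \<partial>P) = (\<Sum>i<N. \<beta> i * (\<integral>q. x i q * u q \<partial>P))"
    by (rule integral_sum_mult) (rule sq)+
   then have Su: "(\<integral>q. (\<Sum>i<N. x i q * \<beta> i) * u q \<partial>P) = 0" using noise_uncorrelated by (simp add: mult.commute)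
   have Du: "(\<integral>q. ?D q * u q \<partial>P) = ?c"
    unfolding integral_diff_mult[OF square_integrable_diff[OF sq(1,2)] S sq(2)] integral_diff_mult[OF sq(1,2,2)] Su process_moments(3) by simp
   have pos: "0 \<le> (\<integral>q. t * (u q * u q) + 1 / t * (?D q)^2 - 2 * e * (?D q * u q) \<partial>P)" if "\<bar>e\<bar> = 1" for e :: real
   proof (rule integral_nonneg_AE, rule AE_I2)
    fix q
    have "e * e = 1" using that by (metis abs_mult_self_eq mult_1)
    then have "t * (u q * u q) + 1 / t * (?D q)^2 - 2 * e * (?D q * u q) = (t * u q - e * ?D q)^2 / t"
     using t by (simp add: field_simps power2_eq_square) (simp add: mult.assoc[symmetric])
    then show "0 \<le> t * (u q * u q) + 1 / t * (?D q)^2 - 2 * e * (?D q * u q)" using t by simp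
   qed
   have eq: "(\<integral>q. t * (u q * u q) + 1 / t * (?D q)^2 - 2 * e * (?D q * u q) \<partial>P) = t * \<sigma>2 + 1 / t * (\<integral>q. (?D q)^2 \<partial>P) - 2 * e * ?c" for e :: real
   proof -
    have i: "integrable P (\<lambda>q. t * (u q * u q))" "integrable P (\<lambda>q. 1 / t * (?D q)^2)" "integrable P (\<lambda>q. 2 * e * (?D q * u q))"
     using square_integrable_mult[OF sq(2,2)] square_integrable_mult[OF D sq(2)] D by (auto simp only: square_integrable_def integrable_mult_right)
    show ?thesis
     unfolding Bochner_Integration.integral_diff[OF Bochner_Integration.integrable_add[OF i(1,2)] i(3)] Bochner_Integration.integral_add[OF i(1,2)]
      integral_mult_right_zero Du process_moments(3) ..
   qed
   show ?thesis using pos[of 1] pos[of "- 1"] unfolding eq by (auto simp: abs_if)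
  qed
  then have "2 * \<bar>?c\<bar> - t * \<sigma>2 \<le> 1 / t * 0"
   by (intro LIMSEQ_le_const[OF tendsto_mult[OF tendsto_const signal_limit]]) auto
  then show ?thesis by simp
 qed
 have "\<bar>?c\<bar> \<le> 0"
 proof (rule ccontr)
  assume "\<not> \<bar>?c\<bar> \<le> 0"
  then have "2 * \<bar>?c\<bar> \<le> \<bar>?c\<bar>" using bound[of "\<bar>?c\<bar> / \<sigma>2"] process_moments(4) by simp
  with \<open>\<not> \<bar>?c\<bar> \<le> 0\<close> show False by simp
 qed
 then show ?thesis by simp
qed

lemma process_char:
 "(\<integral>q. iexp (a * y q + (\<Sum>k=0..<length xs. d k * x (xs ! k) q)) \<partial>P)
  = exp (- (\<integral>q. (a * y q + (\<Sum>k=0..<length xs. d k * x (xs ! k) q))^2 \<partial>P) / 2)"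
proof (rule P.char_normal_rv)
 let ?p = "length xs"
 obtain N where "set xs \<subseteq> {..<N}"
  using finite_nat_bounded[of "set xs"] by auto
 then have N: "\<And>k. k < ?p ==> xs ! k < N" by (auto simp: subset_eq)
 \<comment> \<open>Joint normality is formulated for initial segments of the regressors;
   coefficients along a list, possibly with repetitions, are collected per index.\<close>
 have eq: "(\<Sum>k=0..<?p. d k * x (xs ! k) q) = (\<Sum>i<N. (\<Sum>k=0..<?p. if xs ! k = i then d k else 0) * x i q)" for q
 proof -
  have "(\<Sum>i<N. (\<Sum>k=0..<?p. if xs ! k = i then d k else 0) * x i q) = (\<Sum>k=0..<?p. \<Sum>i<N. if i = xs ! k then d k * x i q else 0)"
   unfolding sum_distrib_right by (subst sum.swap) (intro sum.cong, auto)
  also have "... = (\<Sum>k=0..<?p. d k * x (xs ! k) q)" by (rule sum.cong) (auto simp: N)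
  finally show ?thesis ..
 qed
 have "jointly_gaussian P y x" using dgp by (simp add: data_generating_process_def)
 then have "\<And>b c N. normal_rv P (\<lambda>q. b * y q + (\<Sum>i<N. c i * x i q))" unfolding jointly_gaussian_def by blast
 then show "normal_rv P (\<lambda>q. a * y q + (\<Sum>k=0..<?p. d k * x (xs ! k) q))" unfolding eq .
 show "square_integrable P (\<lambda>q. a * y q + (\<Sum>k=0..<?p. d k * x (xs ! k) q))"
  by (intro square_integrable_add square_integrable_cmult square_integrable_sum process_square_integrable)
 have int: "integrable P y" "integrable P (x i)" for i
  using process_square_integrable square_integrable_imp_integrable[OF P.prob_space_axioms] by auto
 show "P.expectation (\<lambda>q. a * y q + (\<Sum>k=0..<?p. d k * x (xs ! k) q)) = 0"
  using int by (simp add: response_mean process_moments)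
qed

text \<open>\<open>b\<close> holds the projection coefficients of \<open>y\<close> on the
  orthonormalized regressors, and \<open>s\<close> is the standard deviation of the residual
  \<open>e\<close>. The standardized variables are orthonormal, so a linear combination has the sum
  of its squared coefficients as variance; being a centered normal combination of \<open>y\<close>
  and the regressors, it has the stated characteristic function.\<close>

lemma standardized_representation:
 assumes xs: "distinct xs"
 obtains R b s where "\<And>k. k < length xs ==> 0 < R k k" "\<And>i k. k < length xs ==> k < i ==> R i k = 0"
  "0 < s" "\<sigma>2 \<le> s^2" "P.variance y = (\<Sum>k=0..<length xs. (b k)^2) + s^2"
  "\<And>c. (\<integral>q. iexp (\<Sum>k=0..<Suc (length xs). c k * standardized R b s xs k (y q, \<lambda>i. x i q)) \<partial>P)
    = exp (- (\<Sum>k=0..<Suc (length xs). (c k)^2) / 2)"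
proof -
 let ?p = "length xs" note sq = process_square_integrable
 have pd: "0 < (\<integral>q. (\<Sum>i=0..<?p. c i * x (xs ! i) q) * (\<Sum>i=0..<?p. c i * x (xs ! i) q) \<partial>P)" if k: "k < ?p" "c k \<noteq> 0" for c k
 proof -
  define c' where "c' i = (\<Sum>k=0..<?p. if xs ! k = i then c k else 0)" for i
  have c': "c' (xs ! k) = c k" if "k < ?p" for k
  proof -
   have "c' (xs ! k) = (\<Sum>l=0..<?p. if l = k then c l else 0)"
    unfolding c'_def by (rule sum.cong) (use xs that in \<open>auto simp: nth_eq_iff_index_eq\<close>)
   then show ?thesis using that by simp
  qed
  have "finite (set xs) \<and> (\<exists>i\<in>set xs. c' i \<noteq> 0)" using k c'[of k] by (auto intro!: bexI[of _ "xs ! k"])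
  then have "0 < (\<Sum>i\<in>set xs. \<Sum>j\<in>set xs. c' i * c' j * (\<integral>q. x i q * x j q \<partial>P))"
   using dgp unfolding data_generating_process_def by blast
  also have "... = (\<Sum>k=0..<?p. \<Sum>l=0..<?p. c' (xs ! k) * c' (xs ! l) * (\<integral>q. x (xs ! k) q * x (xs ! l) q \<partial>P))"
   by (subst (1 2) sum.reindex_bij_betw[OF bij_betw_nth[OF xs refl refl], unfolded lessThan_atLeast0, symmetric]) simp
  also have "... = (\<Sum>k=0..<?p. c k * (\<Sum>l=0..<?p. c l * (\<integral>q. x (xs ! k) q * x (xs ! l) q \<partial>P)))"
   unfolding sum_distrib_left by (intro sum.cong) (auto simp: c')
  also have "... = (\<integral>q. (\<Sum>i=0..<?p. c i * x (xs ! i) q) * (\<Sum>i=0..<?p. c i * x (xs ! i) q) \<partial>P)"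
   by (subst integral_sum_mult[OF sq(3) square_integrable_sum[OF sq(3)]], subst integral_mult_sum[OF sq(3) sq(3)]) simp
  finally show ?thesis .
 qed
 have "\<exists>R. (\<forall>k<?p. 0 < R k k \<and> (\<forall>i>k. R i k = 0)) \<and>
  (\<forall>k<?p. \<forall>l<?p. (\<integral>q. (\<Sum>i=0..<?p. R i k * x (xs ! i) q) * (\<Sum>i=0..<?p. R i l * x (xs ! i) q) \<partial>P) = (if k = l then 1 else 0 :: real))"
  by (rule gram_schmidt_coefficients[OF sq(3) _ order_refl]) (rule pd)
 then obtain R where
  R: "\<And>k. k < ?p ==> 0 < R k k" "\<And>i k. k < ?p ==> k < i ==> R i k = 0"
  and orth: "\<And>k l. k < ?p ==> l < ?p ==> (\<integral>q. (\<Sum>i=0..<?p. R i k * x (xs ! i) q) * (\<Sum>i=0..<?p. R i l * x (xs ! i) q) \<partial>P) = (if k = l then 1 else 0 :: real)"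
  by blast
 define w where "w k q = (\<Sum>i=0..<?p. R i k * x (xs ! i) q)" for k q
 have w: "square_integrable P (w k)" for k unfolding w_def by (rule square_integrable_sum) (rule sq)
 have ww: "(\<integral>q. w k q * w l q \<partial>P) = (if k = l then 1 else 0)" if "k < ?p" "l < ?p" for k l
  using orth[OF that] unfolding w_def .
 define b where "b k = (\<integral>q. y q * w k q \<partial>P)" for k
 define e where "e q = y q - (\<Sum>k=0..<?p. b k * w k q)" for q
 have bw: "square_integrable P (\<lambda>q. \<Sum>k=0..<?p. c k * w k q)" for c by (rule square_integrable_sum) (rule w)
 have e: "square_integrable P e" unfolding e_def by (rule square_integrable_diff[OF sq(1) bw])
 have ew: "(\<integral>q. e q * w l q \<partial>P) = 0" if "l < ?p" for l
 proof -
  have "(\<integral>q. e q * w l q \<partial>P) = b l - (\<Sum>k=0..<?p. b k * (\<integral>q. w k q * w l q \<partial>P))"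
   unfolding e_def integral_diff_mult[OF sq(1) bw w] integral_sum_mult[OF w w] b_def[of l] ..
  also have "(\<Sum>k=0..<?p. b k * (\<integral>q. w k q * w l q \<partial>P)) = (\<Sum>k=0..<?p. if k = l then b k else 0)"
   by (rule sum.cong) (use ww that in auto)
  finally show ?thesis using that by simp
 qed
 define s where "s = sqrt (\<integral>q. e q * e q \<partial>P)"
 have wu: "(\<integral>q. w k q * u q \<partial>P) = 0" for k
  unfolding w_def integral_sum_mult[OF sq(3) sq(2)] using noise_uncorrelated by (simp add: mult.commute)
 have eu: "(\<integral>q. e q * u q \<partial>P) = \<sigma>2"
  unfolding e_def integral_diff_mult[OF sq(1) bw sq(2)] integral_sum_mult[OF w sq(2)] noise_response wu by simp
 \<comment> \<open>\<open>e\<close> and \<open>u\<close> have covariance \<open>\<sigma>2\<close>,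
   so the second moment of \<open>e - u\<close> is that of \<open>e\<close> minus
   \<open>\<sigma>2\<close>.\<close>
 have ee: "\<sigma>2 \<le> (\<integral>q. e q * e q \<partial>P)"
 proof -
  have "0 \<le> (\<integral>q. (e q - u q) * (e q - u q) \<partial>P)" by (rule integral_nonneg_AE) simp
  also have "... = (\<integral>q. e q * (e q - u q) \<partial>P) - (\<integral>q. u q * (e q - u q) \<partial>P)"
   by (rule integral_diff_mult[OF e sq(2) square_integrable_diff[OF e sq(2)]])
  also have "... = (\<integral>q. e q * e q \<partial>P) - \<sigma>2"
   using integral_diff_mult[OF e sq(2) e] integral_diff_mult[OF e sq(2,2)] eu process_moments(3) by (simp add: mult.commute)
  finally show ?thesis by simp
 qed
 have s: "0 < s" "s^2 = (\<integral>q. e q * e q \<partial>P)" using ee process_moments(4) by (auto simp: s_def)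
 have "(\<integral>q. e q * e q \<partial>P) = (\<integral>q. y q * e q \<partial>P) - (\<Sum>k=0..<?p. b k * (\<integral>q. w k q * e q \<partial>P))"
  using integral_diff_mult[OF sq(1) bw[of b] e] integral_sum_mult[where I = "{0..<?p}" and M = P and F = w and g = e and c = b, OF w e] unfolding e_def by simp
 also have "... = (\<integral>q. e q * y q \<partial>P)" using ew by (simp add: mult.commute)
 also have "... = (\<integral>q. (y q)^2 \<partial>P) - (\<Sum>k=0..<?p. (b k)^2)"
  unfolding e_def integral_diff_mult[OF sq(1) bw sq(1)] integral_sum_mult[OF w sq(1)] b_def by (simp add: power2_eq_square mult.commute)
 finally have vy: "P.variance y = (\<Sum>k=0..<?p. (b k)^2) + s^2"
  unfolding s(2) by (simp add: response_mean)
 have char: "(\<integral>q. iexp (\<Sum>k=0..<Suc ?p. c k * standardized R b s xs k (y q, \<lambda>i. x i q)) \<partial>P)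
    = exp (- (\<Sum>k=0..<Suc ?p. (c k)^2) / 2)" for c
 proof -
  define f where "f q = (\<Sum>k=0..<?p. c k * w k q) + c ?p * (e q / s)" for q
  have f1: "(\<Sum>k=0..<Suc ?p. c k * standardized R b s xs k (y q, \<lambda>i. x i q)) = f q" for q
   by (simp add: f_def standardized_def w_def e_def)
  define d where "d i = (\<Sum>k=0..<?p. (c k - c ?p / s * b k) * R i k)" for i
  have f2: "f q = c ?p / s * y q + (\<Sum>i=0..<?p. d i * x (xs ! i) q)" for q
  proof -
   have "(\<Sum>i=0..<?p. d i * x (xs ! i) q) = (\<Sum>k=0..<?p. (c k - c ?p / s * b k) * w k q)"
    unfolding d_def w_def sum_distrib_left sum_distrib_right by (subst sum.swap) (simp add: mult.assoc)
   also have "... = (\<Sum>k=0..<?p. c k * w k q) - c ?p / s * (\<Sum>k=0..<?p. b k * w k q)"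
    by (simp add: left_diff_distrib sum_subtractf sum_distrib_left mult.assoc)
   finally show ?thesis unfolding f_def e_def by (simp add: right_diff_distrib diff_divide_distrib)
  qed
  have g: "square_integrable P (\<lambda>q. c ?p * (e q / s))" using square_integrable_cmult[OF e, of "c ?p / s"] by simp
  have fs: "square_integrable P f" unfolding f_def by (rule square_integrable_add[OF bw g])
  have fw: "(\<integral>q. f q * w l q \<partial>P) = c l" if "l < ?p" for l
  proof -
   have "(\<integral>q. f q * w l q \<partial>P) = (\<integral>q. (\<Sum>k=0..<?p. c k * w k q) * w l q + c ?p / s * (e q * w l q) \<partial>P)"
    by (rule Bochner_Integration.integral_cong) (auto simp: f_def algebra_simps)
   also have "... = (\<integral>q. (\<Sum>k=0..<?p. c k * w k q) * w l q \<partial>P) + c ?p / s * (\<integral>q. e q * w l q \<partial>P)"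
    by (rule integral_add_cmult[OF square_integrable_mult[OF bw w] square_integrable_mult[OF e w]])
   also have "(\<integral>q. (\<Sum>k=0..<?p. c k * w k q) * w l q \<partial>P) = (\<Sum>k=0..<?p. if k = l then c k else 0)"
    unfolding integral_sum_mult[OF w w] by (rule sum.cong) (use ww that in auto)
   finally show ?thesis using that ew[OF that] by simp
  qed
  have fe: "(\<integral>q. f q * e q \<partial>P) = c ?p * s"
  proof -
   have "(\<integral>q. f q * e q \<partial>P) = (\<integral>q. (\<Sum>k=0..<?p. c k * w k q) * e q + c ?p / s * (e q * e q) \<partial>P)"
    by (rule Bochner_Integration.integral_cong) (auto simp: f_def algebra_simps)
   also have "... = (\<integral>q. (\<Sum>k=0..<?p. c k * w k q) * e q \<partial>P) + c ?p / s * (\<integral>q. e q * e q \<partial>P)"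
    by (rule integral_add_cmult[OF square_integrable_mult[OF bw e] square_integrable_mult[OF e e]])
   also have "(\<integral>q. (\<Sum>k=0..<?p. c k * w k q) * e q \<partial>P) = 0"
    unfolding integral_sum_mult[OF w e] using ew by (simp add: mult.commute)
   finally show ?thesis using s by (simp add: s(2)[symmetric] power2_eq_square)
  qed
  have "(\<integral>q. (f q)^2 \<partial>P) = (\<integral>q. f q * (\<Sum>k=0..<?p. c k * w k q) + c ?p / s * (f q * e q) \<partial>P)"
   by (rule Bochner_Integration.integral_cong) (auto simp: f_def algebra_simps power2_eq_square)
  also have "... = (\<integral>q. f q * (\<Sum>k=0..<?p. c k * w k q) \<partial>P) + c ?p / s * (\<integral>q. f q * e q \<partial>P)"
   by (rule integral_add_cmult[OF square_integrable_mult[OF fs bw] square_integrable_mult[OF fs e]])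
  also have "(\<integral>q. f q * (\<Sum>k=0..<?p. c k * w k q) \<partial>P) = (\<Sum>k=0..<?p. (c k)^2)"
   unfolding integral_mult_sum[OF w fs] by (intro sum.cong) (use fw in \<open>auto simp: power2_eq_square\<close>)
  finally have "(\<integral>q. (f q)^2 \<partial>P) = (\<Sum>k=0..<Suc ?p. (c k)^2)"
   unfolding fe using s(1) by (simp add: power2_eq_square)
  then show ?thesis unfolding f1 f2 using process_char[where a = "c ?p / s" and xs = xs and d = d] by simp
 qed
 show thesis by (rule that[OF R s(1) _ vy char]) (use ee s in auto)
qed

end

section \<open>Moore-Penrose inverse and block estimator\<close>

text \<open>Both \<open>A * B\<close> and \<open>A * C\<close> are the orthogonal projection onto
  the range of \<open>A\<close>, and both \<open>B * A\<close> and \<open>C * A\<close> are that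
  onto the complement of its kernel. The equation \<open>B * A * B = B\<close> then recovers the
  inverse from these projections.\<close>

lemma penrose_unique:
 fixes A :: "real mat"
 assumes A: "A \<in> carrier_mat n m"
  and B: "B \<in> carrier_mat m n" "A * B * A = A" "B * A * B = B" "transpose_mat (A * B) = A * B" "transpose_mat (B * A) = B * A"
  and C: "C \<in> carrier_mat m n" "A * C * A = A" "C * A * C = C" "transpose_mat (A * C) = A * C" "transpose_mat (C * A) = C * A"
 shows "B = C"
proof -
 note AB = mult_carrier_mat[OF A B(1)] and AC = mult_carrier_mat[OF A C(1)] and BA = mult_carrier_mat[OF B(1) A] and CA = mult_carrier_mat[OF C(1) A]
 have "A * C * (A * B) = A * B" using assoc_mult_mat[OF AC A B(1)] C(2) by simp
 then have "A * B = transpose_mat (A * C * (A * B))" using B(4) by simp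
 also have "... = A * B * (A * C)" using transpose_mult[OF AC AB] B(4) C(4) by simp
 also have "... = A * C" using assoc_mult_mat[OF AB A C(1)] B(2) by simp
 finally have 1: "A * B = A * C" .
 have "B * A * (C * A) = B * A" using assoc_mult_mat[OF B(1) A CA] assoc_mult_mat[OF A C(1) A] C(2) by simp
 then have "B * A = transpose_mat (B * A * (C * A))" using B(5) by simp
 also have "... = C * A * (B * A)" using transpose_mult[OF BA CA] B(5) C(5) by simp
 also have "... = C * A" using assoc_mult_mat[OF C(1) A BA] assoc_mult_mat[OF A B(1) A] B(2) by simp
 finally have 2: "B * A = C * A" .
 have "B = C * A * B" using B(3) 2 by simp
 also have "... = C * A * C" using assoc_mult_mat[OF C(1) A B(1)] assoc_mult_mat[OF C(1) A C(1)] 1 by simp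
 finally show ?thesis using C(3) by simp
qed

lemma pinv_eqI:
 assumes A: "A \<in> carrier_mat n m"
  and B: "B \<in> carrier_mat m n" "A * B * A = A" "B * A * B = B" "transpose_mat (A * B) = A * B" "transpose_mat (B * A) = B * A"
 shows "pinv A = B"
 unfolding pinv_def
proof (rule the_equality)
 show "B \<in> carrier_mat (dim_col A) (dim_row A) \<and> A * B * A = A \<and> B * A * B = B \<and> transpose_mat (A * B) = A * B \<and> transpose_mat (B * A) = B * A"
  using assms by auto
 fix C assume "C \<in> carrier_mat (dim_col A) (dim_row A) \<and> A * C * A = A \<and> C * A * C = C \<and> transpose_mat (A * C) = A * C \<and> transpose_mat (C * A) = C * A"
 then have C: "C \<in> carrier_mat m n" "A * C * A = A" "C * A * C = C" "transpose_mat (A * C) = A * C" "transpose_mat (C * A) = C * A"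
  unfolding carrier_matD[OF A] by blast+
 show "C = B" by (rule penrose_unique[OF A C B])
qed

lemma pinv_nonsingular:
 assumes A: "A \<in> carrier_mat n n" and d: "det A \<noteq> 0"
 shows "pinv A = minv A"
 by (rule pinv_eqI[OF A]) (use A minv_inverse[OF A d] minv_carrier[OF A] left_mult_one_mat[OF minv_carrier[OF A]] in auto)

section \<open>Measurability of the Moore-Penrose inverse\<close>

definition pick_cols :: "real mat => nat list => real mat" where
 "pick_cols A J = mat (dim_row A) (length J) (\<lambda>(i, k). A $$ (i, J ! k))"

lemma pick_cols_carrier [simp]: "A \<in> carrier_mat n m ==> pick_cols A J \<in> carrier_mat n (length J)"
 by (simp add: pick_cols_def)

lemma col_pick_cols: "k < length J ==> J ! k < dim_col A ==> col (pick_cols A J) k = col A (J ! k)"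
 by (auto simp: pick_cols_def intro!: eq_vecI)

text \<open>Rank factorization: with a basis \<open>F\<close> of picked columns,
  \<open>A = F * G\<close>, where \<open>G\<close> has full row rank because it contains the unit
  vectors at the picked positions. The Moore-Penrose inverse of the product is that of
  \<open>G\<close> times that of \<open>F\<close>, and \<open>lsq\<close> provides both.\<close>

lemma pinv_pick_cols:
 assumes A: "A \<in> carrier_mat n m" and J: "set J \<subseteq> {0..<m}" and fr: "fullrank (pick_cols A J)" and span: "rsd (pick_cols A J) * A = 0\<^sub>m n m"
 shows "pinv A = transpose_mat (lsq (transpose_mat (lsq (pick_cols A J) * A))) * lsq (pick_cols A J)"
proof -
 define F where "F = pick_cols A J"
 define r where "r = length J"
 have F: "F \<in> carrier_mat n r" unfolding F_def r_def by (rule pick_cols_carrier[OF A])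
 have frF: "fullrank F" using fr unfolding F_def .
 note LF = lsq_carrier[OF F]
 define G where "G = lsq F * A"
 have G: "G \<in> carrier_mat r m" unfolding G_def by (rule mult_carrier_mat[OF LF A])
 have Gt: "transpose_mat G \<in> carrier_mat m r" using G by simp
 have FLA: "F * G = A"
 proof -
  have "0\<^sub>m n m = (1\<^sub>m n - F * lsq F) * A" using span carrier_matD[OF F] unfolding F_def[symmetric] rsd_def by simp
  also have "... = A - F * lsq F * A" using minus_mult_distrib_mat[OF one_carrier_mat mult_carrier_mat[OF F LF] A] A by simp
  also have "F * lsq F * A = F * G" unfolding G_def by (rule assoc_mult_mat[OF F LF A])
  finally have z: "0\<^sub>m n m = A - F * G" .
  show ?thesis
  proof (rule eq_matI)
   fix i j assume ij: "i < dim_row A" "j < dim_col A"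
   then have "(0\<^sub>m n m :: real mat) $$ (i, j) = (A - F * G) $$ (i, j)" unfolding z[symmetric] by simp
   then show "(F * G) $$ (i, j) = A $$ (i, j)" using ij A mult_carrier_mat[OF F G] by (auto simp del: index_mult_mat)
  qed (use mult_carrier_mat[OF F G] A in auto)
 qed
 have colG: "col G (J ! k) = unit_vec r k" if k: "k < r" for k
 proof -
  have Jk: "J ! k < m" using J k by (auto simp: r_def subset_eq)
  have "col G (J ! k) = lsq F *\<^sub>v col A (J ! k)" unfolding G_def using col_mult2[OF LF A Jk] .
  also have "col A (J ! k) = col F k" unfolding F_def by (rule col_pick_cols[symmetric]) (use k Jk A in \<open>auto simp: r_def\<close>)
  also have "lsq F *\<^sub>v col F k = col (lsq F * F) k" using col_mult2[OF LF F k] by simp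
  finally show ?thesis using lsq_mult[OF F frF] k by simp
 qed
 have frG: "fullrank (transpose_mat G)"
  unfolding fullrank_iff[OF Gt]
 proof (intro ballI impI)
  fix v assume v: "v \<in> carrier_vec r" and 0: "transpose_mat G *\<^sub>v v = 0\<^sub>v m"
  show "v = 0\<^sub>v r"
  proof (rule eq_vecI)
   fix k assume k: "k < dim_vec (0\<^sub>v r :: real Matrix.vec)"
   then have Jk: "J ! k < m" using J by (auto simp: r_def subset_eq)
   have "(transpose_mat G *\<^sub>v v) $ (J ! k) = scalar_prod (col G (J ! k)) v" using Jk G by simp
   also have "... = v $ k" using colG[of k] k v by simp
   finally show "v $ k = 0\<^sub>v r $ k" using 0 Jk k by simp
  qed (use v in simp)
 qed
 define H where "H = transpose_mat (lsq (transpose_mat G))"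
 have H: "H \<in> carrier_mat m r" unfolding H_def using lsq_carrier[OF Gt] by simp
 have GH: "G * H = 1\<^sub>m r"
 proof -
  have "G * H = transpose_mat (lsq (transpose_mat G) * transpose_mat G)"
   unfolding H_def using transpose_mult[OF lsq_carrier[OF Gt] Gt] by simp
  then show ?thesis using lsq_mult[OF Gt frG] by simp
 qed
 have HG: "transpose_mat (H * G) = H * G"
 proof -
  have "transpose_mat (H * G) = transpose_mat G * lsq (transpose_mat G)"
   using transpose_mult[OF H G] unfolding H_def by simp
  then have "H * G = transpose_mat (transpose_mat G * lsq (transpose_mat G))" "transpose_mat (H * G) = transpose_mat G * lsq (transpose_mat G)"
   using transpose_transpose[of "H * G"] by simp_all
  then show ?thesis using proj_symmetric[OF Gt frG] by simp
 qed
 define B where "B = H * lsq F"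
 have B: "B \<in> carrier_mat m n" unfolding B_def by (rule mult_carrier_mat[OF H LF])
 have AB: "A * B = F * lsq F"
 proof -
  have "A * B = F * (G * (H * lsq F))" unfolding FLA[symmetric] B_def by (rule assoc_mult_mat[OF F G mult_carrier_mat[OF H LF]])
  also have "G * (H * lsq F) = lsq F" using assoc_mult_mat[OF G H LF] GH LF by simp
  finally show ?thesis .
 qed
 have BA: "B * A = H * G"
 proof -
  have "B * A = H * (lsq F * (F * G))" unfolding FLA B_def by (rule assoc_mult_mat[OF H LF A])
  also have "lsq F * (F * G) = G" using assoc_mult_mat[OF LF F G] lsq_mult[OF F frF] G by simp
  finally show ?thesis .
 qed
 have "pinv A = B"
 proof (rule pinv_eqI[OF A B])
  show "transpose_mat (A * B) = A * B" unfolding AB by (rule proj_symmetric[OF F frF])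
  show "transpose_mat (B * A) = B * A" unfolding BA by (rule HG)
  have "F * lsq F * A = F * (lsq F * A)" by (rule assoc_mult_mat[OF F LF A])
  then show "A * B * A = A" unfolding AB using FLA G_def by simp
  have "H * G * B = H * (G * B)" by (rule assoc_mult_mat[OF H G B])
  also have "G * B = lsq F" unfolding B_def using assoc_mult_mat[OF G H LF] GH LF by simp
  finally have e: "H * G * B = H * lsq F" .
  show "B * A * B = B" unfolding BA e by (rule B_def[symmetric])
 qed
 then show ?thesis unfolding B_def H_def G_def F_def .
qed

text \<open>Greedy choice: a column is kept exactly when its residual on those kept before is
  nonzero.\<close>

lemma pick_cols_exists:
 assumes A: "A \<in> carrier_mat n m"
 shows "\<exists>J. set J \<subseteq> {0..<m} \<and> distinct J \<and> fullrank (pick_cols A J) \<and> rsd (pick_cols A J) * A = 0\<^sub>m n m"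
proof -
 have "c \<le> m ==> \<exists>J. set J \<subseteq> {0..<c} \<and> distinct J \<and> fullrank (pick_cols A J) \<and> (\<forall>k<c. rsd (pick_cols A J) *\<^sub>v col A k = 0\<^sub>v n)" for c
 proof (induction c)
  case 0
  have "fullrank (pick_cols A [])" unfolding fullrank_iff[OF pick_cols_carrier[OF A]] by auto
  then show ?case by (intro exI[of _ "[]"]) auto
 next
  case (Suc c)
  from Suc.IH[OF Suc_leD[OF Suc.prems]] obtain J where J: "set J \<subseteq> {0..<c}" "distinct J" "fullrank (pick_cols A J)"
   and span: "\<And>k. k < c ==> rsd (pick_cols A J) *\<^sub>v col A k = 0\<^sub>v n" by blast
  let ?F = "pick_cols A J" let ?F' = "pick_cols A (J @ [c])"
  have F: "?F \<in> carrier_mat n (length J)" by (rule pick_cols_carrier[OF A])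
  show ?case
  proof (cases "rsd ?F *\<^sub>v col A c = 0\<^sub>v n")
   case True
   then show ?thesis using J span by (intro exI[of _ J]) (auto simp: less_Suc_eq)
  next
   case False
   have F': "?F' \<in> carrier_mat n (Suc (length J))" using pick_cols_carrier[OF A, of "J @ [c]"] by simp
   have last: "col ?F' (length J) = col A c" using col_pick_cols[of "length J" "J @ [c]" A] Suc.prems A by simp
   have sub: "?F = mat n (length J) (\<lambda>(i, k). ?F' $$ (i, k))"
    using A by (intro eq_matI) (auto simp: pick_cols_def nth_append)
   have fr': "fullrank ?F'"
    by (rule fullrank_extend[OF F' sub J(3)]) (use False last in simp)
   have "rsd ?F' *\<^sub>v col A k = 0\<^sub>v n" if k: "k < Suc c" for k
   proof -
    obtain z where z: "z \<in> carrier_vec (Suc (length J))" "col A k = ?F' *\<^sub>v z"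
    proof (cases "k = c")
     case True
     have "?F' *\<^sub>v unit_vec (Suc (length J)) (length J) = col ?F' (length J)"
      by (intro eq_vecI) (use F' in auto)
     then show ?thesis using that[of "unit_vec (Suc (length J)) (length J)"] True last by simp
    next
     case False
     then have kc: "k < c" using k by simp
     have Ak: "col A k \<in> carrier_vec n" using A by auto
     let ?t = "lsq ?F *\<^sub>v col A k"
     have t: "?t \<in> carrier_vec (length J)" by (rule mult_mat_vec_carrier_dim[OF lsq_carrier[OF F]])
     have "col A k - ?F *\<^sub>v ?t = 0\<^sub>v n" using span[OF kc] rsd_vec[OF F J(3) Ak] by simp
     then have e: "col A k = ?F *\<^sub>v ?t"
     proof -
      assume 0: "col A k - ?F *\<^sub>v ?t = 0\<^sub>v n"
      have Ft: "?F *\<^sub>v ?t \<in> carrier_vec n" by (rule mult_mat_vec_carrier_dim[OF F])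
      show ?thesis
      proof (rule eq_vecI)
       fix i assume i: "i < dim_vec (?F *\<^sub>v ?t)"
       then have "i < n" using carrier_vecD[OF Ft] by simp
       then have "(col A k - ?F *\<^sub>v ?t) $ i = 0" unfolding 0 by simp
       then show "col A k $ i = (?F *\<^sub>v ?t) $ i" using i by (simp del: index_mult_mat_vec)
      qed (use carrier_vecD[OF Ft] carrier_vecD[OF Ak] in simp)
     qed
     define z where "z = vec (Suc (length J)) (\<lambda>k. if k < length J then ?t $ k else 0)"
     have zc: "z \<in> carrier_vec (Suc (length J))" by (simp add: z_def)
     have "?F' *\<^sub>v z = ?F *\<^sub>v vec (length J) (\<lambda>k. z $ k) + z $ length J \<cdot>\<^sub>v col ?F' (length J)"
      unfolding sub by (rule mult_mat_vec_split_last[OF F' zc])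
     also have "vec (length J) (\<lambda>k. z $ k) = ?t"
      by (intro eq_vecI) (use carrier_vecD[OF t] in \<open>simp_all add: z_def del: index_mult_mat_vec dim_mult_mat_vec\<close>)
     also have "z $ length J \<cdot>\<^sub>v col ?F' (length J) = 0\<^sub>v n" unfolding last using A by (auto simp: z_def)
     finally have "?F' *\<^sub>v z = ?F *\<^sub>v ?t" using mult_mat_vec_carrier_dim[OF F, of ?t] by simp
     then show ?thesis using that[OF zc] e by simp
    qed
    then show ?thesis using rsd_vec_W[OF F' fr' z(1)] by simp
   qed
   then show ?thesis using J fr' by (intro exI[of _ "J @ [c]"]) (auto simp: subset_eq)
  qed
 qed
 from this[OF order_refl] obtain J where J: "set J \<subseteq> {0..<m}" "distinct J" "fullrank (pick_cols A J)"
  and span: "\<And>k. k < m ==> rsd (pick_cols A J) *\<^sub>v col A k = 0\<^sub>v n" by blast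
 have R: "rsd (pick_cols A J) \<in> carrier_mat n n" by (rule rsd_carrier[OF pick_cols_carrier[OF A]])
 have "rsd (pick_cols A J) * A = 0\<^sub>m n m"
 proof (rule eq_matI)
  fix i j assume ij: "i < dim_row (0\<^sub>m n m :: real mat)" "j < dim_col (0\<^sub>m n m :: real mat)"
  then have "(rsd (pick_cols A J) * A) $$ (i, j) = (rsd (pick_cols A J) *\<^sub>v col A j) $ i"
   using R A by simp
  then show "(rsd (pick_cols A J) * A) $$ (i, j) = 0\<^sub>m n m $$ (i, j)" using span ij by simp
 qed (use R A in auto)
 then show ?thesis using J by blast
qed

lemma sets_meas_mat_eq:
 assumes F: "meas_mat M n p F" and G: "G \<in> carrier_mat n p"
 shows "{x\<in>space M. F x = G} \<in> sets M"
proof -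
 have "F x = G \<longleftrightarrow> (\<forall>i\<in>{0..<n}. \<forall>j\<in>{0..<p}. F x $$ (i, j) = G $$ (i, j))" for x
  using meas_mat_carrier[OF F, of x] G by auto
 moreover have "{x\<in>space M. \<forall>i\<in>{0..<n}. \<forall>j\<in>{0..<p}. F x $$ (i, j) = G $$ (i, j)} \<in> sets M"
 proof (intro sets.sets_Collect_finite_All)
  fix i j assume "i \<in> {0..<n}" "j \<in> {0..<p}"
  then have [measurable]: "(\<lambda>x. F x $$ (i, j)) \<in> borel_measurable M" using meas_mat_entry[OF F] by simp
  show "{x\<in>space M. F x $$ (i, j) = G $$ (i, j)} \<in> sets M" by measurable
 qed auto
 ultimately show ?thesis by simp
qed

lemma borel_measurable_finite_cases:
 fixes f :: "'a => real"
 assumes I: "finite I" and S: "\<And>i. i \<in> I ==> S i \<in> sets M" and U: "space M \<subseteq> (\<Union>i\<in>I. S i)"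
  and g: "\<And>i. i \<in> I ==> g i \<in> borel_measurable M" and eq: "\<And>i x. i \<in> I ==> x \<in> S i ==> f x = g i x"
 shows "f \<in> borel_measurable M"
proof (rule measurableI)
 fix A :: "real set" assume A: "A \<in> sets borel"
 have "f -` A \<inter> space M = (\<Union>i\<in>I. S i \<inter> (g i -` A \<inter> space M))" using U eq by (fastforce simp: subset_eq)
 also have "... \<in> sets M" using I S measurable_sets[OF g A] by (intro sets.finite_UN) auto
 finally show "f -` A \<inter> space M \<in> sets M" .
qed simp

text \<open>The Moore-Penrose inverse jumps where the rank changes, yet it is given by a measurable
  formula on each of finitely many measurable sets, one for every choice of basis columns.\<close>

lemma meas_mat_pinv:
 assumes F: "meas_mat M n m F"
 shows "meas_mat M m n (\<lambda>x. pinv (F x))"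
proof -
 let ?I = "{J. set J \<subseteq> {0..<m} \<and> distinct J}"
 let ?S = "\<lambda>J. {x\<in>space M. fullrank (pick_cols (F x) J) \<and> rsd (pick_cols (F x) J) * F x = 0\<^sub>m n m}"
 let ?g = "\<lambda>J x. transpose_mat (lsq (transpose_mat (lsq (pick_cols (F x) J) * F x))) * lsq (pick_cols (F x) J)"
 have P: "meas_mat M n (length J) (\<lambda>x. pick_cols (F x) J)" if "J \<in> ?I" for J
  unfolding pick_cols_def meas_mat_dim(1)[OF F]
  by (rule meas_mat_mat) (use that meas_mat_entry[OF F] in \<open>auto simp: subset_eq\<close>)
 have g: "meas_mat M m n (?g J)" if "J \<in> ?I" for J
  by (rule meas_mat_mult[OF meas_mat_transpose[OF meas_mat_lsq[OF meas_mat_transpose[OF meas_mat_mult[OF meas_mat_lsq[OF P[OF that]] F]]]] meas_mat_lsq[OF P[OF that]]])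
 have S: "?S J \<in> sets M" if "J \<in> ?I" for J
  using sets.Int[OF sets_fullrank[OF P[OF that]] sets_meas_mat_eq[OF meas_mat_mult[OF meas_mat_rsd[OF P[OF that]] F] zero_carrier_mat]]
  by (simp add: Int_def conj_ac)
 have fin: "finite ?I"
  by (rule finite_subset[OF _ finite_subset_distinct[of "{0..<m}"]]) auto
 have carr: "pinv (F x) \<in> carrier_mat m n" for x
 proof -
  from pick_cols_exists[OF meas_mat_carrier[OF F, of x]] obtain J where J: "set J \<subseteq> {0..<m}" "distinct J"
   "fullrank (pick_cols (F x) J)" "rsd (pick_cols (F x) J) * F x = 0\<^sub>m n m" by blast
  show ?thesis unfolding pinv_pick_cols[OF meas_mat_carrier[OF F] J(1,3,4)] by (rule meas_mat_carrier[OF g]) (use J in simp)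
 qed
 have "(\<lambda>x. pinv (F x) $$ (i, j)) \<in> borel_measurable M" if ij: "i < m" "j < n" for i j
 proof (rule borel_measurable_finite_cases[OF fin S])
  show "space M \<subseteq> (\<Union>J\<in>?I. ?S J)" using pick_cols_exists[OF meas_mat_carrier[OF F]] by blast
  show "(\<lambda>x. ?g J x $$ (i, j)) \<in> borel_measurable M" if "J \<in> ?I" for J by (rule meas_mat_entry[OF g[OF that] ij])
  show "pinv (F x) $$ (i, j) = ?g J x $$ (i, j)" if "J \<in> ?I" "x \<in> ?S J" for J x
   using pinv_pick_cols[OF meas_mat_carrier[OF F, of x], of J] that by simp
 qed
 then show ?thesis using carr unfolding meas_mat_def by blast
qed

lemma annihilator_fullrank:
 assumes W: "W \<in> carrier_mat n p" and fr: "fullrank W"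
 shows "annihilator W = rsd W"
proof -
 have g: "pinv (gram W) = minv (gram W)" by (rule pinv_nonsingular[OF gram_carrier[OF W]]) (use fr in \<open>simp add: fullrank_def\<close>)
 have "W * minv (gram W) * transpose_mat W = W * lsq W"
  unfolding lsq_def by (rule assoc_mult_mat[OF W minv_carrier[OF gram_carrier[OF W]]]) (use W in simp)
 then show ?thesis unfolding annihilator_def rsd_def g by simp
qed

lemma least_squares_fullrank:
 assumes W: "W \<in> carrier_mat n p" and fr: "fullrank W"
 shows "least_squares W Y = lsq W *\<^sub>v Y"
proof -
 have g: "pinv (gram W) = minv (gram W)" by (rule pinv_nonsingular[OF gram_carrier[OF W]]) (use fr in \<open>simp add: fullrank_def\<close>)
 show ?thesis unfolding least_squares_def lsq_def g ..
qed

lemma quad_gram: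
 assumes W: "W \<in> carrier_mat n p" and v: "v \<in> carrier_vec p"
 shows "quad v (gram W) = scalar_prod (W *\<^sub>v v) (W *\<^sub>v v)"
proof -
 have Wt: "transpose_mat W \<in> carrier_mat p n" using W by simp
 show ?thesis unfolding quad_def assoc_mult_mat_vec[OF Wt W v]
  by (rule scalar_prod_transpose[OF W v mult_mat_vec_carrier_dim[OF W], symmetric])
qed

lemma scalar_prod_self_nonneg: "0 \<le> scalar_prod v (v :: real Matrix.vec)"
 by (auto simp: scalar_prod_def intro: sum_nonneg)

section \<open>The block estimator at full rank\<close>

context
 fixes X1 X2 :: "real mat" and Y :: "real Matrix.vec" and n p1 p2 :: nat
 assumes X1: "X1 \<in> carrier_mat n p1" and X2: "X2 \<in> carrier_mat n p2" and Y: "Y \<in> carrier_vec n"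
  and pn: "p1 + p2 < n" and fr: "fullrank (join_cols X1 X2)"
begin

lemma join_cols_fullrank1: "fullrank X1"
 by (rule fullrank_join1[OF X1 X2 fr])

lemma sigma_hat2_fullrank:
 "sigma_hat2 X1 X2 Y = scalar_prod Y (rsd (join_cols X1 X2) *\<^sub>v Y) / (real n - real (p1 + p2))"
proof -
 note X = join_cols_carrier[OF X1 X2]
 show ?thesis
  unfolding sigma_hat2_def Let_def least_squares_fullrank[OF X fr] rsd_vec[OF X fr Y, symmetric] carrier_matD[OF X] rsd_norm[OF X fr Y] ..
qed

lemma sigma_hat2_nonneg: "0 \<le> sigma_hat2 X1 X2 Y"
 unfolding sigma_hat2_def Let_def carrier_matD[OF join_cols_carrier[OF X1 X2]]
 by (rule divide_nonneg_nonneg[OF scalar_prod_self_nonneg]) (use pn in simp)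

lemma theta2_hat_fullrank: "theta2_hat X1 X2 Y = block2_coef X1 X2 *\<^sub>v Y"
proof -
 have c: "transpose_mat X2 * rsd X1 * X2 \<in> carrier_mat p2 p2"
  using rsd_carrier[OF X1] X2 by (meson mult_carrier_mat transpose_carrier_mat)
 show ?thesis
  unfolding theta2_hat_def block2_coef_def annihilator_fullrank[OF X1 join_cols_fullrank1] pinv_nonsingular[OF c det_block2[OF X1 X2 fr]] ..
qed

lemma theta2_hat_carrier: "theta2_hat X1 X2 Y \<in> carrier_vec p2"
 unfolding theta2_hat_fullrank by (rule mult_mat_vec_carrier_dim[OF block2_coef_carrier[OF X1 X2 fr]])

text \<open>Numerator and denominator are nonnegative, and a vanishing denominator gives the factor
  0, which is also in the range.\<close>

lemma shrink1_range:
 assumes "0 \<le> c1" shows "0 \<le> shrink1 c1 X1 X2 Y" "shrink1 c1 X1 X2 Y \<le> 1"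
proof -
 have "0 \<le> quad (theta1_star X1 Y) (gram X1)"
  unfolding theta1_star_def least_squares_fullrank[OF X1 join_cols_fullrank1]
   quad_gram[OF X1 mult_mat_vec_carrier_dim[OF lsq_carrier[OF X1]]] by (rule scalar_prod_self_nonneg)
 then show "0 \<le> shrink1 c1 X1 X2 Y" "shrink1 c1 X1 X2 Y \<le> 1"
  unfolding shrink1_def using sigma_hat2_nonneg assms by (auto intro!: divide_nonneg_nonneg mult_nonneg_nonneg)
qed

lemma shrink2_range:
 assumes "0 \<le> c2" shows "0 \<le> shrink2 c2 X1 X2 Y" "shrink2 c2 X1 X2 Y \<le> 1"
proof -
 have A: "annihilator X1 * X2 \<in> carrier_mat n p2"
  unfolding annihilator_fullrank[OF X1 join_cols_fullrank1] by (rule mult_carrier_mat[OF rsd_carrier[OF X1] X2])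
 have "0 \<le> quad (theta2_hat X1 X2 Y) (gram (annihilator X1 * X2))"
  unfolding quad_gram[OF A theta2_hat_carrier] by (rule scalar_prod_self_nonneg)
 then show "0 \<le> shrink2 c2 X1 X2 Y" "shrink2 c2 X1 X2 Y \<le> 1"
  unfolding shrink2_def Let_def using sigma_hat2_nonneg assms by (auto intro!: divide_nonneg_nonneg mult_nonneg_nonneg)
qed

text \<open>Writing \<open>1 - a1\<close> as \<open>(a2 - a1) + (1 - a2)\<close> joins the
  correction of the first block to the second block and completes the full fit. The estimator
  becomes a combination of two fits that do not involve the shrinkage factors.\<close>

lemma theta_JS_fullrank:
 fixes c1 c2 :: real
 defines "a1 \<equiv> shrink1 c1 X1 X2 Y" and "a2 \<equiv> shrink2 c2 X1 X2 Y"
 shows "theta1_JS c1 c2 X1 X2 Y @\<^sub>v theta2_JS c2 X1 X2 Y =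
  (a2 - a1) \<cdot>\<^sub>v ((lsq X1 *\<^sub>v Y) @\<^sub>v 0\<^sub>v p2) + (1 - a2) \<cdot>\<^sub>v (lsq (join_cols X1 X2) *\<^sub>v Y)"
proof -
 note L1 = lsq_carrier[OF X1]
 define t1 where "t1 = lsq X1 *\<^sub>v Y"
 define t2 where "t2 = theta2_hat X1 X2 Y"
 define z where "z = lsq X1 *\<^sub>v (X2 *\<^sub>v t2)"
 have t1: "t1 \<in> carrier_vec p1" unfolding t1_def by (rule mult_mat_vec_carrier_dim[OF L1])
 have t2: "t2 \<in> carrier_vec p2" unfolding t2_def by (rule theta2_hat_carrier)
 have z: "z \<in> carrier_vec p1" unfolding z_def by (rule mult_mat_vec_carrier_dim[OF L1])
 have X2t: "X2 *\<^sub>v t2 \<in> carrier_vec n" by (rule mult_mat_vec_carrier_dim[OF X2])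
 have g: "pinv (gram X1) = minv (gram X1)"
  by (rule pinv_nonsingular[OF gram_carrier[OF X1]]) (use join_cols_fullrank1 in \<open>simp add: fullrank_def\<close>)
 have th2: "theta2_JS c2 X1 X2 Y = (1 - a2) \<cdot>\<^sub>v t2" unfolding theta2_JS_def a2_def t2_def ..
 have "(pinv (gram X1) * transpose_mat X1 * X2) *\<^sub>v ((1 - a2) \<cdot>\<^sub>v t2) = (1 - a2) \<cdot>\<^sub>v z"
  unfolding g lsq_def[symmetric] z_def assoc_mult_mat_vec[OF L1 X2 t2, symmetric]
  by (rule mult_mat_vec[OF mult_carrier_mat[OF L1 X2] t2])
 then have th1: "theta1_JS c1 c2 X1 X2 Y = (1 - a1) \<cdot>\<^sub>v t1 - (1 - a2) \<cdot>\<^sub>v z"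
  unfolding theta1_JS_def th2 theta1_star_def least_squares_fullrank[OF X1 join_cols_fullrank1] a1_def t1_def by simp
 have lX: "lsq (join_cols X1 X2) *\<^sub>v Y = (t1 - z) @\<^sub>v t2"
  unfolding lsq_join_cols[OF X1 X2 fr Y] theta2_hat_fullrank[symmetric] t2_def[symmetric] t1_def z_def
   mult_minus_distrib_mat_vec[OF L1 Y X2t] ..
 show ?thesis unfolding th1 th2 lX t1_def[symmetric]
  by (rule eq_vecI) (use t1 t2 z in \<open>auto simp: algebra_simps\<close>)
qed

lemma block_rho_hat2_fullrank:
 fixes c1 c2 :: real
 defines "a1 \<equiv> shrink1 c1 X1 X2 Y" and "a2 \<equiv> shrink2 c2 X1 X2 Y"
 shows "block_rho_hat2 c1 c2 X1 X2 Y =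
   ((1 - a2)^2 * (real (p1 + p2) / (real n - real (p1 + p2) + 1)) + 1 - a2\<^sup>2 - (a1 - a2)\<^sup>2 * (real p1 / (real n - real p1 + 1))
    + (a2 - a1) * (2 - a1 - a2) * (real p1 / (real n - real p1 + 1)))
   * (scalar_prod Y (rsd (join_cols X1 X2) *\<^sub>v Y) / (real n - real (p1 + p2)))
  + a1^2 * ((scalar_prod Y Y - scalar_prod Y (rsd X1 *\<^sub>v Y)) / real n)
  + (a2^2 - a1\<^sup>2 * (real p1 / real n) + (a2 - a1)^2 * (real p1 / (real n - real p1 + 1)))
   * (scalar_prod Y (rsd X1 *\<^sub>v Y) / (real n - real p1))"
proof -
 note R = rsd_carrier[OF X1]
 have q: "quad Y (1\<^sub>m n - rsd X1) = scalar_prod Y Y - scalar_prod Y (rsd X1 *\<^sub>v Y)"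
  unfolding quad_def minus_mult_distrib_mat_vec[OF one_carrier_mat R Y] one_mult_mat_vec[OF Y]
  by (rule scalar_prod_minus_distrib[OF Y Y mult_mat_vec_carrier_dim[OF R]])
 show ?thesis
  unfolding block_rho_hat2_def Let_def carrier_matD[OF X1] carrier_matD[OF X2] annihilator_fullrank[OF X1 join_cols_fullrank1] q
   sigma_hat2_fullrank a1_def a2_def quad_def[of Y "rsd X1"] of_nat_add ..
qed

end

section \<open>From the sample to the orthonormalized model\<close>

context gaussian_regression
begin

definition theta_W :: "(nat \<times> nat => real) => real => real => nat => real" where
 "theta_W g a1 a2 k = (if k < p1 then (a2 - a1) * (lsq (W1 g) *\<^sub>v Y g) $ k else 0) + (1 - a2) * (lsq (W g) *\<^sub>v Y g) $ k"

context
 fixes R :: "nat => nat => real" and xs1 xs2 :: "nat list" and D :: "nat => obs" and g :: "nat \<times> nat => real"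
 assumes R0: "\<And>k. k < p ==> 0 < R k k" and Rt: "\<And>i k. k < p ==> k < i ==> R i k = 0"
  and xs: "length xs1 = p1" "length xs2 = p2"
  and g: "\<And>j k. j < n ==> k < Suc p ==> g (j, k) = standardized R b \<sigma> (xs1 @ xs2) k (D (Suc j))"
  and fr: "fullrank (W g)"
begin

abbreviation "X1 \<equiv> design n D xs1"
abbreviation "X2 \<equiv> design n D xs2"
abbreviation "X \<equiv> join_cols X1 X2"
abbreviation "Rm \<equiv> mat p p (\<lambda>(i, k). R i k)"
abbreviation "R1 \<equiv> mat p1 p1 (\<lambda>(i, k). R i k)"

lemma X_carriers: "X1 \<in> carrier_mat n p1" "X2 \<in> carrier_mat n p2" "X \<in> carrier_mat n p" "response n D \<in> carrier_vec n"
 using xs by (auto simp: design_def response_def intro!: join_cols_carrier)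

lemma X_alt: "X = mat n p (\<lambda>(j, k). snd (D (Suc j)) ((xs1 @ xs2) ! k))"
proof -
 have "X1 = mat n p1 (\<lambda>(j, k). snd (D (Suc j)) ((xs1 @ xs2) ! k))" "X2 = mat n p2 (\<lambda>(j, k). snd (D (Suc j)) ((xs1 @ xs2) ! (p1 + k)))"
  using xs by (auto simp: design_def nth_append intro!: eq_matI)
 then show ?thesis using join_cols_mat[of n p1 "\<lambda>(j, k). snd (D (Suc j)) ((xs1 @ xs2) ! k)" p2] by (simp add: case_prod_unfold)
qed

lemma g_regressor: "j < n ==> k < p ==> g (j, k) = (\<Sum>i=0..<p. R i k * snd (D (Suc j)) ((xs1 @ xs2) ! i))"
 using g[of j k] xs by (simp add: standardized_def)

lemma W_design: "W g = X * Rm"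
 unfolding X_alt W_def by (intro eq_matI) (simp_all add: g_regressor scalar_prod_def mult.commute)

text \<open>By upper triangularity the first \<open>p1\<close> orthonormalized regressors involve
  the first block only, so the leading submatrix \<open>R1\<close> suffices.\<close>

lemma W1_design: "W1 g = X1 * R1"
proof (rule eq_matI)
 fix j k assume jk: "j < dim_row (X1 * R1)" "k < dim_col (X1 * R1)"
 then have j: "j < n" and k: "k < p1" using X_carriers(1) by auto
 have "g (j, k) = (\<Sum>i=0..<p1. R i k * snd (D (Suc j)) ((xs1 @ xs2) ! i))"
  unfolding g_regressor[OF j trans_less_add1[OF k]]
  by (rule sum.mono_neutral_right) (use k Rt in auto)
 then show "W1 g $$ (j, k) = (X1 * R1) $$ (j, k)"
  using j k xs by (simp add: W1_def design_def scalar_prod_def nth_append mult.commute)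
qed (use X_carriers(1) in \<open>auto simp: W1_def\<close>)

lemma Y_response: "Y g = response n D"
proof (rule eq_vecI)
 fix j assume "j < dim_vec (response n D)"
 then have j: "j < n" by (simp add: response_def)
 have "\<sigma> * g (j, p) = fst (D (Suc j)) - (\<Sum>k=0..<p. b k * g (j, k))"
  using g[OF j, of p] \<sigma> xs g_regressor[OF j] by (simp add: standardized_def)
 then show "Y g $ j = response n D $ j"
  using j by (simp add: Y_def W_def noise_def response_def scalar_prod_def mult.commute)
qed (use X_carriers carriers(5) in auto)

lemma det_R: "det Rm \<noteq> 0" "det R1 \<noteq> 0"
proof -
 have "det (mat q q (\<lambda>(i, k). R i k)) \<noteq> 0" if "q \<le> p" for q
 proof -
  have "upper_triangular (mat q q (\<lambda>(i, k). R i k))" using that Rt by (auto simp: upper_triangular_def)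
  then have "det (mat q q (\<lambda>(i, k). R i k)) = prod_list (diag_mat (mat q q (\<lambda>(i, k). R i k)))"
   by (rule det_upper_triangular[where n = q]) simp
  moreover have "R i i \<noteq> 0" if "i < q" for i using R0[of i] that \<open>q \<le> p\<close> by simp
  then have "0 \<notin> set (diag_mat (mat q q (\<lambda>(i, k). R i k)))" by (auto simp: diag_mat_def)
  ultimately show ?thesis by (simp add: prod_list_zero_iff)
 qed
 then show "det Rm \<noteq> 0" "det R1 \<noteq> 0" by auto
qed

lemma fullrank_X: "fullrank X"
 unfolding fullrank_iff[OF X_carriers(3)]
proof (intro ballI impI)
 have Rm: "Rm \<in> carrier_mat p p" by simp
 note Ri = minv_carrier[OF Rm] and inv = minv_inverse[OF Rm det_R(1)]
 fix v assume v: "v \<in> carrier_vec p" and 0: "X *\<^sub>v v = 0\<^sub>v n"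
 let ?u = "minv Rm *\<^sub>v v"
 have u: "?u \<in> carrier_vec p" by (rule mult_mat_vec_carrier_dim[OF Ri])
 have Ru: "Rm *\<^sub>v ?u = v" using assoc_mult_mat_vec[OF Rm Ri v] inv v by simp
 then have "W g *\<^sub>v ?u = 0\<^sub>v n" unfolding W_design using assoc_mult_mat_vec[OF X_carriers(3) Rm u] 0 by simp
 then have "?u = 0\<^sub>v p" using fr u unfolding fullrank_iff[OF carriers(3)] by blast
 then have "v = Rm *\<^sub>v 0\<^sub>v p" using Ru by simp
 also have "... = 0\<^sub>v p" by (intro eq_vecI) simp_all
 finally show "v = 0\<^sub>v p" .
qed

lemma fullrank_X1: "fullrank X1"
 by (rule fullrank_join1[OF X_carriers(1,2) fullrank_X])

lemma shrink_range:
 "0 \<le> c1 ==> 0 \<le> shrink1 c1 X1 X2 (response n D)" "0 \<le> c1 ==> shrink1 c1 X1 X2 (response n D) \<le> 1"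
 "0 \<le> c2 ==> 0 \<le> shrink2 c2 X1 X2 (response n D)" "0 \<le> c2 ==> shrink2 c2 X1 X2 (response n D) \<le> 1"
 using shrink1_range[OF X_carriers(1,2,4) pn fullrank_X] shrink2_range[OF X_carriers(1,2,4) pn fullrank_X] by auto

text \<open>Residual projections depend on the column spaces only, and orthonormalization preserves
  these for the first block and for the whole design.\<close>

lemma block_rho_hat2_estimated_error:
 "block_rho_hat2 c1 c2 X1 X2 (response n D) = estimated_error (shrink1 c1 X1 X2 (response n D)) (shrink2 c2 X1 X2 (response n D)) g"
proof -
 have "rsd (W g) = rsd X" unfolding W_design by (rule rsd_mult_right[OF X_carriers(3) fullrank_X _ det_R(1)]) simp
 moreover have "rsd (W1 g) = rsd X1" unfolding W1_design by (rule rsd_mult_right[OF X_carriers(1) fullrank_X1 _ det_R(2)]) simp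
 ultimately show ?thesis
  unfolding block_rho_hat2_fullrank[OF X_carriers(1,2,4) pn fullrank_X] estimated_error_def \<phi>_def \<phi>1_def Y_response by simp
qed

lemma theta_JS_design:
 fixes c1 c2 :: real
 defines "a1 \<equiv> shrink1 c1 X1 X2 (response n D)" and "a2 \<equiv> shrink2 c2 X1 X2 (response n D)"
 assumes k: "k < p"
 shows "(theta1_JS c1 c2 X1 X2 (response n D) @\<^sub>v theta2_JS c2 X1 X2 (response n D)) $ k = (\<Sum>l=0..<p. R k l * theta_W g a1 a2 l)"
proof -
 have Rm: "Rm \<in> carrier_mat p p" and R1: "R1 \<in> carrier_mat p1 p1" by simp_all
 define u where "u = lsq (W1 g) *\<^sub>v Y g"
 define t where "t = lsq (W g) *\<^sub>v Y g"
 have u: "u \<in> carrier_vec p1" unfolding u_def by (rule mult_mat_vec_carrier_dim[OF lsq_carrier[OF carriers(1)]])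
 have t: "t \<in> carrier_vec p" unfolding t_def by (rule mult_mat_vec_carrier_dim[OF lsq_carrier[OF carriers(3)]])
 have 1: "lsq X1 *\<^sub>v response n D = R1 *\<^sub>v u"
  unfolding u_def W1_design Y_response by (rule lsq_mult_right[OF X_carriers(1) fullrank_X1 R1 det_R(2) X_carriers(4), symmetric])
 have 2: "lsq X *\<^sub>v response n D = Rm *\<^sub>v t"
  unfolding t_def W_design Y_response by (rule lsq_mult_right[OF X_carriers(3) fullrank_X Rm det_R(1) X_carriers(4), symmetric])
 have r1: "((R1 *\<^sub>v u) @\<^sub>v 0\<^sub>v p2) $ k = (\<Sum>l=0..<p. R k l * (if l < p1 then u $ l else 0))"
 proof -
  have "(\<Sum>l=0..<p. R k l * (if l < p1 then u $ l else 0)) = (\<Sum>l=0..<p1. R k l * u $ l)"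
   by (rule sum.mono_neutral_cong_right) auto
  also have "... = ((R1 *\<^sub>v u) @\<^sub>v 0\<^sub>v p2) $ k"
  proof (cases "k < p1")
   case False
   then have "(\<Sum>l=0..<p1. R k l * u $ l) = 0" by (intro sum.neutral) (use Rt in auto)
   then show ?thesis using False k by simp
  qed (use u in \<open>simp add: scalar_prod_def\<close>)
  finally show ?thesis ..
 qed
 have "(theta1_JS c1 c2 X1 X2 (response n D) @\<^sub>v theta2_JS c2 X1 X2 (response n D)) $ k
   = (a2 - a1) * ((R1 *\<^sub>v u) @\<^sub>v 0\<^sub>v p2) $ k + (1 - a2) * (Rm *\<^sub>v t) $ k"
  unfolding theta_JS_fullrank[OF X_carriers(1,2,4) pn fullrank_X] 1 2 a1_def a2_def using k by simp
 also have "(Rm *\<^sub>v t) $ k = (\<Sum>l=0..<p. R k l * t $ l)" using k t by (simp add: scalar_prod_def)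
 also have "(a2 - a1) * ((R1 *\<^sub>v u) @\<^sub>v 0\<^sub>v p2) $ k + (1 - a2) * (\<Sum>l=0..<p. R k l * t $ l) = (\<Sum>l=0..<p. R k l * theta_W g a1 a2 l)"
  unfolding r1 sum_distrib_left sum.distrib[symmetric] theta_W_def u_def[symmetric] t_def[symmetric] by (intro sum.cong) (auto simp: algebra_simps)
 finally show ?thesis .
qed

text \<open>Once the training data are fixed, the error at a new observation is a linear combination
  of its standardized variables with fixed coefficients, whose squares sum to
  \<open>prediction_error\<close>. Hence it is centered normal with that variance.\<close>

lemma prediction_residual:
 fixes z :: obs and c1 c2 :: real
 defines "a1 \<equiv> shrink1 c1 X1 X2 (response n D)" and "a2 \<equiv> shrink2 c2 X1 X2 (response n D)"
 shows "fst z - (\<Sum>k=0..<p. snd z ((xs1 @ xs2) ! k) * (theta1_JS c1 c2 X1 X2 (response n D) @\<^sub>v theta2_JS c2 X1 X2 (response n D)) $ k)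
  = (\<Sum>k=0..<Suc p. (if k < p then b k - theta_W g a1 a2 k else \<sigma>) * standardized R b \<sigma> (xs1 @ xs2) k z)"
proof -
 let ?s = "\<lambda>l. \<Sum>i=0..<p. R i l * snd z ((xs1 @ xs2) ! i)"
 have s: "standardized R b \<sigma> (xs1 @ xs2) l z = ?s l" if "l < p" for l using that xs by (simp add: standardized_def)
 have "\<sigma> * standardized R b \<sigma> (xs1 @ xs2) p z = fst z - (\<Sum>k=0..<p. b k * ?s k)"
  using \<sigma> xs by (simp add: standardized_def)
 then have v: "fst z = (\<Sum>k=0..<p. b k * ?s k) + \<sigma> * standardized R b \<sigma> (xs1 @ xs2) p z" by simp
 have "(\<Sum>k=0..<p. snd z ((xs1 @ xs2) ! k) * (theta1_JS c1 c2 X1 X2 (response n D) @\<^sub>v theta2_JS c2 X1 X2 (response n D)) $ k)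
   = (\<Sum>k=0..<p. \<Sum>l=0..<p. theta_W g a1 a2 l * (R k l * snd z ((xs1 @ xs2) ! k)))"
  unfolding a1_def a2_def by (intro sum.cong) (auto simp: theta_JS_design sum_distrib_left mult_ac)
 also have "... = (\<Sum>l=0..<p. theta_W g a1 a2 l * ?s l)" by (subst sum.swap) (simp add: sum_distrib_left)
 finally show ?thesis unfolding v by (simp add: s left_diff_distrib sum_subtractf)
qed

end

end

section \<open>Measurability of the estimators\<close>

lemma meas_quad: "meas_vec M n v ==> meas_mat M n n A ==> (\<lambda>x. quad (v x) (A x)) \<in> borel_measurable M"
 unfolding quad_def by (rule meas_scalar_prod[OF _ meas_mult_mat_vec])

lemma meas_mat_annihilator:
 assumes X: "meas_mat M n p X"
 shows "meas_mat M n n (\<lambda>x. annihilator (X x))"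
 unfolding annihilator_def meas_mat_dim(1)[OF X]
 by (rule meas_mat_minus[OF meas_mat_const[OF one_carrier_mat] meas_mat_mult[OF meas_mat_mult[OF X meas_mat_pinv[OF meas_mat_gram[OF X]]] meas_mat_transpose[OF X]]])

lemma meas_vec_least_squares:
 assumes X: "meas_mat M n p X" and Y: "meas_vec M n Y"
 shows "meas_vec M p (\<lambda>x. least_squares (X x) (Y x))"
 unfolding least_squares_def
 by (rule meas_mult_mat_vec[OF meas_mat_mult[OF meas_mat_pinv[OF meas_mat_gram[OF X]] meas_mat_transpose[OF X]] Y])

context
 fixes M :: "'a measure" and n p1 p2 :: nat and X1 X2 :: "'a => real mat" and Y :: "'a => real Matrix.vec"
 assumes X1: "meas_mat M n p1 X1" and X2: "meas_mat M n p2 X2" and Y: "meas_vec M n Y"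
begin

lemma measurable_sigma_hat2: "(\<lambda>x. sigma_hat2 (X1 x) (X2 x) (Y x)) \<in> borel_measurable M"
proof -
 note X = meas_mat_join_cols[OF X1 X2]
 have e: "meas_vec M n (\<lambda>x. Y x - join_cols (X1 x) (X2 x) *\<^sub>v least_squares (join_cols (X1 x) (X2 x)) (Y x))"
  by (rule meas_vec_minus[OF Y meas_mult_mat_vec[OF X meas_vec_least_squares[OF X Y]]])
 show ?thesis
  unfolding sigma_hat2_def Let_def meas_mat_dim[OF X] by (rule borel_measurable_divide[OF meas_scalar_prod[OF e e]]) simp
qed

lemma meas_vec_theta2_hat: "meas_vec M p2 (\<lambda>x. theta2_hat (X1 x) (X2 x) (Y x))"
 unfolding theta2_hat_def
 by (rule meas_mult_mat_vec[OF meas_mat_mult[OF meas_mat_mult[OF meas_mat_pinv[OF meas_mat_mult[OF meas_mat_mult[OF meas_mat_transpose[OF X2] meas_mat_annihilator[OF X1]] X2]]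
  meas_mat_transpose[OF X2]] meas_mat_annihilator[OF X1]] Y])

lemma measurable_shrink1: "(\<lambda>x. shrink1 c (X1 x) (X2 x) (Y x)) \<in> borel_measurable M"
proof -
 note [measurable] = measurable_sigma_hat2 meas_quad[OF meas_vec_least_squares[OF X1 Y] meas_mat_gram[OF X1]]
 show ?thesis unfolding shrink1_def theta1_star_def meas_mat_dim(2)[OF X1] by measurable
qed

lemma measurable_shrink2: "(\<lambda>x. shrink2 c (X1 x) (X2 x) (Y x)) \<in> borel_measurable M"
proof -
 note [measurable] = measurable_sigma_hat2 meas_quad[OF meas_vec_theta2_hat meas_mat_gram[OF meas_mat_mult[OF meas_mat_annihilator[OF X1] X2]]]
 show ?thesis unfolding shrink2_def Let_def meas_mat_dim(2)[OF X2] by measurable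
qed

lemma meas_vec_theta2_JS: "meas_vec M p2 (\<lambda>x. theta2_JS c (X1 x) (X2 x) (Y x))"
 unfolding theta2_JS_def by (rule meas_vec_smult[OF meas_vec_theta2_hat borel_measurable_diff[OF borel_measurable_const measurable_shrink2]])

lemma meas_vec_theta1_JS: "meas_vec M p1 (\<lambda>x. theta1_JS c c' (X1 x) (X2 x) (Y x))"
 unfolding theta1_JS_def theta1_star_def
 by (rule meas_vec_minus[OF meas_vec_smult[OF meas_vec_least_squares[OF X1 Y] borel_measurable_diff[OF borel_measurable_const measurable_shrink1]]
  meas_mult_mat_vec[OF meas_mat_mult[OF meas_mat_mult[OF meas_mat_pinv[OF meas_mat_gram[OF X1]] meas_mat_transpose[OF X1]] X2] meas_vec_theta2_JS]])

lemma measurable_block_rho_hat2: "(\<lambda>x. block_rho_hat2 c c' (X1 x) (X2 x) (Y x)) \<in> borel_measurable M"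
proof -
 note [measurable] = measurable_sigma_hat2 measurable_shrink1 measurable_shrink2 meas_quad[OF Y meas_mat_annihilator[OF X1]]
  meas_quad[OF Y meas_mat_minus[OF meas_mat_const[OF one_carrier_mat] meas_mat_annihilator[OF X1]]]
 show ?thesis unfolding block_rho_hat2_def Let_def meas_mat_dim[OF X1] meas_mat_dim(2)[OF X2] by measurable
qed

end

definition theta_JS :: "nat => real => real => nat list => nat list => (nat => obs) => real Matrix.vec" where
 "theta_JS n c1 c2 xs1 xs2 D = theta1_JS c1 c2 (design n D xs1) (design n D xs2) (response n D)
   @\<^sub>v theta2_JS c2 (design n D xs1) (design n D xs2) (response n D)"

abbreviation training_space :: "nat => (nat => obs) measure" where
 "training_space n \<equiv> \<Pi>\<^sub>M j\<in>{1..n}. obs_space"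

lemma measurable_regressor: "(\<lambda>z :: obs. snd z i) \<in> borel_measurable obs_space"
 by (rule measurable_compose[OF measurable_snd]) (rule measurable_component_singleton, simp)

lemma meas_mat_design: "meas_mat (training_space n) n (length xs) (\<lambda>D. design n D xs)"
 unfolding design_def
proof (rule meas_mat_mat)
 fix j k assume "j < n"
 then have "(\<lambda>D :: nat => obs. D (Suc j)) \<in> measurable (training_space n) obs_space"
  by (intro measurable_component_singleton) auto
 from measurable_compose[OF this measurable_regressor]
 show "(\<lambda>D. case (j, k) of (j, k) => snd (D (Suc j)) (xs ! k)) \<in> borel_measurable (training_space n)" by simp
qed

lemma meas_vec_response: "meas_vec (training_space n) n (response n)"
 unfolding response_def
proof (rule meas_vec_vec)
 fix j assume "j < n"
 then have "(\<lambda>D :: nat => obs. D (Suc j)) \<in> measurable (training_space n) obs_space"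
  by (intro measurable_component_singleton) auto
 from measurable_compose[OF this measurable_fst]
 show "(\<lambda>D. fst (D (Suc j))) \<in> borel_measurable (training_space n)" .
qed

lemma meas_vec_theta_JS: "meas_vec (training_space n) (length xs1 + length xs2) (theta_JS n c1 c2 xs1 xs2)"
 unfolding theta_JS_def
 by (rule meas_vec_append[OF meas_vec_theta1_JS[OF meas_mat_design meas_mat_design meas_vec_response] meas_vec_theta2_JS[OF meas_mat_design meas_mat_design meas_vec_response]])

lemma measurable_rho_hat: "(\<lambda>D. rho_hat n c1 c2 B D m) \<in> borel_measurable (training_space n)"
proof -
 have [measurable]: "(\<lambda>D. rho_hat2 n c1 c2 B D m) \<in> borel_measurable (training_space n)"
  unfolding rho_hat2_def by (rule measurable_block_rho_hat2[OF meas_mat_design meas_mat_design meas_vec_response])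
 show ?thesis unfolding rho_hat_def by measurable
qed

section \<open>The sample as a Gaussian matrix\<close>

text \<open>The estimators read only the copies from 1 to \<open>n\<close>, so they may be evaluated
  at the restricted sample, on which the training algebra is built.\<close>

lemma sample_restrict:
 "design n (restrict D {1..n}) xs = design n D xs" "response n (restrict D {1..n}) = response n D"
 unfolding design_def response_def by (auto intro!: eq_matI eq_vecI)

lemma candidate_model_blocks:
 assumes "candidate_model n B m"
 shows "length (block1 B m) = card (B m)" "length (block1 B m) + length (block2 B m) = card (coords m)"
  "distinct (block1 B m @ block2 B m)" "set (block1 B m @ block2 B m) = coords m"
  "3 \<le> length (block1 B m)" "3 \<le> length (block2 B m)" "6 \<le> card (coords m)" "card (coords m) < n"
proof -
 have fin: "finite (coords m)" "B m \<subseteq> coords m" "finite (B m)" "finite (coords m - B m)"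
  using assms finite_subset[of "B m" "coords m"] by (auto simp: candidate_model_def)
 have c: "card (B m) + card (coords m - B m) = card (coords m)"
  using fin card_Diff_subset[of "B m" "coords m"] card_mono[of "coords m" "B m"] by simp
 show "length (block1 B m) = card (B m)" "length (block1 B m) + length (block2 B m) = card (coords m)"
  "distinct (block1 B m @ block2 B m)" "set (block1 B m @ block2 B m) = coords m"
  "3 \<le> length (block1 B m)" "3 \<le> length (block2 B m)" "6 \<le> card (coords m)" "card (coords m) < n"
  using fin c assms by (auto simp: block1_def block2_def candidate_model_def)
qed

lemma y_hat0_sum:
 assumes "candidate_model n B m"
 defines "xs \<equiv> block1 B m @ block2 B m"
 shows "y_hat0 n c1 c2 B D m = (\<Sum>k=0..<length xs. snd (D 0) (xs ! k) * theta_JS n c1 c2 (block1 B m) (block2 B m) D $ k)"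
proof -
 note bl = candidate_model_blocks[OF assms(1), folded xs_def]
 have bij: "bij_betw (\<lambda>k. xs ! k) {0..<length xs} (coords m)"
  using bij_betw_nth[OF bl(3) refl refl] bl(4) by (simp add: lessThan_atLeast0)
 have "beta_hat n c1 c2 B D m (xs ! k) = theta_JS n c1 c2 (block1 B m) (block2 B m) D $ k" if k: "k < length xs" for k
 proof -
  have "m (xs ! k) = 1" using nth_mem[OF k] bl(4) by (simp add: coords_def)
  \<comment> \<open>\<open>beta_hat\<close> looks a coordinate up by its first position; in a list
    without repetitions this is the position it was taken from.\<close>
  moreover have "(LEAST l. xs ! l = xs ! k) = k"
  proof (rule Least_equality)
   fix l assume l: "xs ! l = xs ! k"
   show "k \<le> l"
   proof (rule ccontr)
    assume "\<not> k \<le> l"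
    then show False using l k nth_eq_iff_index_eq[OF bl(3), of l k] by simp
   qed
  qed simp
  ultimately show ?thesis unfolding beta_hat_def Let_def theta_JS_def xs_def[symmetric] by simp
 qed
 then show ?thesis unfolding y_hat0_def sum.reindex_bij_betw[OF bij, symmetric] by simp
qed

text \<open>The characteristic function factors over the independent observations, and each factor
  is the standard normal one by \<open>char\<close>.\<close>

lemma distr_sample_gmat:
 fixes V :: "nat => obs => real"
 assumes iid: "iid_copies M Z n P y x" and V: "\<And>k. V k \<in> borel_measurable obs_space" and m: "(\<lambda>w. (y w, \<lambda>i. x i w)) \<in> measurable P obs_space"
  and char: "\<And>c. (\<integral>w. iexp (\<Sum>k=0..<q. c k * V k (y w, \<lambda>i. x i w)) \<partial>P) = exp (- (\<Sum>k=0..<q. (c k)^2) / 2)"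
 shows "distr M (\<Pi>\<^sub>M i\<in>{0..<n} \<times> {0..<q}. borel) (\<lambda>w. \<lambda>i\<in>{0..<n} \<times> {0..<q}. V (snd i) (Z (Suc (fst i)) w)) = gmat n q"
proof -
 interpret prob_space M using iid by (simp add: iid_copies_def)
 have ind: "indep_vars (\<lambda>_. obs_space) Z {0..n}" and law: "\<And>j. j \<in> {0..n} ==> distr M obs_space (Z j) = distr P obs_space (\<lambda>w. (y w, \<lambda>i. x i w))"
  using iid by (auto simp: iid_copies_def)
 have Z: "Z j \<in> measurable M obs_space" if "j \<in> {0..n}" for j using ind that by (auto simp: indep_vars_def)
 show ?thesis
 proof (rule distr_eq_gauss)
  show "(\<lambda>w. V (snd i) (Z (Suc (fst i)) w)) \<in> borel_measurable M" if "i \<in> {0..<n} \<times> {0..<q}" for i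
   by (rule measurable_compose[OF Z V]) (use that in auto)
  fix c :: "nat \<times> nat => real"
  \<comment> \<open>Copy \<open>j\<close> fills matrix row \<open>j - 1\<close>, copy 0 being the
    new observation.\<close>
  let ?f = "\<lambda>j z. iexp (\<Sum>k=0..<q. c (j - 1, k) * V k z)"
  have f: "?f j \<in> borel_measurable obs_space" for j using V by measurable
  have ind': "indep_vars (\<lambda>_. borel) (\<lambda>j w. ?f j (Z j w)) {1..n}"
   by (rule indep_vars_compose2[OF indep_vars_subset[OF ind] f]) auto
  have "(\<Sum>i\<in>{0..<n} \<times> {0..<q}. c i * V (snd i) (Z (Suc (fst i)) w)) = (\<Sum>j\<in>{1..n}. \<Sum>k=0..<q. c (j - 1, k) * V k (Z j w))" for w
  proof -
   have "(\<Sum>i\<in>{0..<n} \<times> {0..<q}. c i * V (snd i) (Z (Suc (fst i)) w)) = (\<Sum>j=0..<n. \<Sum>k=0..<q. c (j, k) * V k (Z (Suc j) w))"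
    by (subst sum.cartesian_product) (simp add: case_prod_unfold)
   also have "... = (\<Sum>j\<in>{1..n}. \<Sum>k=0..<q. c (j - 1, k) * V k (Z j w))"
    by (rule sum.reindex_bij_witness[of _ "\<lambda>j. j - 1" Suc]) auto
   finally show ?thesis .
  qed
  then have "(\<integral>w. iexp (\<Sum>i\<in>{0..<n} \<times> {0..<q}. c i * V (snd i) (Z (Suc (fst i)) w)) \<partial>M) = (\<integral>w. (\<Prod>j\<in>{1..n}. ?f j (Z j w)) \<partial>M)"
   by (simp add: sum_distrib_left exp_sum)
  also have "... = (\<Prod>j\<in>{1..n}. \<integral>w. ?f j (Z j w) \<partial>M)"
  proof (rule indep_vars_lebesgue_integral[OF _ ind'])
   show "integrable M (\<lambda>w. ?f j (Z j w))" if "j \<in> {1..n}" for j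
   proof (rule integrable_const_bound[where B = 1])
    show "(\<lambda>w. ?f j (Z j w)) \<in> borel_measurable M" by (rule measurable_compose[OF Z f]) (use that in simp)
   qed simp
  qed simp
  also have "... = (\<Prod>j\<in>{1..n}. complex_of_real (exp (- (\<Sum>k=0..<q. (c (j - 1, k))^2) / 2)))"
  proof (rule prod.cong[OF refl])
   fix j assume j: "j \<in> {1..n}"
   then have j': "j \<in> {0..n}" by simp
   have "(\<integral>w. ?f j (Z j w) \<partial>M) = (\<integral>z. ?f j z \<partial>distr M obs_space (Z j))" by (rule integral_distr[OF Z[OF j'] f, symmetric])
   also have "... = (\<integral>w. ?f j (y w, \<lambda>i. x i w) \<partial>P)" unfolding law[OF j'] by (rule integral_distr[OF m f])
   also have "... = complex_of_real (exp (- (\<Sum>k=0..<q. (c (j - 1, k))^2) / 2))" by (rule char)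
   finally show "(\<integral>w. ?f j (Z j w) \<partial>M) = complex_of_real (exp (- (\<Sum>k=0..<q. (c (j - 1, k))^2) / 2))" .
  qed
  also have "... = complex_of_real (exp (\<Sum>j\<in>{1..n}. - (\<Sum>k=0..<q. (c (j - 1, k))^2) / 2))"
   by (simp only: exp_sum[OF finite_atLeastAtMost] of_real_prod)
  also have "(\<Sum>j\<in>{1..n}. - (\<Sum>k=0..<q. (c (j - 1, k))^2) / 2) = - (\<Sum>i\<in>{0..<n} \<times> {0..<q}. (c i)^2) / 2"
  proof -
   have "(\<Sum>i\<in>{0..<n} \<times> {0..<q}. (c i)^2) = (\<Sum>j=0..<n. \<Sum>k=0..<q. (c (j, k))^2)"
    by (subst sum.cartesian_product) simp
   also have "... = (\<Sum>j\<in>{1..n}. \<Sum>k=0..<q. (c (j - 1, k))^2)"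
    by (rule sum.reindex_bij_witness[of _ "\<lambda>j. j - 1" Suc]) auto
   finally show ?thesis by (simp add: sum_negf sum_divide_distrib[symmetric])
  qed
  finally show "(\<integral>w. iexp (\<Sum>i\<in>{0..<n} \<times> {0..<q}. c i * V (snd i) (Z (Suc (fst i)) w)) \<partial>M) = exp (- (\<Sum>i\<in>{0..<n} \<times> {0..<q}. (c i)^2) / 2)" .
 qed simp
qed

section \<open>Coverage of normal intervals\<close>

lemma std_normal_symmetric: "distr std_normal_distribution borel uminus = std_normal_distribution"
proof (rule Levy_uniqueness)
 interpret real_distribution std_normal_distribution by (rule real_dist_normal_dist)
 show "real_distribution std_normal_distribution" by (rule real_dist_normal_dist)
 show "real_distribution (distr std_normal_distribution borel uminus)" by (rule real_distribution_distr) simp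
 show "char (distr std_normal_distribution borel uminus) = char std_normal_distribution"
 proof
  fix t :: real
  have "char (distr std_normal_distribution borel uminus) t = char std_normal_distribution (- t)"
   by (simp add: char_def integral_distr)
  then show "char (distr std_normal_distribution borel uminus) t = char std_normal_distribution t"
   by (simp add: char_std_normal_distribution)
 qed
qed

interpretation std_normal: real_distribution std_normal_distribution by (rule real_dist_normal_dist)

lemma std_normal_measure_uminus: "A \<in> sets borel ==> measure std_normal_distribution (uminus -` A) = measure std_normal_distribution A"
 using measure_distr[of uminus std_normal_distribution borel A] by (simp add: std_normal_symmetric)

lemma std_normal_singleton: "measure std_normal_distribution {a} = 0"
proof -
 have "emeasure std_normal_distribution {a} = (\<integral>\<^sup>+x. ennreal (std_normal_density x) * indicator {a} x \<partial>lborel)"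
  by (rule emeasure_density) auto
 also have "... = 0"
 proof (subst nn_integral_0_iff_AE)
  show "AE x in lborel. ennreal (std_normal_density x) * indicator {a} x = 0"
   using AE_lborel_singleton[of a] by eventually_elim auto
 qed auto
 finally show ?thesis by (simp add: measure_def)
qed

lemma std_normal_cdf_uminus: "cdf std_normal_distribution (- z) = 1 - cdf std_normal_distribution z"
proof -
 have "cdf std_normal_distribution (- z) = measure std_normal_distribution {z..}"
 proof -
  have "uminus -` {..- z} = {z..}" by auto
  then show ?thesis unfolding cdf_def using std_normal_measure_uminus[of "{..- z}"] by simp
 qed
 also have "... = measure std_normal_distribution {z<..} + measure std_normal_distribution {z}"
  by (subst std_normal.finite_measure_Union[symmetric]) (auto intro!: arg_cong[where f = "measure _"])
 also have "measure std_normal_distribution {z<..} = 1 - cdf std_normal_distribution z"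
  unfolding cdf_def using std_normal.prob_compl[of "{..z}"] by (simp add: Compl_eq_Diff_UNIV[symmetric] Compl_atMost)
 finally show ?thesis by (simp add: std_normal_singleton)
qed

lemma std_normal_central: "0 \<le> z ==> measure std_normal_distribution {- z..z} = 2 * cdf std_normal_distribution z - 1"
proof -
 assume z: "0 \<le> z"
 have "cdf std_normal_distribution z = measure std_normal_distribution {..- z} + measure std_normal_distribution {- z<..z}"
  unfolding cdf_def using z by (subst std_normal.finite_measure_Union[symmetric]) (auto intro!: arg_cong[where f = "measure _"])
 moreover have "measure std_normal_distribution {- z..z} = measure std_normal_distribution {- z<..z} + measure std_normal_distribution {- z}"
  using z by (subst std_normal.finite_measure_Union[symmetric]) (auto intro!: arg_cong[where f = "measure _"])
 ultimately show ?thesis using std_normal_cdf_uminus[of z] by (simp add: std_normal_singleton cdf_def)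
qed

lemma std_normal_quantile:
 assumes p: "1 / 2 < p" "p < 1"
 shows "cdf std_normal_distribution (quantile std_normal_distribution p) = p" "0 < quantile std_normal_distribution p"
proof -
 let ?F = "cdf std_normal_distribution"
 have cont: "isCont ?F z" for z by (simp add: std_normal.isCont_cdf std_normal_singleton)
 then have contS: "continuous_on UNIV ?F" by (simp add: continuous_at_imp_continuous_on)
 have F0: "?F 0 = 1 / 2" using std_normal_cdf_uminus[of 0] by simp
 have "eventually (\<lambda>z. p < ?F z) at_top" using order_tendstoD(1)[OF std_normal.cdf_lim_at_top_prob p(2)] .
 then obtain z1 where z1: "p < ?F z1" by (auto simp: eventually_at_top_linorder)
 let ?S = "{z. p \<le> ?F z}"
 \<comment> \<open>For \<open>p\<close> above one half the set lies in the positive half-line. Being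
   closed, nonempty and bounded below, it contains its infimum, the quantile.\<close>
 have pos: "0 < z" if "z \<in> ?S" for z
 proof (rule ccontr)
  assume "\<not> 0 < z"
  then have "?F z \<le> ?F 0" by (intro std_normal.cdf_nondecreasing) simp
  with that F0 p show False by simp
 qed
 have z1p: "0 \<le> z1" using pos[of z1] z1 by simp
 obtain z0 where z0: "?F z0 = p" using IVT'[of ?F 0 p z1] F0 p z1 z1p continuous_on_subset[OF contS] by auto
 have bdd: "bdd_below ?S" using pos by (auto intro!: bdd_belowI[of _ 0] less_imp_le)
 have "closed ?S" by (rule closed_Collect_le[OF continuous_on_const contS])
 then have Q: "Inf ?S \<in> ?S" using z0 bdd by (intro closed_contains_Inf) auto
 have "Inf ?S \<le> z0" using z0 bdd by (intro cInf_lower) auto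
 then have "?F (Inf ?S) \<le> p" unfolding z0[symmetric] by (rule std_normal.cdf_nondecreasing)
 then show "?F (quantile std_normal_distribution p) = p" using Q by (simp add: quantile_def)
 show "0 < quantile std_normal_distribution p" using pos[OF Q] by (simp add: quantile_def)
qed

text \<open>\<open>x \<phi>(x)\<close> is maximal at \<open>x = 1\<close>, with a value of about \<open>0.242\<close>.\<close>

lemma std_normal_density_le:
 assumes x: "0 < x"
 shows "std_normal_density x \<le> 1 / (4 * x)" "std_normal_density (- x) \<le> 1 / (4 * x)"
proof -
 \<comment> \<open>The rational lower bounds \<open>8 / 5\<close> and \<open>5 / 2\<close> for the
   two constants are chosen to multiply to 4.\<close>
 have e: "8 / 5 \<le> exp (1/2 :: real)"
 proof -
  have "1 + 1 / 2 + (1 / 2)^2 / 2 \<le> exp (1/2 :: real)" by (rule exp_lower_Taylor_quadratic) simp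
  then show ?thesis by (simp add: power2_eq_square)
 qed
 have pi: "5 / 2 \<le> sqrt (2 * pi)"
 proof (rule real_le_rsqrt)
  show "(5 / 2)^2 \<le> 2 * pi" using pi_approx by (simp add: power2_eq_square)
 qed
 have "1 + (x^2 / 2 - 1 / 2) \<le> exp (x^2 / 2 - 1 / 2)" by (rule exp_ge_add_one_self)
 moreover have "x \<le> 1 + (x^2 / 2 - 1 / 2)"
 proof -
  have "0 \<le> (x - 1)^2" by simp
  then show ?thesis by (simp add: power2_diff)
 qed
 ultimately have "x * exp (1 / 2) \<le> exp (x^2 / 2 - 1 / 2) * exp (1 / 2)" by (intro mult_right_mono) auto
 then have "x * exp (1 / 2) \<le> exp (x^2 / 2)" by (simp add: exp_add[symmetric])
 moreover have "x * (8 / 5) \<le> x * exp (1 / 2)" using e x by simp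
 ultimately have 1: "x * (8 / 5) \<le> exp (x^2 / 2)" by linarith
 have "4 * x = (5 / 2) * (x * (8 / 5))" by simp
 also have "... \<le> sqrt (2 * pi) * exp (x^2 / 2)" using pi 1 x by (intro mult_mono) auto
 finally have "1 / (sqrt (2 * pi) * exp (x^2 / 2)) \<le> 1 / (4 * x)" using x by (intro divide_left_mono) auto
 moreover have "std_normal_density x = 1 / (sqrt (2 * pi) * exp (x^2 / 2))"
  by (simp add: std_normal_density_def exp_minus field_simps)
 ultimately show "std_normal_density x \<le> 1 / (4 * x)" by simp
 then show "std_normal_density (- x) \<le> 1 / (4 * x)" by (simp add: std_normal_density_def)
qed

text \<open>The density bound \<open>1 / (4 * x)\<close> integrates to \<open>ln (v / u) / 4\<close>
  on each of the two side intervals.\<close>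

lemma std_normal_increment:
 assumes u: "0 < u" "u \<le> v"
 shows "measure std_normal_distribution {- v..v} - measure std_normal_distribution {- u..u} \<le> ln (v / u) / 2"
proof -
 have v: "0 < v" using u by simp
 have "emeasure std_normal_distribution {u..v} = (\<integral>\<^sup>+x. ennreal (std_normal_density x) * indicator {u..v} x \<partial>lborel)"
  by (rule emeasure_density) auto
 also have "... \<le> (\<integral>\<^sup>+x. ennreal (1 / (4 * x)) * indicator {u..v} x \<partial>lborel)"
  by (intro nn_integral_mono) (use u std_normal_density_le(1) in \<open>auto split: split_indicator intro!: ennreal_leI\<close>)
 also have "... = ennreal (ln v / 4 - ln u / 4)"
  by (rule nn_integral_FTC_Icc) (use u in \<open>auto intro!: derivative_eq_intros simp: has_real_derivative_iff_has_vector_derivative[symmetric] field_simps\<close>)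
 finally have "emeasure std_normal_distribution {u..v} \<le> ennreal (ln (v / u) / 4)" using u v by (simp add: ln_div diff_divide_distrib)
 moreover have l: "0 \<le> ln (v / u)" using u by simp
 ultimately have m: "measure std_normal_distribution {u..v} \<le> ln (v / u) / 4"
  by (simp add: std_normal.emeasure_eq_measure)
 have "uminus -` {- v..- u} = {u..v}" by auto
 then have m': "measure std_normal_distribution {- v..- u} \<le> ln (v / u) / 4"
  using m std_normal_measure_uminus[of "{- v..- u}"] by simp
 have "measure std_normal_distribution {- v..v} \<le> measure std_normal_distribution (({- v..- u} \<union> {- u..u}) \<union> {u..v})"
  by (rule std_normal.finite_measure_mono) (use u in auto)
 also have "... \<le> measure std_normal_distribution ({- v..- u} \<union> {- u..u}) + measure std_normal_distribution {u..v}"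
  by (rule measure_Un_le) auto
 also have "measure std_normal_distribution ({- v..- u} \<union> {- u..u}) \<le> measure std_normal_distribution {- v..- u} + measure std_normal_distribution {- u..u}"
  by (rule measure_Un_le) auto
 finally show ?thesis using m m' by linarith
qed

text \<open>The tolerance \<open>4 * \<epsilon> / (1 + 4 * \<epsilon>)\<close> is chosen so that 1
  minus it is \<open>1 / (1 + 4 * \<epsilon>)\<close>, while 1 plus it is at most
  \<open>1 + 4 * \<epsilon>\<close>; the logarithm of \<open>\<rho>h / \<rho>\<close> is thus at
  most \<open>4 * \<epsilon>\<close> in absolute value. The square root in the half-width halves
  this, and \<open>std_normal_increment\<close> halves it again.\<close>

lemma std_normal_coverage:
 fixes \<epsilon> :: real
 assumes \<epsilon>: "0 < \<epsilon>" and \<alpha>: "0 < \<alpha>" "\<alpha> < 1" and \<rho>: "0 < \<rho>"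
  and close: "\<bar>\<rho>h - \<rho>\<bar> \<le> 4 * \<epsilon> / (1 + 4 * \<epsilon>) * \<rho>"
 defines "Q \<equiv> quantile std_normal_distribution (1 - \<alpha> / 2)"
 shows "\<bar>(1 - \<alpha>) - measure std_normal_distribution {w. \<bar>w\<bar> \<le> Q * sqrt \<rho>h / sqrt \<rho>}\<bar> \<le> \<epsilon>"
proof -
 have Q: "cdf std_normal_distribution Q = 1 - \<alpha> / 2" "0 < Q"
  unfolding Q_def using \<alpha> by (auto intro!: std_normal_quantile)
 define v where "v = Q * sqrt \<rho>h / sqrt \<rho>"
 let ?N = "\<lambda>u. measure std_normal_distribution {- u..u}"
 have NQ: "?N Q = 1 - \<alpha>" using std_normal_central[of Q] Q by simp
 have near: "(1 - a) * \<rho> \<le> \<rho>h" "\<rho>h \<le> (1 + a) * \<rho>" if "\<bar>\<rho>h - \<rho>\<bar> \<le> a * \<rho>" for a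
  using that by (simp_all add: abs_le_iff algebra_simps)
 have "1 - 4 * \<epsilon> / (1 + 4 * \<epsilon>) = 1 / (1 + 4 * \<epsilon>)" using \<epsilon> by (simp add: field_simps)
 then have "(1 / (1 + 4 * \<epsilon>)) * \<rho> \<le> \<rho>h" using near(1)[OF close] by (simp only:)
 then have lo: "1 / (1 + 4 * \<epsilon>) \<le> \<rho>h / \<rho>" using \<rho> by (simp add: pos_le_divide_eq)
 have "4 * \<epsilon> / (1 + 4 * \<epsilon>) \<le> 4 * \<epsilon>" using \<epsilon> by (simp add: field_simps)
 then have "(1 + 4 * \<epsilon> / (1 + 4 * \<epsilon>)) * \<rho> \<le> (1 + 4 * \<epsilon>) * \<rho>" using \<rho> by (intro mult_right_mono) auto
 then have "\<rho>h \<le> (1 + 4 * \<epsilon>) * \<rho>" by (rule order_trans[OF near(2)[OF close]])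
 then have hi: "\<rho>h / \<rho> \<le> 1 + 4 * \<epsilon>" using \<rho> by (simp only: pos_divide_le_eq)
 have \<tau>: "0 < \<rho>h / \<rho>" using lo \<epsilon> by (auto intro: less_le_trans[of _ "1 / (1 + 4 * \<epsilon>)"])
 then have h: "0 < \<rho>h" using \<rho> by (simp add: zero_less_divide_iff)
 have l1: "ln (1 + 4 * \<epsilon>) \<le> 4 * \<epsilon>" using \<epsilon> by (intro ln_add_one_self_le_self) simp
 have "ln (\<rho>h / \<rho>) \<le> ln (1 + 4 * \<epsilon>)" using hi \<tau> by simp
 moreover have "ln (1 / (1 + 4 * \<epsilon>)) \<le> ln (\<rho>h / \<rho>)" using lo \<epsilon> by (intro ln_mono) auto
 ultimately have ln: "\<bar>ln (\<rho>h / \<rho>)\<bar> \<le> 4 * \<epsilon>" using l1 \<epsilon> by (simp add: ln_div abs_le_iff)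
 have v: "0 < v" using Q h \<rho> by (simp add: v_def)
 have vQ: "ln (v / Q) = ln (\<rho>h / \<rho>) / 2"
  using Q h \<rho> by (simp add: v_def ln_div ln_sqrt diff_divide_distrib)
 have "\<bar>?N Q - ?N v\<bar> \<le> \<epsilon>"
 proof (cases "Q \<le> v")
  case True
  have "?N Q \<le> ?N v" by (rule std_normal.finite_measure_mono) (use True in auto)
  with std_normal_increment[OF Q(2) True] vQ ln show ?thesis by (simp add: abs_le_iff)
 next
  case False
  then have vq: "v \<le> Q" by simp
  have "?N v \<le> ?N Q" by (rule std_normal.finite_measure_mono) (use vq in auto)
  moreover have "ln (Q / v) = - ln (v / Q)" using v Q by (simp add: ln_div)
  ultimately show ?thesis using std_normal_increment[OF v vq] vQ ln by (simp add: abs_le_iff)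
 qed
 moreover have "{w. \<bar>w\<bar> \<le> v} = {- v..v}" by auto
 ultimately show ?thesis unfolding v_def[symmetric] NQ by simp
qed

lemma gaussian_combination_coverage:
 fixes V :: "nat => 'a => real"
 assumes P: "prob_space P" and V: "\<And>k. V k \<in> borel_measurable P"
  and char: "\<And>c. (\<integral>b. iexp (\<Sum>k=0..<q. c k * V k b) \<partial>P) = exp (- (\<Sum>k=0..<q. (c k)^2) / 2)"
  and \<rho>: "0 < (\<Sum>k=0..<q. (c k)^2)"
 shows "measure P {b\<in>space P. \<bar>\<Sum>k=0..<q. c k * V k b\<bar> \<le> h} = measure std_normal_distribution {w. \<bar>w\<bar> \<le> h / sqrt (\<Sum>k=0..<q. (c k)^2)}"
proof -
 interpret prob_space P by fact
 let ?r = "sqrt (\<Sum>k=0..<q. (c k)^2)"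
 have r: "0 < ?r" using \<rho> by simp
 define f where "f b = (\<Sum>k=0..<q. c k * V k b) / ?r" for b
 have f: "f \<in> borel_measurable P" unfolding f_def using V by measurable
 have "distr P borel f = std_normal_distribution"
 proof (rule Levy_uniqueness)
  show "real_distribution (distr P borel f)" by (rule real_distribution_distr[OF f])
  show "real_distribution std_normal_distribution" by (rule real_dist_normal_dist)
  show "char (distr P borel f) = char std_normal_distribution"
  proof
   fix t
   have "char (distr P borel f) t = (\<integral>b. iexp (t * f b) \<partial>P)" by (simp add: char_def integral_distr[OF f])
   also have "... = (\<integral>b. iexp (\<Sum>k=0..<q. (t * c k / ?r) * V k b) \<partial>P)"
    by (simp add: f_def sum_distrib_left sum_divide_distrib mult.assoc)
   also have "... = exp (- (\<Sum>k=0..<q. (t * c k / ?r)^2) / 2)" by (rule char)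
   also have "(\<Sum>k=0..<q. (t * c k / ?r)^2) = t^2 * (\<Sum>k=0..<q. (c k)^2) / ?r^2"
    by (simp add: power_mult_distrib power_divide sum_distrib_left sum_divide_distrib)
   also have "... = t^2" using \<rho> by simp
   finally show "char (distr P borel f) t = char std_normal_distribution t" by (simp add: char_std_normal_distribution)
  qed
 qed
 then have "measure std_normal_distribution {w. \<bar>w\<bar> \<le> h / ?r} = measure (distr P borel f) {w. \<bar>w\<bar> \<le> h / ?r}" by simp
 also have "... = measure P (f -` {w. \<bar>w\<bar> \<le> h / ?r} \<inter> space P)" by (rule measure_distr[OF f]) measurable
 also have "f -` {w. \<bar>w\<bar> \<le> h / ?r} \<inter> space P = {b\<in>space P. \<bar>\<Sum>k=0..<q. c k * V k b\<bar> \<le> h}"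
  unfolding f_def abs_divide abs_of_pos[OF r] using r by (auto simp: divide_le_cancel)
 finally show ?thesis ..
qed

text \<open>Fubini for independent \<open>T\<close> and \<open>Z\<close>: the measure of the section
  of \<open>C\<close> at \<open>T\<close> is the conditional probability given \<open>T\<close>,
  tested here against the events \<open>T b \<in> A\<close>.\<close>

lemma independent_section_integral:
 assumes M: "prob_space M" and T: "T \<in> measurable M N" and Z: "Z \<in> measurable M K" and Q: "prob_space Q" and sQ: "sets Q = sets K"
  and ind: "distr M (N \<Otimes>\<^sub>M K) (\<lambda>b. (T b, Z b)) = distr M N T \<Otimes>\<^sub>M Q"
  and C: "C \<in> sets (N \<Otimes>\<^sub>M K)" and A: "A \<in> sets N"
 shows "measure M {b\<in>space M. T b \<in> A \<and> (T b, Z b) \<in> C} = (\<integral>b. indicator A (T b) * measure Q (Pair (T b) -` C) \<partial>M)"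
  and "(\<lambda>t. measure Q (Pair t -` C)) \<in> borel_measurable N"
proof -
 interpret M: prob_space M by fact
 interpret Q: prob_space Q by fact
 interpret D: prob_space "distr M N T" by (rule M.prob_space_distr[OF T])
 interpret DQ: pair_prob_space "distr M N T" Q ..
 have s: "sets (distr M N T \<Otimes>\<^sub>M Q) = sets (N \<Otimes>\<^sub>M K)" by (intro sets_pair_measure_cong) (auto simp: sQ)
 have sNQ: "sets (N \<Otimes>\<^sub>M Q) = sets (N \<Otimes>\<^sub>M K)" by (intro sets_pair_measure_cong) (auto simp: sQ)
 show meas: "(\<lambda>t. measure Q (Pair t -` C)) \<in> borel_measurable N"
  unfolding measure_def using Q.measurable_emeasure_Pair[of C N] C sNQ by simp
 let ?B = "(A \<times> space K) \<inter> C"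
 have B: "?B \<in> sets (N \<Otimes>\<^sub>M K)" using A C by auto
 have TZ: "(\<lambda>b. (T b, Z b)) \<in> measurable M (N \<Otimes>\<^sub>M K)" using T Z by simp
 have "{b\<in>space M. T b \<in> A \<and> (T b, Z b) \<in> C} = (\<lambda>b. (T b, Z b)) -` ?B \<inter> space M"
  using measurable_space[OF Z] by auto
 then have "measure M {b\<in>space M. T b \<in> A \<and> (T b, Z b) \<in> C} = measure (distr M N T \<Otimes>\<^sub>M Q) ?B"
  unfolding ind[symmetric] by (simp add: measure_distr[OF TZ B])
 also have "... = (\<integral>z. indicator ?B z \<partial>(distr M N T \<Otimes>\<^sub>M Q))"
  using sets.sets_into_space[of ?B "distr M N T \<Otimes>\<^sub>M Q"] B s by (simp add: Int_absorb2)
 also have "... = (\<integral>t. (\<integral>z. indicator ?B (t, z) \<partial>Q) \<partial>distr M N T)"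
  by (rule DQ.integral_fst'[symmetric]) (use B s in \<open>auto intro!: integrable_real_indicator simp: DQ.emeasure_eq_measure\<close>)
 also have "... = (\<integral>t. indicator A t * measure Q (Pair t -` C) \<partial>distr M N T)"
 proof (rule Bochner_Integration.integral_cong[OF refl])
  fix t
  have "Pair t -` C \<subseteq> space Q" using sets.sets_into_space[OF C] sets_eq_imp_space_eq[OF sQ] by (auto simp: space_pair_measure)
  then have "(\<lambda>z. indicator ?B (t, z) :: real) = (\<lambda>z. indicator A t * indicator (Pair t -` C) z)"
   using sets_eq_imp_space_eq[OF sQ] by (auto simp: fun_eq_iff split: split_indicator)
  then show "(\<integral>z. indicator ?B (t, z) \<partial>Q) = indicator A t * measure Q (Pair t -` C)"
   using \<open>Pair t -` C \<subseteq> space Q\<close> by (simp add: Int_absorb2)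
 qed
 also have "... = (\<integral>b. indicator A (T b) * measure Q (Pair (T b) -` C) \<partial>M)"
  by (rule integral_distr[OF T]) (use meas A in measurable)
 finally show "measure M {b\<in>space M. T b \<in> A \<and> (T b, Z b) \<in> C} = (\<integral>b. indicator A (T b) * measure Q (Pair (T b) -` C) \<partial>M)" .
qed

section \<open>Conditional coverage\<close>

lemma measurable_standardized: "standardized R b s xs k \<in> borel_measurable obs_space"
proof -
 note [measurable] = measurable_regressor
 have [measurable]: "(\<lambda>z :: obs. fst z) \<in> borel_measurable obs_space" by (rule measurable_fst)
 show ?thesis unfolding standardized_def by measurable
qed

text \<open>The event of being covered by the interval of a fixed model, as a set of pairs of a
  training sample and a new observation; its sections carry the conditional probabilities.\<close>

definition coverage_set :: "nat => real => real => (model => nat set) => real => model => ((nat => obs) \<times> obs) set" where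
 "coverage_set n c1 c2 B \<alpha> m = {w\<in>space (training_space n \<Otimes>\<^sub>M obs_space).
   \<bar>fst (snd w) - (\<Sum>k=0..<length (block1 B m @ block2 B m). snd (snd w) ((block1 B m @ block2 B m) ! k) * theta_JS n c1 c2 (block1 B m) (block2 B m) (fst w) $ k)\<bar>
    \<le> quantile std_normal_distribution (1 - \<alpha> / 2) * rho_hat n c1 c2 B (fst w) m}"

lemma sets_coverage_set: "coverage_set n c1 c2 B \<alpha> m \<in> sets (training_space n \<Otimes>\<^sub>M obs_space)"
proof -
 let ?N = "training_space n \<Otimes>\<^sub>M obs_space" let ?xs = "block1 B m @ block2 B m"
 have th: "(\<lambda>w. theta_JS n c1 c2 (block1 B m) (block2 B m) (fst w) $ k) \<in> borel_measurable ?N" if "k \<in> {0..<length ?xs}" for k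
  by (rule measurable_compose[OF measurable_fst meas_vec_entry[OF meas_vec_theta_JS]]) (use that in simp)
 have y: "(\<lambda>w. fst (snd w)) \<in> borel_measurable ?N" by (rule measurable_compose[OF measurable_snd measurable_fst])
 have x: "(\<lambda>w. snd (snd w) i) \<in> borel_measurable ?N" for i by (rule measurable_compose[OF measurable_snd measurable_regressor])
 have r: "(\<lambda>w. rho_hat n c1 c2 B (fst w) m) \<in> borel_measurable ?N" by (rule measurable_compose[OF measurable_fst measurable_rho_hat])
 show ?thesis
  unfolding coverage_set_def
  by (intro borel_measurable_le borel_measurable_abs borel_measurable_diff borel_measurable_sum borel_measurable_times th y x r borel_measurable_const)
qed

definition coverage :: "nat => real => real => (model => nat set) => real => obs measure => model => (nat => obs) => real" where
 "coverage n c1 c2 B \<alpha> Q m t = measure Q (Pair t -` coverage_set n c1 c2 B \<alpha> m)"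

context
 fixes P :: "'a measure" and y u :: "'a => real" and x :: "nat => 'a => real" and \<beta> :: "nat => real" and \<sigma>2 :: real
  and M :: "'b measure" and Z :: "nat => 'b => obs" and n :: nat
 assumes dgp: "data_generating_process P y x u \<beta> \<sigma>2" and iid: "iid_copies M Z n P y x"
begin

interpretation P: prob_space P using dgp by (simp add: data_generating_process_def)
interpretation M: prob_space M using iid by (simp add: iid_copies_def)

abbreviation "Q \<equiv> distr P obs_space (\<lambda>v. (y v, \<lambda>i. x i v))"
abbreviation "T \<equiv> \<lambda>v. \<lambda>j\<in>{1..n}. Z j v"

lemma measurable_process: "(\<lambda>v. (y v, \<lambda>i. x i v)) \<in> measurable P obs_space"
proof -
 have "y \<in> borel_measurable P" "x i \<in> borel_measurable P" for i using dgp by (auto simp: data_generating_process_def)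
 then show ?thesis by (intro measurable_Pair measurable_PiM_single') auto
qed

lemma prob_space_Q: "prob_space Q"
 by (rule P.prob_space_distr[OF measurable_process])

lemma measurable_copy: "j \<in> {0..n} ==> Z j \<in> measurable M obs_space"
 using iid by (auto simp: iid_copies_def M.indep_vars_def)

lemma measurable_training: "T \<in> measurable M (training_space n)"
 by (rule measurable_restrict) (use measurable_copy in auto)

text \<open>Independence is available for restrictions to disjoint index sets, so copy 0 first
  appears as a function on the set \<open>{0}\<close> and is then evaluated at 0.\<close>

lemma distr_training_new: "distr M (training_space n \<Otimes>\<^sub>M obs_space) (\<lambda>v. (T v, Z 0 v)) = distr M (training_space n) T \<Otimes>\<^sub>M Q"
proof -
 have ind: "M.indep_vars (\<lambda>_. obs_space) Z {0..n}" and law: "distr M obs_space (Z 0) = Q" using iid by (auto simp: iid_copies_def)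
 let ?S = "\<Pi>\<^sub>M j\<in>{0::nat}. obs_space" let ?Z = "\<lambda>v. restrict (\<lambda>j. Z j v) {0}"
 have "M.indep_var (training_space n) T ?S ?Z"
  by (rule M.indep_var_restrict[OF ind]) auto
 then have d: "distr M (training_space n) T \<Otimes>\<^sub>M distr M ?S ?Z = distr M (training_space n \<Otimes>\<^sub>M ?S) (\<lambda>v. (T v, ?Z v))"
  and Z: "?Z \<in> measurable M ?S" unfolding M.indep_var_distribution_eq by auto
 have p: "(\<lambda>f. f 0) \<in> measurable ?S obs_space" by (rule measurable_component_singleton) simp
 have Q: "distr (distr M ?S ?Z) obs_space (\<lambda>f. f 0) = Q"
  using distr_distr[OF p Z] law by (simp add: comp_def)
 have i: "distr (distr M (training_space n) T) (training_space n) (\<lambda>t. t) = distr M (training_space n) T"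
  using distr_distr[OF measurable_ident_sets[OF refl] measurable_training] by (simp add: comp_def)
 interpret Q: prob_space Q by (rule prob_space_Q)
 have sf: "sigma_finite_measure (distr (distr M ?S ?Z) obs_space (\<lambda>f. f 0))" unfolding Q by (rule Q.sigma_finite_measure_axioms)
 have "distr M (training_space n) T \<Otimes>\<^sub>M Q
   = distr (distr M (training_space n) T \<Otimes>\<^sub>M distr M ?S ?Z) (training_space n \<Otimes>\<^sub>M obs_space) (\<lambda>(t, f). (t, f 0))"
  using pair_measure_distr[of "\<lambda>t. t" "distr M (training_space n) T" "training_space n" "\<lambda>f. f 0" "distr M ?S ?Z" obs_space, OF _ _ sf] p
  unfolding Q i by (simp add: measurable_distr_eq1)
 also have "... = distr M (training_space n \<Otimes>\<^sub>M obs_space) ((\<lambda>(t, f). (t, f 0)) \<circ> (\<lambda>v. (T v, ?Z v)))"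
  unfolding d
 proof (rule distr_distr)
  show "(\<lambda>(t, f). (t, f 0)) \<in> measurable (training_space n \<Otimes>\<^sub>M ?S) (training_space n \<Otimes>\<^sub>M obs_space)"
   unfolding case_prod_unfold by (rule measurable_Pair[OF measurable_fst measurable_compose[OF measurable_snd p]])
  show "(\<lambda>v. (T v, ?Z v)) \<in> measurable M (training_space n \<Otimes>\<^sub>M ?S)" by (rule measurable_Pair[OF measurable_training Z])
 qed
 finally show ?thesis by (simp add: comp_def)
qed

text \<open>The exception event is the preimage of that of \<open>prediction_error_tail\<close>
  under the standardized sample \<open>g\<close>, whose law is Gaussian. The two alternatives in
  \<open>qc\<close> lead to the two bounds of the theorem.\<close>

lemma model_exception:
 assumes m: "candidate_model n B m" and c: "0 \<le> c1" "0 \<le> c2" and \<alpha>: "0 < \<alpha>" "\<alpha> < 1" and \<epsilon>: "0 < \<epsilon>" and q: "0 < q" "q \<le> 1"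
  and qc: "q \<le> (101/100) * (real (card (B m)) / (real n + 1)) \<or> q * P.variance y \<le> \<sigma>2"
 obtains E where "E \<in> sets M"
  "measure M E \<le> 38 * exp (- (real n * q^2 * (1 - real (card (coords m)) / real n) ^ 5 * (4 * \<epsilon> / (1 + 4 * \<epsilon>))^2 / 14400))"
  "\<And>v. v \<in> space M - E ==> \<bar>(1 - \<alpha>) - coverage n c1 c2 B \<alpha> Q m (T v)\<bar> \<le> \<epsilon>"
proof -
 let ?xs1 = "block1 B m" let ?xs2 = "block2 B m" let ?xs = "?xs1 @ ?xs2"
 note bl = candidate_model_blocks[OF m]
 let ?p1 = "length ?xs1" let ?p2 = "length ?xs2" let ?p = "?p1 + ?p2"
 have len: "length ?xs = ?p" by simp
 obtain R b s where
  R: "\<And>k. k < ?p ==> 0 < R k k" "\<And>i k. k < ?p ==> k < i ==> R i k = 0"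
  and s: "0 < s" "\<sigma>2 \<le> s^2" and var: "P.variance y = (\<Sum>k=0..<?p. (b k)^2) + s^2"
  and char: "\<And>c. (\<integral>v. iexp (\<Sum>k=0..<Suc ?p. c k * standardized R b s ?xs k (y v, \<lambda>i. x i v)) \<partial>P)
    = exp (- (\<Sum>k=0..<Suc ?p. (c k)^2) / 2)"
  apply (rule standardized_representation[OF dgp bl(3), unfolded len])
  subgoal premises prems for R b s by (rule prems(1)[OF prems(2-7)])
  done
 interpret G: gaussian_regression n ?p1 ?p2 b s
  by unfold_locales (use bl s in auto)
 let ?V = "standardized R b s ?xs"
 let ?\<eta> = "4 * \<epsilon> / (1 + 4 * \<epsilon>)"
 have \<eta>: "0 < ?\<eta>" "?\<eta> < 1" using \<epsilon> by (auto simp: field_simps)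
 have qc': "q \<le> (101/100) * (G.\<phi>1 / (1 + G.\<phi>1)) \<or> q * G.t2 \<le> s^2"
  using qc
 proof
  assume a: "q \<le> (101/100) * (real (card (B m)) / (real n + 1))"
  have d: "0 < real n - real ?p1 + 1" using bl by simp
  then have "1 + G.\<phi>1 = (real n + 1) / (real n - real ?p1 + 1)" unfolding G.\<phi>1_def by (simp add: field_simps)
  \<comment> \<open>The ratio that \<open>estimated_error_close\<close> asks for is exactly
    \<open>p1 / (n + 1)\<close>; the slack \<open>101 / 100\<close> absorbs the passage from
    \<open>n + 1\<close> to \<open>n\<close>.\<close>
  then have "G.\<phi>1 / (1 + G.\<phi>1) = real ?p1 / (real n + 1)" using d by (simp add: G.\<phi>1_def)
  then show ?thesis using a bl(1) by simp
 next
  assume a: "q * P.variance y \<le> \<sigma>2"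
  have "(\<Sum>k=0..<?p2. (b (?p1 + k))^2) = (\<Sum>k\<in>{?p1..<?p}. (b k)^2)"
   using sum.shift_bounds_nat_ivl[of "\<lambda>k. (b k)^2" 0 ?p1 ?p2] by (simp add: add.commute)
  also have "... \<le> (\<Sum>k=0..<?p. (b k)^2)" by (rule sum_mono2) auto
  finally have "G.t2 \<le> P.variance y" unfolding var G.t2_def G.B2_def by simp
  then have "q * G.t2 \<le> q * P.variance y" using q by simp
  with a s(2) show ?thesis by linarith
 qed
 obtain E0 where E0: "E0 \<in> sets (gmat n (Suc ?p))"
  "measure (gmat n (Suc ?p)) E0 \<le> 38 * exp (- (real n * q^2 * (1 - real ?p / real n) ^ 5 * ?\<eta>^2 / 14400))"
  and close: "\<And>g a1 a2. g \<in> space (gmat n (Suc ?p)) - E0 ==> 0 \<le> a1 ==> a1 \<le> 1 ==> 0 \<le> a2 ==> a2 \<le> 1 ==>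
    fullrank (G.W g) \<and> \<bar>G.estimated_error a1 a2 g - G.prediction_error a1 a2 g\<bar> \<le> ?\<eta> * G.prediction_error a1 a2 g"
  by (rule G.prediction_error_tail[OF q \<eta> qc']) blast
 let ?I = "{0..<n} \<times> {0..<Suc ?p}"
 define g where "g v = (\<lambda>i\<in>?I. ?V (snd i) (Z (Suc (fst i)) v))" for v
 have law: "distr M (\<Pi>\<^sub>M i\<in>?I. borel) g = gmat n (Suc ?p)"
  unfolding g_def by (rule distr_sample_gmat[OF iid measurable_standardized measurable_process char])
 have mg: "g \<in> measurable M (\<Pi>\<^sub>M i\<in>?I. borel)"
  unfolding g_def by (intro measurable_restrict measurable_compose[OF measurable_copy measurable_standardized]) auto
 have E0': "E0 \<in> sets (\<Pi>\<^sub>M i\<in>?I. borel)" using E0(1) by (simp add: sets_gauss)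
 show thesis
 proof (rule that[of "g -` E0 \<inter> space M"])
  show "g -` E0 \<inter> space M \<in> sets M" by (rule measurable_sets[OF mg E0'])
  have "measure M (g -` E0 \<inter> space M) = measure (gmat n (Suc ?p)) E0"
   unfolding law[symmetric] by (rule measure_distr[OF mg E0', symmetric])
  then show "measure M (g -` E0 \<inter> space M) \<le> 38 * exp (- (real n * q^2 * (1 - real (card (coords m)) / real n) ^ 5 * ?\<eta>^2 / 14400))"
   using E0(2) unfolding bl(2) by simp
 next
  fix v assume v: "v \<in> space M - g -` E0 \<inter> space M"
  let ?D = "\<lambda>j. Z j v"
  have gs: "g v \<in> space (gmat n (Suc ?p)) - E0" using v unfolding space_gauss by (auto simp: g_def)
  \<comment> \<open>The range of the actual shrinkage factors is proved from full rank, so full rank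
    is first extracted with the factors 0.\<close>
  have fr: "fullrank (G.W (g v))" using close[OF gs, of 0 0] by simp
  have gV: "g v (j, k) = standardized R b s (?xs1 @ ?xs2) k (?D (Suc j))" if "j < n" "k < Suc ?p" for j k
   using that by (simp add: g_def)
  define a1 where "a1 = shrink1 c1 (design n ?D ?xs1) (design n ?D ?xs2) (response n ?D)"
  define a2 where "a2 = shrink2 c2 (design n ?D ?xs1) (design n ?D ?xs2) (response n ?D)"
  note ctx = R(1) R(2) refl refl gV fr
  have a: "0 \<le> a1" "a1 \<le> 1" "0 \<le> a2" "a2 \<le> 1"
   unfolding a1_def a2_def by (rule G.shrink_range[OF ctx]; use c in simp)+
  let ?\<rho> = "G.prediction_error a1 a2 (g v)" let ?\<rho>h = "G.estimated_error a1 a2 (g v)"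
  have cl: "\<bar>?\<rho>h - ?\<rho>\<bar> \<le> ?\<eta> * ?\<rho>" using close[OF gs a] by blast
  define d where "d k = (if k < ?p then b k - G.theta_W (g v) a1 a2 k else s)" for k
  have d2: "(\<Sum>k=0..<Suc ?p. (d k)^2) = ?\<rho>"
   unfolding G.prediction_error_def sum.op_ivl_Suc d_def by (simp add: G.theta_W_def)
  have \<rho>: "0 < ?\<rho>" unfolding G.prediction_error_def using s(1) by (intro add_pos_nonneg sum_nonneg) auto
  have "?\<eta> * ?\<rho> < 1 * ?\<rho>" using \<eta>(2) \<rho> by (rule mult_strict_right_mono)
  then have \<rho>h: "0 < ?\<rho>h" using cl by linarith
  have "rho_hat2 n c1 c2 B (T v) m = ?\<rho>h"
   unfolding rho_hat2_def sample_restrict a1_def a2_def by (rule G.block_rho_hat2_estimated_error[OF ctx])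
  then have rh: "rho_hat n c1 c2 B (T v) m = sqrt ?\<rho>h" unfolding rho_hat_def using \<rho>h by simp
  have th: "theta_JS n c1 c2 ?xs1 ?xs2 (T v) = theta_JS n c1 c2 ?xs1 ?xs2 ?D"
   unfolding theta_JS_def sample_restrict ..
  let ?q = "quantile std_normal_distribution (1 - \<alpha> / 2)"
  have res: "fst z - (\<Sum>k=0..<?p. snd z (?xs ! k) * theta_JS n c1 c2 ?xs1 ?xs2 ?D $ k) = (\<Sum>k=0..<Suc ?p. d k * ?V k z)" for z
   unfolding theta_JS_def d_def a1_def a2_def by (rule G.prediction_residual[OF ctx])
  have Tsp: "T v \<in> space (training_space n)" using measurable_space[OF measurable_training] v by blast
  have "Pair (T v) -` coverage_set n c1 c2 B \<alpha> m = {z\<in>space Q. \<bar>\<Sum>k=0..<Suc ?p. d k * ?V k z\<bar> \<le> ?q * sqrt ?\<rho>h}"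
  proof -
   have "Pair (T v) -` coverage_set n c1 c2 B \<alpha> m = {z\<in>space obs_space.
    \<bar>fst z - (\<Sum>k=0..<?p. snd z (?xs ! k) * theta_JS n c1 c2 ?xs1 ?xs2 (T v) $ k)\<bar> \<le> ?q * rho_hat n c1 c2 B (T v) m}"
    unfolding coverage_set_def len using Tsp by (auto simp: space_pair_measure)
   then show ?thesis unfolding th rh res by simp
  qed
  then have "coverage n c1 c2 B \<alpha> Q m (T v) = measure Q {z\<in>space Q. \<bar>\<Sum>k=0..<Suc ?p. d k * ?V k z\<bar> \<le> ?q * sqrt ?\<rho>h}"
   unfolding coverage_def by (simp only:)
  also have "... = measure std_normal_distribution {w. \<bar>w\<bar> \<le> ?q * sqrt ?\<rho>h / sqrt (\<Sum>k=0..<Suc ?p. (d k)^2)}"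
  proof (rule gaussian_combination_coverage[OF prob_space_Q])
   show "?V k \<in> borel_measurable Q" for k using measurable_standardized[of R b s ?xs k] by simp
   fix c :: "nat => real"
   have "(\<lambda>z. iexp (\<Sum>k=0..<Suc ?p. c k * ?V k z)) \<in> borel_measurable obs_space"
    using measurable_standardized[of R b s ?xs] by measurable
   then have "(\<integral>z. iexp (\<Sum>k=0..<Suc ?p. c k * ?V k z) \<partial>Q) = (\<integral>v. iexp (\<Sum>k=0..<Suc ?p. c k * ?V k (y v, \<lambda>i. x i v)) \<partial>P)"
    by (rule integral_distr[OF measurable_process])
   also note char
   finally show "(\<integral>z. iexp (\<Sum>k=0..<Suc ?p. c k * ?V k z) \<partial>Q) = exp (- (\<Sum>k=0..<Suc ?p. (c k)^2) / 2)" .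
  qed (use d2 \<rho> in simp)
  finally have "coverage n c1 c2 B \<alpha> Q m (T v) = measure std_normal_distribution {w. \<bar>w\<bar> \<le> ?q * sqrt ?\<rho>h / sqrt ?\<rho>}" unfolding d2 .
  then show "\<bar>(1 - \<alpha>) - coverage n c1 c2 B \<alpha> Q m (T v)\<bar> \<le> \<epsilon>"
   using std_normal_coverage[OF \<epsilon> \<alpha> \<rho> cl] by simp
 qed
qed

text \<open>The events \<open>mhat v = m\<close> lie in the training algebra, so the selected model
  may be treated as fixed on each of them; for a fixed model the new observation is independent of
  the training sample.\<close>

lemma conditional_coverage_AE:
 assumes Ms: "finite Ms" "\<And>m. m \<in> Ms ==> candidate_model n B m"
  and mhat: "mhat \<in> measurable (training_algebra M Z n) (count_space Ms)"
 shows "AE v in M. conditional_coverage n c1 c2 B \<alpha> M Z mhat v = coverage n c1 c2 B \<alpha> Q (mhat v) (T v)"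
proof -
 let ?F = "training_algebra M Z n"
 have sF: "space ?F = space M" unfolding training_algebra_def by simp
 have FM: "sets ?F \<subseteq> sets M"
  unfolding training_algebra_def using measurable_training by (auto simp: sets_vimage_algebra2 measurable_def)
 have sub: "subalgebra M ?F" using sF FM by (simp add: subalgebra_def)
 interpret F: finite_measure_subalgebra M ?F by unfold_locales (rule sub)
 have FA: "\<exists>A'\<in>sets (training_space n). A = T -` A' \<inter> space M" if "A \<in> sets ?F" for A
  using that measurable_training unfolding training_algebra_def by (auto simp: sets_vimage_algebra2 measurable_def)
 let ?I = "\<lambda>m. {v\<in>space M. mhat v = m}"
 have I: "?I m \<in> sets ?F" if "m \<in> Ms" for m
  using measurable_sets[OF mhat, of "{m}"] that sF by (simp add: vimage_def Int_def conj_commute)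
 have mh: "mhat v \<in> Ms" if "v \<in> space M" for v using measurable_space[OF mhat] that sF by simp
 let ?C = "coverage_set n c1 c2 B \<alpha>" let ?h = "coverage n c1 c2 B \<alpha> Q"
 let ?S = "{v \<in> space M. fst (Z 0 v) \<in> prediction_interval n c1 c2 B \<alpha> (\<lambda>j. Z j v) (mhat v)}"
 note sec = independent_section_integral[OF M.prob_space_axioms measurable_training measurable_copy[of 0] prob_space_Q _ distr_training_new sets_coverage_set]
 have hT: "(\<lambda>t. ?h m t) \<in> borel_measurable (training_space n)" for m
  unfolding coverage_def by (rule sec(2)[OF _ _ sets.empty_sets]) auto
 have TF: "T \<in> measurable ?F (training_space n)"
  unfolding training_algebra_def by (rule measurable_vimage_algebra1) (use measurable_space[OF measurable_training] in auto)
 have hF: "(\<lambda>v. ?h m (T v)) \<in> borel_measurable ?F" for m by (rule measurable_compose[OF TF hT])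
 have h1: "0 \<le> ?h m t" "?h m t \<le> 1" for m t
  unfolding coverage_def using prob_space.prob_le_1[OF prob_space_Q] by auto
 have S_iff: "v \<in> ?S \<longleftrightarrow> (T v, Z 0 v) \<in> ?C (mhat v)" if v: "v \<in> space M" for v
 proof -
  let ?m = "mhat v" let ?D = "\<lambda>j. Z j v"
  have th: "theta_JS n c1 c2 (block1 B ?m) (block2 B ?m) (T v) = theta_JS n c1 c2 (block1 B ?m) (block2 B ?m) ?D"
   unfolding theta_JS_def sample_restrict ..
  have rh: "rho_hat n c1 c2 B (T v) ?m = rho_hat n c1 c2 B ?D ?m"
   unfolding rho_hat_def rho_hat2_def sample_restrict ..
  have "(T v, Z 0 v) \<in> space (training_space n \<Otimes>\<^sub>M obs_space)"
   using measurable_space[OF measurable_training v] measurable_space[OF measurable_copy[of 0] v] by (simp add: space_pair_measure)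
  then have "(T v, Z 0 v) \<in> ?C ?m \<longleftrightarrow> \<bar>fst (Z 0 v) - y_hat0 n c1 c2 B ?D ?m\<bar> \<le> quantile std_normal_distribution (1 - \<alpha> / 2) * rho_hat n c1 c2 B ?D ?m"
   unfolding coverage_set_def y_hat0_sum[OF Ms(2)[OF mh[OF v]]] by (simp only: mem_Collect_eq fst_conv snd_conv th rh simp_thms)
  also have "... \<longleftrightarrow> fst (Z 0 v) \<in> prediction_interval n c1 c2 B \<alpha> ?D ?m"
   unfolding prediction_interval_def Let_def by (auto simp: abs_le_iff)
  finally show ?thesis using v by simp
 qed
 have TZ: "(\<lambda>v. (T v, Z 0 v)) \<in> measurable M (training_space n \<Otimes>\<^sub>M obs_space)"
  by (rule measurable_Pair[OF measurable_training measurable_copy]) simp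
 let ?f = "\<lambda>m v. indicator (?I m) v * indicator (?C m) (T v, Z 0 v) :: real"
 let ?g = "\<lambda>m v. indicator (?I m) v * ?h m (T v) :: real"
 have f: "integrable M (?f m)" if "m \<in> Ms" for m
 proof (rule M.integrable_const_bound[where B = 1])
  have "?I m \<in> sets M" using I[OF that] FM by blast
  then show "?f m \<in> borel_measurable M"
   by (intro borel_measurable_times borel_measurable_indicator measurable_compose[OF TZ borel_measurable_indicator[OF sets_coverage_set]])
 qed (simp add: indicator_def)
 have gF: "?g m \<in> borel_measurable ?F" if "m \<in> Ms" for m
  by (intro borel_measurable_times borel_measurable_indicator I[OF that] hF)
 have g: "integrable M (?g m)" if "m \<in> Ms" for m
  by (rule M.integrable_const_bound[where B = 1, OF _ measurable_from_subalg[OF sub gF[OF that]]]) (use h1 in \<open>simp add: indicator_def\<close>)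
 have ae1: "AE v in M. real_cond_exp M ?F (\<lambda>v. \<Sum>m\<in>Ms. ?f m v) v = (\<Sum>m\<in>Ms. ?g m v)"
 proof (rule F.real_cond_exp_charact)
  fix A assume A: "A \<in> sets ?F"
  have AM: "A \<in> sets M" using A FM by blast
  have "(\<integral>v. indicator A v * ?f m v \<partial>M) = (\<integral>v. indicator A v * ?g m v \<partial>M)" if m: "m \<in> Ms" for m
  proof -
   \<comment> \<open>Events of the training algebra are preimages under \<open>T\<close>, which is
     the form in which \<open>independent_section_integral\<close> can be applied.\<close>
   obtain A' where A': "A' \<in> sets (training_space n)" "A \<inter> ?I m = T -` A' \<inter> space M" using FA[OF sets.Int[OF A I[OF m]]] by blast
   have iA: "indicator A v * indicator (?I m) v = (indicator A' (T v) :: real)" if "v \<in> space M" for v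
   proof -
    have "v \<in> A \<inter> ?I m \<longleftrightarrow> T v \<in> A'" using that A'(2) by blast
    then have "indicator (A \<inter> ?I m) v = (indicator A' (T v) :: real)" by (simp only: indicator_def)
    then show ?thesis unfolding indicator_inter_arith .
   qed
   have "(\<integral>v. indicator A v * ?f m v \<partial>M) = (\<integral>v. indicator {v\<in>space M. T v \<in> A' \<and> (T v, Z 0 v) \<in> ?C m} v \<partial>M)"
   proof (rule Bochner_Integration.integral_cong[OF refl])
    fix v assume v: "v \<in> space M"
    have "indicator A v * ?f m v = indicator A' (T v) * indicator (?C m) (T v, Z 0 v)"
     unfolding mult.assoc[symmetric] iA[OF v] ..
    also have "... = indicator {v\<in>space M. T v \<in> A' \<and> (T v, Z 0 v) \<in> ?C m} v" using v by (simp only: indicator_def mem_Collect_eq) simp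
    finally show "indicator A v * ?f m v = indicator {v\<in>space M. T v \<in> A' \<and> (T v, Z 0 v) \<in> ?C m} v" .
   qed
   also have "... = measure M {v\<in>space M. T v \<in> A' \<and> (T v, Z 0 v) \<in> ?C m}" by (simp add: Int_def conj_ac)
   also have "... = (\<integral>v. indicator A' (T v) * ?h m (T v) \<partial>M)"
    unfolding coverage_def by (rule sec(1)[OF _ _ A'(1)]) auto
   also have "... = (\<integral>v. indicator A v * ?g m v \<partial>M)"
    by (rule Bochner_Integration.integral_cong[OF refl], unfold mult.assoc[symmetric], subst iA) (assumption, rule refl)
   finally show ?thesis .
  qed
  moreover have "integrable M (\<lambda>v. indicator A v * ?f m v)" "integrable M (\<lambda>v. indicator A v * ?g m v)" if "m \<in> Ms" for m
   using integrable_mult_indicator[OF AM f[OF that]] integrable_mult_indicator[OF AM g[OF that]] by (simp_all only: real_scaleR_def)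
  ultimately show "(\<integral>v\<in>A. (\<Sum>m\<in>Ms. ?f m v) \<partial>M) = (\<integral>v\<in>A. (\<Sum>m\<in>Ms. ?g m v) \<partial>M)"
   unfolding set_lebesgue_integral_def real_scaleR_def sum_distrib_left by (simp only: Bochner_Integration.integral_sum cong: sum.cong)
 next
  show "integrable M (\<lambda>v. \<Sum>m\<in>Ms. ?f m v)" by (rule Bochner_Integration.integrable_sum) (rule f)
  show "integrable M (\<lambda>v. \<Sum>m\<in>Ms. ?g m v)" by (rule Bochner_Integration.integrable_sum) (rule g)
  show "(\<lambda>v. \<Sum>m\<in>Ms. ?g m v) \<in> borel_measurable ?F" by (rule borel_measurable_sum) (rule gF)
 qed
 have pick: "(\<Sum>m\<in>Ms. indicator (?I m) v * (F m :: real)) = F (mhat v)" if "v \<in> space M" for v F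
 proof -
  have "(\<Sum>m\<in>Ms. indicator (?I m) v * F m) = (\<Sum>m\<in>Ms. if m = mhat v then F m else 0)"
   by (rule sum.cong) (use that in \<open>auto simp: indicator_def\<close>)
  then show ?thesis using mh[OF that] Ms(1) by simp
 qed
 have ae2: "AE v in M. real_cond_exp M ?F (indicator ?S) v = real_cond_exp M ?F (\<lambda>v. \<Sum>m\<in>Ms. ?f m v) v"
 proof (rule F.real_cond_exp_cong)
  have eq: "indicator ?S v = (\<Sum>m\<in>Ms. ?f m v)" if "v \<in> space M" for v
  proof -
   have "(\<Sum>m\<in>Ms. ?f m v) = indicator (?C (mhat v)) (T v, Z 0 v)" by (rule pick[OF that])
   moreover have "indicator ?S v = (indicator (?C (mhat v)) (T v, Z 0 v) :: real)" using S_iff[OF that] by (simp only: indicator_def)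
   ultimately show ?thesis by (simp only:)
  qed
  have int: "integrable M (\<lambda>v. \<Sum>m\<in>Ms. ?f m v)" by (rule Bochner_Integration.integrable_sum) (rule f)
  show "AE v in M. indicator ?S v = (\<Sum>m\<in>Ms. ?f m v)" using eq by simp
  show m: "(\<lambda>v. \<Sum>m\<in>Ms. ?f m v) \<in> borel_measurable M" by (rule borel_measurable_integrable[OF int])
  show "(indicator ?S :: 'b => real) \<in> borel_measurable M" using m by (rule measurable_cong[THEN iffD2, rotated]) (rule eq)
 qed
 from ae1 ae2 AE_space show ?thesis unfolding conditional_coverage_def
 proof eventually_elim
  case (elim v)
  show ?case unfolding elim(2) elim(1) by (rule pick[OF elim(3)])
 qed
qed

end

section \<open>Union bound over the models\<close>

text \<open>The exception event must belong to the training algebra, whereas the events from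
  \<open>model_exception\<close> are only known to be in \<open>M\<close>. It is therefore defined
  by the conditional coverage itself and shown to lie, up to a null set, in the union of those
  events.\<close>

lemma exception_event:
 fixes P :: "'a measure" and M :: "'b measure" and q :: "model => real"
 assumes dgp: "data_generating_process P y x u \<beta> \<sigma>2" and iid: "iid_copies M Z n P y x"
  and Ms: "finite Ms" "\<And>m. m \<in> Ms ==> candidate_model n B m"
  and c: "0 \<le> c1" "0 \<le> c2" and \<alpha>: "0 < \<alpha>" "\<alpha> < 1"
  and mhat: "mhat \<in> measurable (training_algebra M Z n) (count_space Ms)" and \<epsilon>: "0 < \<epsilon>"
  and q: "\<And>m. m \<in> Ms ==> 0 < q m" "\<And>m. m \<in> Ms ==> q m \<le> 1"
  and qc: "\<And>m. m \<in> Ms ==> q m \<le> (101/100) * (real (card (B m)) / (real n + 1)) \<or> q m * prob_space.variance P y \<le> \<sigma>2"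
  and K: "\<And>m. m \<in> Ms ==> 38 * exp (- (real n * (q m)^2 * (1 - real (card (coords m)) / real n) ^ 5 * (4 * \<epsilon> / (1 + 4 * \<epsilon>))^2 / 14400)) \<le> K"
 shows "\<exists>E\<in>sets (training_algebra M Z n).
   (\<forall>\<omega>\<in>space M - E. \<bar>(1 - \<alpha>) - conditional_coverage n c1 c2 B \<alpha> M Z mhat \<omega>\<bar> \<le> \<epsilon>) \<and> measure M E \<le> real (card Ms) * K"
proof -
 interpret M: prob_space M using iid by (simp add: iid_copies_def)
 let ?F = "training_algebra M Z n" let ?cc = "conditional_coverage n c1 c2 B \<alpha> M Z mhat"
 let ?Q = "distr P obs_space (\<lambda>\<omega>. (y \<omega>, \<lambda>i. x i \<omega>))" let ?T = "\<lambda>\<omega>. \<lambda>j\<in>{1..n}. Z j \<omega>"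
 have sF: "space ?F = space M" unfolding training_algebra_def by simp
 have T: "?T \<in> measurable M (training_space n)" by (rule measurable_training[OF dgp iid])
 have FM: "sets ?F \<subseteq> sets M"
  unfolding training_algebra_def using T by (auto simp: sets_vimage_algebra2 measurable_def)
 let ?E = "{\<omega>\<in>space ?F. \<epsilon> < \<bar>(1 - \<alpha>) - ?cc \<omega>\<bar>}"
 have [measurable]: "?cc \<in> borel_measurable ?F" unfolding conditional_coverage_def by (rule borel_measurable_cond_exp)
 have E: "?E \<in> sets ?F" by measurable
 have "\<exists>N. N \<in> sets M \<and> measure M N \<le> K \<and> (\<forall>\<omega>\<in>space M - N. \<bar>(1 - \<alpha>) - coverage n c1 c2 B \<alpha> ?Q m (?T \<omega>)\<bar> \<le> \<epsilon>)" if m: "m \<in> Ms" for m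
 proof (rule model_exception[OF dgp iid Ms(2)[OF m] c \<alpha> \<epsilon> q[OF m] qc[OF m]])
  fix E assume "E \<in> sets M" "\<And>\<omega>. \<omega> \<in> space M - E ==> \<bar>(1 - \<alpha>) - coverage n c1 c2 B \<alpha> ?Q m (?T \<omega>)\<bar> \<le> \<epsilon>"
   "measure M E \<le> 38 * exp (- (real n * (q m)^2 * (1 - real (card (coords m)) / real n) ^ 5 * (4 * \<epsilon> / (1 + 4 * \<epsilon>))^2 / 14400))"
  then show ?thesis using order_trans[OF _ K[OF m]] by (intro exI[of _ E] conjI ballI)
 qed
 then have "\<forall>m\<in>Ms. \<exists>N. N \<in> sets M \<and> measure M N \<le> K \<and> (\<forall>\<omega>\<in>space M - N. \<bar>(1 - \<alpha>) - coverage n c1 c2 B \<alpha> ?Q m (?T \<omega>)\<bar> \<le> \<epsilon>)"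
  by blast
 from bchoice[OF this] obtain N where N0: "\<forall>m\<in>Ms. N m \<in> sets M \<and> measure M (N m) \<le> K \<and> (\<forall>\<omega>\<in>space M - N m. \<bar>(1 - \<alpha>) - coverage n c1 c2 B \<alpha> ?Q m (?T \<omega>)\<bar> \<le> \<epsilon>)" ..
 have N: "N m \<in> sets M" "measure M (N m) \<le> K" "\<omega> \<in> space M - N m ==> \<bar>(1 - \<alpha>) - coverage n c1 c2 B \<alpha> ?Q m (?T \<omega>)\<bar> \<le> \<epsilon>" if "m \<in> Ms" for m \<omega>
  using bspec[OF N0 that] by blast+
 have ae: "AE \<omega> in M. ?cc \<omega> = coverage n c1 c2 B \<alpha> ?Q (mhat \<omega>) (?T \<omega>)"
  by (rule conditional_coverage_AE[OF dgp iid Ms(1) _ mhat]) (rule Ms(2))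
 have "AE \<omega> in M. \<omega> \<in> ?E \<longrightarrow> \<omega> \<in> (\<Union>m\<in>Ms. N m)"
  using ae AE_space
 proof eventually_elim
  case (elim \<omega>)
  have "mhat \<omega> \<in> Ms" using measurable_space[OF mhat] elim(2) sF by simp
  then have mh: "mhat \<omega> \<in> Ms" .
  show ?case
  proof (intro impI UN_I[OF mh], rule ccontr)
   assume "\<omega> \<in> ?E" "\<omega> \<notin> N (mhat \<omega>)"
   then show False using N(3)[OF mh, of \<omega>] elim by simp
  qed
 qed
 then have "measure M ?E \<le> measure M (\<Union>m\<in>Ms. N m)"
  by (rule M.finite_measure_mono_AE) (use N Ms in \<open>auto intro!: sets.finite_UN\<close>)
 also have "... \<le> (\<Sum>m\<in>Ms. measure M (N m))" by (rule M.finite_measure_subadditive_finite) (use N Ms in auto)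
 also have "... \<le> (\<Sum>m\<in>Ms. K)" by (rule sum_mono) (rule N)
 finally have "measure M ?E \<le> real (card Ms) * K" by simp
 moreover have "\<forall>\<omega>\<in>space M - ?E. \<bar>(1 - \<alpha>) - ?cc \<omega>\<bar> \<le> \<epsilon>" using sF by auto
 ultimately show ?thesis using E by blast
qed

theorem corollary6:
  fixes P :: "'a measure" and y u :: "'a \<Rightarrow> real" and x :: "nat \<Rightarrow> 'a \<Rightarrow> real"
    and \<beta> :: "nat \<Rightarrow> real" and \<sigma>2 :: real
    and M :: "'b measure" and Z :: "nat \<Rightarrow> 'b \<Rightarrow> obs" and n :: nat
    and Ms :: "model set" and B :: "model \<Rightarrow> nat set" and mhat :: "'b \<Rightarrow> model"
    and c1 c2 \<alpha> :: real and r s :: nat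
  assumes "data_generating_process P y x u \<beta> \<sigma>2"
    and "iid_copies M Z n P y x"
    and "finite Ms" and "Ms \<noteq> {}" and "\<And>m. m \<in> Ms \<Longrightarrow> candidate_model n B m"
    and "0 \<le> c1" and "0 \<le> c2" and "0 < \<alpha>" and "\<alpha> < 1"
    and "selects_minimizer n c1 c2 B Ms M Z mhat"
    and "r = (INF m\<in>Ms. card (B m))" and "s = (SUP m\<in>Ms. card (coords m))"
  shows "(\<forall>\<epsilon>>0.
      \<exists>E\<in>sets (training_algebra M Z n).
        (\<forall>\<omega>\<in>space M - E. \<bar>(1 - \<alpha>) - conditional_coverage n c1 c2 B \<alpha> M Z mhat \<omega>\<bar> \<le> \<epsilon>) \<and>
        measure M E \<le> 31 * real (card Ms) * real s *
          exp (- (real n * (real r / real n)\<^sup>2 * (1 - real s / real n) ^ 5 *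
                  (\<epsilon>\<^sup>2 / (900 * (1 + 4 * \<epsilon>)\<^sup>2))))) \<and>
    (\<forall>d>0. prob_space.variance P y / \<sigma>2 \<le> d \<longrightarrow> (\<forall>\<epsilon>>0.
      \<exists>E\<in>sets (training_algebra M Z n).
        (\<forall>\<omega>\<in>space M - E. \<bar>(1 - \<alpha>) - conditional_coverage n c1 c2 B \<alpha> M Z mhat \<omega>\<bar> \<le> \<epsilon>) \<and>
        measure M E \<le> 31 * real (card Ms) * real s *
          exp (- (real n * (1 - real s / real n) ^ 5 *
                  (\<epsilon>\<^sup>2 / (1768 * (1 + 4 * \<epsilon>)\<^sup>2 * d\<^sup>2))))))"
proof -
 interpret M: prob_space M using assms(2) by (simp add: iid_copies_def)
 have mhat: "mhat \<in> measurable (training_algebra M Z n) (count_space Ms)" using assms(10) by (simp add: selects_minimizer_def)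
 note cand = assms(5)
 note event = exception_event[OF assms(1,2,3) cand assms(6-9) mhat]
 have r: "r \<le> card (B m)" and ms: "card (coords m) \<le> s" if "m \<in> Ms" for m
  unfolding assms(11,12) using that assms(3) by (auto intro!: cINF_lower cSUP_upper bdd_above_finite)
 have "s \<in> (\<lambda>m. card (coords m)) ` Ms"
  unfolding assms(12) using assms(3,4) by (subst cSup_eq_Max) (auto intro!: Max_in)
 then have s: "6 \<le> s" "s < n" using cand by (auto simp: candidate_model_def)
 have n0: "0 < real n" using s by simp
 define k where "k m = 1 - real (card (coords m)) / real n" for m
 define \<kappa> where "\<kappa> = 1 - real s / real n"
 have \<kappa>: "0 \<le> \<kappa>" "\<kappa> \<le> 1" using s n0 by (auto simp: \<kappa>_def)
 have k: "\<kappa> ^ 5 \<le> (k m) ^ 5" if "m \<in> Ms" for m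
  using ms[OF that] \<kappa>(1) n0 by (intro power_mono) (auto simp: \<kappa>_def k_def divide_right_mono)
 have k0: "0 \<le> (k m) ^ 5" if "m \<in> Ms" for m using k[OF that] zero_le_power[OF \<kappa>(1), of 5] by linarith
 have card: "1 \<le> real (card Ms)" using assms(3,4) by (simp add: Suc_leI card_gt_0_iff)
 have \<eta>: "(4 * \<epsilon> / (1 + 4 * \<epsilon>))^2 / 14400 = \<epsilon>^2 / (900 * (1 + 4 * \<epsilon>)^2)" for \<epsilon> :: real
  by (simp add: power_divide power_mult_distrib)
 \<comment> \<open>As \<open>s\<close> is at least 6, the factor \<open>31 * s\<close> is at least
   186 and absorbs the 38 exponentials of one model.\<close>
 have bound: "38 * exp (- a') \<le> 31 * real s * exp (- a)" if "a \<le> a'" for a a' :: real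
 proof -
  have "exp (- a') \<le> exp (- a)" using that by simp
  then show ?thesis using s by (intro mult_mono) auto
 qed
 have p1: "3 \<le> card (B m)" "card (B m) < n" if "m \<in> Ms" for m
 proof -
  show "3 \<le> card (B m)" using cand[OF that] by (simp add: candidate_model_def)
  have "card (B m) \<le> card (coords m)" using cand[OF that] by (auto simp: candidate_model_def intro!: card_mono)
  then show "card (B m) < n" using ms[OF that] s by simp
 qed
 let ?claim = "\<lambda>\<epsilon> K. \<exists>E\<in>sets (training_algebra M Z n).
  (\<forall>\<omega>\<in>space M - E. \<bar>(1 - \<alpha>) - conditional_coverage n c1 c2 B \<alpha> M Z mhat \<omega>\<bar> \<le> \<epsilon>) \<and> measure M E \<le> K"
 show ?thesis
 proof (intro conjI allI impI)
  fix \<epsilon> :: real assume \<epsilon>: "0 < \<epsilon>"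
  let ?e = "\<epsilon>^2 / (900 * (1 + 4 * \<epsilon>)^2)"
  let ?L = "real n * (real r / real n)^2 * \<kappa> ^ 5 * ?e"
  have e0: "0 \<le> ?e" by simp
  show "?claim \<epsilon> (31 * real (card Ms) * real s * exp (- (real n * (real r / real n)^2 * (1 - real s / real n) ^ 5 * ?e)))"
  \<comment> \<open>For small \<open>n\<close> the exponent is at least \<open>- 1 / 144\<close>,
    the stated bound exceeds 1, and the whole space serves as exception event. From
    \<open>n = 100\<close> on, \<open>n + 1\<close> is at most \<open>(101/100) * n\<close>, which
    the choice of \<open>q\<close> requires.\<close>
  proof (cases "n < 100")
   case True
   have "r \<le> n" using assms(4) r p1 by (meson ex_in_conv less_imp_le order_trans)
   then have rn: "(real r / real n)^2 \<le> 1" using n0 by (intro power_le_one) auto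
   have e1: "?e \<le> 1 / 14400"
   proof -
    have "(4 * \<epsilon> / (1 + 4 * \<epsilon>))^2 \<le> 1" using \<epsilon> by (intro power_le_one) auto
    then show ?thesis unfolding \<eta>[symmetric] by simp
   qed
   have k1: "\<kappa> ^ 5 \<le> 1" using \<kappa> by (intro power_le_one) auto
   define L where "L = ?L"
   have "L \<le> 100 * 1 * 1 * (1 / 14400)"
    unfolding L_def by (intro mult_mono rn k1 e1) (use True \<kappa> in auto)
   then have "exp (- 1) \<le> exp (- L)" by simp
   moreover have "1 / 3 \<le> exp (- 1 :: real)" using exp_le by (simp add: exp_minus field_simps)
   ultimately have X: "1 / 3 \<le> exp (- L)" by linarith
   define C where "C = 31 * real (card Ms) * real s"
   have "31 * 1 * 6 \<le> C" unfolding C_def using card s by (intro mult_mono) auto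
   then have "186 * (1 / 3) \<le> C * exp (- L)" using X by (intro mult_mono) auto
   then have "measure M (space M) \<le> C * exp (- L)" by (simp add: M.prob_space)
   moreover have "space M \<in> sets (training_algebra M Z n)"
    using sets.top[of "training_algebra M Z n"] by (simp add: training_algebra_def)
   ultimately show ?thesis unfolding C_def L_def \<kappa>_def by (intro bexI[of _ "space M"]) auto
  next
   case False
   define q where "q m = real (card (B m)) / real n" for m
   have "?claim \<epsilon> (real (card Ms) * (31 * real s * exp (- ?L)))"
   proof (rule event[OF _ \<epsilon>, where q = q])
    fix m assume m: "m \<in> Ms"
    show "0 < q m" "q m \<le> 1" using p1[OF m] n0 by (auto simp: q_def)
    have "q m \<le> (101/100) * (real (card (B m)) / (real n + 1))"
    proof -
     have "real (card (B m)) * (real n + 1) \<le> real (card (B m)) * ((101/100) * real n)" using False by (intro mult_left_mono) auto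
     then show ?thesis unfolding q_def using n0 by (simp add: field_simps)
    qed
    then show "q m \<le> (101/100) * (real (card (B m)) / (real n + 1)) \<or> q m * prob_space.variance P y \<le> \<sigma>2" ..
    have "(real r / real n)^2 \<le> (q m)^2" using r[OF m] n0 by (intro power_mono) (auto simp: q_def divide_right_mono)
    then have "?L \<le> real n * (q m)^2 * (k m) ^ 5 * ?e"
     using k[OF m] k0[OF m] \<kappa> e0 by (intro mult_mono) auto
    moreover have "real n * (q m)^2 * (1 - real (card (coords m)) / real n) ^ 5 * (4 * \<epsilon> / (1 + 4 * \<epsilon>))^2 / 14400 = real n * (q m)^2 * (k m) ^ 5 * ?e"
     unfolding k_def \<eta>[symmetric] by (simp only: times_divide_eq_right)
    ultimately show "38 * exp (- (real n * (q m)^2 * (1 - real (card (coords m)) / real n) ^ 5 * (4 * \<epsilon> / (1 + 4 * \<epsilon>))^2 / 14400)) \<le> 31 * real s * exp (- ?L)"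
     by (simp only: bound)
   qed
   then show ?thesis unfolding \<kappa>_def by (simp only: mult_ac)
  qed
 next
  fix d \<epsilon> :: real assume d: "0 < d" and var: "prob_space.variance P y / \<sigma>2 \<le> d" and \<epsilon>: "0 < \<epsilon>"
  have \<sigma>2: "0 < \<sigma>2" using assms(1) by (simp add: data_generating_process_def)
  have vd: "prob_space.variance P y \<le> d * \<sigma>2" using var \<sigma>2 by (simp add: pos_divide_le_eq)
  \<comment> \<open>Regression on the empty list: the residual is \<open>y\<close> itself, and its
    variance is at least \<open>\<sigma>2\<close>. This yields \<open>1 \<le> d\<close>, so that
    \<open>1 / d\<close> is admissible for \<open>q\<close>.\<close>
  have "\<sigma>2 \<le> prob_space.variance P y"
   by (rule standardized_representation[OF assms(1) distinct.simps(1)[THEN iffD2, OF TrueI]]) simp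
  then have "1 * \<sigma>2 \<le> d * \<sigma>2" using vd by simp
  then have d1: "1 \<le> d" using \<sigma>2 by (simp only: mult_le_cancel_right_pos)
  let ?e = "\<epsilon>^2 / (1768 * (1 + 4 * \<epsilon>)^2 * d^2)"
  let ?L = "real n * \<kappa> ^ 5 * ?e"
  have "?claim \<epsilon> (real (card Ms) * (31 * real s * exp (- ?L)))"
  proof (rule event[OF _ \<epsilon>, where q = "\<lambda>m. 1 / d"])
   fix m assume m: "m \<in> Ms"
   show "0 < 1 / d" "1 / d \<le> 1" using d d1 by auto
   have "1 / d * prob_space.variance P y \<le> \<sigma>2" using vd d by (simp add: field_simps)
   then show "1 / d \<le> (101/100) * (real (card (B m)) / (real n + 1)) \<or> 1 / d * prob_space.variance P y \<le> \<sigma>2" ..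
   \<comment> \<open>The argument yields the constant 900 here as well; replacing it by 1768 only
     weakens the bound.\<close>
   have "?e \<le> (1 / d)^2 * (\<epsilon>^2 / (900 * (1 + 4 * \<epsilon>)^2))"
   proof -
    have "(1 / d)^2 * (\<epsilon>^2 / (900 * (1 + 4 * \<epsilon>)^2)) = \<epsilon>^2 / (900 * (1 + 4 * \<epsilon>)^2 * d^2)" by (simp add: power_divide)
    also have "?e \<le> ..." using d \<epsilon> by (intro divide_left_mono mult_right_mono mult_pos_pos) auto
    finally show ?thesis .
   qed
   then have "?L \<le> real n * (k m) ^ 5 * ((1 / d)^2 * (\<epsilon>^2 / (900 * (1 + 4 * \<epsilon>)^2)))"
    using k[OF m] k0[OF m] \<kappa> by (intro mult_mono) auto
   also have "... = real n * (1 / d)^2 * (k m) ^ 5 * (\<epsilon>^2 / (900 * (1 + 4 * \<epsilon>)^2))" by (simp only: mult_ac)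
   also have "... = real n * (1 / d)^2 * (1 - real (card (coords m)) / real n) ^ 5 * (4 * \<epsilon> / (1 + 4 * \<epsilon>))^2 / 14400"
    unfolding k_def \<eta>[symmetric] by (simp only: times_divide_eq_right)
   finally show "38 * exp (- (real n * (1 / d)^2 * (1 - real (card (coords m)) / real n) ^ 5 * (4 * \<epsilon> / (1 + 4 * \<epsilon>))^2 / 14400)) \<le> 31 * real s * exp (- ?L)"
    by (rule bound)
  qed
  then show "?claim \<epsilon> (31 * real (card Ms) * real s * exp (- (real n * (1 - real s / real n) ^ 5 * ?e)))"
   unfolding \<kappa>_def by (simp only: mult_ac)
 qed
qed

end
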